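(* Let $\psi_0\in L^2(\mathbb{R}^d)$. The attainable set $$\mathcal{A}=\bigcup_{p>1}\left\{\psi_V(t)\;:\; t\in\mathbb{R},\ V\in M^p_{\mathrm{loc}}(\mathbb{R})\right\},$$ where $\psi_V$ is the solution of the Schrödinger equation in integral form with initial condition $\psi_0$ and potential $V$ (see context), has empty interior in the sphere $$\mathcal{S}_{\psi_0}=\left\{\psi\in L^2(\mathbb{R}^d)\;:\;\|\psi\|_2=\|\psi_0\|_2\right\}$$ equipped with the relative topology of $L^2(\mathbb{R}^d)$.
   Context: For a compact interval $I\subset\mathbb{R}$, $p>1$ and $p'=(1-1/p)^{-1}$, let $M^p(I):=\left(L^{p'}(I,L^1(\mathbb{R}^d,\mathbb{R}))\right)'$ (Banach space dual with dual norm). The pairing is extended complex-linearly to complex-valued elements of $L^{p'}(I,L^1(\mathbb{R}^d))$. An element $V\in M^p(I)$ is identified with the $L^\infty(\mathbb{R}^d,\mathbb{R})$-valued Borel measure on $I$, absolutely continuous with respect to Lebesgue measure, given by $\int_{\mathbb{R}^d} V(E)h\,\mathrm{d}x=\langle V,\chi_E h\rangle$ for $E\subset I$ Borel and $h\in L^1(\mathbb{R}^d,\mathbb{R})$. $M^p_{\mathrm{loc}}(\mathbb{R})$ is the set of $L^\infty(\mathbb{R}^d,\mathbb{R})$-valued Borel measures on $\mathbb{R}$ (defined on bounded Borel sets) whose restriction to every compact interval $I$ belongs to $M^p(I)$. Integrals: for $V\in M^p(I)$ and $f\in L^\infty(I,L^2(\mathbb{R}^d))$, $\int_I f(t)V(\mathrm{d}t)\in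 L^2(\mathbb{R}^d)$ is defined by $\int_{\mathbb{R}^d}\left(\int_I f(t)V(\mathrm{d}t)\right)g\,\mathrm{d}x=\langle V,f(t)g\rangle$ for all $g\in L^2(\mathbb{R}^d)$. The $L^2$-valued measure $f(t)V(\mathrm{d}t)$ has a density $\phi\in L^p(I,L^2(\mathbb{R}^d))$, i.e. $f(t)V(\mathrm{d}t)=\phi(t)\,\mathrm{d}t$, and one sets $\int_I \mathrm{e}^{\mathrm{i}\Delta(s-t)}f(t)V(\mathrm{d}t):=\int_I \mathrm{e}^{\mathrm{i}\Delta(s-t)}\phi(t)\,\mathrm{d}t$, where $\mathrm{e}^{\mathrm{i}\Delta t}$ is the free Schrödinger group on $L^2(\mathbb{R}^d)$. The same applies on subintervals, and $\int_0^t=-\int_t^0$ for $t<0$. Schrödinger equation in integral form: for fixed $\psi_0\in L^2(\mathbb{R}^d)$ and $V\in M^p_{\mathrm{loc}}(\mathbb{R})$, $\psi_V\in C^0(\mathbb{R},L^2(\mathbb{R}^d))$ is the unique solution of $$\psi_V(t)=\mathrm{e}^{\mathrm{i}\Delta t}\psi_0-\mathrm{i}\int_0^t \mathrm{e}^{\mathrm{i}\Delta(t-s)}\psi_V(s)V(\mathrm{d}s),\qquad t\in\mathbb{R}.$$ The norm $\|\psi_V(t)\|_2$ is constant in $t$, so $\mathcal{A}\subset\mathcal{S}_{\psi_0}$.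
   Formalization: The initial condition ψ₀ is assumed to be nonzero: for ψ₀ = 0 both the sphere and the attainable set equal {0}, so the interior is not empty and the statement fails. *)

theory Defs
  imports "HOL-Analysis.Analysis" "HOL-Probability.Essential_Supremum"
begin

definition lp_space :: "nat \<Rightarrow> ('a::euclidean_space \<Rightarrow> 'b::{banach, second_countable_topology}) set" where
  "lp_space p = {f \<in> borel_measurable lborel. integrable lborel (\<lambda>x. norm (f x) ^ p)}"

definition lp_norm :: "nat \<Rightarrow> ('a::euclidean_space \<Rightarrow> 'b::{banach, second_countable_topology}) \<Rightarrow> real" where
  "lp_norm p f = root p (\<integral>x. norm (f x) ^ p \<partial>lborel)"

lemma lp_spaceD:
  assumes "f \<in> lp_space p"
  shows "f \<in> borel_measurable lborel" "integrable lborel (\<lambda>x. norm (f x) ^ p)"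
  using assms by (auto simp: lp_space_def)

lemma power_convex2:
  fixes u v x y :: real
  assumes "0 \<le> x" "0 \<le> y" "0 \<le> u" "0 \<le> v" "u + v = 1"
  shows "(u * x + v * y) ^ p \<le> u * x ^ p + v * y ^ p"
proof -
  have c: "convex_on {0::real..} (\<lambda>x. x ^ p)"
  proof (cases "even p")
    case True
    then show ?thesis
      using convex_on_subset[OF convex_power_even] by (simp add: convex_real_interval)
  next
    case False
    then show ?thesis using convex_power_odd by blast
  qed
  have u: "u = 1 - v" using assms by simp
  show ?thesis
    unfolding u using convex_onD[OF c, of v x y] assms by simp
qed

lemma lp_space_bound:
  assumes f: "f \<in> lp_space p" and g: "g \<in> borel_measurable lborel"
    and le: "AE x in lborel. norm (g x) \<le> c * norm (f x)"
  shows "g \<in> lp_space p"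
proof -
  have "integrable lborel (\<lambda>x. norm (g x) ^ p)"
  proof (rule Bochner_Integration.integrable_bound)
    show "integrable lborel (\<lambda>x. c ^ p * norm (f x) ^ p)"
      using lp_spaceD(2)[OF f] by simp
    show "(\<lambda>x. norm (g x) ^ p) \<in> borel_measurable lborel" using g by measurable
    show "AE x in lborel. norm (norm (g x) ^ p) \<le> norm (c ^ p * norm (f x) ^ p)"
      using le
    proof eventually_elim
      case (elim x)
      then have "norm (g x) ^ p \<le> (c * norm (f x)) ^ p" by (intro power_mono) auto
      also have "\<dots> \<le> norm (c ^ p * norm (f x) ^ p)" by (simp add: power_mult_distrib)
      finally show ?case by simp
    qed
  qed
  with g show ?thesis by (simp add: lp_space_def)
qed

lemma lp_space_add:
  assumes f: "f \<in> lp_space p" and g: "g \<in> lp_space p"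
  shows "(\<lambda>x. f x + g x) \<in> lp_space p"
proof -
  note [measurable] = lp_spaceD(1)[OF f] lp_spaceD(1)[OF g]
  have "integrable lborel (\<lambda>x. norm (f x + g x) ^ p)"
  proof (rule Bochner_Integration.integrable_bound)
    show "integrable lborel (\<lambda>x. 2 ^ p * (norm (f x) ^ p + norm (g x) ^ p))"
      using lp_spaceD(2)[OF f] lp_spaceD(2)[OF g] by simp
    show "(\<lambda>x. norm (f x + g x) ^ p) \<in> borel_measurable lborel" by measurable
    show "AE x in lborel. norm (norm (f x + g x) ^ p) \<le> norm (2 ^ p * (norm (f x) ^ p + norm (g x) ^ p))"
    proof (rule AE_I2)
      fix x
      let ?m = "max (norm (f x)) (norm (g x))"
      have "norm (f x + g x) ^ p \<le> (2 * ?m) ^ p"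
        using norm_triangle_ineq[of "f x" "g x"] by (intro power_mono) auto
      also have "\<dots> = 2 ^ p * ?m ^ p" by (simp add: power_mult_distrib)
      also have "?m ^ p \<le> norm (f x) ^ p + norm (g x) ^ p"
        by (simp add: max_def)
      finally show "norm (norm (f x + g x) ^ p) \<le> norm (2 ^ p * (norm (f x) ^ p + norm (g x) ^ p))"
        by simp
    qed
  qed
  then show ?thesis by (simp add: lp_space_def)
qed

lemma lp_space_scaleR:
  assumes f: "f \<in> lp_space p"
  shows "(\<lambda>x. c *\<^sub>R f x) \<in> lp_space p"
  using lp_spaceD(1)[OF f] by (intro lp_space_bound[OF f, of _ "\<bar>c\<bar>"]) auto

lemma lp_space_zero: "0 < p \<Longrightarrow> (\<lambda>x. 0) \<in> lp_space p"
  by (simp add: lp_space_def zero_power)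

lemma lp_space_diff:
  assumes "f \<in> lp_space p" "g \<in> lp_space p"
  shows "(\<lambda>x. f x - g x) \<in> lp_space p"
  using lp_space_add[OF assms(1) lp_space_scaleR[OF assms(2), of "-1"]] by simp

lemma lp_norm_nonneg: "0 < p \<Longrightarrow> 0 \<le> lp_norm p f"
  by (simp add: lp_norm_def)

lemma lp_norm_power: "0 < p \<Longrightarrow> lp_norm p f ^ p = (\<integral>x. norm (f x) ^ p \<partial>lborel)"
  by (simp add: lp_norm_def)

lemma lp_norm_eq_0:
  assumes p: "0 < p" and f: "f \<in> lp_space p"
  shows "lp_norm p f = 0 \<longleftrightarrow> (AE x in lborel. f x = 0)"
  using integral_nonneg_eq_0_iff_AE[OF lp_spaceD(2)[OF f]] p by (simp add: lp_norm_def)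

lemma lp_norm_cong:
  assumes "f \<in> lp_space p" "g \<in> lp_space p" "AE x in lborel. f x = g x"
  shows "lp_norm p f = lp_norm p g"
  unfolding lp_norm_def
  using assms(3) lp_spaceD(1)[OF assms(1)] lp_spaceD(1)[OF assms(2)]
  by (intro arg_cong[where f="root p"] integral_cong_AE) auto

lemma lp_norm_scaleR: "0 < p \<Longrightarrow> lp_norm p (\<lambda>x. c *\<^sub>R f x) = \<bar>c\<bar> * lp_norm p f"
  by (simp add: lp_norm_def power_mult_distrib real_root_mult real_root_power_cancel)

lemma lp_norm_triangle:
  fixes f g :: "'a::euclidean_space \<Rightarrow> 'b::{banach, second_countable_topology}"
  assumes p: "0 < p" and f: "f \<in> lp_space p" and g: "g \<in> lp_space p"
  shows "lp_norm p (\<lambda>x. f x + g x) \<le> lp_norm p f + lp_norm p g"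
proof -
  let ?h = "\<lambda>x. f x + g x"
  have h: "?h \<in> lp_space p" by (rule lp_space_add[OF f g])
  define a b where "a = lp_norm p f" and "b = lp_norm p g"
  have ab: "0 \<le> a" "0 \<le> b" by (auto simp: a_def b_def lp_norm_nonneg p)
  show ?thesis
  proof (cases "a = 0 \<or> b = 0")
    case True
    then show ?thesis
    proof
      assume "a = 0"
      then have "AE x in lborel. f x = 0" using lp_norm_eq_0[OF p f] a_def by simp
      then have "AE x in lborel. ?h x = g x" by eventually_elim auto
      from lp_norm_cong[OF h g this] show ?thesis using ab by (simp add: a_def)
    next
      assume "b = 0"
      then have "AE x in lborel. g x = 0" using lp_norm_eq_0[OF p g] b_def by simp
      then have "AE x in lborel. ?h x = f x" by eventually_elim auto
      from lp_norm_cong[OF h f this] show ?thesis using ab by (simp add: b_def)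
    qed
  next
    case False
    with ab have pos: "0 < a" "0 < b" by auto
    let ?K = "(a + b) ^ p"
    define u v where "u = a / (a + b)" and "v = b / (a + b)"
    have uv: "0 \<le> u" "0 \<le> v" "u + v = 1"
      using pos by (auto simp: u_def v_def add_divide_distrib[symmetric])
    have "(\<integral>x. norm (?h x) ^ p \<partial>lborel)
        \<le> (\<integral>x. ?K * (u * (norm (f x) ^ p / a ^ p) + v * (norm (g x) ^ p / b ^ p)) \<partial>lborel)"
    proof (rule integral_mono)
      show "integrable lborel (\<lambda>x. norm (?h x) ^ p)" using lp_spaceD(2)[OF h] .
      show "integrable lborel (\<lambda>x. ?K * (u * (norm (f x) ^ p / a ^ p) + v * (norm (g x) ^ p / b ^ p)))"
        using lp_spaceD(2)[OF f] lp_spaceD(2)[OF g] by simp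
      fix x
      have eq: "norm (f x) + norm (g x) = (a + b) * (u * (norm (f x) / a) + v * (norm (g x) / b))"
      proof -
        have "(a + b) * u = a" "(a + b) * v = b" using pos by (auto simp: u_def v_def)
        then have "(a + b) * (u * (norm (f x) / a) + v * (norm (g x) / b))
          = a * (norm (f x) / a) + b * (norm (g x) / b)"
          by (metis (no_types, lifting) distrib_left mult.assoc)
        then show ?thesis using pos by simp
      qed
      have "norm (?h x) ^ p \<le> (norm (f x) + norm (g x)) ^ p"
        by (intro power_mono norm_triangle_ineq) auto
      also have "\<dots> = ?K * (u * (norm (f x) / a) + v * (norm (g x) / b)) ^ p"
        by (subst eq) (simp add: power_mult_distrib)
      also have "\<dots> \<le> ?K * (u * (norm (f x) / a) ^ p + v * (norm (g x) / b) ^ p)"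
        using pos uv by (intro mult_left_mono power_convex2) auto
      finally show "norm (?h x) ^ p \<le> ?K * (u * (norm (f x) ^ p / a ^ p) + v * (norm (g x) ^ p / b ^ p))"
        by (simp add: power_divide)
    qed
    also have "\<dots> = ?K * (u * ((\<integral>x. norm (f x) ^ p \<partial>lborel) / a ^ p) + v * ((\<integral>x. norm (g x) ^ p \<partial>lborel) / b ^ p))"
      using lp_spaceD(2)[OF f] lp_spaceD(2)[OF g] by simp
    also have "\<dots> = ?K * (u + v)"
      using pos by (simp add: lp_norm_power[OF p, symmetric] a_def[symmetric] b_def[symmetric])
    finally have "lp_norm p ?h ^ p \<le> (a + b) ^ p"
      using uv by (simp add: lp_norm_power[OF p])
    then have "lp_norm p ?h \<le> a + b"
      using ab p by (simp add: power_mono_iff lp_norm_nonneg)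
    then show ?thesis by (simp add: a_def b_def)
  qed
qed


definition ae_eq_rel :: "('a::euclidean_space \<Rightarrow> 'b) set \<Rightarrow> (('a \<Rightarrow> 'b) \<times> ('a \<Rightarrow> 'b)) set" where
  "ae_eq_rel S = {(f, g). f \<in> S \<and> g \<in> S \<and> (AE x in lborel. f x = g x)}"

lemma equiv_ae_eq_rel: "equiv S (ae_eq_rel S)"
  by (rule equivI) (auto simp: ae_eq_rel_def refl_on_def sym_def trans_def)

(* L^p with respect to Lebesgue measure for an integer exponent p >= 1, which is given by a
   numeral type: ('a, complex, 2) Lp is L^2('a, complex). Using Borel representatives loses
   nothing, since every Lebesgue measurable function is a.e. equal to a Borel function. *)
typedef (overloaded) ('a, 'b, 'p) Lp =
  "lp_space CARD('p::finite) // ae_eq_rel (lp_space CARD('p) :: ('a::euclidean_space \<Rightarrow> 'b::{banach, second_countable_topology}) set)"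
  by (rule exI, rule quotientI, rule lp_space_zero, simp)

(* Lp_class f is the a.e. class of f; it is unspecified if f is not in lp_space. *)
definition Lp_class :: "('a \<Rightarrow> 'b) \<Rightarrow> ('a::euclidean_space, 'b::{banach, second_countable_topology}, 'p::finite) Lp" where
  "Lp_class f = Abs_Lp (ae_eq_rel (lp_space CARD('p)) `` {f})"

definition Lp_rep :: "('a::euclidean_space, 'b::{banach, second_countable_topology}, 'p::finite) Lp \<Rightarrow> 'a \<Rightarrow> 'b" where
  "Lp_rep u = (SOME f. f \<in> Rep_Lp u)"

lemma Lp_class_eq_iff:
  fixes f g :: "'a::euclidean_space \<Rightarrow> 'b::{banach, second_countable_topology}"
  assumes "f \<in> lp_space CARD('p)" "g \<in> lp_space CARD('p)"
  shows "(Lp_class f :: ('a, 'b, 'p::finite) Lp) = Lp_class g \<longleftrightarrow> (AE x in lborel. f x = g x)"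
proof -
  have "(Lp_class f :: ('a, 'b, 'p) Lp) = Lp_class g \<longleftrightarrow>
    ae_eq_rel (lp_space CARD('p)) `` {f} = ae_eq_rel (lp_space CARD('p)) `` {g}"
    unfolding Lp_class_def using assms by (intro Abs_Lp_inject quotientI)
  also have "\<dots> \<longleftrightarrow> (AE x in lborel. f x = g x)"
    using assms eq_equiv_class_iff[OF equiv_ae_eq_rel assms] by (simp add: ae_eq_rel_def)
  finally show ?thesis .
qed

lemma Rep_LpE:
  fixes u :: "('a::euclidean_space, 'b::{banach, second_countable_topology}, 'p::finite) Lp"
  obtains f where "f \<in> lp_space CARD('p)" "u = Lp_class f"
    "Rep_Lp u = ae_eq_rel (lp_space CARD('p)) `` {f}"
  using Rep_Lp[of u] by (metis Lp_class_def Rep_Lp_inverse quotientE)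

lemma Lp_rep:
  fixes u :: "('a::euclidean_space, 'b::{banach, second_countable_topology}, 'p::finite) Lp"
  shows Lp_rep_space: "Lp_rep u \<in> lp_space CARD('p)" and Lp_class_rep: "Lp_class (Lp_rep u) = u"
proof -
  obtain f where f: "f \<in> lp_space CARD('p)" "u = Lp_class f"
    "Rep_Lp u = ae_eq_rel (lp_space CARD('p)) `` {f}" by (rule Rep_LpE)
  then have "f \<in> Rep_Lp u" by (simp add: ae_eq_rel_def)
  then have "Lp_rep u \<in> Rep_Lp u" unfolding Lp_rep_def by (rule someI[of "\<lambda>f. f \<in> Rep_Lp u"])
  then have *: "Lp_rep u \<in> lp_space CARD('p)" "AE x in lborel. f x = Lp_rep u x"
    using f(3) by (auto simp: ae_eq_rel_def)
  show "Lp_rep u \<in> lp_space CARD('p)" by fact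
  show "Lp_class (Lp_rep u) = u"
    using Lp_class_eq_iff[OF f(1) *(1)] *(2) f(2) by simp
qed

lemma Lp_rep_class:
  assumes "f \<in> lp_space CARD('p)"
  shows "AE x in lborel. Lp_rep (Lp_class f :: ('a::euclidean_space, 'b::{banach, second_countable_topology}, 'p::finite) Lp) x = f x"
  using Lp_class_eq_iff[OF Lp_rep_space assms] Lp_class_rep by blast

lemma Lp_eq_iff:
  fixes u v :: "('a::euclidean_space, 'b::{banach, second_countable_topology}, 'p::finite) Lp"
  shows "u = v \<longleftrightarrow> (AE x in lborel. Lp_rep u x = Lp_rep v x)"
  using Lp_class_eq_iff[OF Lp_rep_space[of u] Lp_rep_space[of v]] by (simp add: Lp_class_rep)

instantiation Lp :: (euclidean_space, "{banach, second_countable_topology}", finite) real_vector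
begin

definition zero_Lp :: "('a, 'b, 'c) Lp" where
  "0 = Lp_class (\<lambda>x. 0)"

definition plus_Lp :: "('a, 'b, 'c) Lp \<Rightarrow> ('a, 'b, 'c) Lp \<Rightarrow> ('a, 'b, 'c) Lp" where
  "u + v = Lp_class (\<lambda>x. Lp_rep u x + Lp_rep v x)"

definition minus_Lp :: "('a, 'b, 'c) Lp \<Rightarrow> ('a, 'b, 'c) Lp \<Rightarrow> ('a, 'b, 'c) Lp" where
  "u - v = Lp_class (\<lambda>x. Lp_rep u x - Lp_rep v x)"

definition uminus_Lp :: "('a, 'b, 'c) Lp \<Rightarrow> ('a, 'b, 'c) Lp" where
  "- u = Lp_class (\<lambda>x. - Lp_rep u x)"

definition scaleR_Lp :: "real \<Rightarrow> ('a, 'b, 'c) Lp \<Rightarrow> ('a, 'b, 'c) Lp" where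
  "r *\<^sub>R u = Lp_class (\<lambda>x. r *\<^sub>R Lp_rep u x)"

lemma Lp_rep_zero: "AE x in lborel. Lp_rep (0 :: ('a, 'b, 'c) Lp) x = 0"
  unfolding zero_Lp_def by (intro Lp_rep_class lp_space_zero) simp

lemma Lp_rep_add: "AE x in lborel. Lp_rep (u + v :: ('a, 'b, 'c) Lp) x = Lp_rep u x + Lp_rep v x"
  unfolding plus_Lp_def by (intro Lp_rep_class lp_space_add Lp_rep_space)

lemma Lp_rep_diff: "AE x in lborel. Lp_rep (u - v :: ('a, 'b, 'c) Lp) x = Lp_rep u x - Lp_rep v x"
  unfolding minus_Lp_def by (intro Lp_rep_class lp_space_diff Lp_rep_space)

lemma Lp_rep_uminus: "AE x in lborel. Lp_rep (- u :: ('a, 'b, 'c) Lp) x = - Lp_rep u x"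
  unfolding uminus_Lp_def
  using lp_space_scaleR[OF Lp_rep_space, of "-1" u] by (intro Lp_rep_class) simp

lemma Lp_rep_scaleR: "AE x in lborel. Lp_rep (r *\<^sub>R u :: ('a, 'b, 'c) Lp) x = r *\<^sub>R Lp_rep u x"
  unfolding scaleR_Lp_def by (intro Lp_rep_class lp_space_scaleR Lp_rep_space)

instance
proof
  fix u v w :: "('a, 'b, 'c) Lp" and r s :: real
  show "u + v + w = u + (v + w)"
    unfolding Lp_eq_iff
    using Lp_rep_add[of "u + v" w] Lp_rep_add[of u v] Lp_rep_add[of u "v + w"] Lp_rep_add[of v w]
    by eventually_elim simp
  show "u + v = v + u"
    unfolding Lp_eq_iff using Lp_rep_add[of u v] Lp_rep_add[of v u] by eventually_elim simp
  show "0 + u = u"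
    unfolding Lp_eq_iff using Lp_rep_add[of 0 u] Lp_rep_zero by eventually_elim simp
  show "- u + u = 0"
    unfolding Lp_eq_iff using Lp_rep_add[of "-u" u] Lp_rep_uminus[of u] Lp_rep_zero
    by eventually_elim simp
  show "u - v = u + - v"
    unfolding Lp_eq_iff using Lp_rep_add[of u "-v"] Lp_rep_uminus[of v] Lp_rep_diff[of u v]
    by eventually_elim simp
  show "r *\<^sub>R (u + v) = r *\<^sub>R u + r *\<^sub>R v"
    unfolding Lp_eq_iff using Lp_rep_scaleR[of r "u + v"] Lp_rep_add[of u v]
      Lp_rep_add[of "r *\<^sub>R u" "r *\<^sub>R v"] Lp_rep_scaleR[of r u] Lp_rep_scaleR[of r v]
    by eventually_elim (simp add: scaleR_add_right)
  show "(r + s) *\<^sub>R u = r *\<^sub>R u + s *\<^sub>R u"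
    unfolding Lp_eq_iff using Lp_rep_scaleR[of "r + s" u]
      Lp_rep_add[of "r *\<^sub>R u" "s *\<^sub>R u"] Lp_rep_scaleR[of r u] Lp_rep_scaleR[of s u]
    by eventually_elim (simp add: scaleR_add_left)
  show "r *\<^sub>R s *\<^sub>R u = (r * s) *\<^sub>R u"
    unfolding Lp_eq_iff using Lp_rep_scaleR[of r "s *\<^sub>R u"] Lp_rep_scaleR[of s u]
      Lp_rep_scaleR[of "r * s" u] by eventually_elim simp
  show "1 *\<^sub>R u = u"
    unfolding Lp_eq_iff using Lp_rep_scaleR[of 1 u] by eventually_elim simp
qed

end

instantiation Lp :: (euclidean_space, "{banach, second_countable_topology}", finite) real_normed_vector
begin

definition norm_Lp :: "('a, 'b, 'c) Lp \<Rightarrow> real" where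
  "norm u = lp_norm CARD('c) (Lp_rep u)"

definition dist_Lp :: "('a, 'b, 'c) Lp \<Rightarrow> ('a, 'b, 'c) Lp \<Rightarrow> real" where
  "dist_Lp u v = norm (u - v)"

definition sgn_Lp :: "('a, 'b, 'c) Lp \<Rightarrow> ('a, 'b, 'c) Lp" where
  "sgn_Lp u = u /\<^sub>R norm u"

definition uniformity_Lp :: "(('a, 'b, 'c) Lp \<times> ('a, 'b, 'c) Lp) filter" where
  "uniformity_Lp = (INF e\<in>{0<..}. principal {(x, y). dist x y < e})"

definition open_Lp :: "('a, 'b, 'c) Lp set \<Rightarrow> bool" where
  "open_Lp U \<longleftrightarrow> (\<forall>x\<in>U. \<forall>\<^sub>F (x', y) in uniformity. x' = x \<longrightarrow> y \<in> U)"

instance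
proof
  fix u v :: "('a, 'b, 'c) Lp" and r :: real
  show "(norm u = 0) = (u = 0)"
  proof -
    have "(norm u = 0) = (AE x in lborel. Lp_rep u x = 0)"
      by (simp add: norm_Lp_def lp_norm_eq_0 Lp_rep_space)
    also have "\<dots> = (u = 0)"
      using Lp_class_eq_iff[OF Lp_rep_space[of u] lp_space_zero] by (simp add: Lp_class_rep zero_Lp_def)
    finally show ?thesis .
  qed
  show "norm (u + v) \<le> norm u + norm v"
    unfolding norm_Lp_def
    using lp_norm_triangle[OF zero_less_card_finite[where 'a='c] Lp_rep_space[of u] Lp_rep_space[of v]]
      lp_norm_cong[OF Lp_rep_space lp_space_add[OF Lp_rep_space Lp_rep_space] Lp_rep_add[of u v]]
    by simp
  show "norm (r *\<^sub>R u) = \<bar>r\<bar> * norm u"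
    unfolding norm_Lp_def
    using lp_norm_cong[OF Lp_rep_space lp_space_scaleR[OF Lp_rep_space] Lp_rep_scaleR[of r u]]
    by (simp add: lp_norm_scaleR)
qed (simp_all add: dist_Lp_def sgn_Lp_def uniformity_Lp_def open_Lp_def)

end

lemma norm_Lp_class:
  assumes "f \<in> lp_space CARD('p)"
  shows "norm (Lp_class f :: ('a::euclidean_space, 'b::{banach, second_countable_topology}, 'p::finite) Lp) = lp_norm CARD('p) f"
  unfolding norm_Lp_def by (rule lp_norm_cong[OF Lp_rep_space assms Lp_rep_class[OF assms]])

lemma Lp_class_add:
  assumes "f \<in> lp_space CARD('p)" "g \<in> lp_space CARD('p)"
  shows "(Lp_class (\<lambda>x. f x + g x) :: ('a::euclidean_space, 'b::{banach, second_countable_topology}, 'p::finite) Lp) = Lp_class f + Lp_class g"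
proof -
  have "AE x in lborel. f x + g x = Lp_rep (Lp_class f :: ('a, 'b, 'p) Lp) x + Lp_rep (Lp_class g :: ('a, 'b, 'p) Lp) x"
    using Lp_rep_class[OF assms(1)] Lp_rep_class[OF assms(2)] by eventually_elim simp
  then show ?thesis
    unfolding plus_Lp_def
    by (simp add: Lp_class_eq_iff lp_space_add assms Lp_rep_space)
qed

lemma Lp_class_diff:
  assumes "f \<in> lp_space CARD('p)" "g \<in> lp_space CARD('p)"
  shows "(Lp_class (\<lambda>x. f x - g x) :: ('a::euclidean_space, 'b::{banach, second_countable_topology}, 'p::finite) Lp) = Lp_class f - Lp_class g"
proof -
  have "AE x in lborel. f x - g x = Lp_rep (Lp_class f :: ('a, 'b, 'p) Lp) x - Lp_rep (Lp_class g :: ('a, 'b, 'p) Lp) x"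
    using Lp_rep_class[OF assms(1)] Lp_rep_class[OF assms(2)] by eventually_elim simp
  then show ?thesis
    unfolding minus_Lp_def
    by (simp add: Lp_class_eq_iff lp_space_diff assms Lp_rep_space)
qed

lemma norm_Lp_power:
  fixes u :: "('a::euclidean_space, 'b::{banach, second_countable_topology}, 'p::finite) Lp"
  shows "norm u ^ CARD('p) = (\<integral>x. norm (Lp_rep u x) ^ CARD('p) \<partial>lborel)"
  by (simp add: norm_Lp_def lp_norm_power)

lemma nn_integral_Lp_diff:
  fixes u v :: "('a::euclidean_space, 'b::{banach, second_countable_topology}, 'p::finite) Lp"
  shows "(\<integral>\<^sup>+x. ennreal (norm (Lp_rep u x - Lp_rep v x) ^ CARD('p)) \<partial>lborel) = ennreal (norm (u - v) ^ CARD('p))"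
proof -
  have "(\<integral>\<^sup>+x. ennreal (norm (Lp_rep u x - Lp_rep v x) ^ CARD('p)) \<partial>lborel)
      = (\<integral>\<^sup>+x. ennreal (norm (Lp_rep (u - v) x) ^ CARD('p)) \<partial>lborel)"
    using Lp_rep_diff[of u v] by (intro nn_integral_cong_AE) (auto elim!: eventually_mono)
  also have "\<dots> = ennreal (norm (u - v) ^ CARD('p))"
    unfolding norm_Lp_power
    by (intro nn_integral_eq_integral lp_spaceD(2)[OF Lp_rep_space]) auto
  finally show ?thesis .
qed

lemma lp_AE_convergent:
  fixes u :: "nat \<Rightarrow> ('a::euclidean_space, 'b::{banach, second_countable_topology}, 'p::finite) Lp"
  assumes d: "\<And>j. norm (u (Suc j) - u j) \<le> (1/4) ^ j"
  shows "AE x in lborel. convergent (\<lambda>j. Lp_rep (u j) x)"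
proof -
  let ?p = "CARD('p)"
  have p: "0 < ?p" by simp
  note [measurable] = lp_spaceD(1)[OF Lp_rep_space]
  define h where "h j x = 2 ^ (j * ?p) * norm (Lp_rep (u (Suc j)) x - Lp_rep (u j) x) ^ ?p" for j x
  have "(\<integral>\<^sup>+x. (\<Sum>j. ennreal (h j x)) \<partial>lborel) = (\<Sum>j. \<integral>\<^sup>+x. ennreal (h j x) \<partial>lborel)"
    unfolding h_def by (intro nn_integral_suminf) measurable
  also have "\<dots> \<le> (\<Sum>j. ennreal ((1/2) ^ j))"
  proof (intro suminf_le summableI)
    fix j
    have "(\<integral>\<^sup>+x. ennreal (h j x) \<partial>lborel)
      = ennreal (2 ^ (j * ?p)) * (\<integral>\<^sup>+x. ennreal (norm (Lp_rep (u (Suc j)) x - Lp_rep (u j) x) ^ ?p) \<partial>lborel)"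
      unfolding h_def by (subst nn_integral_cmult[symmetric]) (auto simp: ennreal_mult')
    also have "\<dots> = ennreal (2 ^ (j * ?p) * norm (u (Suc j) - u j) ^ ?p)"
      by (simp add: nn_integral_Lp_diff ennreal_mult')
    also have "\<dots> \<le> ennreal ((1/2) ^ j)"
    proof (rule ennreal_leI)
      have "2 ^ (j * ?p) * norm (u (Suc j) - u j) ^ ?p = (2 ^ j * norm (u (Suc j) - u j)) ^ ?p"
        by (simp add: power_mult power_mult_distrib)
      also have "\<dots> \<le> ((1/2) ^ j) ^ ?p"
      proof (intro power_mono)
        have "2 ^ j * norm (u (Suc j) - u j) \<le> 2 ^ j * (1/4) ^ j" using d by simp
        also have "\<dots> = (1/2) ^ j" by (simp flip: power_mult_distrib)
        finally show "2 ^ j * norm (u (Suc j) - u j) \<le> (1/2) ^ j" .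
      qed simp
      also have "\<dots> \<le> ((1/2) ^ j) ^ 1"
        using p by (intro power_decreasing) (auto simp: power_le_one Suc_leI)
      finally show "2 ^ (j * ?p) * norm (u (Suc j) - u j) ^ ?p \<le> (1/2) ^ j" by simp
    qed
    finally show "(\<integral>\<^sup>+x. ennreal (h j x) \<partial>lborel) \<le> ennreal ((1/2) ^ j)" .
  qed
  also have "\<dots> = ennreal (\<Sum>j. (1/2) ^ j)"
    by (intro suminf_ennreal2 summable_geometric) auto
  finally have fin: "(\<integral>\<^sup>+x. (\<Sum>j. ennreal (h j x)) \<partial>lborel) \<noteq> \<infinity>"
    by (metis ennreal_less_top infinity_ennreal_def leD)
  have "AE x in lborel. (\<Sum>j. ennreal (h j x)) \<noteq> \<infinity>"
    using fin unfolding h_def by (intro nn_integral_noteq_infinite) auto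
  then show ?thesis
  proof eventually_elim
    case (elim x)
    let ?D = "\<lambda>j. Lp_rep (u (Suc j)) x - Lp_rep (u j) x"
    have "summable (\<lambda>j. h j x)"
      using elim by (intro summable_suminf_not_top) (auto simp: h_def)
    then have "(\<lambda>j. h j x) \<longlonglongrightarrow> 0" by (rule summable_LIMSEQ_zero)
    then have "eventually (\<lambda>j. h j x < 1) sequentially" by (rule order_tendstoD) simp
    then have ev: "eventually (\<lambda>j. norm (?D j) \<le> (1/2) ^ j) sequentially"
    proof eventually_elim
      case (elim j)
      then have "(2 ^ j * norm (?D j)) ^ ?p < 1"
        by (simp add: h_def power_mult power_mult_distrib)
      then have "2 ^ j * norm (?D j) \<le> 1"
        by (meson linorder_not_less one_le_power order_less_imp_le)
      then show ?case by (simp add: field_simps)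
    qed
    have "summable ?D"
      by (rule summable_comparison_test_ev[OF ev]) (simp add: summable_geometric)
    then have "convergent (\<lambda>n. \<Sum>j<n. ?D j)" by (simp add: summable_iff_convergent)
    then have "convergent (\<lambda>n. (\<Sum>j<n. ?D j) + Lp_rep (u 0) x)"
      by (intro convergent_add convergent_const)
    moreover have "(\<Sum>j<n. ?D j) + Lp_rep (u 0) x = Lp_rep (u n) x" for n
      using sum_lessThan_telescope[of "\<lambda>j. Lp_rep (u j) x" n] by simp
    ultimately show ?case by simp
  qed
qed

instance Lp :: (euclidean_space, "{banach, second_countable_topology}", finite) banach
proof
  fix X :: "nat \<Rightarrow> ('a, 'b, 'c) Lp"
  assume X: "Cauchy X"
  let ?p = "CARD('c)"
  have p: "0 < ?p" by simp
  note [measurable] = lp_spaceD(1)[OF Lp_rep_space]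
  have "\<forall>k. \<exists>N. \<forall>m\<ge>N. \<forall>n\<ge>N. norm (X m - X n) < (1/4) ^ k"
    using X by (auto simp: Cauchy_iff)
  then obtain N where N: "\<And>k m n. m \<ge> N k \<Longrightarrow> n \<ge> N k \<Longrightarrow> norm (X m - X n) < (1/4) ^ k"
    by metis
  define r where "r j = (\<Sum>i\<le>j. N i)" for j
  have r: "N k \<le> r j" if "k \<le> j" for k j
    unfolding r_def using that by (intro member_le_sum) auto
  have conv: "AE x in lborel. convergent (\<lambda>j. Lp_rep (X (r j)) x)"
    by (rule lp_AE_convergent) (auto intro!: less_imp_le N r)
  define g where "g x = lim (\<lambda>j. Lp_rep (X (r j)) x)" for x
  have [measurable]: "g \<in> borel_measurable lborel"
    unfolding g_def by (rule borel_measurable_lim_metric) measurable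
  have main: "(\<lambda>x. g x - Lp_rep (X n) x) \<in> lp_space ?p \<and> lp_norm ?p (\<lambda>x. g x - Lp_rep (X n) x) \<le> (1/4) ^ k"
    if n: "n \<ge> N k" for n k
  proof -
    have "(\<integral>\<^sup>+x. ennreal (norm (g x - Lp_rep (X n) x) ^ ?p) \<partial>lborel)
        = (\<integral>\<^sup>+x. liminf (\<lambda>j. ennreal (norm (Lp_rep (X (r j)) x - Lp_rep (X n) x) ^ ?p)) \<partial>lborel)"
    proof (rule nn_integral_cong_AE, use conv in eventually_elim)
      fix x assume "convergent (\<lambda>j. Lp_rep (X (r j)) x)"
      then have "(\<lambda>j. Lp_rep (X (r j)) x) \<longlonglongrightarrow> g x"
        by (simp add: g_def convergent_LIMSEQ_iff)
      then have "(\<lambda>j. ennreal (norm (Lp_rep (X (r j)) x - Lp_rep (X n) x) ^ ?p))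
          \<longlonglongrightarrow> ennreal (norm (g x - Lp_rep (X n) x) ^ ?p)"
        by (intro tendsto_ennrealI tendsto_intros)
      from lim_imp_Liminf[OF _ this]
      show "ennreal (norm (g x - Lp_rep (X n) x) ^ ?p)
        = liminf (\<lambda>j. ennreal (norm (Lp_rep (X (r j)) x - Lp_rep (X n) x) ^ ?p))" by simp
    qed
    also have "\<dots> \<le> liminf (\<lambda>j. \<integral>\<^sup>+x. ennreal (norm (Lp_rep (X (r j)) x - Lp_rep (X n) x) ^ ?p) \<partial>lborel)"
      by (rule nn_integral_liminf) measurable
    also have "\<dots> = liminf (\<lambda>j. ennreal (norm (X (r j) - X n) ^ ?p))"
      by (simp add: nn_integral_Lp_diff)
    also have "\<dots> \<le> liminf (\<lambda>j::nat. ennreal (((1/4) ^ k) ^ ?p))"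
    proof (intro Liminf_mono eventually_sequentiallyI[of k] ennreal_leI power_mono)
      fix j assume "k \<le> j"
      then show "norm (X (r j) - X n) \<le> (1/4) ^ k" using N[OF r n] less_imp_le by blast
    qed auto
    finally have *: "(\<integral>\<^sup>+x. ennreal (norm (g x - Lp_rep (X n) x) ^ ?p) \<partial>lborel) \<le> ennreal (((1/4) ^ k) ^ ?p)"
      by (simp add: Liminf_const)
    have int: "integrable lborel (\<lambda>x. norm (g x - Lp_rep (X n) x) ^ ?p)"
      using * by (intro integrableI_bounded) (auto intro: le_less_trans)
    then have mem: "(\<lambda>x. g x - Lp_rep (X n) x) \<in> lp_space ?p"
      by (simp add: lp_space_def)
    have "(\<integral>x. norm (g x - Lp_rep (X n) x) ^ ?p \<partial>lborel) \<le> ((1/4) ^ k) ^ ?p"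
      using * by (subst (asm) nn_integral_eq_integral[OF int]) (auto simp: ennreal_le_iff)
    then have "lp_norm ?p (\<lambda>x. g x - Lp_rep (X n) x) ^ ?p \<le> ((1/4) ^ k) ^ ?p"
      by (simp add: lp_norm_power)
    then have "lp_norm ?p (\<lambda>x. g x - Lp_rep (X n) x) \<le> (1/4) ^ k"
      by (subst (asm) power_mono_iff) (auto simp: lp_norm_nonneg)
    with mem show ?thesis by simp
  qed
  have g: "g \<in> lp_space ?p"
    using lp_space_add[OF conjunct1[OF main[OF order_refl[of "N 0"]]] Lp_rep_space[of "X (N 0)"]] by simp
  have nrm: "norm (Lp_class g - X n) \<le> (1/4) ^ k" if "n \<ge> N k" for n k
    using conjunct2[OF main[OF that]] norm_Lp_class[OF conjunct1[OF main[OF that]]]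
      Lp_class_diff[OF g Lp_rep_space[of "X n"]] by (simp add: Lp_class_rep)
  have "X \<longlonglongrightarrow> Lp_class g"
  proof (rule LIMSEQ_I)
    fix e :: real assume "0 < e"
    then obtain k where k: "(1/4) ^ k < e" using real_arch_pow_inv[of e "1/4"] by auto
    show "\<exists>no. \<forall>n\<ge>no. norm (X n - Lp_class g) < e"
      using nrm k by (intro exI[of _ "N k"]) (force simp: norm_minus_commute intro: le_less_trans)
  qed
  then show "convergent X" by (rule convergentI)
qed

lemma Lp_dominated_convergence:
  fixes f :: "nat \<Rightarrow> 'a::euclidean_space \<Rightarrow> 'b::{banach, second_countable_topology}"
    and g :: "'a \<Rightarrow> 'b" and w :: "'a \<Rightarrow> real"
  assumes w: "w \<in> lp_space CARD('p::finite)"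
    and f: "\<And>n. f n \<in> borel_measurable lborel" and g: "g \<in> borel_measurable lborel"
    and lim: "AE x in lborel. (\<lambda>n. f n x) \<longlonglongrightarrow> g x"
    and bound: "\<And>n. AE x in lborel. norm (f n x) \<le> w x"
  shows "\<And>n. f n \<in> lp_space CARD('p)" "g \<in> lp_space CARD('p)"
    "(\<lambda>n. Lp_class (f n) :: ('a, 'b, 'p) Lp) \<longlonglongrightarrow> Lp_class g"
proof -
  let ?p = "CARD('p)"
  have p: "0 < ?p" by simp
  note [measurable] = f g lp_spaceD(1)[OF w]
  have bound': "AE x in lborel. \<forall>n. norm (f n x) \<le> w x"
    using bound by (simp add: AE_all_countable)
  have boundg: "AE x in lborel. norm (g x) \<le> w x"
    using lim bound' by eventually_elim (auto intro: tendsto_upperbound[OF tendsto_norm])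
  have to_w: "h \<in> lp_space ?p" if "AE x in lborel. norm (h x) \<le> w x" "h \<in> borel_measurable lborel" for h :: "'a \<Rightarrow> 'b"
  proof (rule lp_space_bound[OF w that(2)])
    show "AE x in lborel. norm (h x) \<le> 1 * norm (w x)"
      using that(1) by eventually_elim auto
  qed
  show fm: "\<And>n. f n \<in> lp_space ?p" using to_w[OF bound f] .
  show gm: "g \<in> lp_space ?p" using to_w[OF boundg g] .
  have "(\<lambda>n. \<integral>x. norm (f n x - g x) ^ ?p \<partial>lborel) \<longlonglongrightarrow> (\<integral>x. 0 \<partial>(lborel :: 'a measure))"
  proof (rule integral_dominated_convergence)
    show "(\<lambda>x. 0) \<in> borel_measurable lborel" by simp
    show "(\<lambda>x. norm (f n x - g x) ^ ?p) \<in> borel_measurable lborel" for n by measurable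
    show "integrable lborel (\<lambda>x. 2 ^ ?p * norm (w x) ^ ?p)"
      using lp_spaceD(2)[OF w] by simp
    show "AE x in lborel. (\<lambda>n. norm (f n x - g x) ^ ?p) \<longlonglongrightarrow> 0"
      using lim
    proof eventually_elim
      case (elim x)
      then have "(\<lambda>n. norm (f n x - g x) ^ ?p) \<longlonglongrightarrow> norm (g x - g x) ^ ?p"
        by (intro tendsto_intros)
      then show ?case by (simp add: zero_power)
    qed
    show "AE x in lborel. norm (norm (f n x - g x) ^ ?p) \<le> 2 ^ ?p * norm (w x) ^ ?p" for n
      using bound[of n] boundg
    proof eventually_elim
      case (elim x)
      have "norm (f n x - g x) ^ ?p \<le> (2 * norm (w x)) ^ ?p"
        using elim norm_triangle_ineq4[of "f n x" "g x"] by (intro power_mono) auto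
      then show ?case by (simp add: power_mult_distrib)
    qed
  qed
  then have "(\<lambda>n. root ?p (\<integral>x. norm (f n x - g x) ^ ?p \<partial>lborel)) \<longlonglongrightarrow> root ?p 0"
    by (intro tendsto_real_root) simp
  then have "(\<lambda>n. norm (Lp_class (f n) - Lp_class g :: ('a, 'b, 'p) Lp)) \<longlonglongrightarrow> 0"
    by (simp add: Lp_class_diff[OF fm gm, symmetric] norm_Lp_class[OF lp_space_diff[OF fm gm]] lp_norm_def)
  then show "(\<lambda>n. Lp_class (f n) :: ('a, 'b, 'p) Lp) \<longlonglongrightarrow> Lp_class g"
    by (simp add: LIM_zero_iff tendsto_norm_zero_iff)
qed

lemma lp_space_indicator:
  assumes "A \<in> sets borel" "emeasure lborel A < \<infinity>" "0 < p"
  shows "(\<lambda>x. indicator A x *\<^sub>R b) \<in> lp_space p"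
proof -
  have "(\<lambda>x. norm (indicator A x *\<^sub>R b) ^ p) = (\<lambda>x. indicator A x *\<^sub>R (norm b ^ p))"
    using assms(3) by (auto simp: indicator_def)
  then show ?thesis using assms by (auto simp: lp_space_def)
qed

lemma second_countable_if_dense:
  fixes D :: "'a::metric_space set"
  assumes "countable D" "closure D = UNIV"
  shows "\<exists>B::'a set set. countable B \<and> open = generate_topology B"
proof -
  let ?B = "(\<lambda>(x, n::nat). ball x (1 / Suc n)) ` (D \<times> UNIV)"
  have "topological_basis ?B"
  proof (rule topological_basisI)
    fix O' :: "'a set" and y assume "open O'" "y \<in> O'"
    then obtain e where e: "0 < e" "ball y e \<subseteq> O'" using open_contains_ball by blast
    obtain n where n: "1 / Suc n < e / 2"
      using e(1) nat_approx_posE[of "e/2"] by (metis half_gt_zero)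
    obtain x where x: "x \<in> D" "dist x y < 1 / Suc n"
      using assms(2) closure_approachable[of y D] by (metis UNIV_I divide_pos_pos of_nat_0_less_iff zero_less_Suc zero_less_one)
    have "ball x (1 / Suc n) \<subseteq> ball y e"
    proof
      fix z assume "z \<in> ball x (1 / Suc n)"
      then show "z \<in> ball y e" using x(2) n dist_triangle[of y z x] by (simp add: dist_commute)
    qed
    then show "\<exists>B'\<in>?B. y \<in> B' \<and> B' \<subseteq> O'"
      using x e(2) by (intro bexI[of _ "ball x (1 / Suc n)"]) auto
  qed auto
  moreover have "countable ?B" using assms(1) by auto
  ultimately show ?thesis by (metis topological_basis_imp_subbasis)
qed

lemma Lp_separable:
  "\<exists>D :: ('a::euclidean_space, 'b::{banach, second_countable_topology}, 'p::finite) Lp set. countable D \<and> closure D = UNIV"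
proof -
  let ?p = "CARD('p)"
  have p: "0 < ?p" by simp
  define ind :: "'a set \<Rightarrow> 'b \<Rightarrow> ('a, 'b, 'p) Lp" where "ind A b = Lp_class (\<lambda>x. indicator A x *\<^sub>R b)" for A b
  obtain Q :: "'b set" where Q: "countable Q" "\<And>X. open X \<Longrightarrow> X \<noteq> {} \<Longrightarrow> \<exists>d\<in>Q. d \<in> X"
    using countable_dense_setE by blast
  define bx where "bx f = box (\<Sum>i\<in>Basis. fst (f i) *\<^sub>R i) (\<Sum>i\<in>Basis. snd (f i) *\<^sub>R (i::'a))" for f :: "'a \<Rightarrow> real \<times> real"
  define J where "J = (Basis \<rightarrow>\<^sub>E \<rat> \<times> \<rat> :: ('a \<Rightarrow> real \<times> real) set)"
  define \<U> where "\<U> = (\<lambda>F. \<Union>f\<in>F. bx f) ` {F. finite F \<and> F \<subseteq> J}"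
  have cJ: "countable J"
    unfolding J_def by (intro countable_PiE countable_SIGMA countable_rat) auto
  have cU: "countable \<U>"
    unfolding \<U>_def by (intro countable_image countable_Collect_finite_subset cJ)
  define D0 where "D0 = sum_list ` lists ((\<lambda>(S, b). ind S b) ` (\<U> \<times> Q))"
  have cD: "countable D0"
    unfolding D0_def using cU Q(1) by (intro countable_image countable_lists) auto
  define K where "K = closure D0"
  have D0_add: "x + y \<in> D0" if "x \<in> D0" "y \<in> D0" for x y
  proof -
    from that obtain xs ys where "x = sum_list xs" "y = sum_list ys"
      "xs \<in> lists ((\<lambda>(S, b). ind S b) ` (\<U> \<times> Q))" "ys \<in> lists ((\<lambda>(S, b). ind S b) ` (\<U> \<times> Q))"
      by (auto simp: D0_def)
    then show ?thesis unfolding D0_def by (intro image_eqI[of _ _ "xs @ ys"]) auto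
  qed
  have K_add: "x + y \<in> K" if "x \<in> K" "y \<in> K" for x y
  proof -
    from that obtain X Y where "\<And>n. X n \<in> D0" "X \<longlonglongrightarrow> x" "\<And>n. Y n \<in> D0" "Y \<longlonglongrightarrow> y"
      unfolding K_def closure_sequential by blast
    then show ?thesis unfolding K_def closure_sequential
      by (intro exI[of _ "\<lambda>n. X n + Y n"]) (auto intro: D0_add tendsto_add)
  qed
  have K_0: "0 \<in> K"
    unfolding K_def D0_def by (rule closure_subset[THEN subsetD]) (auto intro!: image_eqI[of _ _ "[]"])
  have K_sum: "(\<Sum>i\<in>I. F i) \<in> K" if "\<And>i. i \<in> I \<Longrightarrow> F i \<in> K" for I :: "'b set" and F
    using that by (induction I rule: infinite_finite_induct) (auto intro: K_0 K_add)
  have K_lim: "x \<in> K" if "\<And>n. X n \<in> K" "X \<longlonglongrightarrow> x" for X x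
    using closed_sequentially[of K X x] that by (auto simp: K_def)
  have ind_diff: "norm (ind A b - ind A c) = root ?p (measure lborel A) * norm (b - c)"
    if A: "A \<in> sets borel" "emeasure lborel A < \<infinity>" for A b c
  proof -
    have "ind A b - ind A c = Lp_class (\<lambda>x. indicator A x *\<^sub>R (b - c))"
      unfolding ind_def by (subst Lp_class_diff[symmetric]) (auto simp: algebra_simps intro!: lp_space_indicator A)
    then have "norm (ind A b - ind A c) = lp_norm ?p (\<lambda>x. indicator A x *\<^sub>R (b - c))"
      using norm_Lp_class[OF lp_space_indicator[OF A p, of "b - c"]] by simp
    also have "\<dots> = root ?p (\<integral>x. indicator A x *\<^sub>R (norm (b - c) ^ ?p) \<partial>lborel)"
      unfolding lp_norm_def
      by (intro arg_cong[where f = "root ?p"] Bochner_Integration.integral_cong) (auto simp: indicator_def)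
    also have "\<dots> = root ?p (measure lborel A) * norm (b - c)"
      using A by (simp add: real_root_mult real_root_power_cancel)
    finally show ?thesis .
  qed
  have UK: "ind S b \<in> K" if "S \<in> \<U>" for S b
  proof -
    have S: "S \<in> sets borel" "emeasure lborel S < \<infinity>"
    proof -
      from that obtain F where F: "finite F" "S = (\<Union>f\<in>F. bx f)" by (auto simp: \<U>_def)
      then have "bounded S" "open S" by (auto simp: bx_def)
      then show "S \<in> sets borel" "emeasure lborel S < \<infinity>" by (auto dest: emeasure_bounded_finite)
    qed
    have "\<exists>c\<in>Q. norm (c - b) < 1 / Suc n" for n
      using Q(2)[of "ball b (1 / Suc n)"] by (auto simp: dist_norm norm_minus_commute)
    then obtain c where c: "\<And>n. c n \<in> Q" "\<And>n. norm (c n - b) < 1 / Suc n" by metis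
    show ?thesis
    proof (rule K_lim)
      show "ind S (c n) \<in> K" for n
      proof -
        have "ind S (c n) \<in> (\<lambda>(S, b). ind S b) ` (\<U> \<times> Q)"
          using that c(1)[of n] by (intro image_eqI[of _ _ "(S, c n)"]) auto
        then have "[ind S (c n)] \<in> lists ((\<lambda>(S, b). ind S b) ` (\<U> \<times> Q))" by simp
        then have "ind S (c n) \<in> D0" unfolding D0_def by (rule image_eqI[rotated]) simp
        then show ?thesis unfolding K_def by (rule closure_subset[THEN subsetD])
      qed
      have "(\<lambda>n. c n - b) \<longlonglongrightarrow> 0"
        using c(2) by (intro LIMSEQ_norm_0) auto
      then have "(\<lambda>n. norm (ind S (c n) - ind S b)) \<longlonglongrightarrow> 0"
        unfolding ind_diff[OF S] by (intro tendsto_mult_right_zero tendsto_norm_zero)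
      then show "(\<lambda>n. ind S (c n)) \<longlonglongrightarrow> ind S b"
        by (simp add: LIM_zero_iff tendsto_norm_zero_iff)
    qed
  qed
  have openK: "ind U b \<in> K" if U: "open U" "emeasure lborel U < \<infinity>" for U b
  proof -
    define I where "I = {f \<in> J. bx f \<subseteq> U}"
    have Ueq: "U = (\<Union>f\<in>I. bx f)"
      using open_UNION_box[OF U(1)] by (simp add: I_def J_def bx_def)
    have cI: "countable I" using cJ by (auto simp: I_def intro: countable_subset)
    show ?thesis
    proof (cases "I = {}")
      case True
      then show ?thesis using UK[of "{}" b] Ueq by (auto simp: \<U>_def)
    next
      case False
      define e where "e = from_nat_into I"
      have e: "range e = I" unfolding e_def using cI False by (rule range_from_nat_into[rotated])
      define S where "S n = (\<Union>i\<le>n. bx (e i))" for n :: nat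
      have SU: "S n \<in> \<U>" for n
        unfolding \<U>_def S_def using e by (intro image_eqI[of _ _ "e ` {..n}"]) (auto simp: I_def)
      have Ssub: "S n \<subseteq> U" for n unfolding S_def using e by (auto simp: I_def)
      show ?thesis
      proof (rule K_lim[OF UK[OF SU]])
        show "(\<lambda>n. ind (S n) b) \<longlonglongrightarrow> ind U b"
          unfolding ind_def
        proof (rule Lp_dominated_convergence(3)[where w = "\<lambda>x. indicator U x *\<^sub>R norm b"])
          show "(\<lambda>x. indicator U x *\<^sub>R norm b) \<in> lp_space ?p"
            using U by (intro lp_space_indicator) auto
          have "open (S n)" for n unfolding S_def by (auto simp: bx_def)
          then show "(\<lambda>x. indicator (S n) x *\<^sub>R b) \<in> borel_measurable lborel" for n by simp
          show "(\<lambda>x. indicator U x *\<^sub>R b) \<in> borel_measurable lborel" using U(1) by simp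
          show "AE x in lborel. norm (indicator (S n) x *\<^sub>R b) \<le> indicator U x *\<^sub>R norm b" for n
            using Ssub[of n] by (auto simp: indicator_def)
          show "AE x in lborel. (\<lambda>n. indicator (S n) x *\<^sub>R b) \<longlonglongrightarrow> indicator U x *\<^sub>R b"
          proof (rule AE_I2)
            fix x
            have "eventually (\<lambda>n. indicator (S n) x *\<^sub>R b = indicator U x *\<^sub>R b) sequentially"
            proof (cases "x \<in> U")
              case True
              then obtain i where "x \<in> bx (e i)" using Ueq e by blast
              then show ?thesis using Ssub
                by (intro eventually_sequentiallyI[of i]) (auto simp: S_def indicator_def)
            next
              case False
              then have "x \<notin> S n" for n using Ssub by blast
              then show ?thesis using False by simp
            qed
            then show "(\<lambda>n. indicator (S n) x *\<^sub>R b) \<longlonglongrightarrow> indicator U x *\<^sub>R b"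
              by (rule tendsto_eventually)
          qed
        qed
      qed
    qed
  qed
  have setK: "ind A b \<in> K" if A: "A \<in> sets borel" "emeasure lborel A < \<infinity>" for A b
  proof -
    have "\<exists>U. open U \<and> A \<subseteq> U \<and> emeasure lborel (U - A) < ennreal (1 / Suc n)" for n
    proof -
      have "0 < 1 / real (Suc n)" by simp
      then show ?thesis using outer_regular_lborel[OF A(1)] by metis
    qed
    then obtain U where U: "\<And>n. open (U n)" "\<And>n. A \<subseteq> U n" "\<And>n. emeasure lborel (U n - A) < ennreal (1 / Suc n)"
      by metis
    have fin: "emeasure lborel (U n - A) < \<infinity>" for n
      using less_trans[OF U(3)[of n] ennreal_less_top] by simp
    have finU: "emeasure lborel (U n) < \<infinity>" for n
    proof -
      have "emeasure lborel (U n) = emeasure lborel A + emeasure lborel (U n - A)"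
        using U(1,2)[of n] A(1) by (subst plus_emeasure) (auto simp: Un_absorb1)
      then show ?thesis using fin[of n] A(2) by (simp add: ennreal_add_less_top)
    qed
    have UA: "U n - A \<in> sets borel" for n using U(1)[of n] A(1) by auto
    have eq: "norm (ind (U n) b - ind A b) = root ?p (measure lborel (U n - A)) * norm b" for n
    proof -
      have "(\<lambda>x. indicator (U n) x *\<^sub>R b) = (\<lambda>x. indicator (U n - A) x *\<^sub>R b + indicator A x *\<^sub>R b)"
        using U(2)[of n] by (auto simp: indicator_def fun_eq_iff)
      then have "ind (U n) b = ind (U n - A) b + ind A b"
        unfolding ind_def
        using Lp_class_add[OF lp_space_indicator[OF UA fin p] lp_space_indicator[OF A p]] by simp
      moreover have "ind (U n - A) 0 = 0" by (simp add: ind_def zero_Lp_def)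
      ultimately show ?thesis using ind_diff[OF UA fin, of n b 0] by simp
    qed
    show ?thesis
    proof (rule K_lim[OF openK[OF U(1) finU]])
      have "(\<lambda>n. measure lborel (U n - A)) \<longlonglongrightarrow> 0"
      proof (rule real_tendsto_sandwich[where f = "\<lambda>_. 0"])
        show "(\<lambda>n. 1 / real (Suc n)) \<longlonglongrightarrow> 0" using LIMSEQ_inverse_real_of_nat by (simp add: inverse_eq_divide)
        show "\<forall>\<^sub>F n in sequentially. measure lborel (U n - A) \<le> 1 / real (Suc n)"
        proof (rule always_eventually, rule allI)
          fix n
          show "measure lborel (U n - A) \<le> 1 / real (Suc n)"
            unfolding measure_def using U(3)[of n] by (intro enn2real_leI) auto
        qed
      qed auto
      then have "(\<lambda>n. root ?p (measure lborel (U n - A))) \<longlonglongrightarrow> root ?p 0"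
        by (intro tendsto_real_root)
      then have "(\<lambda>n. norm (ind (U n) b - ind A b)) \<longlonglongrightarrow> 0"
        unfolding eq by (intro tendsto_mult_left_zero) simp
      then show "(\<lambda>n. ind (U n) b) \<longlonglongrightarrow> ind A b"
        by (simp add: LIM_zero_iff tendsto_norm_zero_iff)
    qed
  qed
  have "u \<in> K" for u
  proof -
    let ?f = "Lp_rep u"
    have f: "?f \<in> lp_space ?p" by (rule Lp_rep_space)
    obtain F where F: "\<And>i. simple_function lborel (F i)" "\<And>x. (\<lambda>i. F i x) \<longlonglongrightarrow> ?f x"
      "\<And>i x. dist (F i x) 0 \<le> 2 * dist (?f x) 0"
      using borel_measurable_implies_sequence_metric[OF lp_spaceD(1)[OF f], of 0] by auto
    have Fm: "F i \<in> borel_measurable lborel" for i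
      by (rule borel_measurable_simple_function[OF F(1)])
    have Fs: "F i \<in> lp_space ?p" for i
      using F(3)[of i] by (intro lp_space_bound[OF f Fm, of _ 2]) auto
    have FK: "Lp_class (F i) \<in> K" for i
    proof -
      let ?Y = "range (F i) - {0}"
      let ?A = "\<lambda>y. F i -` {y}"
      have fin: "finite (range (F i))" using F(1)[of i] by (simp add: simple_function_def)
      have A: "?A y \<in> sets borel" for y
        using simple_functionD(2)[OF F(1)[of i], of "{y}"] by simp
      have Afin: "emeasure lborel (?A y) < \<infinity>" if "y \<in> ?Y" for y
      proof -
        have "integrable lborel (\<lambda>x. indicator (?A y) x *\<^sub>R (1::real))"
        proof (rule Bochner_Integration.integrable_bound)
          show "integrable lborel (\<lambda>x. inverse (norm y ^ ?p) * norm (F i x) ^ ?p)"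
            using lp_spaceD(2)[OF Fs[of i]] by simp
          show "(\<lambda>x. indicator (?A y) x *\<^sub>R (1::real)) \<in> borel_measurable lborel" using A[of y] by simp
          show "AE x in lborel. norm (indicator (?A y) x *\<^sub>R (1::real)) \<le> norm (inverse (norm y ^ ?p) * norm (F i x) ^ ?p)"
            using that by (auto simp: indicator_def)
        qed
        then show ?thesis using A[of y] by (simp add: integrable_indicator_iff)
      qed
      have rep: "Lp_class (\<lambda>x. \<Sum>y\<in>I. indicator (?A y) x *\<^sub>R y) = (\<Sum>y\<in>I. ind (?A y) y)
          \<and> (\<lambda>x. \<Sum>y\<in>I. indicator (?A y) x *\<^sub>R y) \<in> lp_space ?p" if "finite I" "I \<subseteq> ?Y" for I
        using that
      proof (induction I)
        case empty
        then show ?case by (simp add: zero_Lp_def lp_space_zero)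
      next
        case (insert y I)
        have i1: "(\<lambda>x. indicator (?A y) x *\<^sub>R y) \<in> lp_space ?p"
          using insert.prems by (intro lp_space_indicator A Afin) auto
        have i2: "Lp_class (\<lambda>x. \<Sum>y\<in>I. indicator (?A y) x *\<^sub>R y) = (\<Sum>y\<in>I. ind (?A y) y)"
          "(\<lambda>x. \<Sum>y\<in>I. indicator (?A y) x *\<^sub>R y) \<in> lp_space ?p" using insert by auto
        show ?case
          unfolding sum.insert[OF insert(1,2)]
          using Lp_class_add[OF i1 i2(2)] lp_space_add[OF i1 i2(2)]
          by (simp only: ind_def i2(1)[unfolded ind_def])
      qed
      have "F i = (\<lambda>x. \<Sum>y\<in>?Y. indicator (?A y) x *\<^sub>R y)"
      proof
        fix x
        have "(\<Sum>y\<in>?Y. indicator (?A y) x *\<^sub>R y) = (\<Sum>y\<in>?Y. if y = F i x then y else 0)"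
          by (intro sum.cong) (auto simp: indicator_def)
        also have "\<dots> = F i x" using fin by (auto simp: sum.delta)
        finally show "F i x = (\<Sum>y\<in>?Y. indicator (?A y) x *\<^sub>R y)" by simp
      qed
      then have "Lp_class (F i) = (\<Sum>y\<in>?Y. ind (?A y) y)" using rep[of ?Y] fin by simp
      also have "\<dots> \<in> K" by (intro K_sum setK A Afin)
      finally show ?thesis .
    qed
    have w: "(\<lambda>x. 2 * norm (?f x)) \<in> lp_space ?p"
      using lp_spaceD(1)[OF f] by (intro lp_space_bound[OF f, of _ 2]) auto
    have "(\<lambda>i. Lp_class (F i) :: ('a, 'b, 'p) Lp) \<longlonglongrightarrow> Lp_class ?f"
      by (rule Lp_dominated_convergence(3)[OF w Fm lp_spaceD(1)[OF f]])
        (use F(2,3) in auto)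
    then show ?thesis using K_lim[OF FK] by (simp add: Lp_class_rep)
  qed
  then show ?thesis using cD unfolding K_def by blast
qed

instance Lp :: (euclidean_space, "{banach, second_countable_topology}", finite) second_countable_topology
proof
  show "\<exists>B :: ('a, 'b, 'c) Lp set set. countable B \<and> open = generate_topology B"
    using Lp_separable second_countable_if_dense by blast
qed

definition linf_space :: "('a::euclidean_space \<Rightarrow> 'b::{banach, second_countable_topology}) set" where
  "linf_space = {f \<in> borel_measurable lborel. \<exists>C. AE x in lborel. norm (f x) \<le> C}"

definition linf_norm :: "('a::euclidean_space \<Rightarrow> 'b::{banach, second_countable_topology}) \<Rightarrow> real" where
  "linf_norm f = real_of_ereal (esssup lborel (\<lambda>x. ereal (norm (f x))))"

lemma linf_spaceI:
  assumes "f \<in> borel_measurable lborel" "AE x in lborel. norm (f x) \<le> C"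
  shows "f \<in> linf_space"
  using assms by (auto simp: linf_space_def)

lemma linf_spaceD: "f \<in> linf_space \<Longrightarrow> f \<in> borel_measurable lborel"
  by (simp add: linf_space_def)

lemma esssup_norm_eq:
  fixes f :: "'a::euclidean_space \<Rightarrow> 'b::{banach, second_countable_topology}"
  assumes "f \<in> linf_space"
  shows "esssup lborel (\<lambda>x. ereal (norm (f x))) = ereal (linf_norm f)" "0 \<le> linf_norm f"
proof -
  let ?g = "\<lambda>x. ereal (norm (f x))"
  from assms obtain C where C: "AE x in lborel. norm (f x) \<le> C" and [measurable]: "f \<in> borel_measurable lborel"
    by (auto simp: linf_space_def)
  have up: "esssup lborel ?g \<le> ereal C" using C by (intro esssup_I) auto
  have "esssup lborel (\<lambda>x::'a. 0::ereal) = 0"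
    by (rule esssup_const) simp
  then have lo: "0 \<le> esssup lborel ?g"
    using esssup_mono[of "\<lambda>x::'a. 0::ereal" lborel ?g] by auto
  show "esssup lborel ?g = ereal (linf_norm f)" unfolding linf_norm_def
    using up lo by (cases "esssup lborel ?g") auto
  show "0 \<le> linf_norm f" unfolding linf_norm_def using lo by (simp add: real_of_ereal_pos)
qed

lemma linf_norm_AE:
  assumes "f \<in> linf_space"
  shows "AE x in lborel. norm (f x) \<le> linf_norm f"
  using esssup_AE[of "\<lambda>x. ereal (norm (f x))" lborel] esssup_norm_eq(1)[OF assms] by simp

lemma linf_norm_le:
  assumes "f \<in> linf_space" "AE x in lborel. norm (f x) \<le> C"
  shows "linf_norm f \<le> C"
proof -
  have "esssup lborel (\<lambda>x. ereal (norm (f x))) \<le> ereal C"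
    using assms(2) linf_spaceD[OF assms(1)] by (intro esssup_I) auto
  then show ?thesis by (simp add: esssup_norm_eq(1)[OF assms(1)])
qed

lemma linf_space_zero: "(\<lambda>x. 0) \<in> linf_space"
  by (rule linf_spaceI[of _ 0]) auto

lemma linf_space_add:
  assumes f: "f \<in> linf_space" and g: "g \<in> linf_space"
  shows "(\<lambda>x. f x + g x) \<in> linf_space"
proof (rule linf_spaceI)
  show "(\<lambda>x. f x + g x) \<in> borel_measurable lborel"
    using linf_spaceD[OF f] linf_spaceD[OF g] by measurable
  show "AE x in lborel. norm (f x + g x) \<le> linf_norm f + linf_norm g"
    using linf_norm_AE[OF f] linf_norm_AE[OF g]
  proof eventually_elim
    case (elim x)
    then show ?case using norm_triangle_ineq[of "f x" "g x"] by linarith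
  qed
qed

lemma linf_space_scaleR:
  assumes f: "f \<in> linf_space"
  shows "(\<lambda>x. c *\<^sub>R f x) \<in> linf_space"
proof (rule linf_spaceI)
  show "(\<lambda>x. c *\<^sub>R f x) \<in> borel_measurable lborel"
    using linf_spaceD[OF f] by measurable
  show "AE x in lborel. norm (c *\<^sub>R f x) \<le> \<bar>c\<bar> * linf_norm f"
    using linf_norm_AE[OF f] by eventually_elim (auto intro: mult_left_mono)
qed

lemma linf_space_diff:
  assumes "f \<in> linf_space" "g \<in> linf_space"
  shows "(\<lambda>x. f x - g x) \<in> linf_space"
  using linf_space_add[OF assms(1) linf_space_scaleR[OF assms(2), of "-1"]] by simp

lemma linf_norm_cong:
  assumes f: "f \<in> linf_space" and g: "g \<in> linf_space" and eq: "AE x in lborel. f x = g x"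
  shows "linf_norm f = linf_norm g"
proof (rule antisym)
  show "linf_norm f \<le> linf_norm g"
    using linf_norm_AE[OF g] eq by (intro linf_norm_le[OF f]) (auto elim: eventually_elim2)
  show "linf_norm g \<le> linf_norm f"
    using linf_norm_AE[OF f] eq by (intro linf_norm_le[OF g]) (auto elim: eventually_elim2)
qed

typedef (overloaded) ('a, 'b) Linf =
  "linf_space // ae_eq_rel (linf_space :: ('a::euclidean_space \<Rightarrow> 'b::{banach, second_countable_topology}) set)"
  by (rule exI, rule quotientI, rule linf_space_zero)

definition Linf_class :: "('a \<Rightarrow> 'b) \<Rightarrow> ('a::euclidean_space, 'b::{banach, second_countable_topology}) Linf" where
  "Linf_class f = Abs_Linf (ae_eq_rel linf_space `` {f})"

definition Linf_rep :: "('a::euclidean_space, 'b::{banach, second_countable_topology}) Linf \<Rightarrow> 'a \<Rightarrow> 'b" where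
  "Linf_rep u = (SOME f. f \<in> Rep_Linf u)"

lemma Linf_class_eq_iff:
  fixes f g :: "'a::euclidean_space \<Rightarrow> 'b::{banach, second_countable_topology}"
  assumes "f \<in> linf_space" "g \<in> linf_space"
  shows "Linf_class f = Linf_class g \<longleftrightarrow> (AE x in lborel. f x = g x)"
proof -
  have "Linf_class f = Linf_class g \<longleftrightarrow> ae_eq_rel linf_space `` {f} = ae_eq_rel linf_space `` {g}"
    unfolding Linf_class_def using assms by (intro Abs_Linf_inject quotientI)
  also have "\<dots> \<longleftrightarrow> (AE x in lborel. f x = g x)"
    using assms eq_equiv_class_iff[OF equiv_ae_eq_rel assms] by (simp add: ae_eq_rel_def)
  finally show ?thesis .
qed

lemma Linf_rep:
  fixes u :: "('a::euclidean_space, 'b::{banach, second_countable_topology}) Linf"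
  shows Linf_rep_space: "Linf_rep u \<in> linf_space" and Linf_class_rep: "Linf_class (Linf_rep u) = u"
proof -
  obtain f where f: "f \<in> linf_space" "u = Linf_class f" "Rep_Linf u = ae_eq_rel linf_space `` {f}"
    using Rep_Linf[of u] by (metis Linf_class_def Rep_Linf_inverse quotientE)
  then have "f \<in> Rep_Linf u" by (simp add: ae_eq_rel_def)
  then have "Linf_rep u \<in> Rep_Linf u" unfolding Linf_rep_def by (rule someI[of "\<lambda>f. f \<in> Rep_Linf u"])
  then have *: "Linf_rep u \<in> linf_space" "AE x in lborel. f x = Linf_rep u x"
    using f(3) by (auto simp: ae_eq_rel_def)
  show "Linf_rep u \<in> linf_space" by fact
  show "Linf_class (Linf_rep u) = u"
    using Linf_class_eq_iff[OF f(1) *(1)] *(2) f(2) by simp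
qed

lemma Linf_rep_class:
  assumes "f \<in> linf_space"
  shows "AE x in lborel. Linf_rep (Linf_class f) x = f x"
  using Linf_class_eq_iff[OF Linf_rep_space assms] Linf_class_rep by blast

lemma Linf_eq_iff: "u = v \<longleftrightarrow> (AE x in lborel. Linf_rep u x = Linf_rep v x)"
  using Linf_class_eq_iff[OF Linf_rep_space[of u] Linf_rep_space[of v]] by (simp add: Linf_class_rep)

instantiation Linf :: (euclidean_space, "{banach, second_countable_topology}") real_vector
begin

definition zero_Linf :: "('a, 'b) Linf" where
  "0 = Linf_class (\<lambda>x. 0)"

definition plus_Linf :: "('a, 'b) Linf \<Rightarrow> ('a, 'b) Linf \<Rightarrow> ('a, 'b) Linf" where
  "u + v = Linf_class (\<lambda>x. Linf_rep u x + Linf_rep v x)"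

definition minus_Linf :: "('a, 'b) Linf \<Rightarrow> ('a, 'b) Linf \<Rightarrow> ('a, 'b) Linf" where
  "u - v = Linf_class (\<lambda>x. Linf_rep u x - Linf_rep v x)"

definition uminus_Linf :: "('a, 'b) Linf \<Rightarrow> ('a, 'b) Linf" where
  "- u = Linf_class (\<lambda>x. - Linf_rep u x)"

definition scaleR_Linf :: "real \<Rightarrow> ('a, 'b) Linf \<Rightarrow> ('a, 'b) Linf" where
  "r *\<^sub>R u = Linf_class (\<lambda>x. r *\<^sub>R Linf_rep u x)"

lemma Linf_rep_zero: "AE x in lborel. Linf_rep (0 :: ('a, 'b) Linf) x = 0"
  unfolding zero_Linf_def by (intro Linf_rep_class linf_space_zero)

lemma Linf_rep_add: "AE x in lborel. Linf_rep (u + v :: ('a, 'b) Linf) x = Linf_rep u x + Linf_rep v x"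
  unfolding plus_Linf_def by (intro Linf_rep_class linf_space_add Linf_rep_space)

lemma Linf_rep_diff: "AE x in lborel. Linf_rep (u - v :: ('a, 'b) Linf) x = Linf_rep u x - Linf_rep v x"
  unfolding minus_Linf_def by (intro Linf_rep_class linf_space_diff Linf_rep_space)

lemma Linf_rep_uminus: "AE x in lborel. Linf_rep (- u :: ('a, 'b) Linf) x = - Linf_rep u x"
  unfolding uminus_Linf_def
  using linf_space_scaleR[OF Linf_rep_space, of "-1" u] by (intro Linf_rep_class) simp

lemma Linf_rep_scaleR: "AE x in lborel. Linf_rep (r *\<^sub>R u :: ('a, 'b) Linf) x = r *\<^sub>R Linf_rep u x"
  unfolding scaleR_Linf_def by (intro Linf_rep_class linf_space_scaleR Linf_rep_space)

instance
proof
  fix u v w :: "('a, 'b) Linf" and r s :: real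
  show "u + v + w = u + (v + w)"
    unfolding Linf_eq_iff
    using Linf_rep_add[of "u + v" w] Linf_rep_add[of u v] Linf_rep_add[of u "v + w"] Linf_rep_add[of v w]
    by eventually_elim simp
  show "u + v = v + u"
    unfolding Linf_eq_iff using Linf_rep_add[of u v] Linf_rep_add[of v u] by eventually_elim simp
  show "0 + u = u"
    unfolding Linf_eq_iff using Linf_rep_add[of 0 u] Linf_rep_zero by eventually_elim simp
  show "- u + u = 0"
    unfolding Linf_eq_iff using Linf_rep_add[of "-u" u] Linf_rep_uminus[of u] Linf_rep_zero
    by eventually_elim simp
  show "u - v = u + - v"
    unfolding Linf_eq_iff using Linf_rep_add[of u "-v"] Linf_rep_uminus[of v] Linf_rep_diff[of u v]
    by eventually_elim simp
  show "r *\<^sub>R (u + v) = r *\<^sub>R u + r *\<^sub>R v"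
    unfolding Linf_eq_iff using Linf_rep_scaleR[of r "u + v"] Linf_rep_add[of u v]
      Linf_rep_add[of "r *\<^sub>R u" "r *\<^sub>R v"] Linf_rep_scaleR[of r u] Linf_rep_scaleR[of r v]
    by eventually_elim (simp add: scaleR_add_right)
  show "(r + s) *\<^sub>R u = r *\<^sub>R u + s *\<^sub>R u"
    unfolding Linf_eq_iff using Linf_rep_scaleR[of "r + s" u]
      Linf_rep_add[of "r *\<^sub>R u" "s *\<^sub>R u"] Linf_rep_scaleR[of r u] Linf_rep_scaleR[of s u]
    by eventually_elim (simp add: scaleR_add_left)
  show "r *\<^sub>R s *\<^sub>R u = (r * s) *\<^sub>R u"
    unfolding Linf_eq_iff using Linf_rep_scaleR[of r "s *\<^sub>R u"] Linf_rep_scaleR[of s u]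
      Linf_rep_scaleR[of "r * s" u] by eventually_elim simp
  show "1 *\<^sub>R u = u"
    unfolding Linf_eq_iff using Linf_rep_scaleR[of 1 u] by eventually_elim simp
qed

end

instantiation Linf :: (euclidean_space, "{banach, second_countable_topology}") real_normed_vector
begin

definition norm_Linf :: "('a, 'b) Linf \<Rightarrow> real" where
  "norm u = linf_norm (Linf_rep u)"

definition dist_Linf :: "('a, 'b) Linf \<Rightarrow> ('a, 'b) Linf \<Rightarrow> real" where
  "dist_Linf u v = norm (u - v)"

definition sgn_Linf :: "('a, 'b) Linf \<Rightarrow> ('a, 'b) Linf" where
  "sgn_Linf u = u /\<^sub>R norm u"

definition uniformity_Linf :: "(('a, 'b) Linf \<times> ('a, 'b) Linf) filter" where
  "uniformity_Linf = (INF e\<in>{0<..}. principal {(x, y). dist x y < e})"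

definition open_Linf :: "('a, 'b) Linf set \<Rightarrow> bool" where
  "open_Linf U \<longleftrightarrow> (\<forall>x\<in>U. \<forall>\<^sub>F (x', y) in uniformity. x' = x \<longrightarrow> y \<in> U)"

instance
proof
  fix u v :: "('a, 'b) Linf" and r :: real
  show "(norm u = 0) = (u = 0)"
  proof -
    have "(norm u = 0) = (AE x in lborel. Linf_rep u x = 0)"
    proof
      assume "norm u = 0"
      then show "AE x in lborel. Linf_rep u x = 0"
        using linf_norm_AE[OF Linf_rep_space[of u]] by (simp add: norm_Linf_def)
    next
      assume "AE x in lborel. Linf_rep u x = 0"
      then have "linf_norm (Linf_rep u) \<le> 0" by (intro linf_norm_le Linf_rep_space) simp
      then show "norm u = 0"
        using esssup_norm_eq(2)[OF Linf_rep_space[of u]] by (simp add: norm_Linf_def)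
    qed
    also have "\<dots> = (u = 0)"
      using Linf_class_eq_iff[OF Linf_rep_space[of u] linf_space_zero] by (simp add: Linf_class_rep zero_Linf_def)
    finally show ?thesis .
  qed
  show "norm (u + v) \<le> norm u + norm v"
    unfolding norm_Linf_def
  proof (rule linf_norm_le[OF Linf_rep_space])
    show "AE x in lborel. norm (Linf_rep (u + v) x) \<le> linf_norm (Linf_rep u) + linf_norm (Linf_rep v)"
      using Linf_rep_add[of u v] linf_norm_AE[OF Linf_rep_space[of u]] linf_norm_AE[OF Linf_rep_space[of v]]
    proof eventually_elim
      case (elim x)
      then show ?case using norm_triangle_ineq[of "Linf_rep u x" "Linf_rep v x"] by simp
    qed
  qed
  have le: "norm (r *\<^sub>R u) \<le> \<bar>r\<bar> * norm u" for r and u :: "('a, 'b) Linf"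
    unfolding norm_Linf_def
  proof (rule linf_norm_le[OF Linf_rep_space])
    show "AE x in lborel. norm (Linf_rep (r *\<^sub>R u) x) \<le> \<bar>r\<bar> * linf_norm (Linf_rep u)"
      using Linf_rep_scaleR[of r u] linf_norm_AE[OF Linf_rep_space[of u]]
      by eventually_elim (simp add: mult_left_mono)
  qed
  show "norm (r *\<^sub>R u) = \<bar>r\<bar> * norm u"
  proof (cases "r = 0")
    case True
    have "0 \<le> norm (0 *\<^sub>R u)"
      unfolding norm_Linf_def by (rule esssup_norm_eq(2)[OF Linf_rep_space])
    then show ?thesis using le[of 0 u] True by simp
  next
    case False
    have "norm u = norm (inverse r *\<^sub>R (r *\<^sub>R u))" using False by simp
    also have "\<dots> \<le> \<bar>inverse r\<bar> * norm (r *\<^sub>R u)" by (rule le)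
    finally have "\<bar>r\<bar> * norm u \<le> norm (r *\<^sub>R u)"
      using False by (simp add: field_simps)
    with le[of r u] show ?thesis by simp
  qed
qed (simp_all add: dist_Linf_def sgn_Linf_def uniformity_Linf_def open_Linf_def)

end

definition Lp_cmult :: "complex \<Rightarrow> ('a::euclidean_space, complex, 'p::finite) Lp \<Rightarrow> ('a, complex, 'p) Lp" where
  "Lp_cmult c u = Lp_class (\<lambda>x. c * Lp_rep u x)"

definition Lp_Re :: "('a::euclidean_space, complex, 'p::finite) Lp \<Rightarrow> ('a, real, 'p) Lp" where
  "Lp_Re u = Lp_class (\<lambda>x. Re (Lp_rep u x))"

definition Lp_Im :: "('a::euclidean_space, complex, 'p::finite) Lp \<Rightarrow> ('a, real, 'p) Lp" where
  "Lp_Im u = Lp_class (\<lambda>x. Im (Lp_rep u x))"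

definition L2_mult :: "('a::euclidean_space, complex, 2) Lp \<Rightarrow> ('a, complex, 2) Lp \<Rightarrow> ('a, complex, 1) Lp" where
  "L2_mult u v = Lp_class (\<lambda>x. Lp_rep u x * Lp_rep v x)"

definition fourier_integral :: "real \<Rightarrow> ('a::euclidean_space \<Rightarrow> complex) \<Rightarrow> 'a \<Rightarrow> complex" where
  "fourier_integral \<sigma> f \<xi> =
    complex_of_real ((2 * pi) powr (- real DIM('a) / 2)) * (\<integral>x. cis (\<sigma> * (x \<bullet> \<xi>)) * f x \<partial>lborel)"

(* Unitary Fourier transform on L^2 (sign -1) and its inverse (sign 1), as the L^2 limit of the
   transforms of the truncations to balls, which lie in both L^1 and L^2 (Plancherel). *)
definition L2_fourier :: "real \<Rightarrow> ('a::euclidean_space, complex, 2) Lp \<Rightarrow> ('a, complex, 2) Lp" where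
  "L2_fourier \<sigma> u =
    lim (\<lambda>n. Lp_class (fourier_integral \<sigma> (\<lambda>x. indicator (cball 0 (real n)) x *\<^sub>R Lp_rep u x)))"

(* exp(i t Laplacian) is the Fourier multiplier with symbol exp(- i t |xi|^2). *)
definition free_schroedinger :: "real \<Rightarrow> ('a::euclidean_space, complex, 2) Lp \<Rightarrow> ('a, complex, 2) Lp" where
  "free_schroedinger t u =
    L2_fourier 1 (Lp_class (\<lambda>\<xi>. cis (- t * (norm \<xi>)\<^sup>2) * Lp_rep (L2_fourier (-1) u) \<xi>))"

(* L^q(I, 'b) as a space of functions with the seminorm bochner_norm, without passing to a.e.
   classes. For separable 'b, in particular for L^1 and L^2, Borel measurability coincides with
   strong measurability. The values of the functions outside I are irrelevant. *)
definition bochner_space :: "real \<Rightarrow> real set \<Rightarrow> (real \<Rightarrow> 'b::real_normed_vector) set" where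
  "bochner_space q I =
    {f \<in> borel_measurable (restrict_space lborel I).
      integrable (restrict_space lborel I) (\<lambda>t. norm (f t) powr q)}"

definition bochner_norm :: "real \<Rightarrow> real set \<Rightarrow> (real \<Rightarrow> 'b::real_normed_vector) \<Rightarrow> real" where
  "bochner_norm q I f = (\<integral>t. norm (f t) powr q \<partial>restrict_space lborel I) powr (1 / q)"

definition conj_exponent :: "real \<Rightarrow> real" where
  "conj_exponent p = inverse (1 - 1 / p)"

(* The dual of L^p'(I, L^1), p' = conj_exponent p: bounded linear functionals for the seminorm
   vanish on functions that are 0 a.e. on I, so they are the functionals on a.e. classes. They are
   normalised by extensionality outside L^p'(I, L^1). *)
definition Mp :: "real \<Rightarrow> real set \<Rightarrow> ((real \<Rightarrow> ('a::euclidean_space, real, 1) Lp) \<Rightarrow> real) set" where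
  "Mp p I = (let X = bochner_space (conj_exponent p) I in
    {\<Phi> \<in> extensional X.
      (\<forall>f\<in>X. \<forall>g\<in>X. \<Phi> (\<lambda>t. f t + g t) = \<Phi> f + \<Phi> g) \<and>
      (\<forall>c. \<forall>f\<in>X. \<Phi> (\<lambda>t. c *\<^sub>R f t) = c * \<Phi> f) \<and>
      (\<exists>C. \<forall>f\<in>X. \<bar>\<Phi> f\<bar> \<le> C * bochner_norm (conj_exponent p) I f)})"

(* The identification of an element of the dual with an L^infinity-valued measure on I. *)
definition represents ::
  "((real \<Rightarrow> ('a::euclidean_space, real, 1) Lp) \<Rightarrow> real) \<Rightarrow> real set \<Rightarrow> (real set \<Rightarrow> ('a, real) Linf) \<Rightarrow> bool" where
  "represents \<Phi> I V \<longleftrightarrow>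
    (\<forall>E\<in>sets borel. E \<subseteq> I \<longrightarrow>
      (\<forall>h. (\<integral>x. Linf_rep (V E) x * Lp_rep h x \<partial>lborel) = \<Phi> (\<lambda>t. indicator E t *\<^sub>R h)))"

(* Only the values on bounded Borel sets matter. Countable additivity is with respect to the
   L^infinity norm; the measures of elements of the dual satisfy it because p' < infinity. *)
definition Linf_measure :: "(real set \<Rightarrow> ('a::euclidean_space, real) Linf) \<Rightarrow> bool" where
  "Linf_measure V \<longleftrightarrow>
    (\<forall>E :: nat \<Rightarrow> real set. range E \<subseteq> sets borel \<longrightarrow> disjoint_family E \<longrightarrow> bounded (\<Union>n. E n) \<longrightarrow>
      (\<lambda>n. V (E n)) sums V (\<Union>n. E n))"

definition Mp_loc :: "real \<Rightarrow> (real set \<Rightarrow> ('a::euclidean_space, real) Linf) set" where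
  "Mp_loc p = {V. Linf_measure V \<and> (\<forall>a b. a \<le> b \<longrightarrow> (\<exists>\<Phi>\<in>Mp p {a..b}. represents \<Phi> {a..b} V))}"

(* The element of the dual identified with the restriction of V to I. It is unique by
   Mp_represents_unique. *)
definition Mp_pairing ::
  "real \<Rightarrow> real set \<Rightarrow> (real set \<Rightarrow> ('a::euclidean_space, real) Linf) \<Rightarrow> (real \<Rightarrow> ('a, real, 1) Lp) \<Rightarrow> real" where
  "Mp_pairing p I V = (THE \<Phi>. \<Phi> \<in> Mp p I \<and> represents \<Phi> I V)"

(* Complex linear extension of the pairing. *)
definition Mp_cpairing ::
  "real \<Rightarrow> real set \<Rightarrow> (real set \<Rightarrow> ('a::euclidean_space, real) Linf) \<Rightarrow> (real \<Rightarrow> ('a, complex, 1) Lp) \<Rightarrow> complex" where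
  "Mp_cpairing p I V h = Complex (Mp_pairing p I V (\<lambda>t. Lp_Re (h t))) (Mp_pairing p I V (\<lambda>t. Lp_Im (h t)))"

lemma conj_exponent_gt_1: "1 < p \<Longrightarrow> 1 < conj_exponent p"
  by (simp add: conj_exponent_def field_simps)

lemma bochner_space_bound:
  fixes f g :: "real \<Rightarrow> 'b::real_normed_vector"
  assumes q: "0 < q" and f: "f \<in> bochner_space q I" and g: "g \<in> borel_measurable (restrict_space lborel I)"
    and le: "\<And>t. norm (g t) \<le> c * norm (f t)"
  shows "g \<in> bochner_space q I"
proof -
  have [measurable]: "g \<in> borel_measurable (restrict_space lborel I)" by fact
  have "integrable (restrict_space lborel I) (\<lambda>t. norm (g t) powr q)"
  proof (rule Bochner_Integration.integrable_bound)
    show "integrable (restrict_space lborel I) (\<lambda>t. \<bar>c\<bar> powr q * norm (f t) powr q)"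
      using f by (simp add: bochner_space_def)
    show "(\<lambda>t. norm (g t) powr q) \<in> borel_measurable (restrict_space lborel I)" by measurable
    show "AE t in restrict_space lborel I. norm (norm (g t) powr q) \<le> norm (\<bar>c\<bar> powr q * norm (f t) powr q)"
    proof (rule AE_I2)
      fix t
      have "norm (g t) \<le> \<bar>c\<bar> * norm (f t)"
        using le[of t] by (meson abs_ge_self mult_right_mono norm_ge_zero order_trans)
      then have "norm (g t) powr q \<le> (\<bar>c\<bar> * norm (f t)) powr q"
        using q by (intro powr_mono2) auto
      then show "norm (norm (g t) powr q) \<le> norm (\<bar>c\<bar> powr q * norm (f t) powr q)"
        by (simp add: powr_mult)
    qed
  qed
  with g show ?thesis by (simp add: bochner_space_def)
qed

lemma bochner_space_add:
  fixes f g :: "real \<Rightarrow> 'b::{real_normed_vector, second_countable_topology}"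
  assumes q: "0 < q" and f: "f \<in> bochner_space q I" and g: "g \<in> bochner_space q I"
  shows "(\<lambda>t. f t + g t) \<in> bochner_space q I"
proof -
  have [measurable]: "f \<in> borel_measurable (restrict_space lborel I)" "g \<in> borel_measurable (restrict_space lborel I)"
    using f g by (auto simp: bochner_space_def)
  have "integrable (restrict_space lborel I) (\<lambda>t. norm (f t + g t) powr q)"
  proof (rule Bochner_Integration.integrable_bound)
    show "integrable (restrict_space lborel I) (\<lambda>t. 2 powr q * (norm (f t) powr q + norm (g t) powr q))"
      using f g by (simp add: bochner_space_def)
    show "(\<lambda>t. norm (f t + g t) powr q) \<in> borel_measurable (restrict_space lborel I)" by measurable
    show "AE t in restrict_space lborel I.
      norm (norm (f t + g t) powr q) \<le> norm (2 powr q * (norm (f t) powr q + norm (g t) powr q))"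
    proof (rule AE_I2)
      fix t
      let ?m = "max (norm (f t)) (norm (g t))"
      have "norm (f t + g t) \<le> 2 * ?m" using norm_triangle_ineq[of "f t" "g t"] by simp
      then have "norm (f t + g t) powr q \<le> (2 * ?m) powr q"
        using q by (intro powr_mono2) auto
      also have "\<dots> = 2 powr q * ?m powr q" by (rule powr_mult)
      also have "?m powr q \<le> norm (f t) powr q + norm (g t) powr q" by (auto simp: max_def)
      finally show "norm (norm (f t + g t) powr q) \<le> norm (2 powr q * (norm (f t) powr q + norm (g t) powr q))"
        by simp
    qed
  qed
  then show ?thesis by (simp add: bochner_space_def)
qed

lemma Mp_represents_unique:
  fixes \<Phi> \<Psi> :: "(real \<Rightarrow> ('a::euclidean_space, real, 1) Lp) \<Rightarrow> real"
  assumes p: "1 < p" and I: "I \<in> sets borel" "emeasure lborel I < \<infinity>"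
    and \<Phi>: "\<Phi> \<in> Mp p I" "represents \<Phi> I V" and \<Psi>: "\<Psi> \<in> Mp p I" "represents \<Psi> I V"
  shows "\<Phi> = \<Psi>"
proof -
  define q where "q = conj_exponent p"
  have q: "1 < q" using conj_exponent_gt_1[OF p] by (simp add: q_def)
  define X :: "(real \<Rightarrow> ('a, real, 1) Lp) set" where "X = bochner_space q I"
  define M where "M = restrict_space lborel I"
  have spM: "space M = I" by (simp add: M_def space_restrict_space)
  have setsM: "E \<in> sets M \<longleftrightarrow> E \<in> sets borel \<and> E \<subseteq> I" for E
    using I(1) by (auto simp: M_def sets_restrict_space_iff)
  have ext: "\<Theta> f = undefined" if "\<Theta> \<in> Mp p I" "f \<notin> X" for \<Theta> f
    using that by (auto simp: Mp_def X_def q_def Let_def extensional_def)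
  have add: "\<Theta> (\<lambda>t. f t + g t) = \<Theta> f + \<Theta> g" if "\<Theta> \<in> Mp p I" "f \<in> X" "g \<in> X" for \<Theta> f g
    using that by (auto simp: Mp_def X_def q_def Let_def)
  have scl: "\<Theta> (\<lambda>t. c *\<^sub>R f t) = c * \<Theta> f" if "\<Theta> \<in> Mp p I" "f \<in> X" for \<Theta> c f
    using that by (auto simp: Mp_def X_def q_def Let_def)
  have bdd: "\<exists>C. \<forall>f\<in>X. \<bar>\<Theta> f\<bar> \<le> C * bochner_norm q I f" if "\<Theta> \<in> Mp p I" for \<Theta>
    using that by (auto simp: Mp_def X_def q_def Let_def)
  have meas: "f \<in> borel_measurable M" if "f \<in> X" for f
    using that by (simp add: X_def bochner_space_def M_def)
  have ind: "(\<lambda>t. indicator E t *\<^sub>R h) \<in> X \<and> \<Phi> (\<lambda>t. indicator E t *\<^sub>R h) = \<Psi> (\<lambda>t. indicator E t *\<^sub>R h)"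
    if E: "E \<in> sets M" for E h
  proof
    have "(\<lambda>t. norm (indicator E t *\<^sub>R h) powr q) = (\<lambda>t. indicator E t *\<^sub>R (norm h powr q))"
      using q by (auto simp: indicator_def)
    moreover have "emeasure M E < \<infinity>"
    proof -
      have "emeasure M E = emeasure lborel E"
        using E I(1) unfolding M_def by (intro emeasure_restrict_space) (auto simp: setsM[unfolded M_def])
      also have "\<dots> \<le> emeasure lborel I"
        using E I(1) by (intro emeasure_mono) (auto simp: setsM)
      finally show ?thesis using I(2) by (rule le_less_trans)
    qed
    ultimately show "(\<lambda>t. indicator E t *\<^sub>R h) \<in> X"
      using E by (auto simp: X_def bochner_space_def M_def[symmetric])
    show "\<Phi> (\<lambda>t. indicator E t *\<^sub>R h) = \<Psi> (\<lambda>t. indicator E t *\<^sub>R h)"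
      using \<Phi>(2) \<Psi>(2) E by (auto simp: represents_def setsM)
  qed
  have eq: "\<Phi> f = \<Psi> f" if f: "f \<in> X" for f
  proof -
    obtain F where F: "\<And>i. simple_function M (F i)" "\<And>x. x \<in> space M \<Longrightarrow> (\<lambda>i. F i x) \<longlonglongrightarrow> f x"
      "\<And>i x. x \<in> space M \<Longrightarrow> dist (F i x) 0 \<le> 2 * dist (f x) 0"
      using borel_measurable_implies_sequence_metric[OF meas[OF f], of 0] by metis
    have null: "\<Theta> k = 0" if "\<Theta> \<in> Mp p I" "k \<in> X" "\<And>t. t \<in> I \<Longrightarrow> k t = 0" for \<Theta> k
    proof -
      have "bochner_norm q I k = 0"
      proof -
        have "(\<integral>t. norm (k t) powr q \<partial>M) = (\<integral>t. 0 \<partial>M)"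
          using that(3) q by (intro Bochner_Integration.integral_cong) (auto simp: spM)
        then show ?thesis by (simp add: bochner_norm_def M_def[symmetric])
      qed
      moreover obtain C where "\<And>f. f \<in> X \<Longrightarrow> \<bar>\<Theta> f\<bar> \<le> C * bochner_norm q I f"
        using bdd[OF \<open>\<Theta> \<in> Mp p I\<close>] by blast
      ultimately show ?thesis using \<open>k \<in> X\<close> by fastforce
    qed
    have Fs: "F i \<in> X" and Feq: "\<Phi> (F i) = \<Psi> (F i)" for i
    proof -
      let ?Y = "F i ` I"
      let ?A = "\<lambda>y. F i -` {y} \<inter> I"
      have fin: "finite ?Y" using F(1)[of i] by (simp add: simple_function_def spM)
      have A: "?A y \<in> sets M" for y
        using F(1)[of i] simple_functionD(2)[of M "F i" "{y}"] by (simp add: spM)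
      have rep: "(\<lambda>t. \<Sum>y\<in>S. indicator (?A y) t *\<^sub>R y) \<in> X
          \<and> \<Phi> (\<lambda>t. \<Sum>y\<in>S. indicator (?A y) t *\<^sub>R y) = \<Psi> (\<lambda>t. \<Sum>y\<in>S. indicator (?A y) t *\<^sub>R y)"
        if "finite S" for S
        using that
      proof (induction S)
        case empty
        have "(\<lambda>t. 0) \<in> X" using ind[of "{}" 0] by simp
        then show ?case using null[OF \<Phi>(1)] null[OF \<Psi>(1)] by simp
      next
        case (insert y S)
        let ?k = "\<lambda>t. \<Sum>y\<in>S. indicator (?A y) t *\<^sub>R y"
        let ?l = "\<lambda>t. indicator (?A y) t *\<^sub>R y"
        have k: "?k \<in> X" "\<Phi> ?k = \<Psi> ?k" using insert by auto
        have l: "?l \<in> X" "\<Phi> ?l = \<Psi> ?l" using ind[OF A] by auto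
        have "(\<lambda>t. ?l t + ?k t) \<in> X"
          using bochner_space_add[of q] q k(1) l(1) by (simp add: X_def)
        then show ?case
          unfolding sum.insert[OF insert(1,2)]
          using add[OF \<Phi>(1) l(1) k(1)] add[OF \<Psi>(1) l(1) k(1)] by (simp only: k(2) l(2))
      qed
      show FX: "F i \<in> X"
        unfolding X_def
      proof -
        have "integrable M (\<lambda>t. norm (F i t) powr q)"
        proof (rule Bochner_Integration.integrable_bound)
          show "integrable M (\<lambda>t. 2 powr q * norm (f t) powr q)"
            using f by (simp add: X_def bochner_space_def M_def)
          show "(\<lambda>t. norm (F i t) powr q) \<in> borel_measurable M"
            using borel_measurable_simple_function[OF F(1)[of i]] by measurable
          show "AE t in M. norm (norm (F i t) powr q) \<le> norm (2 powr q * norm (f t) powr q)"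
          proof (rule AE_I2)
            fix t assume "t \<in> space M"
            then have "norm (F i t) powr q \<le> (2 * norm (f t)) powr q"
              using F(3)[of t i] q by (intro powr_mono2) auto
            then show "norm (norm (F i t) powr q) \<le> norm (2 powr q * norm (f t) powr q)"
              by (simp add: powr_mult)
          qed
        qed
        then show "F i \<in> bochner_space q I"
          using borel_measurable_simple_function[OF F(1)[of i]] by (simp add: bochner_space_def M_def)
      qed
      define s where "s = (\<lambda>t. \<Sum>y\<in>?Y. indicator (?A y) t *\<^sub>R y)"
      have s: "s \<in> X" "\<Phi> s = \<Psi> s" using rep[OF fin] by (auto simp only: s_def)
      have on_I: "F i t = s t" if "t \<in> I" for t
      proof -
        have "s t = (\<Sum>y\<in>?Y. if y = F i t then y else 0)"
          unfolding s_def using that by (intro sum.cong) (auto simp: indicator_def)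
        then show ?thesis using fin that by (simp add: sum.delta)
      qed
      have "\<Theta> (F i) = \<Theta> s" if \<Theta>: "\<Theta> \<in> Mp p I" for \<Theta>
      proof -
        let ?d = "\<lambda>t. F i t - s t"
        have "integrable M (\<lambda>t. norm (?d t) powr q) = integrable M (\<lambda>t. 0::real)"
          using on_I q by (intro Bochner_Integration.integrable_cong) (auto simp: spM)
        moreover have "?d \<in> borel_measurable M"
          using meas[OF FX] meas[OF s(1)] by (rule borel_measurable_diff)
        ultimately have d: "?d \<in> X" by (simp add: X_def bochner_space_def M_def)
        have "\<Theta> (\<lambda>t. ?d t + s t) = \<Theta> ?d + \<Theta> s" by (rule add[OF \<Theta> d s(1)])
        moreover have "\<Theta> ?d = 0" using on_I by (intro null[OF \<Theta> d]) auto
        ultimately show ?thesis by simp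
      qed
      from this[OF \<Phi>(1)] this[OF \<Psi>(1)] s(2) show "\<Phi> (F i) = \<Psi> (F i)" by simp
    qed
    have D: "(\<lambda>t. F i t - f t) \<in> X" for i
    proof -
      have "(\<lambda>t. - 1 *\<^sub>R f t) \<in> X"
        unfolding X_def
      proof (rule bochner_space_bound[where c = 1])
        show "(\<lambda>t. - 1 *\<^sub>R f t) \<in> borel_measurable (restrict_space lborel I)"
          using meas[OF f] by (intro borel_measurable_scaleR) (auto simp: M_def)
      qed (use q f in \<open>auto simp: X_def\<close>)
      then have "(\<lambda>t. F i t + - 1 *\<^sub>R f t) \<in> X"
        using bochner_space_add[of q "F i" I "\<lambda>t. - 1 *\<^sub>R f t"] q Fs[of i] unfolding X_def by simp
      then show ?thesis by simp
    qed
    have "(\<lambda>i. \<integral>t. norm (F i t - f t) powr q \<partial>M) \<longlonglongrightarrow> (\<integral>t. 0 \<partial>M)"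
    proof (rule integral_dominated_convergence)
      show "(\<lambda>t. norm (F i t - f t) powr q) \<in> borel_measurable M" for i
        using meas[OF D[of i]] by measurable
      show "integrable M (\<lambda>t. 3 powr q * norm (f t) powr q)"
        using f by (simp add: X_def bochner_space_def M_def)
      show "AE t in M. (\<lambda>i. norm (F i t - f t) powr q) \<longlonglongrightarrow> 0"
      proof (rule AE_I2)
        fix t assume "t \<in> space M"
        then have "(\<lambda>i. norm (F i t - f t)) \<longlonglongrightarrow> 0"
          using F(2) by (simp add: LIM_zero tendsto_norm_zero)
        then have "(\<lambda>i. norm (F i t - f t) powr q) \<longlonglongrightarrow> 0 powr q"
          using q by (intro tendsto_powr') auto
        then show "(\<lambda>i. norm (F i t - f t) powr q) \<longlonglongrightarrow> 0" by simp
      qed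
      show "AE t in M. norm (norm (F i t - f t) powr q) \<le> 3 powr q * norm (f t) powr q" for i
      proof (rule AE_I2)
        fix t assume "t \<in> space M"
        then have "norm (F i t - f t) \<le> 3 * norm (f t)"
          using F(3)[of t i] norm_triangle_ineq4[of "F i t" "f t"] by simp
        then have "norm (F i t - f t) powr q \<le> (3 * norm (f t)) powr q"
          using q by (intro powr_mono2) auto
        then show "norm (norm (F i t - f t) powr q) \<le> 3 powr q * norm (f t) powr q"
          by (simp add: powr_mult)
      qed
    qed auto
    then have "(\<lambda>i. (\<integral>t. norm (F i t - f t) powr q \<partial>M) powr (1 / q)) \<longlonglongrightarrow> 0 powr (1 / q)"
      using q by (intro tendsto_powr') auto
    then have lim: "(\<lambda>i. bochner_norm q I (\<lambda>t. F i t - f t)) \<longlonglongrightarrow> 0"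
      by (simp add: bochner_norm_def M_def)
    have conv: "(\<lambda>i. \<Theta> (F i)) \<longlonglongrightarrow> \<Theta> f" if \<Theta>: "\<Theta> \<in> Mp p I" for \<Theta>
    proof -
      obtain C where C: "\<And>k. k \<in> X \<Longrightarrow> \<bar>\<Theta> k\<bar> \<le> C * bochner_norm q I k"
        using bdd[OF \<Theta>] by blast
      have "\<Theta> (F i) - \<Theta> f = \<Theta> (\<lambda>t. F i t - f t)" for i
        using add[OF \<Theta> D f, of i] by simp
      moreover have "(\<lambda>i. \<Theta> (\<lambda>t. F i t - f t)) \<longlonglongrightarrow> 0"
        by (rule Lim_null_comparison[OF always_eventually[OF allI] tendsto_mult_right_zero[OF lim, of C]])
          (simp add: C D)
      ultimately have "(\<lambda>i. \<Theta> (F i) - \<Theta> f) \<longlonglongrightarrow> 0" by simp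
      then show ?thesis by (rule LIM_zero_cancel)
    qed
    show ?thesis
      using LIMSEQ_unique[OF conv[OF \<Phi>(1)]] conv[OF \<Psi>(1)] by (simp add: Feq)
  qed
  show ?thesis
  proof
    fix f show "\<Phi> f = \<Psi> f"
      using eq[of f] ext[OF \<Phi>(1), of f] ext[OF \<Psi>(1), of f] by (cases "f \<in> X") auto
  qed
qed

lemma Mp_pairing:
  assumes "1 < p" "V \<in> Mp_loc p" "a \<le> b"
  shows "Mp_pairing p {a..b} V \<in> Mp p {a..b}" "represents (Mp_pairing p {a..b} V) {a..b} V"
proof -
  obtain \<Phi> where \<Phi>: "\<Phi> \<in> Mp p {a..b}" "represents \<Phi> {a..b} V"
    using assms by (auto simp: Mp_loc_def)
  have "Mp_pairing p {a..b} V = \<Phi>"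
    unfolding Mp_pairing_def
  proof (rule the_equality)
    fix \<Psi> assume "\<Psi> \<in> Mp p {a..b} \<and> represents \<Psi> {a..b} V"
    then show "\<Psi> = \<Phi>"
      using Mp_represents_unique[OF assms(1) _ emeasure_bounded_finite, of "{a..b}"] \<Phi> by auto
  qed (use \<Phi> in simp)
  with \<Phi> show "Mp_pairing p {a..b} V \<in> Mp p {a..b}" "represents (Mp_pairing p {a..b} V) {a..b} V"
    by auto
qed

(* w is the integral of f(t) V(dt) over E, a Borel subset of I. The pairing with g is bilinear
   (no complex conjugation). *)
definition has_potential_integral ::
  "real \<Rightarrow> real set \<Rightarrow> (real set \<Rightarrow> ('a::euclidean_space, real) Linf) \<Rightarrow>
    (real \<Rightarrow> ('a, complex, 2) Lp) \<Rightarrow> real set \<Rightarrow> ('a, complex, 2) Lp \<Rightarrow> bool" where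
  "has_potential_integral p I V f E w \<longleftrightarrow>
    (\<forall>g. (\<integral>x. Lp_rep w x * Lp_rep g x \<partial>lborel) =
      Mp_cpairing p I V (\<lambda>t. indicator E t *\<^sub>R L2_mult (f t) g))"

(* f(t) V(dt) = phi(t) dt on I with phi in L^p(I, L^2). Such phi is unique up to null sets. *)
definition potential_density ::
  "real \<Rightarrow> real set \<Rightarrow> (real set \<Rightarrow> ('a::euclidean_space, real) Linf) \<Rightarrow>
    (real \<Rightarrow> ('a, complex, 2) Lp) \<Rightarrow> (real \<Rightarrow> ('a, complex, 2) Lp) \<Rightarrow> bool" where
  "potential_density p I V f \<phi> \<longleftrightarrow>
    \<phi> \<in> bochner_space p I \<and>
    (\<forall>E\<in>sets borel. E \<subseteq> I \<longrightarrow> has_potential_integral p I V f E (LINT s:E|lborel. \<phi> s))"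

(* w is the integral from 0 to t of exp(i (t - s) Laplacian) f(s) V(ds). The interval integral
   LBINT s=0..t changes sign for t < 0. *)
definition has_duhamel_integral ::
  "real \<Rightarrow> (real set \<Rightarrow> ('a::euclidean_space, real) Linf) \<Rightarrow>
    (real \<Rightarrow> ('a, complex, 2) Lp) \<Rightarrow> real \<Rightarrow> ('a, complex, 2) Lp \<Rightarrow> bool" where
  "has_duhamel_integral p V f t w \<longleftrightarrow>
    (\<exists>\<phi>. potential_density p {min 0 t..max 0 t} V f \<phi> \<and>
      w = (LBINT s=0..t. free_schroedinger (t - s) (\<phi> s)))"

definition schroedinger_solution ::
  "real \<Rightarrow> ('a::euclidean_space, complex, 2) Lp \<Rightarrow> (real set \<Rightarrow> ('a, real) Linf) \<Rightarrow>
    (real \<Rightarrow> ('a, complex, 2) Lp) \<Rightarrow> bool" where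
  "schroedinger_solution p psi0 V psi \<longleftrightarrow>
    continuous_on UNIV psi \<and>
    (\<forall>t. \<exists>w. has_duhamel_integral p V psi t w \<and> psi t = free_schroedinger t psi0 - Lp_cmult \<i> w)"

(* For each V there is exactly one solution psi; the set collects its values at all times. *)
definition attainable_set :: "('a::euclidean_space, complex, 2) Lp \<Rightarrow> ('a, complex, 2) Lp set" where
  "attainable_set psi0 =
    (\<Union>p\<in>{1<..}. {psi t |psi t. \<exists>V\<in>Mp_loc p. schroedinger_solution p psi0 V psi})"

end

theory Submission
  imports Defs "HOL-Probability.Characteristic_Functions"
begin

text \<open>Bound the time, the norm of the potential, the conjugate exponent and the size of the solution by
  natural numbers. This splits the attainable set into countably many pieces. Each of them is
  relatively compact in \<open>L\<^sup>2\<close>, and compact sets are nowhere dense in the sphere, which is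
  infinite-dimensional and complete, so Baire's theorem applies.

  Compactness comes from dispersion. Testing the Duhamel integral against \<open>h\<close> gives the pairing of \<open>V\<close>
  with \<open>\<psi>(s) \<cdot> g\<^sub>h(s)\<close>, where \<open>g\<^sub>h\<close> is a free solution with data \<open>h\<close> on the Fourier side. If the
  values of all solutions are within \<open>\<epsilon>\<close> of a finite set \<open>C\<close>, then \<open>\<psi>(s) \<cdot> g\<^sub>h(s)\<close> is within
  \<open>\<epsilon> |h|\<close> of some \<open>c \<cdot> g\<^sub>h(s)\<close> with \<open>c \<in> C\<close>, and \<open>h \<mapsto> c \<cdot> g\<^sub>h\<close> is a compact operator into
  \<open>L\<^sup>q(L\<^sup>1)\<close>. Hence, up to an error controlled by \<open>\<epsilon>\<close>, the Duhamel integrals lie in a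
  finite-dimensional space. With an exponential weight in time this error is at most \<open>\<epsilon> / 2\<close>, so the
  measure of noncompactness of the set of values is \<open>0\<close>. Only the boundedness and the symmetry of the
  Fourier transform enter, not its inversion.\<close>

subsection \<open>Gaussians and oscillatory integrals\<close>

text \<open>A general V has neither regularity nor decay in x, so all compactness has to come from
  the free wave on which V is tested. The wave is measured by its square, integrated against a
  Gaussian in space-time. Expanding the square gives the kernel exp(-|P(\<xi>) - P(\<eta>)|^2 / 2)
  on frequencies, with P(\<xi>) = (|\<xi>|^2, -\<xi>). At large \<xi> the paraboloid is steep: its
  points near P(\<xi>) come from a thin slab of frequencies, and the row integrals of the kernel
  tend to 0. On a ball of frequencies finitely many linear conditions on h suffice instead. This
  yields smallness in mean square only, whereas the pairing asks for the q-th power in time, where q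
  may be any exponent in (1, N]. The uniform bound on the solutions turns one into the other. One
  net has to serve all solutions of a piece at once, so every constant must be uniform in V and q;
  in particular the exponent \<open>\<mu>\<close> of the weight depends on N alone.\<close>

lemma borel_measurable_cis[measurable (raw)]:
  assumes "f \<in> borel_measurable M"
  shows "(\<lambda>x. cis (f x)) \<in> borel_measurable M"
  using assms by (rule borel_measurable_continuous_on[rotated]) (intro continuous_intros)

lemma (in pair_sigma_finite) integrable_product_mult:
  fixes f :: "'a \<Rightarrow> 'c::{banach, second_countable_topology, real_normed_algebra}" and g :: "'b \<Rightarrow> 'c"
  assumes f: "integrable M1 f" and g: "integrable M2 g"
  shows "integrable (M1 \<Otimes>\<^sub>M M2) (\<lambda>(x, y). f x * g y)"
proof (rule Fubini_integrable)
  note [measurable] = borel_measurable_integrable[OF f] borel_measurable_integrable[OF g]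
  show meas: "(\<lambda>(x, y). f x * g y) \<in> borel_measurable (M1 \<Otimes>\<^sub>M M2)" by measurable
  have fg: "integrable M2 (\<lambda>y. f x * g y)" for x
    using g by simp
  then show "AE x in M1. integrable M2 (\<lambda>y. case (x, y) of (x, y) \<Rightarrow> f x * g y)" by simp
  show "integrable M1 (\<lambda>x. \<integral>y. norm (case (x, y) of (x, y) \<Rightarrow> f x * g y) \<partial>M2)"
  proof (rule Bochner_Integration.integrable_bound)
    show "integrable M1 (\<lambda>x. norm (f x) * (\<integral>y. norm (g y) \<partial>M2))" using f by simp
    show "(\<lambda>x. \<integral>y. norm (case (x, y) of (x, y) \<Rightarrow> f x * g y) \<partial>M2) \<in> borel_measurable M1"
      by measurable
    have "(\<integral>y. norm (f x * g y) \<partial>M2) \<le> (\<integral>y. norm (f x) * norm (g y) \<partial>M2)" for x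
      using fg[of x] g by (intro integral_mono) (auto simp: norm_mult_ineq)
    then show "AE x in M1. norm (\<integral>y. norm (case (x, y) of (x, y) \<Rightarrow> f x * g y) \<partial>M2)
        \<le> norm (norm (f x) * (\<integral>y. norm (g y) \<partial>M2))"
      by (auto simp: integral_nonneg_AE)
  qed
qed

text \<open>Rescaling by \<open>sqrt a\<close> reduces both claims to the characteristic function of
  the standard normal distribution.\<close>

lemma gauss_fourier_real:
  fixes a t :: real
  assumes "0 < a"
  shows "integrable lborel (\<lambda>x. complex_of_real (exp (- a * x\<^sup>2 / 2)) * cis (t * x))"
    and "(\<integral>x. complex_of_real (exp (- a * x\<^sup>2 / 2)) * cis (t * x) \<partial>lborel)
      = complex_of_real (sqrt (2 * pi / a) * exp (- t\<^sup>2 / (2 * a)))"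
proof -
  let ?f = "\<lambda>t x. complex_of_real (exp (- x\<^sup>2 / 2)) * cis (t * x)"
  have dens: "std_normal_density x *\<^sub>R iexp (t * x) = (1 / sqrt (2 * pi)) *\<^sub>R ?f t x" for t x
    by (simp add: std_normal_density_def cis_conv_exp scaleR_conv_of_real)
  have i0: "integrable lborel std_normal_density"
    by (rule integrable_normal_density) simp
  have "integrable lborel (\<lambda>x. std_normal_density x *\<^sub>R iexp (t * x))" for t
    by (rule Bochner_Integration.integrable_bound[OF i0]) auto
  then have int1: "integrable lborel (?f t)" for t
    using integrable_scaleR_right[of "sqrt (2 * pi)"] unfolding dens by fastforce
  have "complex_of_real (exp (- (t^2) / 2)) = (1 / sqrt (2 * pi)) *\<^sub>R (\<integral>x. ?f t x \<partial>lborel)" for t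
  proof -
    have "complex_of_real (exp (- (t^2) / 2)) = char std_normal_distribution t"
      by (simp add: char_std_normal_distribution)
    also have "\<dots> = (\<integral>x. std_normal_density x *\<^sub>R iexp (t * x) \<partial>lborel)"
      unfolding char_def by (rule integral_density) auto
    also have "\<dots> = (1 / sqrt (2 * pi)) *\<^sub>R (\<integral>x. ?f t x \<partial>lborel)"
      unfolding dens by simp
    finally show ?thesis .
  qed
  then have val1: "(\<integral>x. ?f t x \<partial>lborel) = complex_of_real (sqrt (2 * pi) * exp (- (t^2) / 2))" for t
    by (simp add: scaleR_conv_of_real field_simps)
  have eq: "complex_of_real (exp (- a * x\<^sup>2 / 2)) * cis (t * x) = ?f (t / sqrt a) (0 + sqrt a * x)" for x
    using assms by (simp add: power_mult_distrib)
  show "integrable lborel (\<lambda>x. complex_of_real (exp (- a * x\<^sup>2 / 2)) * cis (t * x))"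
    unfolding eq using assms by (intro lborel_integrable_real_affine int1) auto
  have "(\<integral>x. ?f (t / sqrt a) x \<partial>lborel) = \<bar>sqrt a\<bar> *\<^sub>R (\<integral>x. ?f (t / sqrt a) (0 + sqrt a * x) \<partial>lborel)"
    using assms by (intro lborel_integral_real_affine) auto
  then have "(\<integral>x. ?f (t / sqrt a) (0 + sqrt a * x) \<partial>lborel)
      = complex_of_real (sqrt (2 * pi) * exp (- ((t / sqrt a)^2) / 2)) / complex_of_real (sqrt a)"
    using assms unfolding val1 by (simp add: scaleR_conv_of_real field_simps)
  also have "\<dots> = complex_of_real (sqrt (2 * pi / a) * exp (- t\<^sup>2 / (2 * a)))"
    using assms by (simp add: real_sqrt_divide power_divide mult.commute)
  finally show "(\<integral>x. complex_of_real (exp (- a * x\<^sup>2 / 2)) * cis (t * x) \<partial>lborel)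
      = complex_of_real (sqrt (2 * pi / a) * exp (- t\<^sup>2 / (2 * a)))"
    unfolding eq .
qed

text \<open>\<open>lborel\<close> is the image of a product of one-dimensional Lebesgue measures,
  and both the Gaussian and the oscillating factor split over the coordinates.\<close>

lemma gauss_fourier:
  fixes z :: "'a::euclidean_space"
  assumes "0 < a"
  shows "integrable lborel (\<lambda>x. complex_of_real (exp (- a * (norm x)\<^sup>2 / 2)) * cis (x \<bullet> z))"
    and "(\<integral>x. complex_of_real (exp (- a * (norm x)\<^sup>2 / 2)) * cis (x \<bullet> z) \<partial>lborel)
      = complex_of_real (sqrt (2 * pi / a) ^ DIM('a) * exp (- (norm z)\<^sup>2 / (2 * a)))"
proof -
  interpret product_sigma_finite "\<lambda>b::'a. lborel :: real measure" ..
  let ?P = "\<Pi>\<^sub>M b\<in>(Basis::'a set). (lborel :: real measure)"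
  let ?T = "\<lambda>f. \<Sum>b\<in>(Basis::'a set). f b *\<^sub>R b"
  define F where "F x = complex_of_real (exp (- a * (norm x)\<^sup>2 / 2)) * cis (x \<bullet> z)" for x :: 'a
  define G where "G b t = complex_of_real (exp (- a * t\<^sup>2 / 2)) * cis ((z \<bullet> b) * t)" for b :: 'a and t :: real
  have T[measurable]: "?T \<in> ?P \<rightarrow>\<^sub>M borel" by measurable
  have F[measurable]: "F \<in> borel_measurable borel" unfolding F_def by measurable
  have FT: "F (?T f) = (\<Prod>b\<in>Basis. G b (f b))" for f
  proof -
    have "(norm (?T f))\<^sup>2 = (\<Sum>b\<in>Basis. (f b)\<^sup>2)"
      by (subst power2_norm_eq_inner, subst euclidean_inner) (simp add: power2_eq_square)
    then have "complex_of_real (exp (- a * (norm (?T f))\<^sup>2 / 2)) = (\<Prod>b\<in>Basis. complex_of_real (exp (- a * (f b)\<^sup>2 / 2)))"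
      by (simp add: sum_distrib_left sum_divide_distrib exp_sum of_real_prod flip: sum_negf)
    moreover have "cis (?T f \<bullet> z) = (\<Prod>b\<in>Basis. cis ((z \<bullet> b) * f b))"
    proof -
      have "?T f \<bullet> z = (\<Sum>b\<in>Basis. (z \<bullet> b) * f b)"
        by (subst inner_sum_left) (simp add: inner_commute mult.commute)
      moreover have "cis (sum g B) = (\<Prod>b\<in>B. cis (g b))" if "finite B" for g :: "'a \<Rightarrow> real" and B
        using that by induction (auto simp flip: cis_mult)
      ultimately show ?thesis by simp
    qed
    ultimately show ?thesis by (simp add: F_def G_def prod.distrib)
  qed
  have G: "integrable lborel (G b)" for b
    unfolding G_def by (rule gauss_fourier_real(1)[OF assms])
  have "integrable ?P (\<lambda>f. \<Prod>b\<in>Basis. G b (f b))"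
    by (rule product_integrable_prod) (auto intro: G)
  then have "integrable ?P (\<lambda>f. F (?T f))" by (simp add: FT)
  then show "integrable lborel (\<lambda>x. complex_of_real (exp (- a * (norm x)\<^sup>2 / 2)) * cis (x \<bullet> z))"
    unfolding F_def[symmetric] by (subst lborel_eq) (simp add: integrable_distr_eq)
  have "(\<integral>x. F x \<partial>lborel) = (\<integral>f. F (?T f) \<partial>?P)"
    by (subst lborel_eq) (simp add: integral_distr)
  also have "\<dots> = (\<Prod>b\<in>Basis. \<integral>t. G b t \<partial>lborel)"
    unfolding FT by (rule product_integral_prod) (auto intro: G)
  also have "\<dots> = (\<Prod>b\<in>Basis. complex_of_real (sqrt (2 * pi / a) * exp (- (z \<bullet> b)\<^sup>2 / (2 * a))))"
    unfolding G_def gauss_fourier_real(2)[OF assms] ..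
  also have "\<dots> = complex_of_real (sqrt (2 * pi / a) ^ DIM('a) * (\<Prod>b\<in>Basis. exp (- (z \<bullet> b)\<^sup>2 / (2 * a))))"
    by (simp add: prod.distrib flip: of_real_prod)
  also have "(\<Prod>b\<in>Basis. exp (- (z \<bullet> b)\<^sup>2 / (2 * a))) = exp (\<Sum>b\<in>Basis. - (z \<bullet> b)\<^sup>2 / (2 * a))"
    by (simp add: exp_sum)
  also have "(\<Sum>b\<in>Basis. - (z \<bullet> b)\<^sup>2 / (2 * a)) = - (norm z)\<^sup>2 / (2 * a)"
    unfolding power2_norm_eq_inner by (subst euclidean_inner[of z z])
      (simp add: sum_negf power2_eq_square flip: sum_divide_distrib)
  finally show "(\<integral>x. complex_of_real (exp (- a * (norm x)\<^sup>2 / 2)) * cis (x \<bullet> z) \<partial>lborel)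
      = complex_of_real (sqrt (2 * pi / a) ^ DIM('a) * exp (- (norm z)\<^sup>2 / (2 * a)))"
    by (simp add: F_def)
qed

lemma gauss_integral:
  assumes "0 < a"
  shows "integrable lborel (\<lambda>x::'a::euclidean_space. exp (- a * (norm x)\<^sup>2 / 2))"
    and "(\<integral>x. exp (- a * (norm (x::'a))\<^sup>2 / 2) \<partial>lborel) = sqrt (2 * pi / a) ^ DIM('a)"
    and "(\<integral>\<^sup>+x. ennreal (exp (- a * (norm (x::'a))\<^sup>2 / 2)) \<partial>lborel) = ennreal (sqrt (2 * pi / a) ^ DIM('a))"
proof -
  have "integrable lborel (\<lambda>x::'a. complex_of_real (exp (- a * (norm x)\<^sup>2 / 2)))"
    using gauss_fourier(1)[OF assms, of "0::'a"] by simp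
  then show int: "integrable lborel (\<lambda>x::'a. exp (- a * (norm x)\<^sup>2 / 2))"
    by (rule complex_of_real_integrable_eq[THEN iffD1])
  have "complex_of_real (\<integral>x. exp (- a * (norm (x::'a))\<^sup>2 / 2) \<partial>lborel) = complex_of_real (sqrt (2 * pi / a) ^ DIM('a))"
    using gauss_fourier(2)[OF assms, of "0::'a"] by (simp flip: of_real_power)
  then show val: "(\<integral>x. exp (- a * (norm (x::'a))\<^sup>2 / 2) \<partial>lborel) = sqrt (2 * pi / a) ^ DIM('a)"
    by (simp only: of_real_eq_iff)
  show "(\<integral>\<^sup>+x. ennreal (exp (- a * (norm (x::'a))\<^sup>2 / 2)) \<partial>lborel) = ennreal (sqrt (2 * pi / a) ^ DIM('a))"
    by (subst nn_integral_eq_integral[OF int]) (auto simp only: val exp_ge_zero)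
qed

text \<open>The square of an oscillatory integral is expanded into a double integral, and the integration
  over the parameter is carried out first.\<close>
lemma oscillatory_integral_square:
  fixes f :: "'a::euclidean_space \<Rightarrow> complex" and \<theta> :: "'y \<Rightarrow> 'a \<Rightarrow> real"
  assumes "finite_measure N"
    and \<theta>: "(\<lambda>(y, \<xi>). \<theta> y \<xi>) \<in> borel_measurable (N \<Otimes>\<^sub>M lborel)"
    and f: "integrable lborel f"
    and K: "\<And>\<xi> \<eta>. norm (\<integral>y. cis (\<theta> y \<xi> - \<theta> y \<eta>) \<partial>N) \<le> K \<xi> \<eta>"
    and K_meas: "(\<lambda>(\<xi>, \<eta>). K \<xi> \<eta>) \<in> borel_measurable (lborel \<Otimes>\<^sub>M lborel)"
  shows "(\<integral>\<^sup>+y. ennreal ((norm (\<integral>\<xi>. cis (\<theta> y \<xi>) * f \<xi> \<partial>lborel))\<^sup>2) \<partial>N)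
    \<le> (\<integral>\<^sup>+\<xi>. \<integral>\<^sup>+\<eta>. ennreal (norm (f \<xi>) * norm (f \<eta>) * K \<xi> \<eta>) \<partial>lborel \<partial>lborel)"
proof -
  interpret N: finite_measure N by fact
  interpret NL: pair_sigma_finite N "lborel :: 'a measure" ..
  interpret NLL: pair_sigma_finite N "lborel \<Otimes>\<^sub>M lborel :: ('a \<times> 'a) measure" ..
  note [measurable] = borel_measurable_integrable[OF f]
  have f2[measurable]: "f \<in> borel_measurable borel" using borel_measurable_integrable[OF f] by simp
  have [measurable]: "(\<lambda>y. \<theta> (fst y) (snd y)) \<in> borel_measurable (N \<Otimes>\<^sub>M lborel)"
    using \<theta> by (simp add: case_prod_unfold)
  have [measurable]: "cnj \<in> borel_measurable borel"
    by (intro borel_measurable_continuous_onI continuous_intros)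
  define I where "I y = (\<integral>\<xi>. cis (\<theta> y \<xi>) * f \<xi> \<partial>lborel)" for y
  define g where "g y z = cis (\<theta> y (fst z) - \<theta> y (snd z)) * (f (fst z) * cnj (f (snd z)))" for y and z :: "'a \<times> 'a"
  have ff: "integrable (lborel \<Otimes>\<^sub>M lborel) (\<lambda>z. f (fst z) * cnj (f (snd z)))"
  proof -
    have "integrable (lborel \<Otimes>\<^sub>M lborel) (\<lambda>(x, y). f x * cnj (f y))"
      using f by (intro lborel_pair.integrable_product_mult integrable_cnj) auto
    then show ?thesis by (simp only: case_prod_unfold)
  qed
  have m1: "(\<lambda>w. \<theta> (fst w) (fst (snd w))) \<in> borel_measurable (N \<Otimes>\<^sub>M (lborel \<Otimes>\<^sub>M (lborel :: 'a measure)))"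
  proof -
    have "(\<lambda>w. (fst w, fst (snd w))) \<in> N \<Otimes>\<^sub>M (lborel \<Otimes>\<^sub>M (lborel :: 'a measure)) \<rightarrow>\<^sub>M N \<Otimes>\<^sub>M (lborel :: 'a measure)"
      by measurable
    from measurable_compose[OF this \<theta>] show ?thesis by (simp only: case_prod_unfold fst_conv snd_conv)
  qed
  have m2: "(\<lambda>w. \<theta> (fst w) (snd (snd w))) \<in> borel_measurable (N \<Otimes>\<^sub>M ((lborel :: 'a measure) \<Otimes>\<^sub>M lborel))"
  proof -
    have "(\<lambda>w. (fst w, snd (snd w))) \<in> N \<Otimes>\<^sub>M ((lborel :: 'a measure) \<Otimes>\<^sub>M lborel) \<rightarrow>\<^sub>M N \<Otimes>\<^sub>M (lborel :: 'a measure)"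
      by measurable
    from measurable_compose[OF this \<theta>] show ?thesis by (simp only: case_prod_unfold fst_conv snd_conv)
  qed
  note [measurable] = m1 m2
  have gm: "(\<lambda>(y, z). g y z) \<in> borel_measurable (N \<Otimes>\<^sub>M (lborel \<Otimes>\<^sub>M lborel))"
    unfolding g_def case_prod_unfold by measurable
  \<comment> \<open>The modulus of \<open>g\<close> does not depend on the parameter y, and
    \<open>N\<close> is finite; this is what makes Fubini available.\<close>
  have gint: "integrable (N \<Otimes>\<^sub>M (lborel \<Otimes>\<^sub>M lborel)) (\<lambda>(y, z). g y z)"
  proof (rule Bochner_Integration.integrable_bound)
    have "integrable (N \<Otimes>\<^sub>M (lborel \<Otimes>\<^sub>M lborel)) (\<lambda>(y, z). (1::complex) * (f (fst z) * cnj (f (snd z))))"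
      using ff by (intro NLL.integrable_product_mult) auto
    then show "integrable (N \<Otimes>\<^sub>M (lborel \<Otimes>\<^sub>M lborel)) (\<lambda>(y, z). f (fst z) * cnj (f (snd z)))" by simp
  qed (use gm in \<open>auto simp: g_def norm_mult\<close>)
  have Iy: "I y * cnj (I y) = (\<integral>z. g y z \<partial>(lborel \<Otimes>\<^sub>M lborel))" if y: "y \<in> space N" for y
  proof -
    have [measurable]: "\<theta> y \<in> borel_measurable lborel"
      using measurable_Pair2[OF \<theta> y] by simp
    have i: "integrable lborel (\<lambda>\<xi>. cis (\<theta> y \<xi>) * f \<xi>)"
      by (rule Bochner_Integration.integrable_bound[OF f]) (auto simp: norm_mult)
    have "integrable (lborel \<Otimes>\<^sub>M lborel) (\<lambda>(a, b). (cis (\<theta> y a) * f a) * cnj (cis (\<theta> y b) * f b))"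
      using i by (intro lborel_pair.integrable_product_mult integrable_cnj) auto
    from lborel_pair.integral_fst'[OF this]
    have "(\<integral>(a, b). (cis (\<theta> y a) * f a) * cnj (cis (\<theta> y b) * f b) \<partial>(lborel \<Otimes>\<^sub>M lborel)) = I y * cnj (I y)"
      using i by (simp add: I_def del: complex_cnj_mult)
    moreover have "(\<lambda>(a, b). (cis (\<theta> y a) * f a) * cnj (cis (\<theta> y b) * f b)) = g y"
    proof -
      have "cis (p - q) = cis p * cnj (cis q)" for p q
        by (simp add: cis_cnj cis_mult)
      then show ?thesis
        by (simp only: g_def fun_eq_iff split_paired_all prod.case fst_conv snd_conv complex_cnj_mult mult_ac) simp
    qed
    ultimately show ?thesis by simp
  qed
  have sq: "complex_of_real ((norm (I y))\<^sup>2) = I y * cnj (I y)" for y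
    by (simp add: complex_mult_cnj cmod_power2)
  have "integrable N (\<lambda>y. \<integral>z. g y z \<partial>(lborel \<Otimes>\<^sub>M lborel))"
    using NLL.integrable_fst[OF gint] by simp
  then have "integrable N (\<lambda>y. complex_of_real ((norm (I y))\<^sup>2))"
    by (rule Bochner_Integration.integrable_cong[THEN iffD1, rotated -1]) (auto simp: Iy sq simp del: of_real_power)
  then have Iint: "integrable N (\<lambda>y. (norm (I y))\<^sup>2)"
    by (rule complex_of_real_integrable_eq[THEN iffD1])
  have "complex_of_real (\<integral>y. (norm (I y))\<^sup>2 \<partial>N) = (\<integral>y. complex_of_real ((norm (I y))\<^sup>2) \<partial>N)"
    by (rule integral_complex_of_real[symmetric])
  also have "\<dots> = (\<integral>y. \<integral>z. g y z \<partial>(lborel \<Otimes>\<^sub>M lborel) \<partial>N)"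
    by (rule Bochner_Integration.integral_cong) (simp_all only: sq Iy)
  also have "\<dots> = (\<integral>z. \<integral>y. g y z \<partial>N \<partial>(lborel \<Otimes>\<^sub>M lborel))"
    by (rule NLL.Fubini_integral[OF gint, symmetric])
  finally have "norm (complex_of_real (\<integral>y. (norm (I y))\<^sup>2 \<partial>N)) = norm (\<integral>z. \<integral>y. g y z \<partial>N \<partial>(lborel \<Otimes>\<^sub>M lborel))"
    by (rule arg_cong)
  then have E: "(\<integral>y. (norm (I y))\<^sup>2 \<partial>N) = norm (\<integral>z. \<integral>y. g y z \<partial>N \<partial>(lborel \<Otimes>\<^sub>M lborel))"
    by simp
  have gz: "norm (\<integral>y. g y z \<partial>N) \<le> norm (f (fst z)) * norm (f (snd z)) * K (fst z) (snd z)" for z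
  proof -
    have "(\<integral>y. g y z \<partial>N) = (\<integral>y. cis (\<theta> y (fst z) - \<theta> y (snd z)) \<partial>N) * (f (fst z) * cnj (f (snd z)))"
      unfolding g_def by simp
    then show ?thesis
      using mult_right_mono[OF K[of "fst z" "snd z"], of "norm (f (fst z)) * norm (f (snd z))"]
      by (simp add: norm_mult mult_ac)
  qed
  have [measurable]: "(\<lambda>z. K (fst z) (snd z)) \<in> borel_measurable (lborel \<Otimes>\<^sub>M lborel)"
    using K_meas by (simp add: case_prod_unfold)
  have "(\<integral>\<^sup>+y. ennreal ((norm (I y))\<^sup>2) \<partial>N) = ennreal (norm (\<integral>z. \<integral>y. g y z \<partial>N \<partial>(lborel \<Otimes>\<^sub>M lborel)))"
    by (subst nn_integral_eq_integral[OF Iint]) (simp_all only: E zero_le_power2 AE_I2)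
  also have "\<dots> \<le> (\<integral>\<^sup>+z. ennreal (norm (\<integral>y. g y z \<partial>N)) \<partial>(lborel \<Otimes>\<^sub>M lborel))"
    by (rule integral_norm_bound_ennreal) (use NLL.integrable_snd[OF gint] in simp)
  also have "\<dots> \<le> (\<integral>\<^sup>+z. ennreal (norm (f (fst z)) * norm (f (snd z)) * K (fst z) (snd z)) \<partial>(lborel \<Otimes>\<^sub>M lborel))"
    by (intro nn_integral_mono ennreal_leI gz)
  also have "\<dots> = (\<integral>\<^sup>+\<xi>. \<integral>\<^sup>+\<eta>. ennreal (norm (f \<xi>) * norm (f \<eta>) * K \<xi> \<eta>) \<partial>lborel \<partial>lborel)"
    by (subst lborel.nn_integral_fst[symmetric]) (auto simp: borel_prod)
  finally show ?thesis unfolding I_def .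
qed

text \<open>Schur's test: |f(\<xi>)| |f(\<eta>)| is at most the mean of the two squares, and the
  symmetry of \<open>K\<close> makes both halves equal. The row bound is imposed only where
  \<open>f\<close> is nonzero, so that for high-frequency data only the rows with large \<xi> have
  to be estimated.\<close>

lemma schur_bound:
  fixes f :: "'a::euclidean_space \<Rightarrow> complex"
  assumes f: "f \<in> borel_measurable lborel"
    and K_meas: "(\<lambda>(\<xi>, \<eta>). K \<xi> \<eta>) \<in> borel_measurable (lborel \<Otimes>\<^sub>M lborel)"
    and K_nonneg: "\<And>\<xi> \<eta>. 0 \<le> K \<xi> \<eta>" and K_sym: "\<And>\<xi> \<eta>. K \<xi> \<eta> = K \<eta> \<xi>"
    and K_le: "\<And>\<xi>. f \<xi> \<noteq> 0 \<Longrightarrow> (\<integral>\<^sup>+\<eta>. ennreal (K \<xi> \<eta>) \<partial>lborel) \<le> ennreal C"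
  shows "(\<integral>\<^sup>+\<xi>. \<integral>\<^sup>+\<eta>. ennreal (norm (f \<xi>) * norm (f \<eta>) * K \<xi> \<eta>) \<partial>lborel \<partial>lborel)
    \<le> ennreal C * (\<integral>\<^sup>+\<xi>. ennreal ((norm (f \<xi>))\<^sup>2) \<partial>lborel)"
proof -
  have [measurable]: "f \<in> borel_measurable borel" using f by simp
  have [measurable]: "(\<lambda>z. K (fst z) (snd z)) \<in> borel_measurable (lborel \<Otimes>\<^sub>M lborel)"
    using K_meas by (simp add: case_prod_unfold)
  have [measurable]: "(\<lambda>z. K (fst z) (snd z)) \<in> borel_measurable (borel \<Otimes>\<^sub>M borel)"
    using K_meas by (simp add: case_prod_unfold cong: measurable_cong_sets)
  have [measurable]: "(\<lambda>z. K (snd z) (fst z)) \<in> borel_measurable (borel \<Otimes>\<^sub>M borel)"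
    "(\<lambda>z. K (snd z) (fst z)) \<in> borel_measurable (lborel \<Otimes>\<^sub>M lborel)"
    by (subst K_sym, measurable)+
  have K1[measurable]: "(\<lambda>\<eta>. K \<xi> \<eta>) \<in> borel_measurable borel" for \<xi>
    using measurable_Pair2[OF K_meas, of \<xi>] by simp
  have K2[measurable]: "(\<lambda>\<xi>. K \<xi> \<eta>) \<in> borel_measurable borel" for \<eta>
    using K1[of \<eta>] by (subst K_sym)
  let ?A = "\<lambda>\<xi> \<eta>. ennreal ((norm (f \<xi>))\<^sup>2 / 2 * K \<xi> \<eta>)"
  have A: "(\<integral>\<^sup>+\<xi>. \<integral>\<^sup>+\<eta>. ?A \<xi> \<eta> \<partial>lborel \<partial>lborel) \<le> ennreal C * (\<integral>\<^sup>+\<xi>. ennreal ((norm (f \<xi>))\<^sup>2 / 2) \<partial>lborel)"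
  proof -
    have "(\<integral>\<^sup>+\<eta>. ?A \<xi> \<eta> \<partial>lborel) \<le> ennreal C * ennreal ((norm (f \<xi>))\<^sup>2 / 2)" for \<xi>
    proof (cases "f \<xi> = 0")
      case False
      have "(\<integral>\<^sup>+\<eta>. ?A \<xi> \<eta> \<partial>lborel) = ennreal ((norm (f \<xi>))\<^sup>2 / 2) * (\<integral>\<^sup>+\<eta>. ennreal (K \<xi> \<eta>) \<partial>lborel)"
        by (subst nn_integral_cmult[symmetric]) (auto simp: K_nonneg simp flip: ennreal_mult')
      also have "\<dots> \<le> ennreal ((norm (f \<xi>))\<^sup>2 / 2) * ennreal C"
        by (intro mult_left_mono K_le False) auto
      finally show ?thesis by (simp add: mult.commute)
    qed simp
    then have "(\<integral>\<^sup>+\<xi>. \<integral>\<^sup>+\<eta>. ?A \<xi> \<eta> \<partial>lborel \<partial>lborel) \<le> (\<integral>\<^sup>+\<xi>. ennreal C * ennreal ((norm (f \<xi>))\<^sup>2 / 2) \<partial>lborel)"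
      by (intro nn_integral_mono)
    also have "\<dots> = ennreal C * (\<integral>\<^sup>+\<xi>. ennreal ((norm (f \<xi>))\<^sup>2 / 2) \<partial>lborel)"
      by (rule nn_integral_cmult) auto
    finally show ?thesis .
  qed
  have B: "(\<integral>\<^sup>+\<xi>. \<integral>\<^sup>+\<eta>. ?A \<eta> \<xi> \<partial>lborel \<partial>lborel) = (\<integral>\<^sup>+\<xi>. \<integral>\<^sup>+\<eta>. ?A \<xi> \<eta> \<partial>lborel \<partial>lborel)"
    by (rule lborel_pair.Fubini'[symmetric]) (auto simp: case_prod_unfold)
  have "(\<integral>\<^sup>+\<xi>. \<integral>\<^sup>+\<eta>. ennreal (norm (f \<xi>) * norm (f \<eta>) * K \<xi> \<eta>) \<partial>lborel \<partial>lborel)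
      \<le> (\<integral>\<^sup>+\<xi>. \<integral>\<^sup>+\<eta>. ?A \<xi> \<eta> + ?A \<eta> \<xi> \<partial>lborel \<partial>lborel)"
  proof (intro nn_integral_mono)
    fix \<xi> \<eta>
    have "norm (f \<xi>) * norm (f \<eta>) \<le> (norm (f \<xi>))\<^sup>2 / 2 + (norm (f \<eta>))\<^sup>2 / 2"
      using sum_squares_bound[of "norm (f \<xi>)" "norm (f \<eta>)"] by simp
    from mult_right_mono[OF this K_nonneg[of \<xi> \<eta>]]
    have "norm (f \<xi>) * norm (f \<eta>) * K \<xi> \<eta> \<le> (norm (f \<xi>))\<^sup>2 / 2 * K \<xi> \<eta> + (norm (f \<eta>))\<^sup>2 / 2 * K \<eta> \<xi>"
      by (simp add: distrib_right K_sym[of \<eta> \<xi>])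
    then show "ennreal (norm (f \<xi>) * norm (f \<eta>) * K \<xi> \<eta>) \<le> ?A \<xi> \<eta> + ?A \<eta> \<xi>"
      by (subst ennreal_plus[symmetric]) (auto intro!: ennreal_leI mult_nonneg_nonneg K_nonneg)
  qed
  also have "\<dots> = (\<integral>\<^sup>+\<xi>. \<integral>\<^sup>+\<eta>. ?A \<xi> \<eta> \<partial>lborel \<partial>lborel) + (\<integral>\<^sup>+\<xi>. \<integral>\<^sup>+\<eta>. ?A \<eta> \<xi> \<partial>lborel \<partial>lborel)"
    by (subst nn_integral_add, measurable)+
  also have "\<dots> \<le> ennreal C * (\<integral>\<^sup>+\<xi>. ennreal ((norm (f \<xi>))\<^sup>2 / 2) \<partial>lborel) + ennreal C * (\<integral>\<^sup>+\<xi>. ennreal ((norm (f \<xi>))\<^sup>2 / 2) \<partial>lborel)"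
    unfolding B by (intro add_mono A)
  also have "\<dots> = ennreal C * (\<integral>\<^sup>+\<xi>. ennreal ((norm (f \<xi>))\<^sup>2 / 2) + ennreal ((norm (f \<xi>))\<^sup>2 / 2) \<partial>lborel)"
    by (subst nn_integral_add) (auto simp: distrib_left)
  also have "\<dots> = ennreal C * (\<integral>\<^sup>+\<xi>. ennreal ((norm (f \<xi>))\<^sup>2) \<partial>lborel)"
    by (simp flip: ennreal_plus)
  finally show ?thesis .
qed

text \<open>The Fourier transform of the Gaussian weight is again a Gaussian, which makes the kernel
  of \<open>oscillatory_integral_square\<close> explicit. The map \<open>Z\<close> allows two
  applications: a multiple of the identity gives Bessel's inequality, and \<open>phase_point\<close>
  gives the dispersive estimate, in one more dimension.\<close>

lemma gauss_oscillatory_bound: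
  fixes f :: "'a::euclidean_space \<Rightarrow> complex" and Z :: "'a \<Rightarrow> 'e::euclidean_space"
  assumes a: "0 < a" and f: "integrable lborel f" and Z: "Z \<in> borel_measurable borel"
  shows "(\<integral>\<^sup>+z. ennreal (exp (- a * (norm z)\<^sup>2 / 2)) * ennreal ((norm (\<integral>\<xi>. cis (z \<bullet> Z \<xi>) * f \<xi> \<partial>lborel))\<^sup>2) \<partial>lborel)
    \<le> (\<integral>\<^sup>+\<xi>. \<integral>\<^sup>+\<eta>. ennreal (norm (f \<xi>) * norm (f \<eta>) *
        (sqrt (2 * pi / a) ^ DIM('e) * exp (- (norm (Z \<xi> - Z \<eta>))\<^sup>2 / (2 * a)))) \<partial>lborel \<partial>lborel)"
proof -
  note [measurable] = Z
  have [measurable]: "f \<in> borel_measurable borel" using borel_measurable_integrable[OF f] by simp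
  define w where "w z = exp (- a * (norm z)\<^sup>2 / 2)" for z :: 'e
  have [measurable]: "w \<in> borel_measurable borel" unfolding w_def by measurable
  define N where "N = density lborel (\<lambda>z. ennreal (w z))"
  have "emeasure N (space N) < \<infinity>"
    unfolding N_def using gauss_integral(3)[OF a, where 'a='e]
    by (simp add: emeasure_density w_def[abs_def])
  then have N: "finite_measure N" by (intro finite_measureI) auto
  have sN: "sets N = sets lborel" by (simp add: N_def)
  have "(\<integral>\<^sup>+z. ennreal (w z) * ennreal ((norm (\<integral>\<xi>. cis (z \<bullet> Z \<xi>) * f \<xi> \<partial>lborel))\<^sup>2) \<partial>lborel)
      = (\<integral>\<^sup>+z. ennreal ((norm (\<integral>\<xi>. cis (z \<bullet> Z \<xi>) * f \<xi> \<partial>lborel))\<^sup>2) \<partial>N)"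
    unfolding N_def by (subst nn_integral_density) auto
  also have "\<dots> \<le> (\<integral>\<^sup>+\<xi>. \<integral>\<^sup>+\<eta>. ennreal (norm (f \<xi>) * norm (f \<eta>) *
        (sqrt (2 * pi / a) ^ DIM('e) * exp (- (norm (Z \<xi> - Z \<eta>))\<^sup>2 / (2 * a)))) \<partial>lborel \<partial>lborel)"
  proof (rule oscillatory_integral_square[OF N _ f])
    show "(\<lambda>(z, \<xi>). z \<bullet> Z \<xi>) \<in> borel_measurable (N \<Otimes>\<^sub>M lborel)"
      by (subst measurable_cong_sets[OF sets_pair_measure_cong[OF sN refl] refl]) measurable
    show "(\<lambda>(\<xi>, \<eta>). sqrt (2 * pi / a) ^ DIM('e) * exp (- (norm (Z \<xi> - Z \<eta>))\<^sup>2 / (2 * a)))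
        \<in> borel_measurable (lborel \<Otimes>\<^sub>M lborel)"
      by measurable
    fix \<xi> \<eta> :: 'a
    have "(\<integral>z. cis (z \<bullet> Z \<xi> - z \<bullet> Z \<eta>) \<partial>N) = (\<integral>z. w z *\<^sub>R cis (z \<bullet> Z \<xi> - z \<bullet> Z \<eta>) \<partial>lborel)"
      unfolding N_def by (rule integral_density) (auto simp: w_def)
    also have "\<dots> = (\<integral>z. complex_of_real (exp (- a * (norm z)\<^sup>2 / 2)) * cis (z \<bullet> (Z \<xi> - Z \<eta>)) \<partial>lborel)"
      by (simp add: w_def scaleR_conv_of_real inner_diff_right)
    also have "norm \<dots> = sqrt (2 * pi / a) ^ DIM('e) * exp (- (norm (Z \<xi> - Z \<eta>))\<^sup>2 / (2 * a))"
      unfolding gauss_fourier(2)[OF a] norm_of_real using a by simp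
    finally show "norm (\<integral>z. cis (z \<bullet> Z \<xi> - z \<bullet> Z \<eta>) \<partial>N)
        \<le> sqrt (2 * pi / a) ^ DIM('e) * exp (- (norm (Z \<xi> - Z \<eta>))\<^sup>2 / (2 * a))" by simp
  qed
  finally show ?thesis unfolding w_def .
qed

subsection \<open>Multiplication operators and the bilinear pairing on L2\<close>

lemma norm_Lp_le:
  fixes u :: "('a::euclidean_space, 'b::{banach, second_countable_topology}, 'p::finite) Lp"
    and v :: "('a, 'c::{banach, second_countable_topology}, 'p) Lp"
  assumes c: "0 \<le> c" and le: "AE x in lborel. norm (Lp_rep u x) \<le> c * norm (Lp_rep v x)"
  shows "norm u \<le> c * norm v"
proof -
  let ?p = "CARD('p)"
  have "norm u ^ ?p \<le> (\<integral>x. c ^ ?p * norm (Lp_rep v x) ^ ?p \<partial>lborel)"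
    unfolding norm_Lp_power
  proof (rule integral_mono_AE)
    show "AE x in lborel. norm (Lp_rep u x) ^ ?p \<le> c ^ ?p * norm (Lp_rep v x) ^ ?p"
      using le by eventually_elim (metis norm_ge_zero power_mono power_mult_distrib)
  qed (use lp_spaceD(2)[OF Lp_rep_space[of u]] lp_spaceD(2)[OF Lp_rep_space[of v]] in auto)
  also have "\<dots> = (c * norm v) ^ ?p" by (simp add: norm_Lp_power power_mult_distrib)
  finally show ?thesis using c by (simp add: power_mono_iff)
qed

lemma Lp_rep_measurable[measurable]:
  fixes u :: "('a::euclidean_space, 'b::{banach, second_countable_topology}, 'p::finite) Lp"
  shows "Lp_rep u \<in> borel_measurable borel" "Lp_rep u \<in> borel_measurable lborel"
  using lp_spaceD(1)[OF Lp_rep_space[of u]] by simp_all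

lemma Lp_eqI:
  fixes u v :: "('a::euclidean_space, 'b::{banach, second_countable_topology}, 'p::finite) Lp"
  assumes "AE x in lborel. Lp_rep u x = Lp_rep v x"
  shows "u = v"
  using assms Lp_eq_iff by blast

lemma norm_L2_eq:
  fixes u :: "('a::euclidean_space, 'b::{banach, second_countable_topology}, 2) Lp"
  shows "(norm u)\<^sup>2 = (\<integral>x. (norm (Lp_rep u x))\<^sup>2 \<partial>lborel)"
    and "integrable lborel (\<lambda>x. (norm (Lp_rep u x))\<^sup>2)"
    and "(\<integral>\<^sup>+x. ennreal ((norm (Lp_rep u x))\<^sup>2) \<partial>lborel) = ennreal ((norm u)\<^sup>2)"
proof -
  show 1: "(norm u)\<^sup>2 = (\<integral>x. (norm (Lp_rep u x))\<^sup>2 \<partial>lborel)"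
    using norm_Lp_power[of u] by simp
  show 2: "integrable lborel (\<lambda>x. (norm (Lp_rep u x))\<^sup>2)"
    using lp_spaceD(2)[OF Lp_rep_space[of u]] by simp
  show "(\<integral>\<^sup>+x. ennreal ((norm (Lp_rep u x))\<^sup>2) \<partial>lborel) = ennreal ((norm u)\<^sup>2)"
    unfolding 1 by (rule nn_integral_eq_integral[OF 2]) simp
qed

lemma norm_L1_eq:
  fixes u :: "('a::euclidean_space, 'b::{banach, second_countable_topology}, 1) Lp"
  shows "norm u = (\<integral>x. norm (Lp_rep u x) \<partial>lborel)" "integrable lborel (Lp_rep u)"
proof -
  show "norm u = (\<integral>x. norm (Lp_rep u x) \<partial>lborel)"
    using norm_Lp_power[of u] by simp
  have "integrable lborel (\<lambda>x. norm (Lp_rep u x))"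
    using lp_spaceD(2)[OF Lp_rep_space[of u]] by simp
  then show "integrable lborel (Lp_rep u)"
    by (rule integrable_norm_cancel) simp
qed

lemma norm_Lp_mono:
  fixes u :: "('a::euclidean_space, 'b::{banach, second_countable_topology}, 'p::finite) Lp"
    and v :: "('a, 'c::{banach, second_countable_topology}, 'p) Lp"
  assumes "AE x in lborel. norm (Lp_rep u x) \<le> norm (Lp_rep v x)"
  shows "norm u \<le> norm v"
  using norm_Lp_le[of 1 u v] assms by simp

text \<open>The class is specified only if the product lies in \<open>lp_space\<close>, hence the
  boundedness assumptions on \<open>m\<close> below. Scalars, truncations, phases and the Gaussian
  weight are all instances.\<close>

definition Lp_mul :: "('a \<Rightarrow> complex) \<Rightarrow> ('a::euclidean_space, complex, 'p::finite) Lp \<Rightarrow> ('a, complex, 'p) Lp" where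
  "Lp_mul m u = Lp_class (\<lambda>x. m x * Lp_rep u x)"

lemma Lp_rep_mul:
  fixes u :: "('a::euclidean_space, complex, 'p::finite) Lp"
  assumes m: "m \<in> borel_measurable borel" and c: "\<And>x. norm (m x) \<le> c"
  shows "AE x in lborel. Lp_rep (Lp_mul m u) x = m x * Lp_rep u x"
  unfolding Lp_mul_def
proof (rule Lp_rep_class, rule lp_space_bound[OF Lp_rep_space[of u], of _ c])
  have [measurable]: "m \<in> borel_measurable borel" by fact
  show "(\<lambda>x. m x * Lp_rep u x) \<in> borel_measurable lborel"
    using Lp_rep_measurable[of u] by measurable
  show "AE x in lborel. norm (m x * Lp_rep u x) \<le> c * norm (Lp_rep u x)"
    by (auto simp: norm_mult intro!: mult_right_mono c)
qed

lemma norm_Lp_mul_le: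
  fixes u :: "('a::euclidean_space, complex, 'p::finite) Lp"
  assumes m: "m \<in> borel_measurable borel" and c: "\<And>x. norm (m x) \<le> c"
  shows "norm (Lp_mul m u) \<le> c * norm u"
proof (rule norm_Lp_le)
  show "0 \<le> c" using c norm_ge_zero order_trans by blast
  show "AE x in lborel. norm (Lp_rep (Lp_mul m u) x) \<le> c * norm (Lp_rep u x)"
    using Lp_rep_mul[OF assms, of u] by eventually_elim (auto simp: norm_mult intro!: mult_right_mono c)
qed

lemma bounded_linear_Lp_mul:
  assumes m: "m \<in> borel_measurable borel" and c: "\<And>x. norm (m x) \<le> c"
  shows "bounded_linear (Lp_mul m :: ('a::euclidean_space, complex, 'p::finite) Lp \<Rightarrow> _)"
proof (rule bounded_linear_intro[of _ c])
  fix u v :: "('a, complex, 'p) Lp" and r :: real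
  show "Lp_mul m (u + v) = Lp_mul m u + Lp_mul m v"
    using Lp_rep_mul[OF assms, of "u + v"] Lp_rep_mul[OF assms, of u] Lp_rep_mul[OF assms, of v]
      Lp_rep_add[of u v] Lp_rep_add[of "Lp_mul m u" "Lp_mul m v"]
    by (intro Lp_eqI, eventually_elim) (simp add: algebra_simps)
  show "Lp_mul m (r *\<^sub>R u) = r *\<^sub>R Lp_mul m u"
    using Lp_rep_mul[OF assms, of "r *\<^sub>R u"] Lp_rep_mul[OF assms, of u] Lp_rep_scaleR[of r u]
      Lp_rep_scaleR[of r "Lp_mul m u"]
    by (intro Lp_eqI, eventually_elim) simp
  show "norm (Lp_mul m u) \<le> norm u * c"
    using norm_Lp_mul_le[OF assms, of u] by (simp add: mult.commute)
qed

lemma Lp_mul_mul: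
  fixes u :: "('a::euclidean_space, complex, 'p::finite) Lp"
  assumes m: "m \<in> borel_measurable borel" "\<And>x. norm (m x) \<le> c"
    and k: "k \<in> borel_measurable borel" "\<And>x. norm (k x) \<le> d"
  shows "Lp_mul m (Lp_mul k u) = Lp_mul (\<lambda>x. m x * k x) u"
proof (rule Lp_eqI)
  have mk: "(\<lambda>x. m x * k x) \<in> borel_measurable borel"
    using m(1) k(1) by measurable
  have "norm (m x * k x) \<le> c * d" for x
    unfolding norm_mult using m(2)[of x] k(2)[of x] by (intro mult_mono) (auto intro: order_trans[OF norm_ge_zero])
  from Lp_rep_mul[OF mk this, of u] Lp_rep_mul[OF m, of "Lp_mul k u"] Lp_rep_mul[OF k, of u]
  show "AE x in lborel. Lp_rep (Lp_mul m (Lp_mul k u)) x = Lp_rep (Lp_mul (\<lambda>x. m x * k x) u) x"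
    by eventually_elim simp
qed

lemma Lp_mul_1: "Lp_mul (\<lambda>x. 1) u = u"
  by (simp add: Lp_mul_def Lp_class_rep)

lemma Lp_cmult_eq_mul: "Lp_cmult c = Lp_mul (\<lambda>x. c)"
  by (simp add: fun_eq_iff Lp_cmult_def Lp_mul_def)

lemma Lp_rep_cmult: "AE x in lborel. Lp_rep (Lp_cmult c u) x = c * Lp_rep u x"
  unfolding Lp_cmult_eq_mul by (rule Lp_rep_mul[of _ "norm c"]) auto

lemma bounded_linear_Lp_cmult: "bounded_linear (Lp_cmult c)"
  unfolding Lp_cmult_eq_mul by (rule bounded_linear_Lp_mul[of _ "norm c"]) auto

lemma norm_Lp_cmult_le: "norm (Lp_cmult c u) \<le> norm c * norm u"
  unfolding Lp_cmult_eq_mul by (rule norm_Lp_mul_le) auto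

text \<open>Dominated convergence with majorant c |u|. It shows that the truncations tend to the
  identity and that the phases are strongly continuous in time.\<close>

lemma Lp_mul_tendsto:
  fixes u :: "('a::euclidean_space, complex, 'p::finite) Lp"
  assumes m: "\<And>n. m n \<in> borel_measurable borel" "k \<in> borel_measurable borel"
    and c: "\<And>n x. norm (m n x) \<le> c" "\<And>x. norm (k x) \<le> c" and lim: "\<And>x. (\<lambda>n. m n x) \<longlonglongrightarrow> k x"
  shows "(\<lambda>n. Lp_mul (m n) u) \<longlonglongrightarrow> Lp_mul k u"
  unfolding Lp_mul_def
proof (rule Lp_dominated_convergence(3)[where w = "\<lambda>x. c * norm (Lp_rep u x)"])
  note [measurable] = m
  have "0 \<le> c" using c(2) norm_ge_zero order_trans by blast
  then show "(\<lambda>x. c * norm (Lp_rep u x)) \<in> lp_space CARD('p)"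
    by (intro lp_space_bound[OF Lp_rep_space[of u], of _ c]) auto
  show "(\<lambda>x. m n x * Lp_rep u x) \<in> borel_measurable lborel" for n
    using Lp_rep_measurable(1)[of u] by measurable
  show "(\<lambda>x. k x * Lp_rep u x) \<in> borel_measurable lborel"
    using Lp_rep_measurable(1)[of u] by measurable
  show "AE x in lborel. (\<lambda>n. m n x * Lp_rep u x) \<longlonglongrightarrow> k x * Lp_rep u x"
    by (intro AE_I2 tendsto_mult lim tendsto_const)
  show "AE x in lborel. norm (m n x * Lp_rep u x) \<le> c * norm (Lp_rep u x)" for n
    by (auto simp: norm_mult intro!: mult_right_mono c)
qed

text \<open>Truncations lie in L^1 as well as in L^2, so their Fourier transforms are integrals.
  Below, the equation \<open>L2_trunc k h = h\<close> is the way to say that h vanishes a.e. outside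
  the ball of radius k.\<close>

definition L2_trunc :: "nat \<Rightarrow> ('a::euclidean_space, complex, 2) Lp \<Rightarrow> ('a, complex, 2) Lp" where
  "L2_trunc n = Lp_mul (indicator (cball 0 (real n)))"

lemma indicator_norm_le: "norm (indicator A x :: complex) \<le> 1"
  by (simp add: indicator_def)

lemma indicator_cball_measurable: "(indicator (cball a r) :: 'a::euclidean_space \<Rightarrow> complex) \<in> borel_measurable borel"
  by (rule borel_measurable_indicator) simp

lemma L2_trunc_tendsto: "(\<lambda>n. L2_trunc n u) \<longlonglongrightarrow> u"
proof -
  have "(\<lambda>n. L2_trunc n u) \<longlonglongrightarrow> Lp_mul (\<lambda>x. 1) u"
    unfolding L2_trunc_def
  proof (rule Lp_mul_tendsto[of _ _ 1])
    fix x :: 'a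
    obtain k :: nat where k: "norm x \<le> k" using real_arch_simple by blast
    show "(\<lambda>n. indicator (cball 0 (real n)) x :: complex) \<longlonglongrightarrow> 1"
      by (rule tendsto_eventually, rule eventually_sequentiallyI[of k]) (use k in auto)
  qed (auto intro: indicator_norm_le indicator_cball_measurable)
  then show ?thesis by (simp add: Lp_mul_1)
qed

lemma bounded_linear_L2_trunc: "bounded_linear (L2_trunc n)"
  unfolding L2_trunc_def by (rule bounded_linear_Lp_mul[of _ 1]) (auto intro: indicator_norm_le indicator_cball_measurable)

lemma norm_L2_trunc_le: "norm (L2_trunc n u) \<le> norm u"
  unfolding L2_trunc_def
  using norm_Lp_mul_le[OF indicator_cball_measurable indicator_norm_le, of 0 "real n" u] by simp

lemma Lp_rep_trunc: "AE x in lborel. Lp_rep (L2_trunc n u) x = indicator (cball 0 (real n)) x * Lp_rep u x"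
  unfolding L2_trunc_def by (rule Lp_rep_mul[of _ 1]) (auto intro: indicator_norm_le indicator_cball_measurable)

section \<open>Products of two square-integrable functions\<close>

lemma integrable_L2_product:
  fixes u v :: "('a::euclidean_space, complex, 2) Lp"
  shows "integrable lborel (\<lambda>x. Lp_rep u x * Lp_rep v x)"
proof (rule Bochner_Integration.integrable_bound)
  show "integrable lborel (\<lambda>x. (norm (Lp_rep u x))\<^sup>2 + (norm (Lp_rep v x))\<^sup>2)"
    using norm_L2_eq(2)[of u] norm_L2_eq(2)[of v] by simp
  show "(\<lambda>x. Lp_rep u x * Lp_rep v x) \<in> borel_measurable lborel"
    by measurable
  show "AE x in lborel. norm (Lp_rep u x * Lp_rep v x) \<le> norm ((norm (Lp_rep u x))\<^sup>2 + (norm (Lp_rep v x))\<^sup>2)"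
  proof (rule AE_I2)
    fix x
    have "2 * (norm (Lp_rep u x) * norm (Lp_rep v x)) \<le> (norm (Lp_rep u x))\<^sup>2 + (norm (Lp_rep v x))\<^sup>2"
      using sum_squares_bound[of "norm (Lp_rep u x)" "norm (Lp_rep v x)"] by simp
    moreover have "0 \<le> norm (Lp_rep u x) * norm (Lp_rep v x)" by simp
    ultimately have "norm (Lp_rep u x) * norm (Lp_rep v x) \<le> (norm (Lp_rep u x))\<^sup>2 + (norm (Lp_rep v x))\<^sup>2"
      by linarith
    then show "norm (Lp_rep u x * Lp_rep v x) \<le> norm ((norm (Lp_rep u x))\<^sup>2 + (norm (Lp_rep v x))\<^sup>2)"
      unfolding norm_mult by simp
  qed
qed

lemma L2_cauchy_schwarz:
  fixes u v :: "('a::euclidean_space, complex, 2) Lp"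
  shows "(\<integral>x. norm (Lp_rep u x * Lp_rep v x) \<partial>lborel) \<le> norm u * norm v"
proof (cases "u = 0 \<or> v = 0")
  case True
  have "AE x in lborel. Lp_rep u x * Lp_rep v x = 0"
    using True
  proof
    assume "u = 0" with Lp_rep_zero show ?thesis by (auto elim: eventually_mono)
  next
    assume "v = 0" with Lp_rep_zero show ?thesis by (auto elim: eventually_mono)
  qed
  then have "(\<integral>x. norm (Lp_rep u x * Lp_rep v x) \<partial>lborel) = (\<integral>x. 0 \<partial>(lborel::'a measure))"
    by (intro integral_cong_AE) auto
  then show ?thesis by simp
next
  case False
  then have pos: "0 < norm u" "0 < norm v" by auto
  \<comment> \<open>The weights in the inequality of means are chosen such that each of the two
    squares integrates to half of \<open>norm u * norm v\<close>.\<close>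
  have "(\<integral>x. norm (Lp_rep u x * Lp_rep v x) \<partial>lborel)
      \<le> (\<integral>x. norm v / (2 * norm u) * (norm (Lp_rep u x))\<^sup>2 + norm u / (2 * norm v) * (norm (Lp_rep v x))\<^sup>2 \<partial>lborel)"
  proof (rule integral_mono)
    show "integrable lborel (\<lambda>x. norm (Lp_rep u x * Lp_rep v x))"
      using integrable_L2_product by (rule integrable_norm)
    show "integrable lborel (\<lambda>x. norm v / (2 * norm u) * (norm (Lp_rep u x))\<^sup>2 + norm u / (2 * norm v) * (norm (Lp_rep v x))\<^sup>2)"
      using norm_L2_eq(2)[of u] norm_L2_eq(2)[of v] by simp
    fix x
    define a b where "a = norm (Lp_rep u x)" and "b = norm (Lp_rep v x)"
    have "2 * (norm v * a) * (norm u * b) \<le> (norm v * a)\<^sup>2 + (norm u * b)\<^sup>2"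
      by (rule sum_squares_bound)
    then have "a * b \<le> norm v / (2 * norm u) * a\<^sup>2 + norm u / (2 * norm v) * b\<^sup>2"
      using pos by (simp add: divide_simps power2_eq_square) (simp add: mult_ac)
    then show "norm (Lp_rep u x * Lp_rep v x)
        \<le> norm v / (2 * norm u) * (norm (Lp_rep u x))\<^sup>2 + norm u / (2 * norm v) * (norm (Lp_rep v x))\<^sup>2"
      by (simp add: norm_mult a_def b_def)
  qed
  also have "\<dots> = norm v / (2 * norm u) * (norm u)\<^sup>2 + norm u / (2 * norm v) * (norm v)\<^sup>2"
    using norm_L2_eq(2)[of u] norm_L2_eq(2)[of v] by (simp add: norm_L2_eq(1))
  also have "\<dots> = norm u * norm v"
    using pos by (simp add: power2_eq_square)
  finally show ?thesis .
qed

lemma Lp_rep_L2_mult: "AE x in lborel. Lp_rep (L2_mult u v) x = Lp_rep u x * Lp_rep v x"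
  unfolding L2_mult_def
  by (rule Lp_rep_class) (use integrable_norm[OF integrable_L2_product, of u v] in \<open>simp add: lp_space_def\<close>)

lemma norm_L2_mult: "norm (L2_mult u v) = (\<integral>x. norm (Lp_rep u x * Lp_rep v x) \<partial>lborel)"
  unfolding norm_L1_eq using Lp_rep_L2_mult[of u v] by (intro integral_cong_AE) auto

lemma norm_L2_mult_le: "norm (L2_mult u v) \<le> norm u * norm v"
  unfolding norm_L2_mult by (rule L2_cauchy_schwarz)

lemma bounded_bilinear_L2_mult: "bounded_bilinear L2_mult"
proof
  fix u v w :: "('a, complex, 2) Lp" and r :: real
  show "L2_mult (u + v) w = L2_mult u w + L2_mult v w"
    using Lp_rep_L2_mult[of "u + v" w] Lp_rep_L2_mult[of u w] Lp_rep_L2_mult[of v w] Lp_rep_add[of u v]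
      Lp_rep_add[of "L2_mult u w" "L2_mult v w"]
    by (intro Lp_eqI, eventually_elim) (simp add: algebra_simps)
  show "L2_mult u (v + w) = L2_mult u v + L2_mult u w"
    using Lp_rep_L2_mult[of u "v + w"] Lp_rep_L2_mult[of u w] Lp_rep_L2_mult[of u v] Lp_rep_add[of v w]
      Lp_rep_add[of "L2_mult u v" "L2_mult u w"]
    by (intro Lp_eqI, eventually_elim) (simp add: algebra_simps)
  show "L2_mult (r *\<^sub>R u) v = r *\<^sub>R L2_mult u v"
    using Lp_rep_L2_mult[of "r *\<^sub>R u" v] Lp_rep_L2_mult[of u v] Lp_rep_scaleR[of r u]
      Lp_rep_scaleR[of r "L2_mult u v"]
    by (intro Lp_eqI, eventually_elim) simp
  show "L2_mult u (r *\<^sub>R v) = r *\<^sub>R L2_mult u v"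
    using Lp_rep_L2_mult[of u "r *\<^sub>R v"] Lp_rep_L2_mult[of u v] Lp_rep_scaleR[of r v]
      Lp_rep_scaleR[of r "L2_mult u v"]
    by (intro Lp_eqI, eventually_elim) simp
  show "\<exists>K. \<forall>a b. norm (L2_mult a b) \<le> norm a * norm b * K"
    by (intro exI[of _ 1]) (simp add: norm_L2_mult_le)
qed

text \<open>Bilinear, to match \<open>has_potential_integral\<close>: operators are moved across it
  by transposition, without conjugation, and the Fourier transform is its own transpose.\<close>

definition L2_pair :: "('a::euclidean_space, complex, 2) Lp \<Rightarrow> ('a, complex, 2) Lp \<Rightarrow> complex" where
  "L2_pair u v = (\<integral>x. Lp_rep u x * Lp_rep v x \<partial>lborel)"

lemma L2_pair_eq_AE:
  assumes "AE x in lborel. Lp_rep u x * Lp_rep v x = f x" "f \<in> borel_measurable lborel"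
  shows "L2_pair u v = (\<integral>x. f x \<partial>lborel)"
  unfolding L2_pair_def using assms by (intro integral_cong_AE) auto

lemma norm_L2_pair_le: "norm (L2_pair u v) \<le> norm u * norm v"
  unfolding L2_pair_def by (rule order_trans[OF integral_norm_bound L2_cauchy_schwarz])

lemma bounded_bilinear_L2_pair: "bounded_bilinear L2_pair"
proof
  fix u v w :: "('a, complex, 2) Lp" and r :: real
  note [simp] = integrable_L2_product
  show "L2_pair (u + v) w = L2_pair u w + L2_pair v w"
    unfolding L2_pair_def[of u] L2_pair_def[of v]
    by (subst Bochner_Integration.integral_add[symmetric], simp, simp, rule L2_pair_eq_AE)
       (use Lp_rep_add[of u v] in \<open>auto elim!: eventually_mono simp: algebra_simps\<close>)
  show "L2_pair u (v + w) = L2_pair u v + L2_pair u w"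
    unfolding L2_pair_def[of u v] L2_pair_def[of u w]
    by (subst Bochner_Integration.integral_add[symmetric], simp, simp, rule L2_pair_eq_AE)
       (use Lp_rep_add[of v w] in \<open>auto elim!: eventually_mono simp: algebra_simps\<close>)
  show "L2_pair (r *\<^sub>R u) v = r *\<^sub>R L2_pair u v"
    unfolding L2_pair_def[of u v] integral_scaleR_right[symmetric]
    by (rule L2_pair_eq_AE) (use Lp_rep_scaleR[of r u] in \<open>auto elim!: eventually_mono\<close>)
  show "L2_pair u (r *\<^sub>R v) = r *\<^sub>R L2_pair u v"
    unfolding L2_pair_def[of u v] integral_scaleR_right[symmetric]
    by (rule L2_pair_eq_AE) (use Lp_rep_scaleR[of r v] in \<open>auto elim!: eventually_mono\<close>)
  show "\<exists>K. \<forall>a b. norm (L2_pair a b) \<le> norm a * norm b * K"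
    by (intro exI[of _ 1]) (simp add: norm_L2_pair_le)
qed

lemma L2_pair_mul:
  assumes "m \<in> borel_measurable borel" "\<And>x. norm (m x) \<le> c"
  shows "L2_pair (Lp_mul m u) v = L2_pair u (Lp_mul m v)"
  unfolding L2_pair_def
  by (rule integral_cong_AE)
    (use Lp_rep_mul[OF assms, of u] Lp_rep_mul[OF assms, of v] in \<open>auto elim: eventually_elim2\<close>)

lemma L2_pair_cmult: "L2_pair (Lp_cmult a u) v = a * L2_pair u v" "L2_pair u (Lp_cmult a v) = a * L2_pair u v"
proof -
  show *: "L2_pair (Lp_cmult a u) v = a * L2_pair u v" for u v :: "('a, complex, 2) Lp"
    unfolding L2_pair_def[of u] integral_mult_right_zero[symmetric]
    by (rule L2_pair_eq_AE) (use Lp_rep_cmult[of a u] in \<open>auto elim!: eventually_mono\<close>)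
  show "L2_pair u (Lp_cmult a v) = a * L2_pair u v"
    using *[of v u] by (simp add: L2_pair_def mult.commute)
qed

text \<open>Conjugating one argument of \<open>L2_pair\<close> gives the inner product; this is how
  norms are recovered from the bilinear pairing.\<close>

definition Lp_cnj :: "('a::euclidean_space, complex, 'p::finite) Lp \<Rightarrow> ('a, complex, 'p) Lp" where
  "Lp_cnj u = Lp_class (\<lambda>x. cnj (Lp_rep u x))"

lemma Lp_rep_cnj: "AE x in lborel. Lp_rep (Lp_cnj u :: ('a::euclidean_space, complex, 'p::finite) Lp) x = cnj (Lp_rep u x)"
  unfolding Lp_cnj_def
proof (rule Lp_rep_class, rule lp_space_bound[OF Lp_rep_space[of u], of _ 1])
  have [measurable]: "cnj \<in> borel_measurable borel"
    by (intro borel_measurable_continuous_onI continuous_intros)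
  show "(\<lambda>x. cnj (Lp_rep u x)) \<in> borel_measurable lborel" by measurable
qed simp

lemma norm_Lp_cnj: "norm (Lp_cnj u) = norm u"
proof (rule antisym)
  show "norm (Lp_cnj u) \<le> norm u"
    by (rule norm_Lp_mono) (use Lp_rep_cnj[of u] in \<open>auto elim!: eventually_mono\<close>)
  show "norm u \<le> norm (Lp_cnj u)"
    by (rule norm_Lp_mono) (use Lp_rep_cnj[of u] in \<open>auto elim!: eventually_mono\<close>)
qed

lemma L2_pair_cnj: "L2_pair u (Lp_cnj u) = complex_of_real ((norm u)\<^sup>2)"
  unfolding norm_L2_eq(1) integral_complex_of_real[symmetric]
  by (rule L2_pair_eq_AE)
    (use Lp_rep_cnj[of u] in \<open>auto elim!: eventually_mono simp: complex_mult_cnj cmod_power2\<close>)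

section \<open>Real and imaginary parts\<close>

lemma Lp_rep_Re: "AE x in lborel. Lp_rep (Lp_Re u :: ('a::euclidean_space, real, 'p::finite) Lp) x = Re (Lp_rep u x)"
  unfolding Lp_Re_def
  by (rule Lp_rep_class, rule lp_space_bound[OF Lp_rep_space[of u], of _ 1]) (auto simp: abs_Re_le_cmod)

lemma Lp_rep_Im: "AE x in lborel. Lp_rep (Lp_Im u :: ('a::euclidean_space, real, 'p::finite) Lp) x = Im (Lp_rep u x)"
  unfolding Lp_Im_def
  by (rule Lp_rep_class, rule lp_space_bound[OF Lp_rep_space[of u], of _ 1]) (auto simp: abs_Im_le_cmod)

lemma norm_Lp_Re_le: "norm (Lp_Re u) \<le> norm u"
  by (rule norm_Lp_mono) (use Lp_rep_Re[of u] in \<open>auto elim!: eventually_mono simp: abs_Re_le_cmod\<close>)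

lemma norm_Lp_Im_le: "norm (Lp_Im u) \<le> norm u"
  by (rule norm_Lp_mono) (use Lp_rep_Im[of u] in \<open>auto elim!: eventually_mono simp: abs_Im_le_cmod\<close>)

lemma bounded_linear_Lp_Re: "bounded_linear (Lp_Re :: ('a::euclidean_space, complex, 'p::finite) Lp \<Rightarrow> _)"
proof (rule bounded_linear_intro[of _ 1])
  fix u v :: "('a, complex, 'p) Lp" and r :: real
  show "Lp_Re (u + v) = Lp_Re u + Lp_Re v"
    using Lp_rep_Re[of "u + v"] Lp_rep_Re[of u] Lp_rep_Re[of v] Lp_rep_add[of u v] Lp_rep_add[of "Lp_Re u" "Lp_Re v"]
    by (intro Lp_eqI, eventually_elim) simp
  show "Lp_Re (r *\<^sub>R u) = r *\<^sub>R Lp_Re u"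
    using Lp_rep_Re[of "r *\<^sub>R u"] Lp_rep_Re[of u] Lp_rep_scaleR[of r u] Lp_rep_scaleR[of r "Lp_Re u"]
    by (intro Lp_eqI, eventually_elim) simp
qed (simp add: norm_Lp_Re_le)

lemma bounded_linear_Lp_Im: "bounded_linear (Lp_Im :: ('a::euclidean_space, complex, 'p::finite) Lp \<Rightarrow> _)"
proof (rule bounded_linear_intro[of _ 1])
  fix u v :: "('a, complex, 'p) Lp" and r :: real
  show "Lp_Im (u + v) = Lp_Im u + Lp_Im v"
    using Lp_rep_Im[of "u + v"] Lp_rep_Im[of u] Lp_rep_Im[of v] Lp_rep_add[of u v] Lp_rep_add[of "Lp_Im u" "Lp_Im v"]
    by (intro Lp_eqI, eventually_elim) simp
  show "Lp_Im (r *\<^sub>R u) = r *\<^sub>R Lp_Im u"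
    using Lp_rep_Im[of "r *\<^sub>R u"] Lp_rep_Im[of u] Lp_rep_scaleR[of r u] Lp_rep_scaleR[of r "Lp_Im u"]
    by (intro Lp_eqI, eventually_elim) simp
qed (simp add: norm_Lp_Im_le)

text \<open>The symbol of exp(i t Laplacian) is exp(-i t |\<xi>|^2), so this is the multiplier of
  exp(-i s Laplacian).\<close>

definition L2_phase :: "real \<Rightarrow> ('a::euclidean_space, complex, 2) Lp \<Rightarrow> ('a, complex, 2) Lp" where
  "L2_phase s = Lp_mul (\<lambda>\<xi>. cis (s * (norm \<xi>)\<^sup>2))"

lemma L2_phase_add: "L2_phase s (L2_phase t u) = L2_phase (s + t) u"
  unfolding L2_phase_def by (subst Lp_mul_mul[of _ 1 _ 1]) (auto simp: cis_mult distrib_right)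

lemma bounded_linear_L2_phase: "bounded_linear (L2_phase s)"
  unfolding L2_phase_def by (rule bounded_linear_Lp_mul[of _ 1]) auto

lemma norm_L2_phase_le: "norm (L2_phase s u) \<le> norm u"
  unfolding L2_phase_def using norm_Lp_mul_le[of "\<lambda>\<xi>. cis (s * (norm \<xi>)\<^sup>2)" 1 u] by auto

lemma Lp_rep_phase: "AE \<xi> in lborel. Lp_rep (L2_phase s u) \<xi> = cis (s * (norm \<xi>)\<^sup>2) * Lp_rep u \<xi>"
  unfolding L2_phase_def by (rule Lp_rep_mul[of _ 1]) auto

text \<open>Joint continuity: for a fixed vector the phases are strongly continuous in s, and since
  they are contractions, uniformly in s, a change of the vector does no harm.\<close>

lemma continuous_L2_phase: "continuous_on UNIV (\<lambda>z. L2_phase (fst z) (snd z))"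
proof (rule continuous_on_sequentiallyI)
  fix z :: "nat \<Rightarrow> real \<times> ('a, complex, 2) Lp" and a
  assume "z \<longlonglongrightarrow> a"
  then have 1: "(\<lambda>n. fst (z n)) \<longlonglongrightarrow> fst a" and 2: "(\<lambda>n. snd (z n)) \<longlonglongrightarrow> snd a"
    by (auto intro: tendsto_fst tendsto_snd)
  have "(\<lambda>n. L2_phase (fst (z n)) (snd a)) \<longlonglongrightarrow> L2_phase (fst a) (snd a)"
    unfolding L2_phase_def
  proof (rule Lp_mul_tendsto[of _ _ 1])
    have "isCont cis y" for y
      using continuous_on_cis[OF continuous_on_id, of UNIV] by (simp add: continuous_on_eq_continuous_at)
    then show "(\<lambda>n. cis (fst (z n) * (norm x)\<^sup>2)) \<longlonglongrightarrow> cis (fst a * (norm x)\<^sup>2)" for x :: 'a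
      by (rule isCont_tendsto_compose[OF _ tendsto_mult[OF 1 tendsto_const]])
  qed auto
  moreover have "(\<lambda>n. L2_phase (fst (z n)) (snd (z n) - snd a)) \<longlonglongrightarrow> 0"
  proof (rule Lim_null_comparison)
    show "\<forall>\<^sub>F n in sequentially. norm (L2_phase (fst (z n)) (snd (z n) - snd a)) \<le> norm (snd (z n) - snd a)"
      by (simp add: norm_L2_phase_le)
    show "(\<lambda>n. norm (snd (z n) - snd a)) \<longlonglongrightarrow> 0"
      using 2 by (simp add: LIM_zero tendsto_norm_zero)
  qed
  ultimately have "(\<lambda>n. L2_phase (fst (z n)) (snd a) + L2_phase (fst (z n)) (snd (z n) - snd a)) \<longlonglongrightarrow> L2_phase (fst a) (snd a) + 0"
    by (rule tendsto_add)
  then show "(\<lambda>n. L2_phase (fst (z n)) (snd (z n))) \<longlonglongrightarrow> L2_phase (fst a) (snd a)"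
    by (simp add: linear_simps[OF bounded_linear_L2_phase])
qed

subsection \<open>The Fourier transform on L2\<close>

lemma fourier_integral_measurable:
  fixes f :: "'a::euclidean_space \<Rightarrow> complex"
  assumes [measurable]: "f \<in> borel_measurable borel"
  shows "fourier_integral \<sigma> f \<in> borel_measurable borel"
  unfolding fourier_integral_def
  by (intro borel_measurable_times borel_measurable_const lborel.borel_measurable_lebesgue_integral)
     (measurable)

lemma integrable_cis_mult:
  fixes f :: "'a::euclidean_space \<Rightarrow> complex"
  assumes "integrable lborel f" "g \<in> borel_measurable borel"
  shows "integrable lborel (\<lambda>x. cis (g x) * f x)"
proof (rule Bochner_Integration.integrable_bound[OF assms(1)])
  show "(\<lambda>x. cis (g x) * f x) \<in> borel_measurable lborel"
    using assms(2) borel_measurable_integrable[OF assms(1)] by measurable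
qed (auto simp: norm_mult)

lemma fourier_integral_cong_AE:
  fixes f :: "'a::euclidean_space \<Rightarrow> complex"
  assumes "AE x in lborel. f x = g x" "f \<in> borel_measurable borel" "g \<in> borel_measurable borel"
  shows "fourier_integral \<sigma> f = fourier_integral \<sigma> g"
proof
  fix \<xi>
  note [measurable] = assms(2,3)
  have "(\<integral>x. cis (\<sigma> * (x \<bullet> \<xi>)) * f x \<partial>lborel) = (\<integral>x. cis (\<sigma> * (x \<bullet> \<xi>)) * g x \<partial>lborel)"
    by (rule integral_cong_AE, measurable) (use assms(1) in \<open>auto elim: eventually_mono\<close>)
  then show "fourier_integral \<sigma> f \<xi> = fourier_integral \<sigma> g \<xi>" by (simp add: fourier_integral_def)
qed

lemma fourier_const_square:
  "((2 * pi) powr (- real d / 2))\<^sup>2 = 1 / (2 * pi) ^ d"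
proof -
  have "((2 * pi) powr (- real d / 2))\<^sup>2 = (2 * pi) powr (- real d)"
    by (simp add: powr_power)
  then show ?thesis by (simp add: powr_minus_divide powr_realpow)
qed

text \<open>Bessel's inequality for the Fourier transform: a Gaussian weight \<open>exp (- a |y|\<^sup>2 / 2)\<close> turns the
  left-hand side into a convolution with a Gaussian of total mass \<open>(2 \<pi>)\<^sup>d\<close>, independently of \<open>a\<close>, and
  \<open>a \<rightarrow> 0\<close> afterwards.\<close>
lemma fourier_integral_L2_bound:
  fixes f :: "'a::euclidean_space \<Rightarrow> complex"
  assumes f: "integrable lborel f" and \<sigma>: "\<bar>\<sigma>\<bar> = 1"
  shows "(\<integral>\<^sup>+y. ennreal ((norm (fourier_integral \<sigma> f y))\<^sup>2) \<partial>lborel) \<le> (\<integral>\<^sup>+x. ennreal ((norm (f x))\<^sup>2) \<partial>lborel)"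
proof -
  define I where "I y = (\<integral>x. cis (\<sigma> * (x \<bullet> y)) * f x \<partial>lborel)" for y
  have fm[measurable]: "f \<in> borel_measurable borel" using borel_measurable_integrable[OF f] by simp
  have Im[measurable]: "I \<in> borel_measurable borel"
    unfolding I_def by (intro lborel.borel_measurable_lebesgue_integral) measurable
  let ?d = "DIM('a)"
  define w where "w a y = exp (- a * (norm y)\<^sup>2 / 2)" for a and y :: 'a
  have wm[measurable]: "w a \<in> borel_measurable borel" for a unfolding w_def by measurable
  have bound: "(\<integral>\<^sup>+y. ennreal (w a y) * ennreal ((norm (I y))\<^sup>2) \<partial>lborel)
      \<le> ennreal ((2 * pi) ^ ?d) * (\<integral>\<^sup>+x. ennreal ((norm (f x))\<^sup>2) \<partial>lborel)" if a: "0 < a" for a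
  proof -
    define K where "K \<xi> \<eta> = sqrt (2 * pi / a) ^ ?d * exp (- (1 / a) * (norm (\<xi> - \<eta>))\<^sup>2 / 2)" for \<xi> \<eta> :: 'a
    have "(\<integral>\<^sup>+y. ennreal (w a y) * ennreal ((norm (I y))\<^sup>2) \<partial>lborel)
        = (\<integral>\<^sup>+y. ennreal (exp (- a * (norm y)\<^sup>2 / 2)) * ennreal ((norm (\<integral>x. cis (y \<bullet> (\<sigma> *\<^sub>R x)) * f x \<partial>lborel))\<^sup>2) \<partial>lborel)"
      by (simp add: w_def I_def inner_commute)
    also have "\<dots> \<le> (\<integral>\<^sup>+\<xi>. \<integral>\<^sup>+\<eta>. ennreal (norm (f \<xi>) * norm (f \<eta>) * 
        (sqrt (2 * pi / a) ^ ?d * exp (- (norm (\<sigma> *\<^sub>R \<xi> - \<sigma> *\<^sub>R \<eta>))\<^sup>2 / (2 * a)))) \<partial>lborel \<partial>lborel)"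
      by (rule gauss_oscillatory_bound[OF a f]) measurable
    also have "\<dots> = (\<integral>\<^sup>+\<xi>. \<integral>\<^sup>+\<eta>. ennreal (norm (f \<xi>) * norm (f \<eta>) * K \<xi> \<eta>) \<partial>lborel \<partial>lborel)"
      using \<sigma> by (simp add: K_def mult.commute[of a] flip: scaleR_diff_right)
    also have "\<dots> \<le> ennreal ((2 * pi) ^ ?d) * (\<integral>\<^sup>+x. ennreal ((norm (f x))\<^sup>2) \<partial>lborel)"
    proof (rule schur_bound)
      show "(\<lambda>(\<xi>, \<eta>). K \<xi> \<eta>) \<in> borel_measurable (lborel \<Otimes>\<^sub>M lborel)"
        unfolding K_def by measurable
      show "0 \<le> K \<xi> \<eta>" "K \<xi> \<eta> = K \<eta> \<xi>" for \<xi> \<eta>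
        using a by (auto simp: K_def norm_minus_commute)
      fix \<xi> :: 'a
      have Km: "K \<xi> \<in> borel_measurable borel" unfolding K_def by measurable
      have "(\<integral>\<^sup>+\<eta>. ennreal (K \<xi> \<eta>) \<partial>lborel) = (\<integral>\<^sup>+\<eta>. ennreal (K \<xi> \<eta>) \<partial>distr lborel borel ((+) \<xi>))"
        by (simp add: lborel_distr_plus)
      also have "\<dots> = (\<integral>\<^sup>+\<eta>. ennreal (K \<xi> (\<xi> + \<eta>)) \<partial>lborel)"
        using Km by (intro nn_integral_distr) auto
      also have "\<dots> = (\<integral>\<^sup>+\<eta>. ennreal (sqrt (2 * pi / a) ^ ?d) * ennreal (exp (- (1 / a) * (norm (\<eta>::'a))\<^sup>2 / 2)) \<partial>lborel)"
        using a by (simp add: K_def ennreal_mult')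
      also have "\<dots> = ennreal (sqrt (2 * pi / a) ^ ?d) * ennreal (sqrt (2 * pi / (1 / a)) ^ ?d)"
        using a by (subst nn_integral_cmult) (simp_all only: gauss_integral(3) zero_less_divide_1_iff, measurable)
      also have "\<dots> = ennreal ((sqrt (2 * pi / a) * sqrt (2 * pi / (1 / a))) ^ ?d)"
        using a by (simp add: power_mult_distrib flip: ennreal_mult)
      also have "sqrt (2 * pi / a) * sqrt (2 * pi / (1 / a)) = 2 * pi"
      proof -
        have "sqrt (2 * pi / a) * sqrt (2 * pi / (1 / a)) = sqrt ((2 * pi / a) * (2 * pi / (1 / a)))"
          by (rule real_sqrt_mult[symmetric])
        also have "(2 * pi / a) * (2 * pi / (1 / a)) = (2 * pi)\<^sup>2"
          using a by (simp add: power2_eq_square)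
        also have "sqrt ((2 * pi)\<^sup>2) = 2 * pi" by (rule real_sqrt_unique) simp_all
        finally show ?thesis .
      qed
      finally show "(\<integral>\<^sup>+\<eta>. ennreal (K \<xi> \<eta>) \<partial>lborel) \<le> ennreal ((2 * pi) ^ ?d)" by simp
    qed simp
    finally show ?thesis .
  qed
  have "(\<integral>\<^sup>+y. ennreal ((norm (I y))\<^sup>2) \<partial>lborel)
      = (\<integral>\<^sup>+y. liminf (\<lambda>n. ennreal (w (1 / real (Suc n)) y) * ennreal ((norm (I y))\<^sup>2)) \<partial>lborel)"
  proof (rule nn_integral_cong)
    fix y :: 'a
    have "(\<lambda>n. - (1 / real (Suc n)) * (norm y)\<^sup>2 / 2) \<longlonglongrightarrow> - 0 * (norm y)\<^sup>2 / 2"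
      by (intro tendsto_intros LIMSEQ_inverse_real_of_nat[unfolded inverse_eq_divide]) auto
    then have "(\<lambda>n. exp (- (1 / real (Suc n)) * (norm y)\<^sup>2 / 2)) \<longlonglongrightarrow> exp (- 0 * (norm y)\<^sup>2 / 2)"
      by (rule tendsto_exp)
    then have "(\<lambda>n. w (1 / real (Suc n)) y * (norm (I y))\<^sup>2) \<longlonglongrightarrow> exp (- 0 * (norm y)\<^sup>2 / 2) * (norm (I y))\<^sup>2"
      unfolding w_def by (intro tendsto_mult tendsto_const)
    then have "(\<lambda>n. ennreal (w (1 / real (Suc n)) y * (norm (I y))\<^sup>2)) \<longlonglongrightarrow> ennreal (exp (- 0 * (norm y)\<^sup>2 / 2) * (norm (I y))\<^sup>2)"
      by (rule tendsto_ennrealI)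
    from lim_imp_Liminf[OF _ this]
    show "ennreal ((norm (I y))\<^sup>2) = liminf (\<lambda>n. ennreal (w (1 / real (Suc n)) y) * ennreal ((norm (I y))\<^sup>2))"
      by (simp add: ennreal_mult' w_def)
  qed
  \<comment> \<open>Fatou's lemma with a = 1 / (n + 1); the bound on the right does not depend on
    n.\<close>
  also have "\<dots> \<le> liminf (\<lambda>n. \<integral>\<^sup>+y. ennreal (w (1 / real (Suc n)) y) * ennreal ((norm (I y))\<^sup>2) \<partial>lborel)"
    by (rule nn_integral_liminf) measurable
  also have "\<dots> \<le> liminf (\<lambda>n::nat. ennreal ((2 * pi) ^ ?d) * (\<integral>\<^sup>+x. ennreal ((norm (f x))\<^sup>2) \<partial>lborel))"
    by (intro Liminf_mono always_eventually allI bound) simp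
  finally have I2: "(\<integral>\<^sup>+y. ennreal ((norm (I y))\<^sup>2) \<partial>lborel) \<le> ennreal ((2 * pi) ^ ?d) * (\<integral>\<^sup>+x. ennreal ((norm (f x))\<^sup>2) \<partial>lborel)"
    by (simp add: Liminf_const)
  have "(norm (fourier_integral \<sigma> f y))\<^sup>2 = 1 / (2 * pi) ^ ?d * (norm (I y))\<^sup>2" for y
    unfolding fourier_integral_def I_def[symmetric] norm_mult norm_of_real power_mult_distrib
      power2_abs fourier_const_square ..
  then have "(\<integral>\<^sup>+y. ennreal ((norm (fourier_integral \<sigma> f y))\<^sup>2) \<partial>lborel)
      = ennreal (1 / (2 * pi) ^ ?d) * (\<integral>\<^sup>+y. ennreal ((norm (I y))\<^sup>2) \<partial>lborel)"
    by (subst nn_integral_cmult[symmetric]) (auto simp: ennreal_mult'[symmetric])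
  also have "\<dots> \<le> ennreal (1 / (2 * pi) ^ ?d) * (ennreal ((2 * pi) ^ ?d) * (\<integral>\<^sup>+x. ennreal ((norm (f x))\<^sup>2) \<partial>lborel))"
    by (intro mult_left_mono I2) auto
  also have "\<dots> = (\<integral>\<^sup>+x. ennreal ((norm (f x))\<^sup>2) \<partial>lborel)"
    by (subst mult.assoc[symmetric], subst ennreal_mult'[symmetric]) auto
  finally show ?thesis .
qed

lemma fourier_integral_lp_space:
  fixes u :: "('a::euclidean_space, complex, 2) Lp"
  assumes u: "integrable lborel (Lp_rep u)" and \<sigma>: "\<bar>\<sigma>\<bar> = 1"
  shows "fourier_integral \<sigma> (Lp_rep u) \<in> lp_space CARD(2)"
proof -
  have [measurable]: "fourier_integral \<sigma> (Lp_rep u) \<in> borel_measurable borel"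
    by (rule fourier_integral_measurable) simp
  have "(\<integral>\<^sup>+y. ennreal ((norm (fourier_integral \<sigma> (Lp_rep u) y))\<^sup>2) \<partial>lborel) \<le> ennreal ((norm u)\<^sup>2)"
    using fourier_integral_L2_bound[OF u \<sigma>] by (simp add: norm_L2_eq(3))
  then have "integrable lborel (\<lambda>y. (norm (fourier_integral \<sigma> (Lp_rep u) y))\<^sup>2)"
    by (intro integrableI_bounded) (auto intro: le_less_trans)
  then show ?thesis by (simp add: lp_space_def)
qed

text \<open>Meaningful for u in L^1 and L^2, where the transform is a convergent integral and is in
  L^2 by Bessel's inequality. The limit that defines \<open>L2_fourier\<close> runs through its
  values at truncations.\<close>

definition L2_fourier_integral :: "real \<Rightarrow> ('a::euclidean_space, complex, 2) Lp \<Rightarrow> ('a, complex, 2) Lp" where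
  "L2_fourier_integral \<sigma> u = Lp_class (fourier_integral \<sigma> (Lp_rep u))"

lemma Lp_rep_fourier_integral:
  assumes "integrable lborel (Lp_rep u)" "\<bar>\<sigma>\<bar> = 1"
  shows "AE y in lborel. Lp_rep (L2_fourier_integral \<sigma> u) y = fourier_integral \<sigma> (Lp_rep u) y"
  unfolding L2_fourier_integral_def by (rule Lp_rep_class[OF fourier_integral_lp_space[OF assms]])

lemma norm_L2_fourier_integral_le:
  assumes "integrable lborel (Lp_rep u)" "\<bar>\<sigma>\<bar> = 1"
  shows "norm (L2_fourier_integral \<sigma> u) \<le> norm u"
proof -
  have "ennreal ((norm (L2_fourier_integral \<sigma> u))\<^sup>2) = (\<integral>\<^sup>+y. ennreal ((norm (fourier_integral \<sigma> (Lp_rep u) y))\<^sup>2) \<partial>lborel)"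
    unfolding norm_L2_eq(3)[symmetric]
    using Lp_rep_fourier_integral[OF assms] by (intro nn_integral_cong_AE) (auto elim!: eventually_mono)
  also have "\<dots> \<le> ennreal ((norm u)\<^sup>2)"
    using fourier_integral_L2_bound[OF assms] by (simp add: norm_L2_eq(3))
  finally have "(norm (L2_fourier_integral \<sigma> u))\<^sup>2 \<le> (norm u)\<^sup>2" by simp
  then show ?thesis by (rule power2_le_imp_le) simp
qed

lemma L2_fourier_integral_add:
  assumes u: "integrable lborel (Lp_rep u)" and v: "integrable lborel (Lp_rep v)" and \<sigma>: "\<bar>\<sigma>\<bar> = 1"
  shows "L2_fourier_integral \<sigma> (u + v) = L2_fourier_integral \<sigma> u + L2_fourier_integral \<sigma> v"
proof -
  have "fourier_integral \<sigma> (Lp_rep (u + v)) = fourier_integral \<sigma> (\<lambda>x. Lp_rep u x + Lp_rep v x)"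
    by (rule fourier_integral_cong_AE[OF Lp_rep_add]) auto
  also have "\<dots> = (\<lambda>y. fourier_integral \<sigma> (Lp_rep u) y + fourier_integral \<sigma> (Lp_rep v) y)"
    by (simp add: fourier_integral_def fun_eq_iff distrib_left integrable_cis_mult u v)
  finally show ?thesis
    unfolding L2_fourier_integral_def
    using Lp_class_add[OF fourier_integral_lp_space[OF u \<sigma>] fourier_integral_lp_space[OF v \<sigma>]] by simp
qed

lemma L2_fourier_integral_cmult:
  assumes u: "integrable lborel (Lp_rep u)" and \<sigma>: "\<bar>\<sigma>\<bar> = 1"
  shows "L2_fourier_integral \<sigma> (Lp_cmult c u) = Lp_cmult c (L2_fourier_integral \<sigma> u)"
proof -
  have eq: "fourier_integral \<sigma> (Lp_rep (Lp_cmult c u)) = (\<lambda>y. c * fourier_integral \<sigma> (Lp_rep u) y)"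
  proof -
    have "fourier_integral \<sigma> (Lp_rep (Lp_cmult c u)) = fourier_integral \<sigma> (\<lambda>x. c * Lp_rep u x)"
      by (rule fourier_integral_cong_AE[OF Lp_rep_cmult]) auto
    then show ?thesis by (simp add: fourier_integral_def fun_eq_iff mult.left_commute)
  qed
  have "integrable lborel (Lp_rep (Lp_cmult c u))"
    using u Lp_rep_cmult[of c u] by (subst integrable_cong_AE[of _ _ "\<lambda>x. c * Lp_rep u x"]) auto
  from Lp_rep_fourier_integral[OF this \<sigma>] Lp_rep_fourier_integral[OF u \<sigma>] Lp_rep_cmult[of c "L2_fourier_integral \<sigma> u"]
  show ?thesis by (intro Lp_eqI, eventually_elim) (simp add: eq)
qed

lemma integrable_L2_trunc: "integrable lborel (Lp_rep (L2_trunc n u))"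
proof -
  have "integrable lborel (\<lambda>x. indicator (cball 0 (real n)) x * Lp_rep u x)"
  proof (rule Bochner_Integration.integrable_bound)
    have "emeasure lborel (cball (0::'a) (real n)) < \<infinity>" by (rule emeasure_bounded_finite) simp
    then show "integrable lborel (\<lambda>x. indicator (cball 0 (real n)) x + (norm (Lp_rep u x))\<^sup>2)"
      using norm_L2_eq(2)[of u] by (intro Bochner_Integration.integrable_add) auto
    have [measurable]: "(indicator (cball 0 (real n)) :: 'a \<Rightarrow> complex) \<in> borel_measurable borel"
      by (rule indicator_cball_measurable)
    show "(\<lambda>x. indicator (cball 0 (real n)) x * Lp_rep u x) \<in> borel_measurable lborel" by measurable
    show "AE x in lborel. norm (indicator (cball 0 (real n)) x * Lp_rep u x)
        \<le> norm (indicator (cball 0 (real n)) x + (norm (Lp_rep u x))\<^sup>2)"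
    proof (rule AE_I2)
      fix x
      have "norm (Lp_rep u x) \<le> 1 + (norm (Lp_rep u x))\<^sup>2"
        using sum_squares_bound[of 1 "norm (Lp_rep u x)"] norm_ge_zero[of "Lp_rep u x"]
        unfolding mult_1_right power_one by linarith
      then show "norm (indicator (cball 0 (real n)) x * Lp_rep u x)
        \<le> norm (indicator (cball 0 (real n)) x + (norm (Lp_rep u x))\<^sup>2)"
        by (auto simp: indicator_def)
    qed
  qed
  then show ?thesis
    using Lp_rep_trunc[of n u] indicator_cball_measurable[of "0::'a" "real n"]
    by (subst integrable_cong_AE[of _ _ "\<lambda>x. indicator (cball 0 (real n)) x * Lp_rep u x"]) auto
qed

text \<open>The \<open>lim\<close> in \<open>L2_fourier\<close> has a value to speak of only if the
  sequence converges. By linearity and Bessel's inequality the transforms of the truncations are as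
  close to each other as the truncations themselves, hence Cauchy.\<close>

lemma L2_fourier_tendsto:
  fixes u :: "('a::euclidean_space, complex, 2) Lp"
  assumes \<sigma>: "\<bar>\<sigma>\<bar> = 1"
  shows "(\<lambda>n. L2_fourier_integral \<sigma> (L2_trunc n u)) \<longlonglongrightarrow> L2_fourier \<sigma> u"
proof -
  let ?F = "\<lambda>n. L2_fourier_integral \<sigma> (L2_trunc n u)"
  have eq: "Lp_class (fourier_integral \<sigma> (\<lambda>x. indicator (cball 0 (real n)) x *\<^sub>R Lp_rep u x)) = ?F n" for n
  proof -
    have "fourier_integral \<sigma> (Lp_rep (L2_trunc n u)) = fourier_integral \<sigma> (\<lambda>x. indicator (cball 0 (real n)) x * Lp_rep u x)"
      using indicator_cball_measurable[of "0::'a" "real n"]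
      by (intro fourier_integral_cong_AE[OF Lp_rep_trunc]) auto
    moreover have "(\<lambda>x. indicator (cball 0 (real n)) x *\<^sub>R Lp_rep u x) = (\<lambda>x. indicator (cball 0 (real n)) x * Lp_rep u x)"
      by (auto simp: indicator_def fun_eq_iff)
    ultimately show ?thesis by (simp only: L2_fourier_integral_def)
  qed
  have diff: "norm (?F m - ?F n) \<le> norm (L2_trunc m u - L2_trunc n u)" for m n
  proof -
    have i: "integrable lborel (Lp_rep (L2_trunc m u - L2_trunc n u))"
      using integrable_L2_trunc[of m u] integrable_L2_trunc[of n u] Lp_rep_diff[of "L2_trunc m u" "L2_trunc n u"]
      by (subst integrable_cong_AE[of _ _ "\<lambda>x. Lp_rep (L2_trunc m u) x - Lp_rep (L2_trunc n u) x"]) auto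
    from L2_fourier_integral_add[OF i integrable_L2_trunc[of n u] \<sigma>]
    have "?F m - ?F n = L2_fourier_integral \<sigma> (L2_trunc m u - L2_trunc n u)" by simp
    then show ?thesis using norm_L2_fourier_integral_le[OF i \<sigma>] by simp
  qed
  have "Cauchy (\<lambda>n. L2_trunc n u)"
    using L2_trunc_tendsto by (rule LIMSEQ_imp_Cauchy)
  then have "Cauchy ?F"
    unfolding Cauchy_iff using diff by (meson le_less_trans)
  then have "convergent ?F" by (rule Cauchy_convergent)
  then show ?thesis
    unfolding L2_fourier_def eq by (simp add: convergent_LIMSEQ_iff)
qed

lemma norm_L2_fourier_le: "\<bar>\<sigma>\<bar> = 1 \<Longrightarrow> norm (L2_fourier \<sigma> u) \<le> norm u"
  by (rule LIMSEQ_le[OF tendsto_norm[OF L2_fourier_tendsto] tendsto_norm[OF L2_trunc_tendsto]])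
    (auto intro!: norm_L2_fourier_integral_le integrable_L2_trunc)

lemma L2_fourier_cmult:
  assumes \<sigma>: "\<bar>\<sigma>\<bar> = 1"
  shows "L2_fourier \<sigma> (Lp_cmult c u) = Lp_cmult c (L2_fourier \<sigma> u)"
proof (rule LIMSEQ_unique[OF L2_fourier_tendsto[OF \<sigma>]])
  have "L2_trunc n (Lp_cmult c u) = Lp_cmult c (L2_trunc n u)" for n
    using Lp_rep_trunc[of n "Lp_cmult c u"] Lp_rep_trunc[of n u] Lp_rep_cmult[of c u] Lp_rep_cmult[of c "L2_trunc n u"]
    by (intro Lp_eqI, eventually_elim) simp
  then show "(\<lambda>n. L2_fourier_integral \<sigma> (L2_trunc n (Lp_cmult c u))) \<longlonglongrightarrow> Lp_cmult c (L2_fourier \<sigma> u)"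
    using bounded_linear.tendsto[OF bounded_linear_Lp_cmult L2_fourier_tendsto[OF \<sigma>]]
    by (simp add: L2_fourier_integral_cmult integrable_L2_trunc \<sigma>)
qed

lemma bounded_linear_L2_fourier:
  assumes \<sigma>: "\<bar>\<sigma>\<bar> = 1"
  shows "bounded_linear (L2_fourier \<sigma>)"
proof (rule bounded_linear_intro[of _ 1])
  fix u v :: "('a, complex, 2) Lp" and r :: real
  show "L2_fourier \<sigma> (u + v) = L2_fourier \<sigma> u + L2_fourier \<sigma> v"
  proof (rule LIMSEQ_unique[OF L2_fourier_tendsto[OF \<sigma>]])
    show "(\<lambda>n. L2_fourier_integral \<sigma> (L2_trunc n (u + v))) \<longlonglongrightarrow> L2_fourier \<sigma> u + L2_fourier \<sigma> v"
      using tendsto_add[OF L2_fourier_tendsto[OF \<sigma>, of u] L2_fourier_tendsto[OF \<sigma>, of v]]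
      by (simp add: L2_fourier_integral_add integrable_L2_trunc \<sigma> linear_simps[OF bounded_linear_L2_trunc])
  qed
  have "r *\<^sub>R w = Lp_cmult (complex_of_real r) w" for w :: "('a, complex, 2) Lp"
    using Lp_rep_scaleR[of r w] Lp_rep_cmult[of "complex_of_real r" w]
    by (intro Lp_eqI, eventually_elim) (simp add: scaleR_conv_of_real)
  then show "L2_fourier \<sigma> (r *\<^sub>R u) = r *\<^sub>R L2_fourier \<sigma> u"
    by (simp add: L2_fourier_cmult[OF \<sigma>])
qed (simp add: norm_L2_fourier_le \<sigma>)

lemma L2_trunc_trunc: "k \<le> n \<Longrightarrow> L2_trunc n (L2_trunc k u) = L2_trunc k u"
  using Lp_rep_trunc[of n "L2_trunc k u"] Lp_rep_trunc[of k u]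
  by (intro Lp_eqI, eventually_elim) (auto simp: indicator_def)

text \<open>For u of bounded support the defining sequence is eventually constant, so the transform
  is the Fourier integral itself. This gives pointwise access to the waves below.\<close>

lemma Lp_rep_fourier_trunc:
  assumes \<sigma>: "\<bar>\<sigma>\<bar> = 1" and u: "L2_trunc k u = u"
  shows "AE y in lborel. Lp_rep (L2_fourier \<sigma> u) y = fourier_integral \<sigma> (Lp_rep u) y"
proof -
  have "L2_trunc n u = u" if "k \<le> n" for n
    using L2_trunc_trunc[OF that, of u] u by simp
  then have "(\<lambda>n. L2_fourier_integral \<sigma> (L2_trunc n u)) \<longlonglongrightarrow> L2_fourier_integral \<sigma> u"
    by (intro tendsto_eventually eventually_sequentiallyI[of k]) simp
  then have "L2_fourier \<sigma> u = L2_fourier_integral \<sigma> u"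
    by (rule LIMSEQ_unique[OF L2_fourier_tendsto[OF \<sigma>]])
  moreover have "integrable lborel (Lp_rep u)"
    using integrable_L2_trunc[of k u] u by simp
  ultimately show ?thesis using Lp_rep_fourier_integral \<sigma> by metis
qed

text \<open>The Fourier kernel is symmetric in x and \<xi>, and Fubini applies because the product
  of two L^1 functions is integrable on the product space.\<close>

lemma L2_pair_fourier_integral:
  fixes u v :: "('a::euclidean_space, complex, 2) Lp"
  assumes u: "integrable lborel (Lp_rep u)" and v: "integrable lborel (Lp_rep v)" and \<sigma>: "\<bar>\<sigma>\<bar> = 1"
  shows "L2_pair (L2_fourier_integral \<sigma> u) v = L2_pair u (L2_fourier_integral \<sigma> v)"
proof -
  define c where "c = complex_of_real ((2 * pi) powr (- real DIM('a) / 2))"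
  define H where "H = (\<lambda>(x, \<xi>). cis (\<sigma> * (x \<bullet> \<xi>)) * (Lp_rep u x * Lp_rep v \<xi>))"
  have Hm: "H \<in> borel_measurable (lborel \<Otimes>\<^sub>M lborel)" unfolding H_def by measurable
  have uv: "integrable (lborel \<Otimes>\<^sub>M lborel) (\<lambda>(x, \<xi>). Lp_rep u x * Lp_rep v \<xi>)"
    using u v by (rule lborel_pair.integrable_product_mult)
  have H: "integrable (lborel \<Otimes>\<^sub>M lborel) H"
    by (rule Bochner_Integration.integrable_bound[OF uv Hm]) (auto simp: H_def norm_mult)
  have "L2_pair (L2_fourier_integral \<sigma> u) v = (\<integral>\<xi>. fourier_integral \<sigma> (Lp_rep u) \<xi> * Lp_rep v \<xi> \<partial>lborel)"
    using Lp_rep_fourier_integral[OF u \<sigma>] fourier_integral_measurable[of "Lp_rep u" \<sigma>]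
    by (intro L2_pair_eq_AE) (auto elim!: eventually_mono)
  also have "\<dots> = (\<integral>\<xi>. c * (\<integral>x. H (x, \<xi>) \<partial>lborel) \<partial>lborel)"
    by (simp add: fourier_integral_def c_def H_def mult.assoc flip: integral_mult_left_zero)
  also have "\<dots> = c * (\<integral>\<xi>. \<integral>x. H (x, \<xi>) \<partial>lborel \<partial>lborel)" by simp
  also have "(\<integral>\<xi>. \<integral>x. H (x, \<xi>) \<partial>lborel \<partial>lborel) = (\<integral>x. \<integral>\<xi>. H (x, \<xi>) \<partial>lborel \<partial>lborel)"
    using lborel_pair.Fubini_integral[of "\<lambda>x \<xi>. H (x, \<xi>)"] H by (simp add: case_prod_unfold)
  also have "c * \<dots> = (\<integral>x. c * (\<integral>\<xi>. H (x, \<xi>) \<partial>lborel) \<partial>lborel)" by simp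
  also have "\<dots> = (\<integral>x. Lp_rep u x * fourier_integral \<sigma> (Lp_rep v) x \<partial>lborel)"
  proof (rule Bochner_Integration.integral_cong[OF refl])
    fix x
    have "(\<integral>\<xi>. H (x, \<xi>) \<partial>lborel) = (\<integral>\<xi>. Lp_rep u x * (cis (\<sigma> * (\<xi> \<bullet> x)) * Lp_rep v \<xi>) \<partial>lborel)"
      by (intro Bochner_Integration.integral_cong) (auto simp: H_def inner_commute)
    then show "c * (\<integral>\<xi>. H (x, \<xi>) \<partial>lborel) = Lp_rep u x * fourier_integral \<sigma> (Lp_rep v) x"
      by (simp add: fourier_integral_def c_def)
  qed
  also have "\<dots> = L2_pair u (L2_fourier_integral \<sigma> v)"
    using Lp_rep_fourier_integral[OF v \<sigma>] fourier_integral_measurable[of "Lp_rep v" \<sigma>]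
    by (intro L2_pair_eq_AE[symmetric]) (auto elim!: eventually_mono)
  finally show ?thesis .
qed

lemma L2_pair_fourier:
  assumes \<sigma>: "\<bar>\<sigma>\<bar> = 1"
  shows "L2_pair (L2_fourier \<sigma> u) v = L2_pair u (L2_fourier \<sigma> v)"
proof (rule LIMSEQ_unique)
  show "(\<lambda>n. L2_pair (L2_fourier_integral \<sigma> (L2_trunc n u)) (L2_trunc n v)) \<longlonglongrightarrow> L2_pair (L2_fourier \<sigma> u) v"
    by (intro bounded_bilinear.tendsto[OF bounded_bilinear_L2_pair] L2_fourier_tendsto \<sigma> L2_trunc_tendsto)
  show "(\<lambda>n. L2_pair (L2_fourier_integral \<sigma> (L2_trunc n u)) (L2_trunc n v)) \<longlonglongrightarrow> L2_pair u (L2_fourier \<sigma> v)"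
    by (subst L2_pair_fourier_integral[OF integrable_L2_trunc integrable_L2_trunc \<sigma>])
      (intro bounded_bilinear.tendsto[OF bounded_bilinear_L2_pair] L2_fourier_tendsto \<sigma> L2_trunc_tendsto)
qed

lemma free_schroedinger_eq:
  "free_schroedinger t u = L2_fourier 1 (L2_phase (- t) (L2_fourier (- 1) u))"
  by (simp add: free_schroedinger_def L2_phase_def Lp_mul_def)

subsection \<open>High frequencies\<close>

lemma norm_cis_diff_le: "norm (cis a - cis b) \<le> \<bar>a - b\<bar>"
proof -
  have "cis a - cis b = cis b * (cis (a - b) - 1)"
    by (simp add: right_diff_distrib cis_mult)
  then have "norm (cis a - cis b) = norm (cis (a - b) - 1)"
    by (simp add: norm_mult)
  also have "\<dots> \<le> \<bar>a - b\<bar>"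
    using iexp_approx1[of "a - b" 0] by (simp add: cis_conv_exp)
  finally show ?thesis .
qed

text \<open>The point of the paraboloid in time-frequency and space-frequency that belongs to \<xi>:
  \<open>cis ((s, y) \<bullet> phase_point \<xi>)\<close> is the plane wave exp(i (s |\<xi>|^2 - y .
  \<xi>)).\<close>

definition phase_point :: "'a::euclidean_space \<Rightarrow> real \<times> 'a" where
  "phase_point \<xi> = ((norm \<xi>)\<^sup>2, - \<xi>)"

lemma phase_point_measurable[measurable]: "phase_point \<in> borel_measurable borel"
  unfolding phase_point_def by measurable

lemma norm_phase_point_diff:
  "(norm (phase_point \<xi> - phase_point (\<xi> + \<zeta>)))\<^sup>2 = (2 * (\<xi> \<bullet> \<zeta>) + (norm \<zeta>)\<^sup>2)\<^sup>2 + (norm \<zeta>)\<^sup>2"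
proof -
  have "(norm (\<xi> + \<zeta>))\<^sup>2 - (norm \<xi>)\<^sup>2 = 2 * (\<xi> \<bullet> \<zeta>) + (norm \<zeta>)\<^sup>2"
    by (simp add: power2_norm_eq_inner inner_add_left inner_add_right inner_commute)
  then show ?thesis
    using power2_commute[of "(norm \<xi>)\<^sup>2" "(norm (\<xi> + \<zeta>))\<^sup>2"] by (simp add: phase_point_def norm_Pair)
qed

text \<open>Along a sequence \<open>\<xi>\<^sub>n\<close> with \<open>|\<xi>\<^sub>n| \<rightarrow> \<infinity>\<close> and \<open>\<xi>\<^sub>n / |\<xi>\<^sub>n| \<rightarrow> l\<close> the integrand in the variable
  \<open>\<zeta> = \<eta> - \<xi>\<^sub>n\<close> tends to \<open>0\<close> off the hyperplane orthogonal to \<open>l\<close>. Compactness of the sphere makes this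
  uniform in the direction.\<close>
lemma phase_kernel_decay:
  assumes "0 < \<epsilon>"
  shows "\<exists>R::nat. \<forall>\<xi>::'a::euclidean_space. real R \<le> norm \<xi> \<longrightarrow>
    (\<integral>\<^sup>+\<eta>. ennreal (exp (- (norm (phase_point \<xi> - phase_point \<eta>))\<^sup>2 / 2)) \<partial>lborel) \<le> ennreal \<epsilon>"
proof (rule ccontr)
  define J where "J \<xi> \<zeta> = exp (- ((2 * (\<xi> \<bullet> \<zeta>) + (norm \<zeta>)\<^sup>2)\<^sup>2 + (norm \<zeta>)\<^sup>2) / 2)" for \<xi> \<zeta> :: 'a
  have [measurable]: "J \<xi> \<in> borel_measurable borel" for \<xi> unfolding J_def by measurable
  have shift: "(\<integral>\<^sup>+\<eta>. ennreal (exp (- (norm (phase_point \<xi> - phase_point \<eta>))\<^sup>2 / 2)) \<partial>lborel) = (\<integral>\<^sup>+\<zeta>. ennreal (J \<xi> \<zeta>) \<partial>lborel)"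
    for \<xi> :: 'a
  proof -
    have "(\<integral>\<^sup>+\<eta>. ennreal (exp (- (norm (phase_point \<xi> - phase_point \<eta>))\<^sup>2 / 2)) \<partial>lborel)
        = (\<integral>\<^sup>+\<eta>. ennreal (exp (- (norm (phase_point \<xi> - phase_point \<eta>))\<^sup>2 / 2)) \<partial>distr lborel borel ((+) \<xi>))"
      by (simp add: lborel_distr_plus)
    also have "\<dots> = (\<integral>\<^sup>+\<zeta>. ennreal (exp (- (norm (phase_point \<xi> - phase_point (\<xi> + \<zeta>)))\<^sup>2 / 2)) \<partial>lborel)"
      by (intro nn_integral_distr) measurable
    finally show ?thesis by (simp only: norm_phase_point_diff J_def)
  qed
  assume "\<not> ?thesis"
  then have "\<exists>\<xi>::'a. real (Suc n) \<le> norm \<xi> \<and> ennreal \<epsilon> < (\<integral>\<^sup>+\<zeta>. ennreal (J \<xi> \<zeta>) \<partial>lborel)" for n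
    unfolding shift by (meson linorder_not_le)
  then obtain x :: "nat \<Rightarrow> 'a" where x: "\<And>n. real (Suc n) \<le> norm (x n)"
    "\<And>n. ennreal \<epsilon> < (\<integral>\<^sup>+\<zeta>. ennreal (J (x n) \<zeta>) \<partial>lborel)" by metis
  have x_pos: "0 < norm (x n)" for n using x(1)[of n] by linarith
  have "\<forall>n. x n /\<^sub>R norm (x n) \<in> sphere 0 1" using x_pos by auto
  then obtain l r where l: "l \<in> sphere (0::'a) 1" "strict_mono (r :: nat \<Rightarrow> nat)"
    "((\<lambda>n. x n /\<^sub>R norm (x n)) \<circ> r) \<longlonglongrightarrow> l"
    by (rule seq_compactE[OF compact_imp_seq_compact[OF compact_sphere]])
  have "(\<lambda>n. \<integral>\<^sup>+\<zeta>. ennreal (J (x (r n)) \<zeta>) \<partial>lborel) \<longlonglongrightarrow> (\<integral>\<^sup>+\<zeta>. 0 \<partial>(lborel :: 'a measure))"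
  \<comment> \<open>The space component of \<open>phase_point\<close> alone supplies the integrable
    majorant; the time component supplies the pointwise decay.\<close>
  proof (rule nn_integral_dominated_convergence[where w = "\<lambda>\<zeta>. ennreal (exp (- 1 * (norm \<zeta>)\<^sup>2 / 2))"])
    show "AE \<zeta> in lborel. ennreal (J (x (r n)) \<zeta>) \<le> ennreal (exp (- 1 * (norm \<zeta>)\<^sup>2 / 2))" for n
      by (intro AE_I2 ennreal_leI) (simp add: J_def)
    show "(\<integral>\<^sup>+\<zeta>. ennreal (exp (- 1 * (norm (\<zeta>::'a))\<^sup>2 / 2)) \<partial>lborel) < \<infinity>"
      by (subst gauss_integral(3)) auto
    have "negligible {\<zeta>. l \<bullet> \<zeta> = 0}" using l(1) by (intro negligible_hyperplane) auto
    moreover have "{\<zeta>. l \<bullet> \<zeta> = 0} \<in> sets lborel" by measurable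
    ultimately have "{\<zeta>. l \<bullet> \<zeta> = 0} \<in> null_sets lborel"
      by (simp add: negligible_iff_null_sets null_sets_completion_iff)
    then have "AE \<zeta> in lborel. l \<bullet> \<zeta> \<noteq> 0" by (rule AE_I') auto
    then show "AE \<zeta> in lborel. (\<lambda>n. ennreal (J (x (r n)) \<zeta>)) \<longlonglongrightarrow> 0"
    proof eventually_elim
      case (elim \<zeta>)
      have rn: "real n \<le> norm (x (r n))" for n
        using x(1)[of "r n"] seq_suble[OF l(2), of n] by linarith
      have top: "filterlim (\<lambda>n. norm (x (r n))) at_infinity sequentially"
        by (rule filterlim_at_top_imp_at_infinity, rule filterlim_at_top_mono[OF filterlim_real_sequentially])
          (simp add: rn)
      \<comment> \<open>The direction tends to \<open>l\<close> with
        \<open>l \<bullet> \<zeta> \<noteq> 0\<close>, and multiplication by the length of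
        \<open>x (r n)\<close> drives the time component of the difference to infinity.\<close>
      have "(\<lambda>n. 2 * ((x (r n) /\<^sub>R norm (x (r n))) \<bullet> \<zeta>)) \<longlonglongrightarrow> 2 * (l \<bullet> \<zeta>)"
        using l(3) by (intro tendsto_intros) (simp add: o_def)
      then have "filterlim (\<lambda>n. 2 * ((x (r n) /\<^sub>R norm (x (r n))) \<bullet> \<zeta>) * norm (x (r n))) at_infinity sequentially"
        using elim top by (intro tendsto_mult_filterlim_at_infinity[of _ "2 * (l \<bullet> \<zeta>)"]) auto
      moreover have "2 * ((x (r n) /\<^sub>R norm (x (r n))) \<bullet> \<zeta>) * norm (x (r n)) = 2 * (x (r n) \<bullet> \<zeta>)" for n
        using x_pos[of "r n"] by simp
      ultimately have "filterlim (\<lambda>n. 2 * (x (r n) \<bullet> \<zeta>)) at_infinity sequentially" by (simp only:)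
      then have "filterlim (\<lambda>n. (norm \<zeta>)\<^sup>2 + 2 * (x (r n) \<bullet> \<zeta>)) at_infinity sequentially"
        by (intro tendsto_add_filterlim_at_infinity[OF tendsto_const])
      then have "filterlim (\<lambda>n. norm ((norm \<zeta>)\<^sup>2 + 2 * (x (r n) \<bullet> \<zeta>))) at_top sequentially"
        by (rule filterlim_at_infinity_imp_norm_at_top)
      then have "filterlim (\<lambda>n. norm ((norm \<zeta>)\<^sup>2 + 2 * (x (r n) \<bullet> \<zeta>)) * norm ((norm \<zeta>)\<^sup>2 + 2 * (x (r n) \<bullet> \<zeta>))) at_top sequentially"
        by (intro filterlim_at_top_mult_at_top)
      then have "filterlim (\<lambda>n. (2 * (x (r n) \<bullet> \<zeta>) + (norm \<zeta>)\<^sup>2)\<^sup>2) at_top sequentially"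
        by (simp add: power2_eq_square add.commute)
      then have "filterlim (\<lambda>n. (1/2) * ((norm \<zeta>)\<^sup>2 + (2 * (x (r n) \<bullet> \<zeta>) + (norm \<zeta>)\<^sup>2)\<^sup>2)) at_top sequentially"
        by (intro filterlim_tendsto_pos_mult_at_top[OF tendsto_const] filterlim_tendsto_add_at_top[OF tendsto_const]) auto
      then have "filterlim (\<lambda>n. - ((1/2) * ((norm \<zeta>)\<^sup>2 + (2 * (x (r n) \<bullet> \<zeta>) + (norm \<zeta>)\<^sup>2)\<^sup>2))) at_bot sequentially"
        by (simp add: filterlim_uminus_at_bot)
      then have "(\<lambda>n. exp (- ((1/2) * ((norm \<zeta>)\<^sup>2 + (2 * (x (r n) \<bullet> \<zeta>) + (norm \<zeta>)\<^sup>2)\<^sup>2)))) \<longlonglongrightarrow> 0"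
        by (rule filterlim_compose[OF exp_at_bot])
      then have "(\<lambda>n. J (x (r n)) \<zeta>) \<longlonglongrightarrow> 0"
        by (simp add: J_def add_divide_distrib diff_divide_distrib algebra_simps)
      then show ?case using tendsto_ennrealI by fastforce
    qed
  qed measurable
  moreover have "\<exists>n. \<not> ennreal \<epsilon> < (\<integral>\<^sup>+\<zeta>. ennreal (J (x (r n)) \<zeta>) \<partial>lborel)"
  proof -
    have "\<forall>\<^sub>F n in sequentially. (\<integral>\<^sup>+\<zeta>. ennreal (J (x (r n)) \<zeta>) \<partial>lborel) < ennreal \<epsilon>"
      using calculation assms by (intro order_tendstoD(2)[where y = 0]) auto
    then show ?thesis by (meson eventually_sequentially order.asym order_refl)
  qed
  ultimately show False using x(2) by blast
qed

text \<open>The Fourier extension operator of the paraboloid. Time and space form one variable, so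
  that a single Gaussian weight and a single application of \<open>gauss_oscillatory_bound\<close>
  deal with both.\<close>

definition phase_integral :: "('a::euclidean_space \<Rightarrow> complex) \<Rightarrow> real \<times> 'a \<Rightarrow> complex" where
  "phase_integral f z = (\<integral>\<xi>. cis (z \<bullet> phase_point \<xi>) * f \<xi> \<partial>lborel)"

lemma phase_integral_measurable[measurable]:
  assumes [measurable]: "f \<in> borel_measurable borel"
  shows "phase_integral f \<in> borel_measurable borel"
  unfolding phase_integral_def by (intro lborel.borel_measurable_lebesgue_integral) measurable

lemma phase_integral_cong_AE:
  assumes "AE x in lborel. f x = g x" "f \<in> borel_measurable borel" "g \<in> borel_measurable borel"
  shows "phase_integral f = phase_integral g"
proof
  fix z
  note [measurable] = assms(2,3)
  show "phase_integral f z = phase_integral g z"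
    unfolding phase_integral_def
    by (rule integral_cong_AE, measurable) (use assms(1) in \<open>auto elim: eventually_mono\<close>)
qed

text \<open>The transpose of \<open>\<phi> \<mapsto> exp (i s |\<xi>|\<^sup>2) F \<phi>\<close>, applied to \<open>h\<close>.\<close>
definition adj_flow :: "('a::euclidean_space, complex, 2) Lp \<Rightarrow> real \<Rightarrow> ('a, complex, 2) Lp" where
  "adj_flow h s = L2_fourier (- 1) (L2_phase s h)"

lemma norm_adj_flow_le: "norm (adj_flow h s) \<le> norm h"
  unfolding adj_flow_def
  by (rule order_trans[OF norm_L2_fourier_le norm_L2_phase_le]) simp

lemma adj_flow_add: "adj_flow (h + k) s = adj_flow h s + adj_flow k s"
  by (simp add: adj_flow_def linear_simps[OF bounded_linear_L2_phase] linear_simps[OF bounded_linear_L2_fourier])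

lemma continuous_adj_flow: "continuous_on UNIV (adj_flow h)"
proof -
  have "continuous_on UNIV (\<lambda>s. L2_phase s h)"
    by (rule continuous_on_compose2[OF continuous_L2_phase, of UNIV "\<lambda>s. (s, h)", simplified])
      (intro continuous_intros)
  then show ?thesis
    unfolding adj_flow_def
    by (intro bounded_linear.continuous_on[OF bounded_linear_L2_fourier]) auto
qed

text \<open>For h of bounded support the wave is an honest integral: up to the normalisation (2
  pi)^(-d/2) it is the extension integral at the space-time point (s, y).\<close>

lemma norm_adj_flow_square:
  assumes "L2_trunc k h = h"
  shows "AE y in lborel. (norm (Lp_rep (adj_flow h s) y))\<^sup>2 =
    1 / (2 * pi) ^ DIM('a::euclidean_space) * (norm (phase_integral (Lp_rep h) (s, y :: 'a)))\<^sup>2"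
proof -
  have t: "L2_trunc k (L2_phase s h) = L2_phase s h"
    using Lp_rep_trunc[of k "L2_phase s h"] Lp_rep_trunc[of k h] Lp_rep_phase[of s h]
    unfolding assms by (intro Lp_eqI, eventually_elim) auto
  have m: "(\<lambda>x. cis (s * (norm x)\<^sup>2) * Lp_rep h x) \<in> borel_measurable borel" by measurable
  have "fourier_integral (- 1) (Lp_rep (L2_phase s h)) = fourier_integral (- 1) (\<lambda>x. cis (s * (norm x)\<^sup>2) * Lp_rep h x)"
    by (rule fourier_integral_cong_AE[OF Lp_rep_phase]) (use m in simp_all)
  also have "\<dots> = (\<lambda>y. complex_of_real ((2 * pi) powr (- real DIM('a) / 2)) * phase_integral (Lp_rep h) (s, y))"
  proof -
    have "cis ((s, y) \<bullet> phase_point x) * z = cis (- 1 * (x \<bullet> y)) * (cis (s * (norm x)\<^sup>2) * z)" for x y :: 'a and z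
      unfolding mult.assoc[symmetric] cis_mult by (simp add: phase_point_def inner_prod_def inner_commute)
    then show ?thesis by (simp only: fun_eq_iff fourier_integral_def phase_integral_def simp_thms)
  qed
  finally have eq: "fourier_integral (- 1) (Lp_rep (L2_phase s h))
      = (\<lambda>y. complex_of_real ((2 * pi) powr (- real DIM('a) / 2)) * phase_integral (Lp_rep h) (s, y))" .
  have "AE y in lborel. Lp_rep (adj_flow h s) y = fourier_integral (- 1) (Lp_rep (L2_phase s h)) y"
    unfolding adj_flow_def by (rule Lp_rep_fourier_trunc[OF _ t]) simp
  then show ?thesis
    unfolding eq
    by eventually_elim (simp only: norm_mult norm_of_real power_mult_distrib power2_abs fourier_const_square)
qed

text \<open>Localisation in x. The exponent 1/4 makes the squared weight exp(-|x|^2 / 2), which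
  together with the time weight exp(-s^2 / 2) is the space-time Gaussian with a = 1.\<close>

definition gauss_weight :: "('a::euclidean_space, complex, 2) Lp \<Rightarrow> ('a, complex, 2) Lp" where
  "gauss_weight = Lp_mul (\<lambda>x. complex_of_real (exp (- (norm x)\<^sup>2 / 4)))"

lemma gauss_weight_measurable: "(\<lambda>x::'a::euclidean_space. complex_of_real (exp (- (norm x)\<^sup>2 / 4))) \<in> borel_measurable borel"
  by measurable

lemma gauss_weight_bound: "norm (complex_of_real (exp (- (norm x)\<^sup>2 / 4))) \<le> 1"
  by simp

lemma Lp_rep_gauss_weight: "AE x in lborel. Lp_rep (gauss_weight u) x = complex_of_real (exp (- (norm x)\<^sup>2 / 4)) * Lp_rep u x"
  unfolding gauss_weight_def by (rule Lp_rep_mul[OF gauss_weight_measurable gauss_weight_bound])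

lemma bounded_linear_gauss_weight: "bounded_linear gauss_weight"
  unfolding gauss_weight_def by (rule bounded_linear_Lp_mul[OF gauss_weight_measurable gauss_weight_bound])

lemma norm_gauss_weight:
  "ennreal ((norm (gauss_weight u))\<^sup>2) =
    (\<integral>\<^sup>+y. ennreal (exp (- (norm y)\<^sup>2 / 2)) * ennreal ((norm (Lp_rep u y))\<^sup>2) \<partial>lborel)"
  unfolding norm_L2_eq(3)[symmetric]
proof (rule nn_integral_cong_AE)
  show "AE x in lborel. ennreal ((norm (Lp_rep (gauss_weight u) x))\<^sup>2) =
      ennreal (exp (- (norm x)\<^sup>2 / 2)) * ennreal ((norm (Lp_rep u x))\<^sup>2)"
    using Lp_rep_gauss_weight[of u]
  proof eventually_elim
    case (elim x)
    have "(exp (- (norm x)\<^sup>2 / 4))\<^sup>2 = exp (- (norm x)\<^sup>2 / 2)"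
      by (simp add: power2_eq_square flip: exp_add)
    then show ?case by (simp add: elim norm_mult power_mult_distrib ennreal_mult')
  qed
qed

lemma gauss_weight_adj_flow:
  assumes "L2_trunc k h = h"
  shows "ennreal ((norm (gauss_weight (adj_flow h s)))\<^sup>2) = ennreal (1 / (2 * pi) ^ DIM('a::euclidean_space)) *
    (\<integral>\<^sup>+y. ennreal (exp (- (norm (y::'a))\<^sup>2 / 2)) * ennreal ((norm (phase_integral (Lp_rep h) (s, y)))\<^sup>2) \<partial>lborel)"
proof -
  have [measurable]: "(\<lambda>y. phase_integral (Lp_rep h) (s, y)) \<in> borel_measurable borel"
    using measurable_compose[OF _ phase_integral_measurable, of "\<lambda>y. (s, y)" borel "Lp_rep h"] by simp
  have c0: "0 \<le> 1 / (2 * pi) ^ DIM('a)" by simp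
  have "ennreal ((norm (gauss_weight (adj_flow h s)))\<^sup>2) = (\<integral>\<^sup>+y. ennreal (1 / (2 * pi) ^ DIM('a)) *
      (ennreal (exp (- (norm y)\<^sup>2 / 2)) * ennreal ((norm (phase_integral (Lp_rep h) (s, y)))\<^sup>2)) \<partial>lborel)"
    unfolding norm_gauss_weight
    using norm_adj_flow_square[OF assms, of s]
    by (intro nn_integral_cong_AE, eventually_elim) (simp only: ennreal_mult'[OF c0] mult.left_commute)
  then show ?thesis by (subst (asm) nn_integral_cmult) measurable
qed

text \<open>The weights in s and y combine to one Gaussian on space-time, and the weighted square of
  the extension integral becomes a double integral with kernel D exp(-|P(\<xi>) - P(\<eta>)|^2 / 2),
  where P is \<open>phase_point\<close>. Schur's test bounds it by the row integrals at |\<xi>| at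
  least R. The constant D comes from the Fourier transform of the Gaussian in d + 1
  variables.\<close>

lemma high_frequency_bound:
  fixes h :: "('a::euclidean_space, complex, 2) Lp"
  assumes h: "L2_trunc k h = h" and R: "AE \<xi> in lborel. norm \<xi> < R \<longrightarrow> Lp_rep h \<xi> = 0"
    and \<kappa>: "\<And>\<xi>::'a. R \<le> norm \<xi> \<Longrightarrow>
      (\<integral>\<^sup>+\<eta>. ennreal (exp (- (norm (phase_point \<xi> - phase_point \<eta>))\<^sup>2 / 2)) \<partial>lborel) \<le> ennreal \<kappa>"
  shows "(\<integral>\<^sup>+s. ennreal (exp (- s\<^sup>2 / 2)) * ennreal ((norm (gauss_weight (adj_flow h s)))\<^sup>2) \<partial>lborel)
    \<le> ennreal (1 / (2 * pi) ^ DIM('a) * (sqrt (2 * pi) ^ (DIM('a) + 1) * \<kappa>) * (norm h)\<^sup>2)"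
proof -
  \<comment> \<open>A representative that vanishes everywhere on the ball, not just a.e.: the row
    bound in \<open>schur_bound\<close> is asked for at every point where \<open>f\<close> is
    nonzero.\<close>
  define f where "f \<xi> = (if norm \<xi> < R then 0 else Lp_rep h \<xi>)" for \<xi>
  define D where "D = sqrt (2 * pi) ^ (DIM('a) + 1)"
  have D: "0 \<le> D" by (simp add: D_def)
  have fm[measurable]: "f \<in> borel_measurable borel" unfolding f_def by measurable
  have f_eq: "AE x in lborel. Lp_rep h x = f x"
    using R by eventually_elim (auto simp: f_def)
  have f_int: "integrable lborel f"
    using integrable_L2_trunc[of k h] f_eq unfolding h
    by (subst integrable_cong_AE[of _ _ "Lp_rep h"]) auto
  have pf: "phase_integral (Lp_rep h) = phase_integral f"
    by (rule phase_integral_cong_AE[OF f_eq]) auto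
  define g where "g z = ennreal (exp (- 1 * (norm z)\<^sup>2 / 2)) * ennreal ((norm (phase_integral f z))\<^sup>2)" for z
  have [measurable]: "g \<in> borel_measurable borel" unfolding g_def by measurable
  have gs: "ennreal (exp (- s\<^sup>2 / 2)) * (ennreal (exp (- (norm y)\<^sup>2 / 2)) * ennreal ((norm (phase_integral f (s, y)))\<^sup>2)) = g (s, y)"
    for s and y :: 'a
  proof -
    have "exp (- s\<^sup>2 / 2) * exp (- (norm y)\<^sup>2 / 2) = exp (- 1 * (norm (s, y))\<^sup>2 / 2)"
      by (simp add: norm_Pair add_divide_distrib flip: exp_add)
    then show ?thesis by (simp add: g_def mult.assoc[symmetric] flip: ennreal_mult')
  qed
  have g2[measurable]: "(\<lambda>y. g (s, y)) \<in> borel_measurable borel" for s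
    using measurable_compose[of "\<lambda>y. (s, y)" borel borel g] by simp
  have sec: "ennreal (exp (- s\<^sup>2 / 2)) * ennreal ((norm (gauss_weight (adj_flow h s)))\<^sup>2)
      = ennreal (1 / (2 * pi) ^ DIM('a)) * (\<integral>\<^sup>+y. g (s, y) \<partial>lborel)" for s
  proof -
    have [measurable]: "(\<lambda>y. phase_integral f (s, y)) \<in> borel_measurable borel"
      using measurable_compose[OF _ phase_integral_measurable, of "\<lambda>y. (s, y)" borel f] by simp
    have "ennreal (exp (- s\<^sup>2 / 2)) * ennreal ((norm (gauss_weight (adj_flow h s)))\<^sup>2)
      = ennreal (1 / (2 * pi) ^ DIM('a)) * (ennreal (exp (- s\<^sup>2 / 2)) *
         (\<integral>\<^sup>+y. ennreal (exp (- (norm y)\<^sup>2 / 2)) * ennreal ((norm (phase_integral f (s, y)))\<^sup>2) \<partial>lborel))"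
      unfolding gauss_weight_adj_flow[OF h] pf by (simp only: mult_ac)
    also have "ennreal (exp (- s\<^sup>2 / 2)) *
         (\<integral>\<^sup>+y. ennreal (exp (- (norm y)\<^sup>2 / 2)) * ennreal ((norm (phase_integral f (s, y)))\<^sup>2) \<partial>lborel)
       = (\<integral>\<^sup>+y. g (s, y) \<partial>lborel)"
      unfolding gs[symmetric] by (rule nn_integral_cmult[symmetric]) measurable
    finally show ?thesis .
  qed
  have "(\<integral>\<^sup>+s. ennreal (exp (- s\<^sup>2 / 2)) * ennreal ((norm (gauss_weight (adj_flow h s)))\<^sup>2) \<partial>lborel)
      = ennreal (1 / (2 * pi) ^ DIM('a)) * (\<integral>\<^sup>+s. \<integral>\<^sup>+y. g (s, y) \<partial>lborel \<partial>lborel)"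
    unfolding sec by (rule nn_integral_cmult) (simp add: lborel.borel_measurable_nn_integral)
  also have "(\<integral>\<^sup>+s. \<integral>\<^sup>+y. g (s, y) \<partial>lborel \<partial>lborel) = (\<integral>\<^sup>+z. g z \<partial>lborel)"
    by (subst lborel_prod[symmetric], rule lborel.nn_integral_fst) (simp add: lborel_prod)
  also have "\<dots> \<le> (\<integral>\<^sup>+\<xi>. \<integral>\<^sup>+\<eta>. ennreal (norm (f \<xi>) * norm (f \<eta>) *
        (sqrt (2 * pi / 1) ^ DIM(real \<times> 'a) * exp (- (norm (phase_point \<xi> - phase_point \<eta>))\<^sup>2 / (2 * 1)))) \<partial>lborel \<partial>lborel)"
    unfolding g_def phase_integral_def by (rule gauss_oscillatory_bound) (auto intro: f_int)
  also have "\<dots> = (\<integral>\<^sup>+\<xi>. \<integral>\<^sup>+\<eta>. ennreal (norm (f \<xi>) * norm (f \<eta>) *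
        (D * exp (- (norm (phase_point \<xi> - phase_point \<eta>))\<^sup>2 / 2))) \<partial>lborel \<partial>lborel)"
    by (simp add: D_def)
  also have "\<dots> \<le> ennreal (D * \<kappa>) * (\<integral>\<^sup>+\<xi>. ennreal ((norm (f \<xi>))\<^sup>2) \<partial>lborel)"
  proof (rule schur_bound)
    show "(\<lambda>(\<xi>, \<eta>). D * exp (- (norm (phase_point \<xi> - phase_point \<eta>))\<^sup>2 / 2)) \<in> borel_measurable (lborel \<Otimes>\<^sub>M lborel)"
      by measurable
    fix \<xi> assume "f \<xi> \<noteq> 0"
    then have "R \<le> norm \<xi>" by (auto simp: f_def split: if_splits)
    have "(\<integral>\<^sup>+\<eta>. ennreal (D * exp (- (norm (phase_point \<xi> - phase_point \<eta>))\<^sup>2 / 2)) \<partial>lborel)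
        = ennreal D * (\<integral>\<^sup>+\<eta>. ennreal (exp (- (norm (phase_point \<xi> - phase_point \<eta>))\<^sup>2 / 2)) \<partial>lborel)"
      using D by (subst nn_integral_cmult[symmetric]) (auto simp: ennreal_mult')
    also have "\<dots> \<le> ennreal D * ennreal \<kappa>"
      by (intro mult_left_mono \<kappa> \<open>R \<le> norm \<xi>\<close>) auto
    finally show "(\<integral>\<^sup>+\<eta>. ennreal (D * exp (- (norm (phase_point \<xi> - phase_point \<eta>))\<^sup>2 / 2)) \<partial>lborel) \<le> ennreal (D * \<kappa>)"
      using D by (simp add: ennreal_mult')
  qed (use D in \<open>auto simp: norm_minus_commute\<close>)
  also have "(\<integral>\<^sup>+\<xi>. ennreal ((norm (f \<xi>))\<^sup>2) \<partial>lborel) = ennreal ((norm h)\<^sup>2)"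
    unfolding norm_L2_eq(3)[symmetric] using f_eq by (intro nn_integral_cong_AE) (auto elim!: eventually_mono)
  finally have "(\<integral>\<^sup>+s. ennreal (exp (- s\<^sup>2 / 2)) * ennreal ((norm (gauss_weight (adj_flow h s)))\<^sup>2) \<partial>lborel)
      \<le> ennreal (1 / (2 * pi) ^ DIM('a)) * (ennreal (D * \<kappa>) * ennreal ((norm h)\<^sup>2))"
    by (simp add: mult_left_mono)
  also have "\<dots> = ennreal (1 / (2 * pi) ^ DIM('a) * (D * \<kappa>) * (norm h)\<^sup>2)"
    by (subst ennreal_mult''[symmetric], simp, subst ennreal_mult'[symmetric], simp, simp only: mult.assoc)
  finally show ?thesis by (simp add: D_def)
qed

subsection \<open>Low frequencies and local smoothing\<close>

text \<open>A Borel choice of a nearby centre, built by adding one ball at a time. Its fibres cut a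
  compact set into small cells; this is used for frequencies here and for times in
  \<open>potential_density_pairing\<close>.\<close>

lemma measurable_net_selector:
  fixes F :: "'a::euclidean_space set"
  assumes "finite F"
  shows "\<exists>p. p \<in> borel_measurable borel \<and> (\<forall>x\<in>(\<Union>a\<in>F. ball a \<eta>). p x \<in> F \<and> dist (p x) x < \<eta>)"
  using assms
proof (induction F)
  case empty
  then show ?case by (intro exI[of _ "\<lambda>x. 0"]) auto
next
  case (insert a F)
  then obtain p where p: "p \<in> borel_measurable borel" "\<forall>x\<in>(\<Union>a\<in>F. ball a \<eta>). p x \<in> F \<and> dist (p x) x < \<eta>"
    by auto
  have "(\<lambda>x. if x \<in> ball a \<eta> then a else p x) \<in> borel_measurable borel"
    using p(1) by (intro measurable_If_set) auto
  then show ?case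
    using p(2) by (intro exI[of _ "\<lambda>x. if x \<in> ball a \<eta> then a else p x"]) auto
qed

text \<open>Cauchy-Schwarz against the indicator of the ball.\<close>

lemma L1_norm_trunc_le:
  "\<exists>L\<ge>0. \<forall>h::('a::euclidean_space, complex, 2) Lp. L2_trunc R h = h \<longrightarrow> (\<integral>x. norm (Lp_rep h x) \<partial>lborel) \<le> L * norm h"
proof -
  let ?B = "cball (0::'a) (real R)"
  define u :: "('a, complex, 2) Lp" where "u = Lp_class (\<lambda>x. indicator ?B x *\<^sub>R 1)"
  have "(\<lambda>x. indicator ?B x *\<^sub>R (1::complex)) \<in> lp_space CARD(2)"
    using emeasure_bounded_finite[OF bounded_cball, of "0::'a" "real R"] by (intro lp_space_indicator) auto
  then have u: "AE x in lborel. Lp_rep u x = indicator ?B x *\<^sub>R 1"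
    unfolding u_def by (rule Lp_rep_class)
  have "(\<integral>x. norm (Lp_rep h x) \<partial>lborel) \<le> norm u * norm h" if h: "L2_trunc R h = h" for h :: "('a, complex, 2) Lp"
  proof -
    have "(\<integral>x. norm (Lp_rep h x) \<partial>lborel) = (\<integral>x. norm (Lp_rep u x * Lp_rep h x) \<partial>lborel)"
    proof (rule integral_cong_AE)
      show "AE x in lborel. norm (Lp_rep h x) = norm (Lp_rep u x * Lp_rep h x)"
        using u Lp_rep_trunc[of R h] unfolding h by eventually_elim (auto simp: indicator_def)
    qed auto
    then show ?thesis using L2_cauchy_schwarz[of u h] by simp
  qed
  then show ?thesis by (intro exI[of _ "norm u"]) auto
qed

text \<open>On each cell the plane wave is replaced by its value at the centre \<open>p x\<close>.
  The replaced integral is a combination of the integrals of h over the cells, hence 0. The error is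
  controlled by the gradient of the phase s |x|^2 - y . x, which is at most 2 R T + |y| on the
  ball.\<close>

lemma phase_integral_small:
  fixes h :: "('a::euclidean_space, complex, 2) Lp"
  assumes h: "L2_trunc R h = h" and F: "finite F" "F \<subseteq> cball 0 (real R)"
    and p: "p \<in> borel_measurable borel" "\<And>x. x \<in> cball 0 (real R) \<Longrightarrow> p x \<in> F \<and> dist (p x) x < \<eta>"
    and zero: "\<And>a. a \<in> F \<Longrightarrow> (\<integral>x. indicator {x \<in> cball 0 (real R). p x = a} x * Lp_rep h x \<partial>lborel) = 0"
    and s: "\<bar>s\<bar> \<le> T"
  shows "norm (phase_integral (Lp_rep h) (s, y)) \<le> \<eta> * (norm y + 2 * real R * T) * (\<integral>x. norm (Lp_rep h x) \<partial>lborel)"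
proof -
  note [measurable] = p(1)
  define E where "E x = cis ((s, y) \<bullet> phase_point x)" for x
  have Em[measurable]: "E \<in> borel_measurable borel" unfolding E_def by measurable
  have nE[simp]: "norm (E x) = 1" for x by (simp add: E_def)
  have hi: "integrable lborel (Lp_rep h)" using integrable_L2_trunc[of R h] by (simp add: h)
  have off: "AE x in lborel. x \<notin> cball 0 (real R) \<longrightarrow> Lp_rep h x = 0"
    using Lp_rep_trunc[of R h] unfolding h by eventually_elim auto
  let ?A = "\<lambda>a. {x \<in> cball 0 (real R). p x = a}"
  have A: "?A a \<in> sets borel" for a by measurable
  have Ai: "integrable lborel (\<lambda>x. indicator (?A a) x * Lp_rep h x)" for a
  proof (rule Bochner_Integration.integrable_bound[OF hi])
    have "(indicator (?A a) :: 'a \<Rightarrow> complex) \<in> borel_measurable borel" using A by (rule borel_measurable_indicator)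
    then show "(\<lambda>x. indicator (?A a) x * Lp_rep h x) \<in> borel_measurable lborel" by measurable
  qed (auto simp: indicator_def)
  have i1: "integrable lborel (\<lambda>x. E x * Lp_rep h x)" and i2: "integrable lborel (\<lambda>x. E (p x) * Lp_rep h x)"
    by (rule Bochner_Integration.integrable_bound[OF hi], measurable, simp add: norm_mult)+
  have "(\<integral>x. E (p x) * Lp_rep h x \<partial>lborel) = (\<integral>x. (\<Sum>a\<in>F. E a * (indicator (?A a) x * Lp_rep h x)) \<partial>lborel)"
  proof (rule integral_cong_AE)
    show "(\<lambda>x. E (p x) * Lp_rep h x) \<in> borel_measurable lborel" by measurable
    show "(\<lambda>x. \<Sum>a\<in>F. E a * (indicator (?A a) x * Lp_rep h x)) \<in> borel_measurable lborel"
      by (intro borel_measurable_sum borel_measurable_times borel_measurable_const borel_measurable_integrable[OF Ai])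
        (use borel_measurable_indicator[OF A] in auto)
    show "AE x in lborel. E (p x) * Lp_rep h x = (\<Sum>a\<in>F. E a * (indicator (?A a) x * Lp_rep h x))"
      using off
    proof eventually_elim
      case (elim x)
      show ?case
      proof (cases "x \<in> cball 0 (real R)")
        case True
        have "(\<Sum>a\<in>F. E a * (indicator (?A a) x * Lp_rep h x)) = (\<Sum>a\<in>F. if a = p x then E a * Lp_rep h x else 0)"
          using True by (intro sum.cong) (auto simp: indicator_def)
        then show ?thesis using F(1) p(2)[OF True] by simp
      qed (use elim in simp)
    qed
  qed
  also have "\<dots> = (\<Sum>a\<in>F. E a * (\<integral>x. indicator (?A a) x * Lp_rep h x \<partial>lborel))"
    using Ai by simp
  also have "\<dots> = 0" using zero by simp
  finally have z: "(\<integral>x. E (p x) * Lp_rep h x \<partial>lborel) = 0" .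
  have "phase_integral (Lp_rep h) (s, y) = (\<integral>x. E x * Lp_rep h x \<partial>lborel) - (\<integral>x. E (p x) * Lp_rep h x \<partial>lborel)"
    unfolding z by (simp add: phase_integral_def E_def)
  also have "\<dots> = (\<integral>x. E x * Lp_rep h x - E (p x) * Lp_rep h x \<partial>lborel)"
    using i1 i2 by simp
  also have "norm \<dots> \<le> (\<integral>x. norm (E x * Lp_rep h x - E (p x) * Lp_rep h x) \<partial>lborel)"
    by (rule integral_norm_bound)
  also have "\<dots> \<le> (\<integral>x. \<eta> * (norm y + 2 * real R * T) * norm (Lp_rep h x) \<partial>lborel)"
  proof (rule integral_mono_AE)
    show "integrable lborel (\<lambda>x. norm (E x * Lp_rep h x - E (p x) * Lp_rep h x))" using i1 i2 by simp
    show "integrable lborel (\<lambda>x. \<eta> * (norm y + 2 * real R * T) * norm (Lp_rep h x))" using hi by simp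
  next
    have "AE x in lborel. norm (E x * Lp_rep h x - E (p x) * Lp_rep h x) \<le> \<eta> * (norm y + 2 * real R * T) * norm (Lp_rep h x)"
      using off
    proof eventually_elim
      case (elim x)
      show ?case
      proof (cases "x \<in> cball 0 (real R)")
        case True
        then have px: "norm (p x) \<le> R" "dist (p x) x < \<eta>" and x: "norm x \<le> R" using p(2)[OF True] F(2) by auto
        have d: "norm (x - p x) \<le> \<eta>" using px(2) by (simp add: dist_norm norm_minus_commute)
        have \<eta>: "0 \<le> \<eta>" using px(2) by (meson dist_not_less_zero linorder_not_le order.strict_trans)
        have "norm (E x - E (p x)) \<le> \<bar>(s, y) \<bullet> phase_point x - (s, y) \<bullet> phase_point (p x)\<bar>"
          unfolding E_def by (rule norm_cis_diff_le)
        also have "(s, y) \<bullet> phase_point x - (s, y) \<bullet> phase_point (p x)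
            = s * ((norm x)\<^sup>2 - (norm (p x))\<^sup>2) - y \<bullet> (x - p x)"
          by (simp add: phase_point_def inner_prod_def algebra_simps inner_diff_right)
        also have "\<bar>\<dots>\<bar> \<le> \<bar>s * ((norm x)\<^sup>2 - (norm (p x))\<^sup>2)\<bar> + \<bar>y \<bullet> (x - p x)\<bar>" by linarith
        also have "\<bar>s * ((norm x)\<^sup>2 - (norm (p x))\<^sup>2)\<bar> \<le> T * ((2 * real R) * \<eta>)"
        proof -
          have "\<bar>(norm x)\<^sup>2 - (norm (p x))\<^sup>2\<bar> = (norm x + norm (p x)) * \<bar>norm x - norm (p x)\<bar>"
            by (simp add: square_diff_square_factored power2_eq_square abs_mult)
          also have "\<dots> \<le> (2 * real R) * \<eta>"
            using px x d norm_triangle_ineq3[of x "p x"] by (intro mult_mono) auto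
          finally show ?thesis unfolding abs_mult using s by (intro mult_mono) auto
        qed
        also have "\<bar>y \<bullet> (x - p x)\<bar> \<le> norm y * \<eta>"
          using Cauchy_Schwarz_ineq2[of y "x - p x"] d by (meson mult_left_mono norm_ge_zero order_trans)
        finally have "norm (E x - E (p x)) \<le> \<eta> * (norm y + 2 * real R * T)" by (simp add: algebra_simps)
        then show ?thesis
          unfolding left_diff_distrib[symmetric] norm_mult by (intro mult_right_mono) auto
      qed (use elim in simp)
    qed
    then show "AE x in lborel. norm (E x * Lp_rep h x - E (p x) * Lp_rep h x) \<le> \<eta> * (norm y + 2 * real R * T) * norm (Lp_rep h x)" .
  qed
  finally show ?thesis by simp
qed

text \<open>The estimate of \<open>phase_integral_small\<close> grows in y, but only polynomially,
  and the Gaussian weight absorbs this. The mesh of the cells depends on R, T and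
  \<open>\<delta>\<close>, not on h or s.\<close>

lemma low_frequency_bound:
  assumes \<delta>: "0 < \<delta>" and T: "0 \<le> T"
  shows "\<exists>(F :: 'a::euclidean_space set) (p :: 'a \<Rightarrow> 'a). finite F \<and> p \<in> borel_measurable borel \<and>
    (\<forall>h. L2_trunc R h = h \<longrightarrow>
      (\<forall>a\<in>F. (\<integral>x. indicator {x \<in> cball 0 (real R). p x = a} x * Lp_rep h x \<partial>lborel) = 0) \<longrightarrow>
      (\<forall>s. \<bar>s\<bar> \<le> T \<longrightarrow> norm (gauss_weight (adj_flow h s)) \<le> \<delta> * norm h))"
proof -
  let ?d = "DIM('a)"
  obtain L where L: "0 \<le> L" "\<And>h::('a, complex, 2) Lp. L2_trunc R h = h \<Longrightarrow> (\<integral>x. norm (Lp_rep h x) \<partial>lborel) \<le> L * norm h"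
    using L1_norm_trunc_le[of R] by metis
  \<comment> \<open>Chosen such that the square of the polynomial is at most B exp(|y|^2 / 4). This
    uses up half of the exponent of exp(-|y|^2 / 2) and leaves an integrable Gaussian.\<close>
  define B where "B = 8 + 8 * (real R * T)\<^sup>2"
  have B: "0 < B" by (simp add: B_def add_pos_nonneg)
  have poly: "(norm y + 2 * real R * T)\<^sup>2 \<le> B * exp ((norm y)\<^sup>2 / 4)" for y :: 'a
  proof -
    have e: "1 + (norm y)\<^sup>2 / 4 \<le> exp ((norm y)\<^sup>2 / 4)" by (rule exp_ge_add_one_self)
    have "(norm y + 2 * real R * T)\<^sup>2 \<le> 2 * (norm y)\<^sup>2 + 2 * (2 * real R * T)\<^sup>2"
      using sum_squares_bound[of "norm y" "2 * real R * T"] by (simp add: power2_sum)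
    also have "\<dots> = 2 * (norm y)\<^sup>2 + 8 * (real R * T)\<^sup>2"
      by (simp add: power2_eq_square)
    also have "\<dots> \<le> 8 * exp ((norm y)\<^sup>2 / 4) + 8 * (real R * T)\<^sup>2 * exp ((norm y)\<^sup>2 / 4)"
    proof (rule add_mono)
      show "2 * (norm y)\<^sup>2 \<le> 8 * exp ((norm y)\<^sup>2 / 4)" using e by linarith
      show "8 * (real R * T)\<^sup>2 \<le> 8 * (real R * T)\<^sup>2 * exp ((norm y)\<^sup>2 / 4)"
        using mult_left_mono[of 1 "exp ((norm y)\<^sup>2 / 4)" "8 * (real R * T)\<^sup>2"] by simp
    qed
    finally show ?thesis by (simp add: B_def distrib_right)
  qed
  \<comment> \<open>The final estimate of the squared norm is
    \<open>\<eta>\<^sup>2 * Q * (norm h)\<^sup>2\<close>, and the mesh \<open>\<eta>\<close> is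
    adjusted to it. The 1 in \<open>sqrt (Q + 1)\<close> keeps the quotient meaningful for Q =
    0.\<close>
  define Q where "Q = 1 / (2 * pi) ^ ?d * (L\<^sup>2 * B * sqrt (2 * pi / (1 / 2)) ^ ?d)"
  have Q: "0 \<le> Q" using B by (simp add: Q_def)
  define \<eta> where "\<eta> = \<delta> / sqrt (Q + 1)"
  have \<eta>: "0 < \<eta>" using \<delta> Q by (simp add: \<eta>_def)
  have \<eta>Q: "\<eta>\<^sup>2 * Q \<le> \<delta>\<^sup>2"
    using Q \<delta> by (simp add: \<eta>_def power_divide field_simps)
  have "cball (0::'a) R \<subseteq> (\<Union>a\<in>cball 0 R. ball a \<eta>)" using \<eta> by auto
  then obtain F where F: "F \<subseteq> cball (0::'a) R" "finite F" "cball 0 R \<subseteq> (\<Union>a\<in>F. ball a \<eta>)"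
    by (rule compactE_image[OF compact_cball open_ball])
  obtain p where p: "p \<in> borel_measurable borel" "\<forall>x\<in>(\<Union>a\<in>F. ball a \<eta>). p x \<in> F \<and> dist (p x) x < \<eta>"
    using measurable_net_selector[OF F(2)] by metis
  have main: "norm (gauss_weight (adj_flow h s)) \<le> \<delta> * norm h"
    if h: "L2_trunc R h = h" "\<forall>a\<in>F. (\<integral>x. indicator {x \<in> cball 0 (real R). p x = a} x * Lp_rep h x \<partial>lborel) = 0"
      and s: "\<bar>s\<bar> \<le> T" for h s
  proof -
    define D where "D = \<eta>\<^sup>2 * (L * norm h)\<^sup>2 * B"
    have D: "0 \<le> D" using B by (simp add: D_def)
    have pi_bound: "exp (- (norm y)\<^sup>2 / 2) * (norm (phase_integral (Lp_rep h) (s, y)))\<^sup>2 \<le> D * exp (- (1/2) * (norm y)\<^sup>2 / 2)" for y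
    proof -
      have "norm (phase_integral (Lp_rep h) (s, y)) \<le> \<eta> * (norm y + 2 * real R * T) * (\<integral>x. norm (Lp_rep h x) \<partial>lborel)"
        using h p F s by (intro phase_integral_small) auto
      also have "\<dots> \<le> \<eta> * (norm y + 2 * real R * T) * (L * norm h)"
        using \<eta> T by (intro mult_left_mono L(2) h(1)) auto
      finally have "(norm (phase_integral (Lp_rep h) (s, y)))\<^sup>2 \<le> (\<eta> * (norm y + 2 * real R * T) * (L * norm h))\<^sup>2"
        by (rule power_mono) simp
      also have "\<dots> = \<eta>\<^sup>2 * (L * norm h)\<^sup>2 * (norm y + 2 * real R * T)\<^sup>2" by (simp add: power_mult_distrib)
      also have "\<dots> \<le> \<eta>\<^sup>2 * (L * norm h)\<^sup>2 * (B * exp ((norm y)\<^sup>2 / 4))"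
        by (intro mult_left_mono poly) auto
      finally have "exp (- (norm y)\<^sup>2 / 2) * (norm (phase_integral (Lp_rep h) (s, y)))\<^sup>2
          \<le> exp (- (norm y)\<^sup>2 / 2) * (D * exp ((norm y)\<^sup>2 / 4))"
        by (intro mult_left_mono) (auto simp: D_def mult_ac)
      also have "\<dots> = D * (exp (- (norm y)\<^sup>2 / 2) * exp ((norm y)\<^sup>2 / 4))" by simp
      also have "exp (- (norm y)\<^sup>2 / 2) * exp ((norm y)\<^sup>2 / 4) = exp (- (1/2) * (norm y)\<^sup>2 / 2)"
        by (simp flip: exp_add)
      finally show ?thesis .
    qed
    have "ennreal ((norm (gauss_weight (adj_flow h s)))\<^sup>2) = ennreal (1 / (2 * pi) ^ ?d) *
        (\<integral>\<^sup>+y. ennreal (exp (- (norm (y::'a))\<^sup>2 / 2)) * ennreal ((norm (phase_integral (Lp_rep h) (s, y)))\<^sup>2) \<partial>lborel)"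
      by (rule gauss_weight_adj_flow[OF h(1)])
    also have "\<dots> \<le> ennreal (1 / (2 * pi) ^ ?d) * (\<integral>\<^sup>+y. ennreal D * ennreal (exp (- (1/2) * (norm (y::'a))\<^sup>2 / 2)) \<partial>lborel)"
      by (intro mult_left_mono nn_integral_mono)
        (use pi_bound D in \<open>auto simp flip: ennreal_mult' simp del: minus_mult_minus intro!: ennreal_leI\<close>)
    also have "(\<integral>\<^sup>+y. ennreal D * ennreal (exp (- (1/2) * (norm (y::'a))\<^sup>2 / 2)) \<partial>lborel)
        = ennreal D * ennreal (sqrt (2 * pi / (1/2)) ^ ?d)"
      by (subst nn_integral_cmult, measurable) (subst gauss_integral(3), auto)
    also have "ennreal (1 / (2 * pi) ^ ?d) * (ennreal D * ennreal (sqrt (2 * pi / (1/2)) ^ ?d))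
        = ennreal (1 / (2 * pi) ^ ?d * (D * sqrt (2 * pi / (1/2)) ^ ?d))"
      by (subst ennreal_mult''[symmetric], simp, subst ennreal_mult'[symmetric]) simp_all
    finally have "(norm (gauss_weight (adj_flow h s)))\<^sup>2 \<le> 1 / (2 * pi) ^ ?d * (D * sqrt (2 * pi / (1/2)) ^ ?d)"
      using D by (subst (asm) ennreal_le_iff) auto
    also have "\<dots> = \<eta>\<^sup>2 * Q * (norm h)\<^sup>2"
      by (simp add: D_def Q_def power_mult_distrib)
    also have "\<dots> \<le> \<delta>\<^sup>2 * (norm h)\<^sup>2"
      by (intro mult_right_mono \<eta>Q) auto
    finally have "(norm (gauss_weight (adj_flow h s)))\<^sup>2 \<le> (\<delta> * norm h)\<^sup>2"
      by (simp add: power_mult_distrib)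
    then show ?thesis by (rule power2_le_imp_le) (use \<delta> in simp)
  qed
  show ?thesis
    by (rule exI[of _ F], rule exI[of _ p]) (intro conjI allI impI F(2) p(1) main)
qed

text \<open>The range of the weight is dense: on a ball the Gaussian is bounded below, so a
  truncation of c can be divided by it.\<close>

lemma gauss_weight_approx:
  fixes c :: "('a::euclidean_space, complex, 2) Lp"
  assumes "0 < \<epsilon>"
  shows "\<exists>c'. norm (c - gauss_weight c') \<le> \<epsilon>"
proof -
  have "eventually (\<lambda>n. dist (L2_trunc n c) c < \<epsilon>) sequentially"
    using L2_trunc_tendsto assms by (rule tendstoD)
  then obtain n where n: "dist (L2_trunc n c) c < \<epsilon>"
    by (auto simp: eventually_sequentially)
  let ?B = "cball (0::'a) (real n)"
  define m where "m x = indicator ?B x * complex_of_real (exp ((norm x)\<^sup>2 / 4))" for x :: 'a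
  have mm: "m \<in> borel_measurable borel"
    unfolding m_def by (intro borel_measurable_times indicator_cball_measurable) measurable
  have mb: "norm (m x) \<le> exp (real n ^ 2 / 4)" for x
    by (auto simp: m_def indicator_def intro: power_mono)
  have "gauss_weight (Lp_mul m c) = L2_trunc n c"
    using Lp_rep_gauss_weight[of "Lp_mul m c"] Lp_rep_mul[OF mm mb, of c] Lp_rep_trunc[of n c]
  proof (intro Lp_eqI, eventually_elim)
    case (elim x)
    have "complex_of_real (exp (- (norm x)\<^sup>2 / 4)) * complex_of_real (exp ((norm x)\<^sup>2 / 4)) = 1"
      by (simp flip: of_real_mult exp_add)
    then have "complex_of_real (exp (- (norm x)\<^sup>2 / 4)) * (complex_of_real (exp ((norm x)\<^sup>2 / 4)) * z) = z" for z
      by (simp only: mult.assoc[symmetric]) simp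
    then show ?case by (simp only: elim m_def mult.assoc mult.left_commute[of "indicator ?B x"])
  qed
  then show ?thesis using n by (intro exI[of _ "Lp_mul m c"]) (simp add: dist_norm norm_minus_commute)
qed

lemma L2_mult_gauss_weight: "L2_mult (gauss_weight u) v = L2_mult u (gauss_weight v)"
  using Lp_rep_L2_mult[of "gauss_weight u" v] Lp_rep_L2_mult[of u "gauss_weight v"]
    Lp_rep_gauss_weight[of u] Lp_rep_gauss_weight[of v]
  by (intro Lp_eqI, eventually_elim) simp

text \<open>The linear conditions kill the low frequencies, since the phase is nearly constant on each cell
  \<open>A\<close>. The high frequencies are dispersed: they only contribute to \<open>b\<close>, which is small in mean square.\<close>
lemma local_smoothing:
  fixes C :: "('a::euclidean_space, complex, 2) Lp set"
  assumes C: "finite C" and \<epsilon>: "0 < \<epsilon>" "0 < \<epsilon>'" and T: "0 \<le> T"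
  shows "\<exists>(R::nat) (\<A> :: 'a set set). finite \<A> \<and> \<A> \<subseteq> sets borel \<and> disjoint \<A> \<and> (\<forall>A\<in>\<A>. A \<subseteq> cball 0 (real R)) \<and>
    (\<forall>h k. L2_trunc k h = h \<longrightarrow> (\<forall>A\<in>\<A>. (\<integral>x. indicator A x * Lp_rep h x \<partial>lborel) = 0) \<longrightarrow>
      (\<exists>b\<in>borel_measurable borel. (\<forall>s. 0 \<le> b s) \<and>
        (\<forall>s c. \<bar>s\<bar> \<le> T \<longrightarrow> c \<in> C \<longrightarrow> norm (L2_mult c (adj_flow h s)) \<le> \<epsilon> * norm h + b s) \<and>
        (\<integral>\<^sup>+s. ennreal (indicator {- T..T} s * (b s)\<^sup>2) \<partial>lborel) \<le> ennreal (\<epsilon>' * (norm h)\<^sup>2)))"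
proof -
  \<comment> \<open>Each c is nearly of the form \<open>gauss_weight (c' c)\<close>, and in a
    product the weight may be moved onto the free wave. Decay of c in x thus becomes localisation of
    the wave.\<close>
  obtain c' :: "('a, complex, 2) Lp \<Rightarrow> ('a, complex, 2) Lp" where c': "\<And>c. norm (c - gauss_weight (c' c)) \<le> \<epsilon> / 2"
    using gauss_weight_approx[of "\<epsilon> / 2"] \<epsilon>(1) by (metis half_gt_zero)
  define M where "M = (\<Sum>c\<in>C. norm (c' c)) + 1"
  have M: "0 < M" unfolding M_def by (intro add_nonneg_pos sum_nonneg) auto
  have M_le: "norm (c' c) \<le> M" if "c \<in> C" for c
    unfolding M_def using member_le_sum[OF that, of "\<lambda>c. norm (c' c)"] C by simp
  \<comment> \<open>Collects the constant of \<open>high_frequency_bound\<close>, the factor M^2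
    from the products with c', and exp(T^2 / 2), which undoes the time weight on [-T, T]. With
    \<open>\<kappa> = \<epsilon>' / D\<close> the high frequencies contribute exactly
    \<open>\<epsilon>'\<close>.\<close>
  define D where "D = 1 / (2 * pi) ^ DIM('a) * sqrt (2 * pi) ^ (DIM('a) + 1) * M\<^sup>2 * exp (T\<^sup>2 / 2)"
  have D: "0 < D" using M by (simp add: D_def)
  define \<kappa> where "\<kappa> = \<epsilon>' / D"
  have \<kappa>: "0 < \<kappa>" using D \<epsilon> by (simp add: \<kappa>_def)
  obtain R :: nat where R: "\<And>\<xi>::'a. real R \<le> norm \<xi> \<Longrightarrow>
      (\<integral>\<^sup>+\<eta>. ennreal (exp (- (norm (phase_point \<xi> - phase_point \<eta>))\<^sup>2 / 2)) \<partial>lborel) \<le> ennreal \<kappa>"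
    using phase_kernel_decay[OF \<kappa>] by metis
  have "0 < \<epsilon> / (2 * M)" using \<epsilon> M by simp
  from low_frequency_bound[OF this T, of R]
  obtain F and p :: "'a \<Rightarrow> 'a" where Fp: "finite F" "p \<in> borel_measurable borel"
    "\<And>h s. L2_trunc R h = h \<Longrightarrow>
      (\<forall>a\<in>F. (\<integral>x. indicator {x \<in> cball 0 (real R). p x = a} x * Lp_rep h x \<partial>lborel) = 0) \<Longrightarrow>
      \<bar>s\<bar> \<le> T \<Longrightarrow> norm (gauss_weight (adj_flow h s)) \<le> \<epsilon> / (2 * M) * norm h" by blast
  define \<A> where "\<A> = (\<lambda>a. {x \<in> cball 0 (real R). p x = a}) ` F"
  note [measurable] = Fp(2)
  have "finite \<A>" "disjoint \<A>" "\<forall>A\<in>\<A>. A \<subseteq> cball 0 (real R)"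
    using Fp(1) by (auto simp: \<A>_def disjoint_def)
  moreover have "\<A> \<subseteq> sets borel" unfolding \<A>_def by auto
  moreover have "\<exists>b\<in>borel_measurable borel. (\<forall>s. 0 \<le> b s) \<and>
        (\<forall>s c. \<bar>s\<bar> \<le> T \<longrightarrow> c \<in> C \<longrightarrow> norm (L2_mult c (adj_flow h s)) \<le> \<epsilon> * norm h + b s) \<and>
        (\<integral>\<^sup>+s. ennreal (indicator {- T..T} s * (b s)\<^sup>2) \<partial>lborel) \<le> ennreal (\<epsilon>' * (norm h)\<^sup>2)"
    if h: "L2_trunc k h = h" "\<forall>A\<in>\<A>. (\<integral>x. indicator A x * Lp_rep h x \<partial>lborel) = 0" for h k
  proof -
    \<comment> \<open>Low and high part of h. The cells lie in the ball of radius R, so h1 inherits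
      the vanishing cell integrals from h; h2 keeps the bounded support of h.\<close>
    define h1 where "h1 = L2_trunc R h"
    define h2 where "h2 = h - h1"
    have hh: "h = h1 + h2" by (simp add: h2_def)
    have h1R: "L2_trunc R h1 = h1" by (simp add: h1_def L2_trunc_trunc)
    have h1k: "AE x in lborel. Lp_rep h1 x = indicator (cball 0 (real R)) x * Lp_rep h x"
      unfolding h1_def by (rule Lp_rep_trunc)
    have h2x: "AE x in lborel. Lp_rep h2 x = (1 - indicator (cball 0 (real R)) x) * Lp_rep h x"
      using h1k Lp_rep_diff[of h h1] unfolding h2_def by eventually_elim (simp add: algebra_simps)
    have h2k: "L2_trunc k h2 = h2"
      using h2x Lp_rep_trunc[of k h2] Lp_rep_trunc[of k h] unfolding h(1)
      by (intro Lp_eqI, eventually_elim) (auto simp: indicator_def split: if_splits)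
    have h2R: "AE x in lborel. norm x < real R \<longrightarrow> Lp_rep h2 x = 0"
      using h2x by eventually_elim auto
    have h1n: "norm h1 \<le> norm h" unfolding h1_def by (rule norm_L2_trunc_le)
    have h2n: "norm h2 \<le> norm h"
      by (rule norm_Lp_mono) (use h2x in \<open>auto elim!: eventually_mono simp: indicator_def\<close>)
    have h1z: "\<forall>a\<in>F. (\<integral>x. indicator {x \<in> cball 0 (real R). p x = a} x * Lp_rep h1 x \<partial>lborel) = 0"
    proof
      fix a assume "a \<in> F"
      let ?A = "{x \<in> cball 0 (real R). p x = a}"
      have [measurable]: "(indicator ?A :: 'a \<Rightarrow> complex) \<in> borel_measurable borel" 
        by (rule borel_measurable_indicator) measurable
      have "(\<integral>x. indicator ?A x * Lp_rep h1 x \<partial>lborel) = (\<integral>x. indicator ?A x * Lp_rep h x \<partial>lborel)"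
        by (rule integral_cong_AE, measurable) (use h1k in \<open>auto elim!: eventually_mono simp: indicator_def\<close>)
      then show "(\<integral>x. indicator ?A x * Lp_rep h1 x \<partial>lborel) = 0"
        using h(2) \<open>a \<in> F\<close> by (auto simp: \<A>_def)
    qed
    define b where "b s = M * norm (gauss_weight (adj_flow h2 s))" for s
    have "continuous_on UNIV b"
      unfolding b_def
      by (intro continuous_intros bounded_linear.continuous_on[OF bounded_linear_gauss_weight] continuous_adj_flow)
    then have bm[measurable]: "b \<in> borel_measurable borel" by (rule borel_measurable_continuous_onI)
    have b0: "0 \<le> b s" for s using M by (simp add: b_def)
    have bound: "norm (L2_mult c (adj_flow h s)) \<le> \<epsilon> * norm h + b s" if s: "\<bar>s\<bar> \<le> T" and c: "c \<in> C" for s c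
    proof -
      let ?G = "adj_flow h s"
      \<comment> \<open>The first summand is small because c is close to the weighted c', uniformly
        in s; the second sees only the weighted wave.\<close>
      have "L2_mult c ?G = L2_mult (c - gauss_weight (c' c)) ?G + L2_mult (c' c) (gauss_weight ?G)"
        unfolding L2_mult_gauss_weight[symmetric]
        by (simp flip: bounded_bilinear.add_left[OF bounded_bilinear_L2_mult])
      then have "norm (L2_mult c ?G) \<le> norm (L2_mult (c - gauss_weight (c' c)) ?G) + norm (L2_mult (c' c) (gauss_weight ?G))"
        by (simp add: norm_triangle_ineq)
      also have "norm (L2_mult (c - gauss_weight (c' c)) ?G) \<le> \<epsilon> / 2 * norm h"
        using c' \<epsilon> by (intro order_trans[OF norm_L2_mult_le] mult_mono norm_adj_flow_le) auto
      also have "norm (L2_mult (c' c) (gauss_weight ?G)) \<le> M * (norm (gauss_weight (adj_flow h1 s)) + norm (gauss_weight (adj_flow h2 s)))"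
      proof (rule order_trans[OF norm_L2_mult_le], rule mult_mono)
        have "gauss_weight ?G = gauss_weight (adj_flow h1 s) + gauss_weight (adj_flow h2 s)"
          by (simp add: adj_flow_add[symmetric] hh[symmetric] flip: linear_simps(1)[OF bounded_linear_gauss_weight])
        then show "norm (gauss_weight ?G) \<le> norm (gauss_weight (adj_flow h1 s)) + norm (gauss_weight (adj_flow h2 s))"
          by (simp add: norm_triangle_ineq)
      qed (use M M_le[OF c] in auto)
      also have "\<dots> \<le> M * (\<epsilon> / (2 * M) * norm h + norm (gauss_weight (adj_flow h2 s)))"
      proof (intro mult_left_mono add_mono order_refl)
        have "norm (gauss_weight (adj_flow h1 s)) \<le> \<epsilon> / (2 * M) * norm h1"
          by (rule Fp(3)[OF h1R h1z s])
        also have "\<dots> \<le> \<epsilon> / (2 * M) * norm h" using \<epsilon> M h1n by (intro mult_left_mono) auto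
        finally show "norm (gauss_weight (adj_flow h1 s)) \<le> \<epsilon> / (2 * M) * norm h" .
      qed (use M in auto)
      finally show ?thesis using M by (simp add: b_def distrib_left)
    qed
    have "(\<integral>\<^sup>+s. ennreal (indicator {- T..T} s * (b s)\<^sup>2) \<partial>lborel)
      \<le> (\<integral>\<^sup>+s. ennreal (M\<^sup>2 * exp (T\<^sup>2 / 2)) * (ennreal (exp (- s\<^sup>2 / 2)) * ennreal ((norm (gauss_weight (adj_flow h2 s)))\<^sup>2)) \<partial>lborel)"
    proof (rule nn_integral_mono)
      fix s :: real
      show "ennreal (indicator {- T..T} s * (b s)\<^sup>2)
        \<le> ennreal (M\<^sup>2 * exp (T\<^sup>2 / 2)) * (ennreal (exp (- s\<^sup>2 / 2)) * ennreal ((norm (gauss_weight (adj_flow h2 s)))\<^sup>2))"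
      proof (cases "s \<in> {- T..T}")
        case True
        then have "s\<^sup>2 \<le> T\<^sup>2" using T by (intro abs_le_square_iff[THEN iffD1]) auto
        then have "1 \<le> exp (T\<^sup>2 / 2) * exp (- s\<^sup>2 / 2)" by (simp flip: exp_add)
        then have "(b s)\<^sup>2 \<le> exp (T\<^sup>2 / 2) * exp (- s\<^sup>2 / 2) * (b s)\<^sup>2"
          by (simp add: mult_le_cancel_right1)
        then have "ennreal ((b s)\<^sup>2) \<le> ennreal (M\<^sup>2 * exp (T\<^sup>2 / 2) * (exp (- s\<^sup>2 / 2) * (norm (gauss_weight (adj_flow h2 s)))\<^sup>2))"
          by (intro ennreal_leI) (simp add: b_def power_mult_distrib mult_ac)
        then show ?thesis using True by (simp add: ennreal_mult')
      qed simp
    qed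
    also have "\<dots> = ennreal (M\<^sup>2 * exp (T\<^sup>2 / 2)) * (\<integral>\<^sup>+s. ennreal (exp (- s\<^sup>2 / 2)) * ennreal ((norm (gauss_weight (adj_flow h2 s)))\<^sup>2) \<partial>lborel)"
    proof (rule nn_integral_cmult)
      have "continuous_on UNIV (\<lambda>s. norm (gauss_weight (adj_flow h2 s)))"
        by (intro continuous_intros bounded_linear.continuous_on[OF bounded_linear_gauss_weight] continuous_adj_flow)
      then have [measurable]: "(\<lambda>s. norm (gauss_weight (adj_flow h2 s))) \<in> borel_measurable borel"
        by (rule borel_measurable_continuous_onI)
      show "(\<lambda>s. ennreal (exp (- s\<^sup>2 / 2)) * ennreal ((norm (gauss_weight (adj_flow h2 s)))\<^sup>2)) \<in> borel_measurable lborel"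
        by measurable
    qed
    also have "\<dots> \<le> ennreal (M\<^sup>2 * exp (T\<^sup>2 / 2)) * ennreal (1 / (2 * pi) ^ DIM('a) * (sqrt (2 * pi) ^ (DIM('a) + 1) * \<kappa>) * (norm h2)\<^sup>2)"
      by (intro mult_left_mono high_frequency_bound[OF h2k h2R R]) auto
    also have "\<dots> = ennreal (D * \<kappa> * (norm h2)\<^sup>2)"
      by (subst ennreal_mult'[symmetric]) (auto simp: D_def mult_ac)
    also have "\<dots> \<le> ennreal (\<epsilon>' * (norm h)\<^sup>2)"
      using D \<epsilon> h2n by (intro ennreal_leI mult_mono power_mono) (auto simp: \<kappa>_def)
    finally show ?thesis
      using bm b0 bound by (intro bexI[of _ b]) auto
  qed
  ultimately show ?thesis by (intro exI[of _ R] exI[of _ \<A>]) blast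
qed

subsection \<open>Potentials as functionals\<close>

lemma continuous_bounded_Icc:
  fixes f :: "real \<Rightarrow> 'b::real_normed_vector"
  assumes "continuous_on UNIV f"
  obtains B where "\<And>s. s \<in> {a..b} \<Longrightarrow> norm (f s) \<le> B"
proof -
  have "bounded (f ` {a..b})"
    by (intro compact_imp_bounded compact_continuous_image continuous_on_subset[OF assms]) auto
  then obtain B where "\<forall>x\<in>f ` {a..b}. norm x \<le> B" by (auto simp: bounded_iff)
  then show ?thesis by (intro that) auto
qed

lemma bochner_space_iff:
  fixes f :: "real \<Rightarrow> 'b::real_normed_vector"
  assumes I: "I \<in> sets borel"
  shows "f \<in> bochner_space q I \<longleftrightarrow>
    (\<lambda>t. indicator I t *\<^sub>R f t) \<in> borel_measurable borel \<and> integrable lborel (\<lambda>t. indicator I t * norm (f t) powr q)"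
  using I by (simp add: bochner_space_def borel_measurable_restrict_space_iff integrable_restrict_space)

lemma bochner_norm_eq:
  assumes I: "I \<in> sets borel"
  shows "bochner_norm q I f = (\<integral>t. indicator I t * norm (f t) powr q \<partial>lborel) powr (1 / q)"
  using I by (simp add: bochner_norm_def integral_restrict_space)

text \<open>Extension by zero is isometric, so functionals on the larger interval restrict to the
  smaller one without increase of their norm.\<close>

lemma bochner_space_extend:
  fixes f :: "real \<Rightarrow> 'b::real_normed_vector"
  assumes IJ: "I \<in> sets borel" "J \<in> sets borel" "I \<subseteq> J" and q: "0 < q" and f: "f \<in> bochner_space q I"
  shows "(\<lambda>t. indicator I t *\<^sub>R f t) \<in> bochner_space q J"
    and "bochner_norm q J (\<lambda>t. indicator I t *\<^sub>R f t) = bochner_norm q I f"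
proof -
  have 1: "(\<lambda>t. indicator J t *\<^sub>R indicator I t *\<^sub>R f t) = (\<lambda>t. indicator I t *\<^sub>R f t)"
    using IJ(3) by (auto simp: indicator_def fun_eq_iff)
  have 2: "(\<lambda>t. indicator J t * norm (indicator I t *\<^sub>R f t) powr q) = (\<lambda>t. indicator I t * norm (f t) powr q)"
    using IJ(3) q by (auto simp: indicator_def fun_eq_iff)
  show "(\<lambda>t. indicator I t *\<^sub>R f t) \<in> bochner_space q J"
    using f unfolding bochner_space_iff[OF IJ(1)] bochner_space_iff[OF IJ(2)] 1 2 .
  show "bochner_norm q J (\<lambda>t. indicator I t *\<^sub>R f t) = bochner_norm q I f"
    unfolding bochner_norm_eq[OF IJ(1)] bochner_norm_eq[OF IJ(2)] 2 ..
qed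

lemma bochner_norm_mono:
  fixes f :: "real \<Rightarrow> 'b::real_normed_vector" and g :: "real \<Rightarrow> 'c::real_normed_vector"
  assumes I: "I \<in> sets borel" and q: "0 < q" and f: "f \<in> bochner_space q I" and g: "g \<in> bochner_space q I"
    and le: "\<And>t. t \<in> I \<Longrightarrow> norm (f t) \<le> norm (g t)"
  shows "bochner_norm q I f \<le> bochner_norm q I g"
  unfolding bochner_norm_eq[OF I]
proof (rule powr_mono2)
  show "(\<integral>t. indicator I t * norm (f t) powr q \<partial>lborel) \<le> (\<integral>t. indicator I t * norm (g t) powr q \<partial>lborel)"
    using f g q le unfolding bochner_space_iff[OF I]
    by (intro integral_mono) (auto simp: indicator_def intro!: powr_mono2)
qed (use q in \<open>auto intro!: integral_nonneg_AE\<close>)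

lemma bochner_space_bounded:
  fixes f :: "real \<Rightarrow> 'b::{real_normed_vector, second_countable_topology}"
  assumes ab: "a \<le> b" and q: "0 < q" and m: "(\<lambda>t. indicator {a..b} t *\<^sub>R f t) \<in> borel_measurable borel"
    and B: "\<And>t. t \<in> {a..b} \<Longrightarrow> norm (f t) \<le> B"
  shows "f \<in> bochner_space q {a..b}" "bochner_norm q {a..b} f \<le> B * (b - a) powr (1 / q)"
proof -
  have B0: "0 \<le> B" by (rule order_trans[OF norm_ge_zero B[of a]]) (use ab in simp)
  have eq: "(\<lambda>t. indicator {a..b} t * norm (f t) powr q) = (\<lambda>t. norm (indicator {a..b} t *\<^sub>R f t) powr q)"
    using q by (auto simp: indicator_def fun_eq_iff)
  have ib: "integrable lborel (\<lambda>t. indicator {a..b} t * B powr q)"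
    using ab by (intro integrable_mult_left integrable_real_indicator) auto
  have le: "indicator {a..b} t * norm (f t) powr q \<le> indicator {a..b} t * B powr q" for t
    using B[of t] q by (auto simp: indicator_def intro!: powr_mono2)
  have int: "integrable lborel (\<lambda>t. indicator {a..b} t * norm (f t) powr q)"
  proof (rule Bochner_Integration.integrable_bound[OF ib])
    have [measurable]: "(\<lambda>t. indicator {a..b} t *\<^sub>R f t) \<in> borel_measurable lborel" using m by simp
    show "(\<lambda>t. indicator {a..b} t * norm (f t) powr q) \<in> borel_measurable lborel"
      unfolding eq by measurable
    show "AE t in lborel. norm (indicator {a..b} t * norm (f t) powr q) \<le> norm (indicator {a..b} t * B powr q)"
      using le by (auto simp: abs_mult)
  qed
  with m show "f \<in> bochner_space q {a..b}" by (simp add: bochner_space_iff)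
  have "(\<integral>t. indicator {a..b} t * norm (f t) powr q \<partial>lborel) \<le> (\<integral>t. indicator {a..b} t * B powr q \<partial>lborel)"
    by (rule integral_mono[OF int ib le])
  also have "\<dots> = (b - a) * B powr q" using ab by simp
  finally have "bochner_norm q {a..b} f \<le> ((b - a) * B powr q) powr (1 / q)"
    unfolding bochner_norm_eq[OF borel_closed[OF closed_atLeastAtMost]] using q by (intro powr_mono2) (auto intro!: integral_nonneg_AE)
  also have "\<dots> = B * (b - a) powr (1 / q)"
    using ab q B0 by (simp add: powr_mult powr_powr)
  finally show "bochner_norm q {a..b} f \<le> B * (b - a) powr (1 / q)" .
qed

lemma bochner_space_mono:
  fixes f :: "real \<Rightarrow> 'b::real_normed_vector" and g :: "real \<Rightarrow> 'c::{real_normed_vector, second_countable_topology}"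
  assumes q: "0 < q" and f: "f \<in> bochner_space q I" and g: "g \<in> borel_measurable (restrict_space lborel I)"
    and le: "\<And>t. norm (g t) \<le> norm (f t)"
  shows "g \<in> bochner_space q I"
proof -
  have [measurable]: "g \<in> borel_measurable (restrict_space lborel I)" by fact
  have "integrable (restrict_space lborel I) (\<lambda>t. norm (g t) powr q)"
  proof (rule Bochner_Integration.integrable_bound)
    show "integrable (restrict_space lborel I) (\<lambda>t. norm (f t) powr q)"
      using f by (simp add: bochner_space_def)
    show "(\<lambda>t. norm (g t) powr q) \<in> borel_measurable (restrict_space lborel I)" by measurable
    show "AE t in restrict_space lborel I. norm (norm (g t) powr q) \<le> norm (norm (f t) powr q)"
      using q le by (intro AE_I2) (simp add: powr_mono2)
  qed
  with g show ?thesis by (simp add: bochner_space_def)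
qed

lemma Mp_add: "\<Phi> \<in> Mp p I \<Longrightarrow> f \<in> bochner_space (conj_exponent p) I \<Longrightarrow> g \<in> bochner_space (conj_exponent p) I \<Longrightarrow>
    \<Phi> (\<lambda>t. f t + g t) = \<Phi> f + \<Phi> g"
  by (auto simp: Mp_def Let_def)

lemma Mp_scale: "\<Phi> \<in> Mp p I \<Longrightarrow> f \<in> bochner_space (conj_exponent p) I \<Longrightarrow> \<Phi> (\<lambda>t. c *\<^sub>R f t) = c * \<Phi> f"
  by (auto simp: Mp_def Let_def)

text \<open>Composing the functional on the large interval with extension by zero gives an element
  of the dual on the small one which represents the same measure; by
  \<open>Mp_represents_unique\<close> it is the pairing there. Hence one norm bound on [-T, T]
  controls V on all subintervals.\<close>

lemma Mp_pairing_subinterval: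
  fixes V :: "real set \<Rightarrow> ('a::euclidean_space, real) Linf"
  assumes p: "1 < p" and V: "V \<in> Mp_loc p" and ab: "c \<le> a" "a \<le> b" "b \<le> d"
    and f: "f \<in> bochner_space (conj_exponent p) {a..b}"
  shows "Mp_pairing p {a..b} V f = Mp_pairing p {c..d} V (\<lambda>t. indicator {a..b} t *\<^sub>R f t)"
proof -
  let ?I = "{a..b}" and ?J = "{c..d}"
  define q where "q = conj_exponent p"
  have q: "0 < q" using conj_exponent_gt_1[OF p] by (simp add: q_def)
  have sub: "?I \<in> sets borel" "?J \<in> sets borel" "?I \<subseteq> ?J" using ab by auto
  have J: "Mp_pairing p ?J V \<in> Mp p ?J" "represents (Mp_pairing p ?J V) ?J V"
    using Mp_pairing[OF p V, of c d] ab by auto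
  have I: "Mp_pairing p ?I V \<in> Mp p ?I" "represents (Mp_pairing p ?I V) ?I V"
    using Mp_pairing[OF p V, of a b] ab by auto
  define X :: "(real \<Rightarrow> ('a, real, 1) Lp) set" where "X = bochner_space q ?I"
  \<comment> \<open>The value \<open>undefined\<close> outside X meets the extensionality required
    by \<open>Mp\<close>, without which uniqueness could not identify the two functionals.\<close>
  define \<Psi> where "\<Psi> f = (if f \<in> X then Mp_pairing p ?J V (\<lambda>t. indicator ?I t *\<^sub>R f t) else undefined)"
    for f :: "real \<Rightarrow> ('a, real, 1) Lp"
  note ext = bochner_space_extend[OF sub q]
  have Xadd: "(\<lambda>t. f t + g t) \<in> X" if "f \<in> X" "g \<in> X" for f g
    using bochner_space_add[OF q] that by (simp add: X_def)
  have Xscale: "(\<lambda>t. r *\<^sub>R f t) \<in> X" if "f \<in> X" for f r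
    unfolding X_def
  proof (rule bochner_space_bound[OF q that[unfolded X_def], of _ "\<bar>r\<bar>"])
    show "(\<lambda>t. r *\<^sub>R f t) \<in> borel_measurable (restrict_space lborel ?I)"
      using that by (auto simp: X_def bochner_space_def)
  qed simp
  have "\<Psi> \<in> Mp p ?I"
  proof -
    obtain C where C: "\<forall>f\<in>bochner_space q ?J. \<bar>Mp_pairing p ?J V f\<bar> \<le> C * bochner_norm q ?J f"
      using J(1) by (auto simp: Mp_def Let_def q_def)
    have "\<Psi> (\<lambda>t. f t + g t) = \<Psi> f + \<Psi> g" if "f \<in> X" "g \<in> X" for f g
      using that Mp_add[OF J(1) ext(1)[of f, unfolded q_def] ext(1)[of g, unfolded q_def]] Xadd
      by (simp add: \<Psi>_def X_def q_def scaleR_add_right)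
    moreover have "\<Psi> (\<lambda>t. r *\<^sub>R f t) = r * \<Psi> f" if "f \<in> X" for f r
      using that Mp_scale[OF J(1) ext(1)[of f, unfolded q_def], of r] Xscale[OF that, of r]
      by (simp add: \<Psi>_def X_def q_def mult.commute)
    moreover have "\<bar>\<Psi> f\<bar> \<le> C * bochner_norm q ?I f" if "f \<in> X" for f
    proof -
      have "\<bar>\<Psi> f\<bar> \<le> C * bochner_norm q ?J (\<lambda>t. indicator ?I t *\<^sub>R f t)"
        using C ext(1)[OF that[unfolded X_def]] that by (simp add: \<Psi>_def)
      then show ?thesis unfolding ext(2)[OF that[unfolded X_def]] .
    qed
    moreover have "\<Psi> \<in> extensional X" by (simp add: \<Psi>_def extensional_def)
    ultimately show ?thesis unfolding Mp_def Let_def q_def[symmetric] X_def[symmetric] by blast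
  qed
  moreover have "represents \<Psi> ?I V"
    unfolding represents_def
  proof (intro ballI impI allI)
    fix E h assume E: "E \<in> sets borel" "E \<subseteq> ?I"
    have "(\<lambda>t. indicator E t *\<^sub>R h) \<in> X"
      unfolding X_def
    proof (rule bochner_space_bounded(1)[OF ab(2) q, of _ "norm h"])
      show "(\<lambda>t. indicator ?I t *\<^sub>R indicator E t *\<^sub>R h) \<in> borel_measurable borel"
        using E by measurable
    qed (auto simp: indicator_def)
    moreover have "(\<lambda>t. indicator ?I t *\<^sub>R indicator E t *\<^sub>R h) = (\<lambda>t. indicator E t *\<^sub>R h)"
      using E(2) by (auto simp: indicator_def fun_eq_iff)
    ultimately have "\<Psi> (\<lambda>t. indicator E t *\<^sub>R h) = Mp_pairing p ?J V (\<lambda>t. indicator E t *\<^sub>R h)"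
      by (simp add: \<Psi>_def)
    then show "(\<integral>x. Linf_rep (V E) x * Lp_rep h x \<partial>lborel) = \<Psi> (\<lambda>t. indicator E t *\<^sub>R h)"
      using J(2)[unfolded represents_def, rule_format, OF E(1) subset_trans[OF E(2) sub(3)], of h] by simp
  qed
  ultimately have "Mp_pairing p ?I V = \<Psi>"
    using Mp_represents_unique[OF p sub(1) emeasure_bounded_finite[OF bounded_closed_interval] I] by blast
  then show ?thesis using f by (simp add: \<Psi>_def X_def q_def)
qed

text \<open>N bounds the dual norm of V on a symmetric interval, so that Duhamel integrals to
  positive and to negative times are covered by the same constant.\<close>

locale Mp_bounded =
  fixes p N T :: real and V :: "real set \<Rightarrow> ('a::euclidean_space, real) Linf"
  assumes p: "1 < p" and V: "V \<in> Mp_loc p" and N: "0 \<le> N"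
    and bound: "\<And>f. f \<in> bochner_space (conj_exponent p) {- T..T} \<Longrightarrow>
      \<bar>Mp_pairing p {- T..T} V f\<bar> \<le> N * bochner_norm (conj_exponent p) {- T..T} f"
begin

abbreviation "q \<equiv> conj_exponent p"

lemma q: "1 < q" "0 < q"
  using conj_exponent_gt_1[OF p] by auto

context
  fixes a b :: real
  assumes ab: "- T \<le> a" "a \<le> b" "b \<le> T"
begin

lemma pairing_bound:
  assumes "f \<in> bochner_space q {a..b}"
  shows "\<bar>Mp_pairing p {a..b} V f\<bar> \<le> N * bochner_norm q {a..b} f"
  using bound[OF bochner_space_extend(1)[OF _ _ _ q(2) assms]] bochner_space_extend(2)[OF _ _ _ q(2) assms, of "{- T..T}"]
    Mp_pairing_subinterval[OF p V ab assms] ab by simp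

lemma Re_Im_bochner_space:
  assumes h: "h \<in> bochner_space q {a..b}"
  shows "(\<lambda>t. Lp_Re (h t)) \<in> bochner_space q {a..b}" "(\<lambda>t. Lp_Im (h t)) \<in> bochner_space q {a..b}"
proof -
  have hm: "h \<in> borel_measurable (restrict_space lborel {a..b})" using h by (simp add: bochner_space_def)
  have cont: "continuous_on UNIV Lp_Re" "continuous_on UNIV Lp_Im"
    by (intro linear_continuous_on bounded_linear_Lp_Re bounded_linear_Lp_Im)+
  have "(\<lambda>t. Lp_Re (h t)) \<in> borel_measurable (restrict_space lborel {a..b})"
    "(\<lambda>t. Lp_Im (h t)) \<in> borel_measurable (restrict_space lborel {a..b})"
    by (rule measurable_compose[OF hm borel_measurable_continuous_onI[OF cont(1)]]
        measurable_compose[OF hm borel_measurable_continuous_onI[OF cont(2)]])+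
  then show "(\<lambda>t. Lp_Re (h t)) \<in> bochner_space q {a..b}" "(\<lambda>t. Lp_Im (h t)) \<in> bochner_space q {a..b}"
    by (auto intro: bochner_space_mono[OF q(2) h] norm_Lp_Re_le norm_Lp_Im_le)
qed

lemma cpairing_add:
  assumes h: "h \<in> bochner_space q {a..b}" and k: "k \<in> bochner_space q {a..b}"
  shows "Mp_cpairing p {a..b} V (\<lambda>t. h t + k t) = Mp_cpairing p {a..b} V h + Mp_cpairing p {a..b} V k"
  using Mp_add[OF Mp_pairing(1)[OF p V ab(2)] Re_Im_bochner_space(1)[OF h] Re_Im_bochner_space(1)[OF k]]
    Mp_add[OF Mp_pairing(1)[OF p V ab(2)] Re_Im_bochner_space(2)[OF h] Re_Im_bochner_space(2)[OF k]]
  by (simp add: Mp_cpairing_def linear_simps[OF bounded_linear_Lp_Re] linear_simps[OF bounded_linear_Lp_Im] complex_eq_iff)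

text \<open>The factor 2 comes from estimating real and imaginary part separately.\<close>

lemma cpairing_bound:
  assumes h: "h \<in> bochner_space q {a..b}"
  shows "norm (Mp_cpairing p {a..b} V h) \<le> 2 * N * bochner_norm q {a..b} h"
proof -
  note RI = Re_Im_bochner_space[OF h]
  have "norm (Mp_cpairing p {a..b} V h) \<le> \<bar>Mp_pairing p {a..b} V (\<lambda>t. Lp_Re (h t))\<bar> + \<bar>Mp_pairing p {a..b} V (\<lambda>t. Lp_Im (h t))\<bar>"
    using cmod_le[of "Mp_cpairing p {a..b} V h"] by (simp add: Mp_cpairing_def)
  also have "\<dots> \<le> N * bochner_norm q {a..b} (\<lambda>t. Lp_Re (h t)) + N * bochner_norm q {a..b} (\<lambda>t. Lp_Im (h t))"
    by (intro add_mono pairing_bound RI)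
  also have "\<dots> \<le> N * bochner_norm q {a..b} h + N * bochner_norm q {a..b} h"
    by (intro add_mono mult_left_mono bochner_norm_mono q RI h norm_Lp_Re_le norm_Lp_Im_le N) auto
  finally show ?thesis by simp
qed

lemma cpairing_zero: "Mp_cpairing p {a..b} V (\<lambda>t. 0) = 0"
proof -
  have "(\<lambda>t. 0 :: ('a, complex, 1) Lp) \<in> bochner_space q {a..b}"
    by (rule bochner_space_bounded(1)[OF ab(2) q(2), where B = 0]) auto
  from cpairing_add[OF this this] show ?thesis by simp
qed

lemma cpairing_sum:
  assumes "finite F" "\<And>i. i \<in> F \<Longrightarrow> h i \<in> bochner_space q {a..b}"
  shows "(\<lambda>t. \<Sum>i\<in>F. h i t) \<in> bochner_space q {a..b} \<and>
    Mp_cpairing p {a..b} V (\<lambda>t. \<Sum>i\<in>F. h i t) = (\<Sum>i\<in>F. Mp_cpairing p {a..b} V (h i))"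
  using assms
proof (induction F)
  case empty
  have "(\<lambda>t. 0 :: ('a, complex, 1) Lp) \<in> bochner_space q {a..b}"
    by (rule bochner_space_bounded(1)[OF ab(2) q(2), where B = 0]) auto
  then show ?case by (simp add: cpairing_zero)
next
  case (insert i F)
  then have *: "h i \<in> bochner_space q {a..b}" "(\<lambda>t. \<Sum>i\<in>F. h i t) \<in> bochner_space q {a..b}"
    "Mp_cpairing p {a..b} V (\<lambda>t. \<Sum>i\<in>F. h i t) = (\<Sum>i\<in>F. Mp_cpairing p {a..b} V (h i))" by auto
  show ?case
    using bochner_space_add[OF q(2) *(1,2)] cpairing_add[OF *(1,2)] *(3) insert(1,2) by simp
qed

text \<open>Approximating \<open>H\<close> by step functions extends the defining identity of \<open>\<phi>\<close> from constant to
  continuous test functions.\<close>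
lemma potential_density_pairing:
  assumes \<psi>: "continuous_on UNIV \<psi>" and H: "continuous_on UNIV H" and \<phi>: "potential_density p {a..b} V \<psi> \<phi>"
  shows "integrable lborel (\<lambda>s. indicator {a..b} s *\<^sub>R \<phi> s)"
    and "(\<integral>s. L2_pair (indicator {a..b} s *\<^sub>R \<phi> s) (H s) \<partial>lborel) = Mp_cpairing p {a..b} V (\<lambda>s. L2_mult (\<psi> s) (H s))"
proof -
  let ?I = "{a..b}"
  have I: "?I \<in> sets borel" by simp
  define \<phi>' where "\<phi>' s = indicator ?I s *\<^sub>R \<phi> s" for s
  have \<phi>B: "\<phi> \<in> bochner_space p ?I" using \<phi> by (simp add: potential_density_def)
  then have \<phi>m[measurable]: "\<phi>' \<in> borel_measurable borel" and \<phi>p: "integrable lborel (\<lambda>t. indicator ?I t * norm (\<phi> t) powr p)"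
    by (simp_all add: bochner_space_iff \<phi>'_def[abs_def])
  have \<phi>i: "integrable lborel \<phi>'"
  proof (rule Bochner_Integration.integrable_bound)
    show "integrable lborel (\<lambda>t. indicator ?I t + indicator ?I t * norm (\<phi> t) powr p)"
      using \<phi>p ab(2) by (intro Bochner_Integration.integrable_add integrable_real_indicator) auto
    \<comment> \<open>On a bounded interval this turns integrability of the p-th power into
      integrability.\<close>
    have "x \<le> 1 + x powr p" if "0 \<le> x" for x :: real
    proof (cases "x \<le> 1")
      case False
      then have "x powr 1 \<le> x powr p" using p by (intro powr_mono) auto
      then show ?thesis using False by simp
    qed (simp add: add_increasing2)
    then show "AE t in lborel. norm (\<phi>' t) \<le> norm (indicator ?I t + indicator ?I t * norm (\<phi> t) powr p)"
      by (intro AE_I2) (auto simp: \<phi>'_def indicator_def)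
  qed measurable
  then show "integrable lborel (\<lambda>s. indicator ?I s *\<^sub>R \<phi> s)" by (simp add: \<phi>'_def[abs_def])
  have \<psi>m[measurable]: "\<psi> \<in> borel_measurable borel" and Hm[measurable]: "H \<in> borel_measurable borel"
    using \<psi> H by (auto intro: borel_measurable_continuous_onI)
  have mult_m: "(\<lambda>s. L2_mult (f s) (g s)) \<in> borel_measurable M"
    if "f \<in> borel_measurable M" "g \<in> borel_measurable M" for f g and M :: "real measure"
    using that by (rule borel_measurable_continuous_Pair)
      (intro bounded_bilinear.continuous_on[OF bounded_bilinear_L2_mult] continuous_intros)
  have pair_m: "(\<lambda>s. L2_pair (f s) (g s)) \<in> borel_measurable M"
    if "f \<in> borel_measurable M" "g \<in> borel_measurable M" for f g and M :: "real measure"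
    using that by (rule borel_measurable_continuous_Pair)
      (intro bounded_bilinear.continuous_on[OF bounded_bilinear_L2_pair] continuous_intros)
  obtain K where K: "\<And>s. s \<in> ?I \<Longrightarrow> norm (\<psi> s) \<le> K"
    by (rule continuous_bounded_Icc[OF \<psi>, of a b]) (rule that)
  have K0: "0 \<le> K" by (rule order_trans[OF norm_ge_zero K[of a]]) (use ab in simp)
  obtain K' where K': "\<And>s. s \<in> ?I \<Longrightarrow> norm (H s) \<le> K'"
    by (rule continuous_bounded_Icc[OF H, of a b]) (rule that)
  define h where "h s = L2_mult (\<psi> s) (H s)" for s
  \<comment> \<open>Replacing H by an \<epsilon>-close step function costs at most \<epsilon> times
    the L^1 norm of \<open>\<phi>'\<close> on the left-hand side, and \<epsilon> times the second
    summand, from the dual norm of V, on the right-hand side.\<close>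
  define Q where "Q = (\<integral>s. norm (\<phi>' s) \<partial>lborel) + 2 * N * (K * (b - a) powr (1 / q))"
  have Q0: "0 \<le> Q" unfolding Q_def using N K0 by (intro add_nonneg_nonneg) (auto intro!: integral_nonneg_AE mult_nonneg_nonneg)
  have close: "norm ((\<integral>s. L2_pair (\<phi>' s) (H s) \<partial>lborel) - Mp_cpairing p ?I V h) \<le> \<epsilon> * Q" if \<epsilon>: "0 < \<epsilon>" for \<epsilon>
  proof -
    have "uniformly_continuous_on ?I H"
      by (intro compact_uniformly_continuous continuous_on_subset[OF H]) auto
    then obtain \<delta> where \<delta>: "0 < \<delta>" "\<And>s t. s \<in> ?I \<Longrightarrow> t \<in> ?I \<Longrightarrow> dist t s < \<delta> \<Longrightarrow> dist (H t) (H s) < \<epsilon>"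
      unfolding uniformly_continuous_on_def using \<epsilon> by metis
    have "?I \<subseteq> (\<Union>s\<in>?I. ball s \<delta>)" using \<delta>(1) by auto
    then obtain F where F: "F \<subseteq> ?I" "finite F" "?I \<subseteq> (\<Union>s\<in>F. ball s \<delta>)"
      by (rule compactE_image[OF compact_Icc open_ball])
    obtain r where r: "r \<in> borel_measurable borel" "\<forall>s\<in>(\<Union>s\<in>F. ball s \<delta>). r s \<in> F \<and> dist (r s) s < \<delta>"
      using measurable_net_selector[OF F(2)] by metis
    note [measurable] = r(1)
    have rF: "r s \<in> F" and rH: "norm (H s - H (r s)) \<le> \<epsilon>" if "s \<in> ?I" for s
    proof -
      have "r s \<in> F" "dist (r s) s < \<delta>" using r(2) F(3) that by blast+
      then show "r s \<in> F" "norm (H s - H (r s)) \<le> \<epsilon>"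
        using \<delta>(2)[of s "r s"] that F(1) by (auto simp: dist_norm norm_minus_commute)
    qed
    \<comment> \<open>The time cells on which the step function takes the value
      \<open>H c\<close>.\<close>
    define E where "E c = {s \<in> ?I. r s = c}" for c
    have E[measurable]: "E c \<in> sets borel" for c unfolding E_def by measurable
    define g where "g c s = indicator (E c) s *\<^sub>R L2_mult (\<psi> s) (H c)" for c s
    have sumE: "(\<Sum>c\<in>F. indicator (E c) s *\<^sub>R f c) = (if s \<in> ?I then f (r s) else 0)" for s and f :: "real \<Rightarrow> 'z::real_vector"
    proof (cases "s \<in> ?I")
      case True
      have "(\<Sum>c\<in>F. indicator (E c) s *\<^sub>R f c) = (\<Sum>c\<in>F. if c = r s then f c else 0)"
        using True by (intro sum.cong) (auto simp: E_def indicator_def)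
      then show ?thesis using True rF F(2) by simp
    qed (auto simp: E_def)
    have gm: "g c \<in> borel_measurable borel" for c
      unfolding g_def by (intro borel_measurable_scaleR borel_measurable_indicator E mult_m) measurable
    have gB: "g c \<in> bochner_space q ?I" if "c \<in> F" for c
    proof (rule bochner_space_bounded(1)[OF ab(2) q(2)])
      show "(\<lambda>t. indicator ?I t *\<^sub>R g c t) \<in> borel_measurable borel" using gm by measurable
      show "norm (g c t) \<le> K * norm (H c)" if "t \<in> ?I" for t
        using order_trans[OF norm_L2_mult_le mult_right_mono[OF K[OF that]], of "H c"] K0
        by (auto simp: g_def indicator_def)
    qed
    note gsum = cpairing_sum[OF F(2) gB]
    define G where "G t = (\<Sum>c\<in>F. g c t)" for t
    have G: "G \<in> bochner_space q ?I" "Mp_cpairing p ?I V G = (\<Sum>c\<in>F. Mp_cpairing p ?I V (g c))"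
      using gsum by (auto simp: G_def[abs_def])
    have Gm[measurable]: "G \<in> borel_measurable borel"
      unfolding G_def using gm by (intro borel_measurable_sum) auto
    have Gs: "G s = L2_mult (\<psi> s) (H (r s))" if "s \<in> ?I" for s
      unfolding G_def g_def sumE using that by simp
    have hm[measurable]: "h \<in> borel_measurable borel"
      unfolding h_def by (intro mult_m \<psi>m Hm)
    have hG: "(\<lambda>t. h t - G t) \<in> bochner_space q ?I" "bochner_norm q ?I (\<lambda>t. h t - G t) \<le> (K * \<epsilon>) * (b - a) powr (1 / q)"
    proof -
      have hG_le: "norm (h t - G t) \<le> K * \<epsilon>" if "t \<in> ?I" for t
      proof -
        have "h t - G t = L2_mult (\<psi> t) (H t - H (r t))"
          unfolding Gs[OF that] h_def by (rule bounded_bilinear.diff_right[OF bounded_bilinear_L2_mult, symmetric])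
        also have "norm \<dots> \<le> K * \<epsilon>"
          by (rule order_trans[OF norm_L2_mult_le mult_mono[OF K[OF that] rH[OF that] K0]]) simp
        finally show ?thesis .
      qed
      have hG_m: "(\<lambda>t. indicator ?I t *\<^sub>R (h t - G t)) \<in> borel_measurable borel" by measurable
      show "(\<lambda>t. h t - G t) \<in> bochner_space q ?I"
        by (rule bochner_space_bounded(1)[OF ab(2) q(2) hG_m hG_le])
      show "bochner_norm q ?I (\<lambda>t. h t - G t) \<le> (K * \<epsilon>) * (b - a) powr (1 / q)"
        by (rule bochner_space_bounded(2)[OF ab(2) q(2) hG_m hG_le])
    qed
    have step: "(\<integral>s. L2_pair (\<phi>' s) (if s \<in> ?I then H (r s) else 0) \<partial>lborel) = Mp_cpairing p ?I V G"
    proof -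
      have ind: "integrable lborel (\<lambda>s. indicator (E c) s *\<^sub>R \<phi> s)" for c
      proof (rule Bochner_Integration.integrable_bound[OF \<phi>i])
        have "(\<lambda>s. indicator (E c) s *\<^sub>R \<phi> s) = (\<lambda>s. indicator (E c) s *\<^sub>R \<phi>' s)"
          by (auto simp: \<phi>'_def E_def indicator_def fun_eq_iff)
        then show "(\<lambda>s. indicator (E c) s *\<^sub>R \<phi> s) \<in> borel_measurable lborel" by simp
      qed (auto simp: \<phi>'_def E_def indicator_def)
      have bl: "bounded_linear (\<lambda>w. L2_pair w (H c))" for c
        by (rule bounded_bilinear.bounded_linear_left[OF bounded_bilinear_L2_pair])
      \<comment> \<open>With a constant test function the identity on a cell is the defining
        property of the density for the Borel set \<open>E c\<close>; the integral is then pulled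
        through the bounded linear pairing with \<open>H c\<close>.\<close>
      have cell: "Mp_cpairing p ?I V (g c) = (\<integral>s. L2_pair (indicator (E c) s *\<^sub>R \<phi> s) (H c) \<partial>lborel)" for c
      proof -
        have "has_potential_integral p ?I V \<psi> (E c) (LINT s:E c|lborel. \<phi> s)"
        proof -
          have "E c \<subseteq> ?I" by (auto simp: E_def)
          then show ?thesis using \<phi> E[of c] unfolding potential_density_def by blast
        qed
        then have "L2_pair (LINT s:E c|lborel. \<phi> s) (H c) = Mp_cpairing p ?I V (g c)"
          unfolding has_potential_integral_def g_def[abs_def] L2_pair_def by blast
        then show ?thesis
          unfolding set_lebesgue_integral_def integral_bounded_linear[OF bl ind] by simp
      qed
      have "L2_pair (\<phi>' s) (if s \<in> ?I then H (r s) else 0) = (\<Sum>c\<in>F. L2_pair (indicator (E c) s *\<^sub>R \<phi> s) (H c))" for s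
      proof -
        have "(\<Sum>c\<in>F. L2_pair (indicator (E c) s *\<^sub>R \<phi> s) (H c)) = (\<Sum>c\<in>F. indicator (E c) s *\<^sub>R L2_pair (\<phi> s) (H c))"
          by (simp only: bounded_bilinear.scaleR_left[OF bounded_bilinear_L2_pair])
        then show ?thesis
          unfolding sumE by (auto simp: \<phi>'_def bounded_bilinear.zero_right[OF bounded_bilinear_L2_pair])
      qed
      then show ?thesis
        unfolding G(2) cell
        by (subst Bochner_Integration.integral_sum[symmetric]) (auto intro!: integrable_bounded_linear[OF bl ind])
    qed
    have Hr_m: "(\<lambda>s. if s \<in> ?I then H (r s) else 0) \<in> borel_measurable borel" by measurable
    have diffb: "norm (L2_pair (\<phi>' s) (H s) - L2_pair (\<phi>' s) (if s \<in> ?I then H (r s) else 0)) \<le> norm (\<phi>' s) * \<epsilon>" for s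
    proof (cases "s \<in> ?I")
      case True
      then show ?thesis
        unfolding bounded_bilinear.diff_right[OF bounded_bilinear_L2_pair, symmetric]
        by (intro order_trans[OF norm_L2_pair_le] mult_left_mono) (auto intro: rH)
    qed (simp add: \<phi>'_def bounded_bilinear.zero_left[OF bounded_bilinear_L2_pair])
    have int_pair: "integrable lborel (\<lambda>s. L2_pair (\<phi>' s) (f s))"
      if "f \<in> borel_measurable borel" "\<And>s. s \<in> ?I \<Longrightarrow> norm (f s) \<le> B" for f B
    proof (rule Bochner_Integration.integrable_bound)
      show "integrable lborel (\<lambda>s. B *\<^sub>R \<phi>' s)" using \<phi>i by simp
      show "(\<lambda>s. L2_pair (\<phi>' s) (f s)) \<in> borel_measurable lborel"
        using that(1) by (intro pair_m) auto
      show "AE s in lborel. norm (L2_pair (\<phi>' s) (f s)) \<le> norm (B *\<^sub>R \<phi>' s)"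
      proof (rule AE_I2)
        fix s
        show "norm (L2_pair (\<phi>' s) (f s)) \<le> norm (B *\<^sub>R \<phi>' s)"
        proof (cases "s \<in> ?I")
          case True
          have "norm (L2_pair (\<phi>' s) (f s)) \<le> norm (\<phi>' s) * B"
            by (rule order_trans[OF norm_L2_pair_le mult_left_mono[OF that(2)[OF True]]]) simp
          also have "\<dots> \<le> norm (\<phi>' s) * \<bar>B\<bar>" by (intro mult_left_mono) auto
          finally show ?thesis by (simp add: mult.commute)
        qed (simp add: \<phi>'_def bounded_bilinear.zero_left[OF bounded_bilinear_L2_pair])
      qed
    qed
    have i1: "integrable lborel (\<lambda>s. L2_pair (\<phi>' s) (H s))" by (rule int_pair[OF Hm K'])
    have i2: "integrable lborel (\<lambda>s. L2_pair (\<phi>' s) (if s \<in> ?I then H (r s) else 0))"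
    proof (rule int_pair[OF Hr_m, of K'])
      fix s assume s: "s \<in> ?I"
      then have "r s \<in> ?I" using rF F(1) by blast
      from K'[OF this] show "norm (if s \<in> ?I then H (r s) else 0) \<le> K'" using s by simp
    qed
    have "norm ((\<integral>s. L2_pair (\<phi>' s) (H s) \<partial>lborel) - Mp_cpairing p ?I V G)
        = norm (\<integral>s. L2_pair (\<phi>' s) (H s) - L2_pair (\<phi>' s) (if s \<in> ?I then H (r s) else 0) \<partial>lborel)"
      unfolding step[symmetric] using i1 i2 by simp
    also have "\<dots> \<le> (\<integral>s. norm (\<phi>' s) * \<epsilon> \<partial>lborel)"
      by (rule order_trans[OF integral_norm_bound integral_mono]) (use i1 i2 \<phi>i diffb in auto)
    finally have 1: "norm ((\<integral>s. L2_pair (\<phi>' s) (H s) \<partial>lborel) - Mp_cpairing p ?I V G) \<le> (\<integral>s. norm (\<phi>' s) \<partial>lborel) * \<epsilon>"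
      by simp
    have "Mp_cpairing p ?I V h - Mp_cpairing p ?I V G = Mp_cpairing p ?I V (\<lambda>t. h t - G t)"
      using cpairing_add[OF G(1) hG(1)] by simp
    also have "norm \<dots> \<le> 2 * N * ((K * \<epsilon>) * (b - a) powr (1 / q))"
      by (rule order_trans[OF cpairing_bound[OF hG(1)] mult_left_mono[OF hG(2)]]) (use N in simp)
    finally have 2: "norm (Mp_cpairing p ?I V h - Mp_cpairing p ?I V G) \<le> \<epsilon> * (2 * N * (K * (b - a) powr (1 / q)))"
      by (simp add: mult_ac)
    have "norm ((\<integral>s. L2_pair (\<phi>' s) (H s) \<partial>lborel) - Mp_cpairing p ?I V h)
        \<le> norm ((\<integral>s. L2_pair (\<phi>' s) (H s) \<partial>lborel) - Mp_cpairing p ?I V G) + norm (Mp_cpairing p ?I V h - Mp_cpairing p ?I V G)"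
      using norm_triangle_ineq4[of "(\<integral>s. L2_pair (\<phi>' s) (H s) \<partial>lborel) - Mp_cpairing p ?I V G" "Mp_cpairing p ?I V h - Mp_cpairing p ?I V G"] by simp
    also have "\<dots> \<le> \<epsilon> * Q" using 1 2 by (simp add: Q_def distrib_left mult.commute)
    finally show ?thesis .
  qed
  have "norm ((\<integral>s. L2_pair (\<phi>' s) (H s) \<partial>lborel) - Mp_cpairing p ?I V h) \<le> 0"
  proof (rule field_le_epsilon)
    fix e :: real assume "0 < e"
    then have "norm ((\<integral>s. L2_pair (\<phi>' s) (H s) \<partial>lborel) - Mp_cpairing p ?I V h) \<le> e / (Q + 1) * Q"
      using Q0 by (intro close) auto
    also have "\<dots> \<le> 0 + e" using Q0 \<open>0 < e\<close> by (simp add: field_simps)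
    finally show "norm ((\<integral>s. L2_pair (\<phi>' s) (H s) \<partial>lborel) - Mp_cpairing p ?I V h) \<le> 0 + e" .
  qed
  then show "(\<integral>s. L2_pair (indicator ?I s *\<^sub>R \<phi> s) (H s) \<partial>lborel) = Mp_cpairing p ?I V (\<lambda>s. L2_mult (\<psi> s) (H s))"
    by (simp add: \<phi>'_def h_def[abs_def])
qed

end

end

subsection \<open>The Duhamel integral\<close>

lemma interval_integral_from_0:
  fixes f :: "real \<Rightarrow> 'b::{banach, second_countable_topology}"
  shows "(LBINT s=0..t. f s) = (if 0 \<le> t then 1 else - 1) *\<^sub>R (LINT s:{min 0 t..max 0 t}|lborel. f s)"
proof (cases "0 \<le> t")
  case True
  then have "(LBINT s=0..t. f s) = (LINT s:{0..t}|lborel. f s)"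
    using interval_integral_Icc[of 0 t f] by (simp add: zero_ereal_def)
  with True show ?thesis by (simp add: min_def max_def)
next
  case False
  then have "(LBINT s=0..t. f s) = - (LINT s:{t..0}|lborel. f s)"
    using interval_integral_Icc[of t 0 f] interval_integral_endpoints_reverse[of 0 t f] by (simp add: zero_ereal_def)
  with False show ?thesis by (simp add: min_def max_def)
qed

text \<open>\<open>free_schroedinger t\<close> without its inner Fourier transform: the free
  evolution of data given on the frequency side. The Duhamel integral is brought into the form
  \<open>flow t w\<close>, with w on the frequency side.\<close>

definition flow :: "real \<Rightarrow> ('a::euclidean_space, complex, 2) Lp \<Rightarrow> ('a, complex, 2) Lp" where
  "flow t w = L2_fourier 1 (L2_phase (- t) w)"

lemma bounded_linear_flow: "bounded_linear (flow t)"
  unfolding flow_def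
  by (rule bounded_linear_compose[OF bounded_linear_L2_fourier bounded_linear_L2_phase]) simp

lemma norm_flow_le: "norm (flow t w) \<le> norm w"
  unfolding flow_def by (rule order_trans[OF norm_L2_fourier_le norm_L2_phase_le]) simp

lemma flow_cmult: "flow t (Lp_cmult c w) = Lp_cmult c (flow t w)"
proof -
  have "L2_phase (- t) (Lp_cmult c w) = Lp_cmult c (L2_phase (- t) w)"
    using Lp_rep_phase[of "- t" "Lp_cmult c w"] Lp_rep_phase[of "- t" w] Lp_rep_cmult[of c w] Lp_rep_cmult[of c "L2_phase (- t) w"]
    by (intro Lp_eqI, eventually_elim) simp
  then show ?thesis by (simp add: flow_def L2_fourier_cmult)
qed

lemma continuous_flow: "continuous_on UNIV (\<lambda>z. flow (fst z) (snd z))"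
proof -
  have "continuous_on UNIV (\<lambda>z. L2_phase (fst (- fst z, snd z)) (snd (- fst z, snd z)))"
    by (rule continuous_on_compose2[OF continuous_L2_phase, of UNIV "\<lambda>z. (- fst z, snd z)"])
      (auto intro!: continuous_intros)
  then have "continuous_on UNIV (\<lambda>z. L2_phase (- fst z) (snd z))" by simp
  then show ?thesis
    unfolding flow_def by (intro bounded_linear.continuous_on[OF bounded_linear_L2_fourier]) auto
qed

text \<open>The phase at s - t is the product of the phases at -t and s, so \<open>flow t\<close>
  factors out of the Duhamel integral and leaves w, the integral of the phase at s applied to the
  transform of the density. Transposing both operators onto h puts \<open>adj_flow h s\<close> next
  to the density, and \<open>potential_density_pairing\<close> replaces the density by the pairing
  with V.\<close>

lemma (in Mp_bounded) duhamel_representation: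
  assumes sol: "schroedinger_solution p psi0 V \<psi>" and t: "t \<in> {- T..T}"
  shows "\<exists>w. \<psi> t = flow t (L2_fourier (- 1) psi0 - Lp_cmult \<i> w) \<and>
    (\<forall>h. norm (L2_pair w h) \<le> 2 * N * bochner_norm q {min 0 t..max 0 t} (\<lambda>s. L2_mult (\<psi> s) (adj_flow h s)))"
proof -
  let ?I = "{min 0 t..max 0 t}"
  have I: "- T \<le> min 0 t" "min 0 t \<le> max 0 t" "max 0 t \<le> T" using t by auto
  have \<psi>: "continuous_on UNIV \<psi>" using sol by (simp add: schroedinger_solution_def)
  obtain \<phi> where \<phi>: "potential_density p ?I V \<psi> \<phi>"
    and \<psi>t: "\<psi> t = free_schroedinger t psi0 - Lp_cmult \<i> (LBINT s=0..t. free_schroedinger (t - s) (\<phi> s))"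
    using sol by (auto simp: schroedinger_solution_def has_duhamel_integral_def)
  define \<phi>' where "\<phi>' s = indicator ?I s *\<^sub>R \<phi> s" for s
  have \<phi>i: "integrable lborel \<phi>'"
    using potential_density_pairing(1)[OF I \<psi> continuous_on_const \<phi>] by (simp add: \<phi>'_def[abs_def])
  then have \<phi>m: "\<phi>' \<in> borel_measurable borel" using borel_measurable_integrable by fastforce
  define g where "g s = L2_phase s (L2_fourier (- 1) (\<phi>' s))" for s
  have bF: "bounded_linear (L2_fourier (- 1))" by (rule bounded_linear_L2_fourier) simp
  have gm: "g \<in> borel_measurable borel"
    unfolding g_def
    by (rule borel_measurable_continuous_Pair[where f = "\<lambda>s. s" and H = L2_phase])
      (auto intro: continuous_L2_phase borel_measurable_continuous_on[OF linear_continuous_on[OF bF] \<phi>m])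
  have gi: "integrable lborel g"
  proof (rule Bochner_Integration.integrable_bound[OF \<phi>i])
    show "AE s in lborel. norm (g s) \<le> norm (\<phi>' s)"
      unfolding g_def by (intro AE_I2 order_trans[OF norm_L2_phase_le norm_L2_fourier_le]) simp
  qed (use gm in simp)
  define \<sigma> :: real where "\<sigma> = (if 0 \<le> t then 1 else - 1)"
  have \<sigma>: "\<bar>\<sigma>\<bar> = 1" by (auto simp: \<sigma>_def)
  define w where "w = \<sigma> *\<^sub>R (\<integral>s. g s \<partial>lborel)"
  have "indicator ?I s *\<^sub>R free_schroedinger (t - s) (\<phi> s) = flow t (g s)" for s
  proof -
    have "free_schroedinger (t - s) (\<phi> s) = flow t (L2_phase s (L2_fourier (- 1) (\<phi> s)))"
      by (simp add: free_schroedinger_eq flow_def L2_phase_add)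
    then show ?thesis
      by (auto simp: g_def \<phi>'_def linear_simps[OF bF] linear_simps[OF bounded_linear_L2_phase] linear_simps[OF bounded_linear_flow]
          indicator_def)
  qed
  then have "(LBINT s=0..t. free_schroedinger (t - s) (\<phi> s)) = flow t w"
    unfolding interval_integral_from_0 set_lebesgue_integral_def w_def \<sigma>_def
    by (simp add: integral_bounded_linear[OF bounded_linear_flow gi] linear_simps[OF bounded_linear_flow])
  then have "\<psi> t = flow t (L2_fourier (- 1) psi0 - Lp_cmult \<i> w)"
    unfolding \<psi>t by (simp add: free_schroedinger_eq flow_cmult linear_simps[OF bounded_linear_flow] flip: flow_def)
  moreover have "norm (L2_pair w h) \<le> 2 * N * bochner_norm q ?I (\<lambda>s. L2_mult (\<psi> s) (adj_flow h s))" for h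
  proof -
    note cG = continuous_adj_flow[of h]
    have bl: "bounded_linear (\<lambda>w. L2_pair w h)"
      by (rule bounded_bilinear.bounded_linear_left[OF bounded_bilinear_L2_pair])
    have pg: "L2_pair (g s) h = L2_pair (\<phi>' s) (adj_flow h s)" for s
    proof -
      have "L2_pair (g s) h = L2_pair (L2_fourier (- 1) (\<phi>' s)) (L2_phase s h)"
        unfolding g_def L2_phase_def by (rule L2_pair_mul[of _ 1]) auto
      also have "\<dots> = L2_pair (\<phi>' s) (adj_flow h s)"
        unfolding adj_flow_def by (rule L2_pair_fourier) simp
      finally show ?thesis .
    qed
    have "L2_pair w h = \<sigma> *\<^sub>R L2_pair (\<integral>s. g s \<partial>lborel) h"
      unfolding w_def by (rule bounded_bilinear.scaleR_left[OF bounded_bilinear_L2_pair])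
    also have "L2_pair (\<integral>s. g s \<partial>lborel) h = (\<integral>s. L2_pair (g s) h \<partial>lborel)"
      by (rule integral_bounded_linear[OF bl gi, symmetric])
    also have "\<sigma> *\<^sub>R \<dots> = \<sigma> *\<^sub>R Mp_cpairing p ?I V (\<lambda>s. L2_mult (\<psi> s) (adj_flow h s))"
      using potential_density_pairing(2)[OF I \<psi> cG \<phi>] by (simp add: pg \<phi>'_def)
    finally have "norm (L2_pair w h) = norm (Mp_cpairing p ?I V (\<lambda>s. L2_mult (\<psi> s) (adj_flow h s)))"
      using \<sigma> by simp
    also have "\<dots> \<le> 2 * N * bochner_norm q ?I (\<lambda>s. L2_mult (\<psi> s) (adj_flow h s))"
    proof (rule cpairing_bound[OF I])
      have c: "continuous_on UNIV (\<lambda>s. L2_mult (\<psi> s) (adj_flow h s))"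
        by (intro bounded_bilinear.continuous_on[OF bounded_bilinear_L2_mult] \<psi> cG)
      obtain B where B: "\<And>s. s \<in> ?I \<Longrightarrow> norm (L2_mult (\<psi> s) (adj_flow h s)) \<le> B"
        by (rule continuous_bounded_Icc[OF c]) (rule that)
      have "(\<lambda>s. indicator ?I s *\<^sub>R L2_mult (\<psi> s) (adj_flow h s)) \<in> borel_measurable borel"
        using borel_measurable_continuous_onI[OF c] by measurable
      then show "(\<lambda>s. L2_mult (\<psi> s) (adj_flow h s)) \<in> bochner_space q ?I"
        using B by (rule bochner_space_bounded(1)[OF I(2) q(2)])
    qed
    finally show ?thesis .
  qed
  ultimately show ?thesis by blast
qed

text \<open>The factor 1 / \<mu> is the gain from the exponential weight: integrating the weight up
  to t reproduces it at t, with a constant that is small for large \<mu>.\<close>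

lemma exp_abs_integral:
  fixes t \<mu> :: real
  assumes \<mu>: "0 < \<mu>"
  shows "integrable lborel (\<lambda>s. indicator {min 0 t..max 0 t} s * exp (\<mu> * \<bar>s\<bar>))"
    and "(\<integral>s. indicator {min 0 t..max 0 t} s * exp (\<mu> * \<bar>s\<bar>) \<partial>lborel) \<le> exp (\<mu> * \<bar>t\<bar>) / \<mu>"
proof -
  have "integrable lborel (\<lambda>s. indicator {min 0 t..max 0 t} s * exp (\<mu> * \<bar>s\<bar>)) \<and>
    (\<integral>s. indicator {min 0 t..max 0 t} s * exp (\<mu> * \<bar>s\<bar>) \<partial>lborel) = (exp (\<mu> * \<bar>t\<bar>) - 1) / \<mu>"
  proof (cases "0 \<le> t")
    case True
    have eq: "(\<lambda>s. indicator {min 0 t..max 0 t} s * exp (\<mu> * \<bar>s\<bar>)) = (\<lambda>s. exp (\<mu> * s) * indicator {0..t} s)"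
    proof -
      have "min 0 t = 0" "max 0 t = t" using True by (simp_all add: min_def max_def)
      then show ?thesis by (auto simp: indicator_def fun_eq_iff)
    qed
    have D: "\<And>s. ((\<lambda>s. exp (\<mu> * s) / \<mu>) has_real_derivative exp (\<mu> * s)) (at s)"
      using \<mu> by (auto intro!: derivative_eq_intros)
    show ?thesis
      unfolding eq using integral_FTC_Icc_nonneg[OF _ D _ True] integrable_FTC_Icc_nonneg[OF _ D _ True] True \<mu>
      by (simp add: diff_divide_distrib)
  next
    case False
    have eq: "(\<lambda>s. indicator {min 0 t..max 0 t} s * exp (\<mu> * \<bar>s\<bar>)) = (\<lambda>s. exp (- \<mu> * s) * indicator {t..0} s)"
    proof -
      have "min 0 t = t" "max 0 t = 0" using False by (simp_all add: min_def max_def)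
      then show ?thesis by (auto simp: indicator_def fun_eq_iff)
    qed
    have D: "\<And>s. ((\<lambda>s. - exp (- \<mu> * s) / \<mu>) has_real_derivative exp (- \<mu> * s)) (at s)"
      using \<mu> by (auto intro!: derivative_eq_intros)
    have t: "t \<le> 0" using False by simp
    show ?thesis
      unfolding eq using integral_FTC_Icc_nonneg[OF _ D _ t] integrable_FTC_Icc_nonneg[OF _ D _ t] False \<mu>
      by (simp add: diff_divide_distrib)
  qed
  moreover have "(exp (\<mu> * \<bar>t\<bar>) - 1) / \<mu> \<le> exp (\<mu> * \<bar>t\<bar>) / \<mu>" using \<mu> by (simp add: divide_right_mono)
  ultimately show "integrable lborel (\<lambda>s. indicator {min 0 t..max 0 t} s * exp (\<mu> * \<bar>s\<bar>))"
    "(\<integral>s. indicator {min 0 t..max 0 t} s * exp (\<mu> * \<bar>s\<bar>) \<partial>lborel) \<le> exp (\<mu> * \<bar>t\<bar>) / \<mu>" by auto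
qed

text \<open>Converts mean-square smallness of b into a bound for the q-th power of a. Where a
  exceeds x, it is less than 2 b and lies in [x0, N], so a^q = a^(q-2) a^2 with a^(q-2) bounded: by
  N^N if q is at least 2, and by 1 or 1 / x0 otherwise.\<close>

lemma powr_split_bound:
  fixes a b x N q :: real
  assumes "0 < x0" "x0 \<le> x" "0 \<le> a" "a \<le> N" "1 \<le> N" "1 < q" "q \<le> N" "a \<le> x / 2 + b"
  shows "a powr q \<le> x powr q + 4 * (N powr N + 1 + 1 / x0) * b\<^sup>2"
proof (cases "a \<le> x")
  case True
  then have "a powr q \<le> x powr q" using assms by (intro powr_mono2) auto
  moreover have "0 \<le> 4 * (N powr N + 1 + 1 / x0) * b\<^sup>2"
    using assms by (intro mult_nonneg_nonneg add_nonneg_nonneg) auto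
  ultimately show ?thesis by simp
next
  case False
  \<comment> \<open>From x < a and a \<le> x / 2 + b it follows that a < a / 2 + b.\<close>
  then have a: "0 < a" "x0 \<le> a" and "a < 2 * b" using assms by auto
  then have a2: "a\<^sup>2 \<le> (2 * b)\<^sup>2" by (intro power_mono) auto
  have "a powr (q - 2) \<le> N powr N + 1 + 1 / x0"
  proof (cases "2 \<le> q")
    case True
    have "a powr (q - 2) \<le> N powr (q - 2)" using True assms by (intro powr_mono2) auto
    also have "\<dots> \<le> N powr N" using assms by (intro powr_mono) auto
    also have "\<dots> \<le> N powr N + 1 + 1 / x0" using assms by simp
    finally show ?thesis .
  next
    case False
    show ?thesis
    proof (cases "1 \<le> a")
      case True
      have "a powr (q - 2) \<le> a powr 0" using True False by (intro powr_mono) auto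
      then show ?thesis using a assms by (simp add: add_increasing2 add_increasing)
    next
      case na: False
      have "a powr (q - 2) \<le> a powr (- 1)" using na False a assms by (intro powr_mono') auto
      also have "\<dots> = 1 / a" using a by (simp add: powr_minus_divide)
      also have "\<dots> \<le> 1 / x0" using a assms by (intro divide_left_mono) auto
      also have "\<dots> \<le> N powr N + 1 + 1 / x0" by simp
      finally show ?thesis .
    qed
  qed
  moreover have "a powr q = a powr (q - 2) * a\<^sup>2"
  proof -
    have "a powr q = a powr (q - 2) * a powr 2" by (simp flip: powr_add)
    then show ?thesis using a by (simp add: powr_numeral)
  qed
  ultimately have "a powr q \<le> (N powr N + 1 + 1 / x0) * (2 * b)\<^sup>2"
    using a2 assms by (auto intro!: mult_mono add_nonneg_nonneg)
  also have "\<dots> = 4 * (N powr N + 1 + 1 / x0) * b\<^sup>2" by (simp add: power_mult_distrib)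
  finally show ?thesis using powr_ge_zero[of x q] by linarith
qed

text \<open>\<open>powr_split_bound\<close> is applied with x = 4 \<epsilon> exp(\<mu> |s|). Half of
  x covers both the distance of the solution to the net and the \<epsilon> from local smoothing. The
  integral of x^q and the contribution of b are each at most (4 \<epsilon> exp(\<mu> |t|))^q /
  \<mu>, which explains the factor 2 / \<mu>.\<close>

lemma (in Mp_bounded) orbit_product_bound:
  fixes C :: "('a, complex, 2) Lp set"
  assumes \<psi>: "continuous_on UNIV \<psi>" and \<psi>N: "\<And>s. s \<in> {- T..T} \<Longrightarrow> norm (\<psi> s) \<le> N"
    and N1: "1 \<le> N" and qN: "q \<le> N" and t: "t \<in> {- T..T}" and h: "norm h = 1" and \<epsilon>: "0 < \<epsilon>" and \<mu>: "0 < \<mu>"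
    and net: "\<And>s. s \<in> {- T..T} \<Longrightarrow> \<exists>c\<in>C. norm (\<psi> s - c) \<le> \<epsilon> * exp (\<mu> * \<bar>s\<bar>)"
    and b: "b \<in> borel_measurable borel" "\<And>s. 0 \<le> b s"
      "\<And>s c. \<bar>s\<bar> \<le> T \<Longrightarrow> c \<in> C \<Longrightarrow> norm (L2_mult c (adj_flow h s)) \<le> \<epsilon> + b s"
      "(\<integral>\<^sup>+s. ennreal (indicator {- T..T} s * (b s)\<^sup>2) \<partial>lborel) \<le> ennreal \<epsilon>'"
    and \<epsilon>': "0 < \<epsilon>'" "4 * (N powr N + 1 + 1 / (4 * \<epsilon>)) * \<epsilon>' \<le> min (4 * \<epsilon>) ((4 * \<epsilon>) powr N) / \<mu>"
  shows "bochner_norm q {min 0 t..max 0 t} (\<lambda>s. L2_mult (\<psi> s) (adj_flow h s))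
    \<le> 4 * \<epsilon> * exp (\<mu> * \<bar>t\<bar>) * (2 / \<mu>) powr (1 / q)"
proof -
  let ?I = "{min 0 t..max 0 t}"
  have sub: "?I \<subseteq> {- T..T}" using t by auto
  define a where "a s = norm (L2_mult (\<psi> s) (adj_flow h s))" for s
  define D where "D = 4 * (N powr N + 1 + 1 / (4 * \<epsilon>))"
  have D: "0 \<le> D" using N1 \<epsilon> by (auto simp: D_def intro!: add_nonneg_nonneg)
  have "continuous_on UNIV a"
    unfolding a_def by (intro continuous_on_norm bounded_bilinear.continuous_on[OF bounded_bilinear_L2_mult] \<psi> continuous_adj_flow)
  then have am[measurable]: "a \<in> borel_measurable borel" by (rule borel_measurable_continuous_onI)
  note [measurable] = b(1)
  have bi: "integrable lborel (\<lambda>s. indicator {- T..T} s * (b s)\<^sup>2)"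
    using b(4) by (intro integrableI_bounded) (auto intro: le_less_trans simp: abs_mult)
  have bI: "(\<integral>s. indicator {- T..T} s * (b s)\<^sup>2 \<partial>lborel) \<le> \<epsilon>'"
    using b(4) \<epsilon>'(1) by (subst (asm) nn_integral_eq_integral[OF bi]) (auto simp: ennreal_le_iff)
  have aN: "a s \<le> N" if "s \<in> {- T..T}" for s
  proof -
    have "a s \<le> norm (\<psi> s) * norm (adj_flow h s)" unfolding a_def by (rule norm_L2_mult_le)
    also have "\<dots> \<le> N * norm h" by (intro mult_mono \<psi>N[OF that] norm_adj_flow_le N) simp
    finally show ?thesis by (simp add: h)
  qed
  have ab: "a s \<le> (4 * \<epsilon> * exp (\<mu> * \<bar>s\<bar>)) / 2 + b s" if s: "s \<in> {- T..T}" for s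
  proof -
    let ?G = "adj_flow h s"
    obtain c where c: "c \<in> C" "norm (\<psi> s - c) \<le> \<epsilon> * exp (\<mu> * \<bar>s\<bar>)" using net[OF s] by blast
    have "L2_mult (\<psi> s) ?G = L2_mult (\<psi> s - c) ?G + L2_mult c ?G"
      by (simp flip: bounded_bilinear.add_left[OF bounded_bilinear_L2_mult])
    then have "a s \<le> norm (L2_mult (\<psi> s - c) ?G) + norm (L2_mult c ?G)"
      by (simp add: a_def norm_triangle_ineq)
    also have "norm (L2_mult (\<psi> s - c) ?G) \<le> \<epsilon> * exp (\<mu> * \<bar>s\<bar>) * 1"
      by (rule order_trans[OF norm_L2_mult_le mult_mono[OF c(2)]]) (use \<epsilon> h norm_adj_flow_le[of h s] in auto)
    also have "norm (L2_mult c ?G) \<le> \<epsilon> + b s" by (rule b(3)[OF _ c(1)]) (use s in auto)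
    finally have "a s \<le> \<epsilon> * exp (\<mu> * \<bar>s\<bar>) + \<epsilon> + b s" by simp
    moreover have "\<epsilon> \<le> \<epsilon> * exp (\<mu> * \<bar>s\<bar>)" using \<epsilon> \<mu> by simp
    ultimately show ?thesis by simp
  qed
  have x_powr: "(4 * \<epsilon> * exp (\<mu> * \<bar>s\<bar>)) powr q = (4 * \<epsilon>) powr q * exp (\<mu> * q * \<bar>s\<bar>)" for s
    using \<epsilon> by (simp add: powr_mult exp_powr_real mult_ac)
  have point: "indicator ?I s * a s powr q
      \<le> (4 * \<epsilon>) powr q * (indicator ?I s * exp (\<mu> * q * \<bar>s\<bar>)) + D * (indicator {- T..T} s * (b s)\<^sup>2)" for s
  proof (cases "s \<in> ?I")
    case True
    then have s: "s \<in> {- T..T}" using sub by blast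
    have "a s powr q \<le> (4 * \<epsilon> * exp (\<mu> * \<bar>s\<bar>)) powr q + 4 * (N powr N + 1 + 1 / (4 * \<epsilon>)) * (b s)\<^sup>2"
      using \<epsilon> \<mu> aN[OF s] ab[OF s] N1 q qN by (intro powr_split_bound) (auto simp: a_def)
    then show ?thesis using True s unfolding x_powr D_def by simp
  qed (use D in auto)
  have \<mu>q: "0 < \<mu> * q" using \<mu> q by simp
  note e = exp_abs_integral[OF \<mu>q, of t]
  have "(\<integral>s. indicator ?I s * a s powr q \<partial>lborel)
      \<le> (\<integral>s. (4 * \<epsilon>) powr q * (indicator ?I s * exp (\<mu> * q * \<bar>s\<bar>)) + D * (indicator {- T..T} s * (b s)\<^sup>2) \<partial>lborel)"
  proof (rule integral_mono[OF _ _ point])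
    show int: "integrable lborel (\<lambda>s. (4 * \<epsilon>) powr q * (indicator ?I s * exp (\<mu> * q * \<bar>s\<bar>)) + D * (indicator {- T..T} s * (b s)\<^sup>2))"
      by (intro Bochner_Integration.integrable_add integrable_mult_right e(1) bi)
    show "integrable lborel (\<lambda>s. indicator ?I s * a s powr q)"
    proof (rule Bochner_Integration.integrable_bound[OF int])
      show "(\<lambda>s. indicator ?I s * a s powr q) \<in> borel_measurable lborel" by measurable
      show "AE s in lborel. norm (indicator ?I s * a s powr q)
        \<le> norm ((4 * \<epsilon>) powr q * (indicator ?I s * exp (\<mu> * q * \<bar>s\<bar>)) + D * (indicator {- T..T} s * (b s)\<^sup>2))"
      proof (rule AE_I2)
        fix s
        have "norm (indicator ?I s * a s powr q) = indicator ?I s * a s powr q" by (simp add: abs_mult)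
        also note point[of s]
        finally show "norm (indicator ?I s * a s powr q)
          \<le> norm ((4 * \<epsilon>) powr q * (indicator ?I s * exp (\<mu> * q * \<bar>s\<bar>)) + D * (indicator {- T..T} s * (b s)\<^sup>2))"
          by (rule order_trans) simp
      qed
    qed
  qed
  also have "\<dots> = (4 * \<epsilon>) powr q * (\<integral>s. indicator ?I s * exp (\<mu> * q * \<bar>s\<bar>) \<partial>lborel) + D * (\<integral>s. indicator {- T..T} s * (b s)\<^sup>2 \<partial>lborel)"
    using e(1) bi by (subst Bochner_Integration.integral_add) auto
  also have "\<dots> \<le> (4 * \<epsilon>) powr q * (exp (\<mu> * q * \<bar>t\<bar>) / (\<mu> * q)) + D * \<epsilon>'"
    by (intro add_mono mult_left_mono e(2) bI D) auto
  also have "\<dots> \<le> (4 * \<epsilon>) powr q * exp (\<mu> * q * \<bar>t\<bar>) / \<mu> + (4 * \<epsilon>) powr q * exp (\<mu> * q * \<bar>t\<bar>) / \<mu>"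
  proof (rule add_mono)
    have "exp (\<mu> * q * \<bar>t\<bar>) / (\<mu> * q) \<le> exp (\<mu> * q * \<bar>t\<bar>) / \<mu>"
      using \<mu> q by (intro divide_left_mono) auto
    then show "(4 * \<epsilon>) powr q * (exp (\<mu> * q * \<bar>t\<bar>) / (\<mu> * q)) \<le> (4 * \<epsilon>) powr q * exp (\<mu> * q * \<bar>t\<bar>) / \<mu>"
      using mult_left_mono[of "exp (\<mu> * q * \<bar>t\<bar>) / (\<mu> * q)" "exp (\<mu> * q * \<bar>t\<bar>) / \<mu>" "(4 * \<epsilon>) powr q"] by simp
    \<comment> \<open>A lower bound for (4 \<epsilon>)^q that is valid for all q in [1, N], so that
      \<open>\<epsilon>'\<close> can be fixed before the potential and its exponent are
      known.\<close>
    have "min (4 * \<epsilon>) ((4 * \<epsilon>) powr N) \<le> (4 * \<epsilon>) powr q"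
    proof (cases "1 \<le> 4 * \<epsilon>")
      case True
      then have "(4 * \<epsilon>) powr 1 \<le> (4 * \<epsilon>) powr q" using q by (intro powr_mono) auto
      then show ?thesis using \<epsilon> by simp
    next
      case False
      then have "(4 * \<epsilon>) powr N \<le> (4 * \<epsilon>) powr q" using \<epsilon> qN by (intro powr_mono') auto
      then show ?thesis by simp
    qed
    also have "\<dots> \<le> (4 * \<epsilon>) powr q * exp (\<mu> * q * \<bar>t\<bar>)"
      using mult_left_mono[of 1 "exp (\<mu> * q * \<bar>t\<bar>)" "(4 * \<epsilon>) powr q"] \<mu>q by simp
    finally have "min (4 * \<epsilon>) ((4 * \<epsilon>) powr N) / \<mu> \<le> (4 * \<epsilon>) powr q * exp (\<mu> * q * \<bar>t\<bar>) / \<mu>"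
      using \<mu> by (intro divide_right_mono) auto
    then show "D * \<epsilon>' \<le> (4 * \<epsilon>) powr q * exp (\<mu> * q * \<bar>t\<bar>) / \<mu>"
      using \<epsilon>'(2) by (simp add: D_def)
  qed
  also have "\<dots> = (4 * \<epsilon> * exp (\<mu> * \<bar>t\<bar>)) powr q * (2 / \<mu>)"
    unfolding x_powr by simp
  finally have "(\<integral>s. indicator ?I s * a s powr q \<partial>lborel) powr (1 / q) \<le> ((4 * \<epsilon> * exp (\<mu> * \<bar>t\<bar>)) powr q * (2 / \<mu>)) powr (1 / q)"
    using q by (intro powr_mono2) (auto intro!: integral_nonneg_AE)
  also have "\<dots> = 4 * \<epsilon> * exp (\<mu> * \<bar>t\<bar>) * (2 / \<mu>) powr (1 / q)"
    using \<epsilon> \<mu> q by (subst powr_mult) (auto simp: powr_powr)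
  finally show ?thesis
    by (subst bochner_norm_eq) (auto simp: a_def)
qed

subsection \<open>Relative compactness of bounded families of solutions\<close>

definition L2_ind :: "'a set \<Rightarrow> ('a::euclidean_space, complex, 2) Lp" where
  "L2_ind A = Lp_class (\<lambda>x. indicator A x *\<^sub>R 1)"

lemma
  assumes "A \<in> sets borel" "emeasure lborel A < \<infinity>"
  shows Lp_rep_ind: "AE x in lborel. Lp_rep (L2_ind A) x = indicator A x"
    and L2_pair_ind: "L2_pair (L2_ind A) h = (\<integral>x. indicator A x * Lp_rep h x \<partial>lborel)"
    and norm_L2_ind: "(norm (L2_ind A))\<^sup>2 = measure lborel A"
proof -
  have "(\<lambda>x. indicator A x *\<^sub>R (1::complex)) \<in> lp_space CARD(2)"
    using assms by (intro lp_space_indicator) auto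
  then have "AE x in lborel. Lp_rep (L2_ind A) x = indicator A x *\<^sub>R 1"
    unfolding L2_ind_def by (rule Lp_rep_class)
  then show ae: "AE x in lborel. Lp_rep (L2_ind A) x = indicator A x"
    by eventually_elim (auto simp: indicator_def)
  have [measurable]: "(indicator A :: 'a \<Rightarrow> complex) \<in> borel_measurable borel"
    using assms(1) by (rule borel_measurable_indicator)
  show "L2_pair (L2_ind A) h = (\<integral>x. indicator A x * Lp_rep h x \<partial>lborel)"
    using ae by (intro L2_pair_eq_AE) (auto elim!: eventually_mono)
  have "(norm (L2_ind A))\<^sup>2 = (\<integral>x. indicator A x \<partial>lborel)"
    unfolding norm_L2_eq(1) using ae assms(1)
    by (intro integral_cong_AE) (auto elim!: eventually_mono simp: indicator_def)
  then show "(norm (L2_ind A))\<^sup>2 = measure lborel A" using assms by simp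
qed

lemma L2_ind_cases:
  assumes "A \<in> sets borel" "A \<subseteq> cball 0 (real R)"
  shows "emeasure lborel A < \<infinity>" "R \<le> n \<Longrightarrow> L2_trunc n (L2_ind A) = L2_ind A"
proof -
  show fin: "emeasure lborel A < \<infinity>"
    by (rule emeasure_bounded_finite[OF bounded_subset[OF bounded_cball assms(2)]])
  assume "R \<le> n"
  then have sub: "A \<subseteq> cball 0 (real n)" using assms(2) by (meson of_nat_mono order_trans subset_cball)
  show "L2_trunc n (L2_ind A) = L2_ind A"
    using Lp_rep_trunc[of n "L2_ind A"] Lp_rep_ind[OF assms(1) fin]
    by (intro Lp_eqI, eventually_elim) (use sub in \<open>auto simp: indicator_def\<close>)
qed

text \<open>The indicators of disjoint cells are orthogonal, and v = w minus its projection is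
  orthogonal to all of them. Testing w against the conjugate of v gives |v|^2, which the assumed
  bound limits to \<beta> |v|. The bound is available for h of bounded support and is extended by
  truncation.\<close>

lemma L2_projection_bound:
  fixes w :: "('a::euclidean_space, complex, 2) Lp"
  assumes fin: "finite \<A>" and \<A>: "\<A> \<subseteq> sets borel" "disjoint \<A>" "\<And>A. A \<in> \<A> \<Longrightarrow> A \<subseteq> cball 0 (real R)"
    and bound: "\<And>h k. L2_trunc k h = h \<Longrightarrow> (\<And>A. A \<in> \<A> \<Longrightarrow> L2_pair (L2_ind A) h = 0) \<Longrightarrow> norm (L2_pair w h) \<le> \<beta> * norm h"
    and \<beta>: "0 \<le> \<beta>"
  defines "c \<equiv> \<lambda>A. L2_pair (L2_ind A) w / measure lborel A"
  shows "norm (w - (\<Sum>A\<in>\<A>. Lp_cmult (c A) (L2_ind A))) \<le> \<beta>"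
proof -
  note bil = bounded_bilinear_L2_pair
  have A: "A \<in> sets borel" "emeasure lborel A < \<infinity>" if "A \<in> \<A>" for A
    using \<A> that L2_ind_cases(1)[of A R] by auto
  define P where "P = (\<Sum>A\<in>\<A>. Lp_cmult (c A) (L2_ind A))"
  define v where "v = w - P"
  have ortho: "L2_pair (L2_ind A) (L2_ind B) = (if A = B then measure lborel A else 0)" if "A \<in> \<A>" "B \<in> \<A>" for A B
  proof -
    have mA: "(indicator A :: 'a \<Rightarrow> complex) \<in> borel_measurable borel" "(indicator B :: 'a \<Rightarrow> complex) \<in> borel_measurable borel"
      using A(1) that by (auto intro: borel_measurable_indicator)
    have "L2_pair (L2_ind A) (L2_ind B) = (\<integral>x. complex_of_real (indicator (A \<inter> B) x) \<partial>lborel)"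
      using Lp_rep_ind[OF A[OF that(1)]] Lp_rep_ind[OF A[OF that(2)]] A(1) that
      by (intro L2_pair_eq_AE) (auto elim!: eventually_elim2 simp: indicator_def)
    also have "\<dots> = complex_of_real (measure lborel (A \<inter> B))"
      by (subst integral_complex_of_real) (use A that in simp)
    finally show ?thesis
      using \<A>(2) that by (auto simp: disjoint_def)
  qed
  have z: "L2_pair (L2_ind A) v = 0" if "A \<in> \<A>" for A
  proof -
    have "L2_pair (L2_ind A) P = (\<Sum>B\<in>\<A>. c B * L2_pair (L2_ind A) (L2_ind B))"
      unfolding P_def bounded_bilinear.sum_right[OF bil] L2_pair_cmult ..
    also have "\<dots> = (\<Sum>B\<in>\<A>. if B = A then c A * measure lborel A else 0)"
      using that by (intro sum.cong) (auto simp: ortho)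
    also have "\<dots> = c A * measure lborel A" using fin that by simp
    also have "\<dots> = L2_pair (L2_ind A) w"
    \<comment> \<open>A cell of measure zero has the zero class as indicator, and both sides
      vanish.\<close>
    proof (cases "measure lborel A = 0")
      case True
      then have "L2_ind A = 0" using norm_L2_ind[OF A[OF that]] by simp
      then show ?thesis using True by (simp add: bounded_bilinear.zero_left[OF bil])
    qed (simp add: c_def)
    finally show ?thesis by (simp add: v_def bounded_bilinear.diff_right[OF bil])
  qed
  \<comment> \<open>The indicators are real, so conjugation preserves the orthogonality to
    them.\<close>
  define h where "h = Lp_cnj v"
  have zh: "L2_pair (L2_ind A) h = 0" if "A \<in> \<A>" for A
  proof -
    have m: "(indicator A :: 'a \<Rightarrow> complex) \<in> borel_measurable borel"
      using A(1)[OF that] by (rule borel_measurable_indicator)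
    have [measurable]: "cnj \<in> borel_measurable borel"
      by (intro borel_measurable_continuous_onI continuous_intros)
    have "L2_pair (L2_ind A) h = (\<integral>x. cnj (indicator A x * Lp_rep v x) \<partial>lborel)"
    proof (rule L2_pair_eq_AE)
      show "AE x in lborel. Lp_rep (L2_ind A) x * Lp_rep h x = cnj (indicator A x * Lp_rep v x)"
        using Lp_rep_ind[OF A[OF that]] Lp_rep_cnj[of v] unfolding h_def
        by eventually_elim (auto simp: indicator_def)
      show "(\<lambda>x. cnj (indicator A x * Lp_rep v x)) \<in> borel_measurable lborel"
        using m by measurable
    qed
    also have "\<dots> = cnj (L2_pair (L2_ind A) v)"
      unfolding L2_pair_ind[OF A[OF that]] by (rule Bochner_Integration.integral_cnj)
    finally show ?thesis using z[OF that] by simp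
  qed
  have "L2_pair w h = L2_pair v h + L2_pair P h"
    by (simp add: v_def bounded_bilinear.diff_left[OF bil])
  also have "L2_pair P h = 0"
    unfolding P_def bounded_bilinear.sum_left[OF bil] L2_pair_cmult using zh by simp
  finally have wh: "L2_pair w h = complex_of_real ((norm v)\<^sup>2)"
    by (simp add: h_def L2_pair_cnj del: of_real_power)
  have "norm (L2_pair w h) \<le> \<beta> * norm h"
  proof (rule LIMSEQ_le)
    show "(\<lambda>n. norm (L2_pair w (L2_trunc n h))) \<longlonglongrightarrow> norm (L2_pair w h)"
      by (intro tendsto_norm bounded_bilinear.tendsto[OF bil] tendsto_const L2_trunc_tendsto)
    show "(\<lambda>n. \<beta> * norm (L2_trunc n h)) \<longlonglongrightarrow> \<beta> * norm h"
      by (intro tendsto_mult tendsto_const tendsto_norm L2_trunc_tendsto)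
    show "\<exists>N. \<forall>n\<ge>N. norm (L2_pair w (L2_trunc n h)) \<le> \<beta> * norm (L2_trunc n h)"
    \<comment> \<open>From radius R on, the ball contains all cells, and truncating h no longer
      changes its integrals over them.\<close>
    proof (intro exI[of _ R] allI impI bound)
      fix n assume n: "R \<le> n"
      show "L2_trunc n (L2_trunc n h) = L2_trunc n h" by (simp add: L2_trunc_trunc)
      fix A assume "A \<in> \<A>"
      then have "L2_trunc n (L2_ind A) = L2_ind A"
        using \<A> n by (intro L2_ind_cases(2)[of _ R]) auto
      moreover have "L2_pair (L2_ind A) (L2_trunc n h) = L2_pair (L2_trunc n (L2_ind A)) h"
        unfolding L2_trunc_def
        by (rule L2_pair_mul[OF indicator_cball_measurable indicator_norm_le, symmetric])
      ultimately show "L2_pair (L2_ind A) (L2_trunc n h) = 0" using zh[OF \<open>A \<in> \<A>\<close>] by simp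
    qed
  qed
  then have "norm v * norm v \<le> \<beta> * norm v"
    unfolding wh by (simp add: h_def norm_Lp_cnj power2_eq_square norm_mult)
  then have "norm v \<le> \<beta>" using \<beta> by (cases "norm v = 0") auto
  then show ?thesis by (simp add: v_def P_def)
qed

text \<open>By induction: a closed disc of scalars times a fixed vector is compact, and so are sums
  of compact sets.\<close>

lemma compact_Lp_combinations:
  fixes e :: "'i \<Rightarrow> ('a::euclidean_space, complex, 'p::finite) Lp"
  assumes "finite I"
  shows "compact {\<Sum>i\<in>I. Lp_cmult (c i) (e i) | c. \<forall>i\<in>I. norm (c i) \<le> K i}"
  using assms
proof (induction I)
  case (insert a I)
  let ?Z = "{\<Sum>i\<in>I. Lp_cmult (c i) (e i) | c. \<forall>i\<in>I. norm (c i) \<le> K i}"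
  have lin: "bounded_linear (\<lambda>z. Lp_cmult z (e a))"
  proof (rule bounded_linear_intro)
    fix y z :: complex and r :: real
    show "Lp_cmult (y + z) (e a) = Lp_cmult y (e a) + Lp_cmult z (e a)"
      using Lp_rep_cmult[of "y + z" "e a"] Lp_rep_cmult[of y "e a"] Lp_rep_cmult[of z "e a"]
        Lp_rep_add[of "Lp_cmult y (e a)" "Lp_cmult z (e a)"]
      by (intro Lp_eqI, eventually_elim) (simp add: distrib_right)
    show "Lp_cmult (r *\<^sub>R z) (e a) = r *\<^sub>R Lp_cmult z (e a)"
      using Lp_rep_cmult[of "r *\<^sub>R z" "e a"] Lp_rep_cmult[of z "e a"] Lp_rep_scaleR[of r "Lp_cmult z (e a)"]
      by (intro Lp_eqI, eventually_elim) simp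
    show "norm (Lp_cmult z (e a)) \<le> norm z * norm (e a)" by (rule norm_Lp_cmult_le)
  qed
  have "compact ((\<lambda>z. Lp_cmult z (e a)) ` cball 0 (K a))"
    by (intro compact_continuous_image linear_continuous_on lin compact_cball)
  from compact_sums[OF this insert.IH]
  have "compact {x + y | x y. x \<in> (\<lambda>z. Lp_cmult z (e a)) ` cball 0 (K a) \<and> y \<in> ?Z}" .
  also have "{x + y | x y. x \<in> (\<lambda>z. Lp_cmult z (e a)) ` cball 0 (K a) \<and> y \<in> ?Z}
      = {\<Sum>i\<in>insert a I. Lp_cmult (c i) (e i) | c. \<forall>i\<in>insert a I. norm (c i) \<le> K i}" (is "?L = ?R")
  proof
    show "?L \<subseteq> ?R"
    proof
      fix x assume "x \<in> ?L"
      then obtain z c where zc: "x = Lp_cmult z (e a) + (\<Sum>i\<in>I. Lp_cmult (c i) (e i))" "norm z \<le> K a" "\<forall>i\<in>I. norm (c i) \<le> K i"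
        by auto
      have "(\<Sum>i\<in>I. Lp_cmult (c i) (e i)) = (\<Sum>i\<in>I. Lp_cmult ((c(a := z)) i) (e i))"
        using insert(2) by (intro sum.cong) auto
      then have "x = (\<Sum>i\<in>insert a I. Lp_cmult ((c(a := z)) i) (e i))"
        using zc(1) insert(1,2) by simp
      moreover have "\<forall>i\<in>insert a I. norm ((c(a := z)) i) \<le> K i" using zc by auto
      ultimately show "x \<in> ?R" by blast
    qed
    show "?R \<subseteq> ?L"
    proof
      fix x assume "x \<in> ?R"
      then obtain c where c: "x = (\<Sum>i\<in>insert a I. Lp_cmult (c i) (e i))" "\<forall>i\<in>insert a I. norm (c i) \<le> K i" by auto
      have "x = Lp_cmult (c a) (e a) + (\<Sum>i\<in>I. Lp_cmult (c i) (e i))" using c(1) insert(1,2) by simp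
      moreover have "Lp_cmult (c a) (e a) \<in> (\<lambda>z. Lp_cmult z (e a)) ` cball 0 (K a)" using c(2) by auto
      moreover have "(\<Sum>i\<in>I. Lp_cmult (c i) (e i)) \<in> ?Z" using c(2) by auto
      ultimately show "x \<in> ?L" by blast
    qed
  qed
  finally show ?case .
qed simp

lemma compact_finite_net:
  fixes S :: "'b::real_normed_vector set"
  assumes "compact S" "0 < \<epsilon>"
  shows "\<exists>k. finite k \<and> (\<forall>x\<in>S. \<exists>c\<in>k. norm (x - c) \<le> \<epsilon>)"
proof -
  have "\<forall>\<epsilon>>0. \<exists>k. finite k \<and> S \<subseteq> (\<Union>x\<in>k. ball x \<epsilon>)"
    using assms(1) unfolding compact_eq_totally_bounded by (rule conjunct2)
  with assms(2) obtain k where k: "finite k" "S \<subseteq> (\<Union>x\<in>k. ball x \<epsilon>)" by blast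
  then show ?thesis
    by (intro exI[of _ k]) (force simp: dist_norm norm_minus_commute less_imp_le)
qed

lemma compact_closure_net:
  fixes S :: "'b::banach set"
  assumes "\<And>\<epsilon>. 0 < \<epsilon> \<Longrightarrow> \<exists>k. finite k \<and> (\<forall>x\<in>S. \<exists>c\<in>k. norm (x - c) \<le> \<epsilon>)"
  shows "compact (closure S)"
  unfolding compact_eq_totally_bounded
proof (intro conjI allI impI)
  show "complete (closure S)" by (simp add: complete_eq_closed)
  fix \<epsilon> :: real assume "0 < \<epsilon>"
  then obtain k where k: "finite k" "\<forall>x\<in>S. \<exists>c\<in>k. norm (x - c) \<le> \<epsilon> / 2"
    using assms[of "\<epsilon> / 2"] by auto
  have "S \<subseteq> (\<Union>c\<in>k. cball c (\<epsilon> / 2))" using k(2) by (force simp: dist_norm norm_minus_commute)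
  then have "closure S \<subseteq> (\<Union>c\<in>k. cball c (\<epsilon> / 2))"
    using k(1) by (intro closure_minimal closed_UN) auto
  also have "\<dots> \<subseteq> (\<Union>c\<in>k. ball c \<epsilon>)" using \<open>0 < \<epsilon>\<close> by (intro UN_mono) auto
  finally show "\<exists>k. finite k \<and> closure S \<subseteq> (\<Union>x\<in>k. ball x \<epsilon>)" using k(1) by blast
qed

text \<open>The exponent p and the potential vary within one such set. The bound on the conjugate
  exponent keeps p away from 1.\<close>

definition bounded_solutions :: "('a::euclidean_space, complex, 2) Lp \<Rightarrow> real \<Rightarrow> real \<Rightarrow> (real \<Rightarrow> ('a, complex, 2) Lp) set" where
  "bounded_solutions psi0 T N = {\<psi>. \<exists>p V. Mp_bounded p N T V \<and> conj_exponent p \<le> N \<and>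
    schroedinger_solution p psi0 V \<psi> \<and> (\<forall>t\<in>{- T..T}. norm (\<psi> t) \<le> N)}"

text \<open>The weight makes the Duhamel integral contractive on arbitrarily long time intervals.\<close>
definition weighted_net :: "(real \<Rightarrow> 'b::real_normed_vector) set \<Rightarrow> real \<Rightarrow> real \<Rightarrow> real \<Rightarrow> bool" where
  "weighted_net S T \<mu> \<epsilon> \<longleftrightarrow>
    (\<exists>C. finite C \<and> (\<forall>\<psi>\<in>S. \<forall>t\<in>{- T..T}. \<exists>c\<in>C. norm (\<psi> t - c) \<le> \<epsilon> * exp (\<mu> * \<bar>t\<bar>)))"

text \<open>Up to an error \<beta> = (\<epsilon> / 4) exp(\<mu> |t|), the Duhamel vector w lies in a
  compact set of combinations of cell indicators; a finite \<epsilon> / 4 net of the states reached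
  from there completes the step. The choice of \<open>\<mu>\<close> makes (2 / \<mu>)^(1/q) at most
  1 / (32 N) for all q up to N, and 2 N * 4 \<epsilon> / (32 N) = \<epsilon> / 4.\<close>

lemma weighted_net_step:
  fixes psi0 :: "('a::euclidean_space, complex, 2) Lp"
  assumes N1: "1 \<le> N" and T: "0 \<le> T" and \<epsilon>: "0 < \<epsilon>"
  defines "\<mu> \<equiv> 2 * (32 * N) powr N"
  assumes net: "weighted_net (bounded_solutions psi0 T N) T \<mu> \<epsilon>"
  shows "weighted_net (bounded_solutions psi0 T N) T \<mu> (\<epsilon> / 2)"
proof -
  have \<mu>: "0 < \<mu>" using N1 by (simp add: \<mu>_def)
  obtain C where C: "finite C"
    "\<And>\<psi> t. \<psi> \<in> bounded_solutions psi0 T N \<Longrightarrow> t \<in> {- T..T} \<Longrightarrow> \<exists>c\<in>C. norm (\<psi> t - c) \<le> \<epsilon> * exp (\<mu> * \<bar>t\<bar>)"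
    using net unfolding weighted_net_def by blast
  define D where "D = 4 * (N powr N + 1 + 1 / (4 * \<epsilon>))"
  have D: "0 < D"
  proof -
    have "0 < 1 / (4 * \<epsilon>)" using \<epsilon> by simp
    from add_pos_pos[OF add_nonneg_pos[OF powr_ge_zero zero_less_one] this] show ?thesis
      unfolding D_def by (rule mult_pos_pos[rotated]) simp
  qed
  \<comment> \<open>The mean-square tolerance for local smoothing, taken so that the last hypothesis
    of \<open>orbit_product_bound\<close> holds with equality.\<close>
  define \<epsilon>' where "\<epsilon>' = min (4 * \<epsilon>) ((4 * \<epsilon>) powr N) / \<mu> / D"
  have \<epsilon>': "0 < \<epsilon>'" "D * \<epsilon>' \<le> min (4 * \<epsilon>) ((4 * \<epsilon>) powr N) / \<mu>"
    using D \<mu> \<epsilon> by (auto simp: \<epsilon>'_def)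
  obtain R \<A> where \<A>: "finite \<A>" "\<A> \<subseteq> sets borel" "disjoint \<A>" "\<forall>A\<in>\<A>. A \<subseteq> cball (0::'a) (real R)"
    and smooth: "\<forall>h k. L2_trunc k h = h \<longrightarrow> (\<forall>A\<in>\<A>. (\<integral>x. indicator A x * Lp_rep h x \<partial>lborel) = 0) \<longrightarrow>
      (\<exists>b\<in>borel_measurable borel. (\<forall>s. 0 \<le> b s) \<and>
        (\<forall>s c. \<bar>s\<bar> \<le> T \<longrightarrow> c \<in> C \<longrightarrow> norm (L2_mult c (adj_flow h s)) \<le> \<epsilon> * norm h + b s) \<and>
        (\<integral>\<^sup>+s. ennreal (indicator {- T..T} s * (b s)\<^sup>2) \<partial>lborel) \<le> ennreal (\<epsilon>' * (norm h)\<^sup>2))"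
    using local_smoothing[OF C(1) \<epsilon> \<epsilon>'(1) T] by auto
  have Afin: "A \<in> sets borel" "emeasure lborel A < \<infinity>" if "A \<in> \<A>" for A
    using \<A> that L2_ind_cases(1)[of A R] by auto
  \<comment> \<open>A priori bound for |w|: 2 N from the pairing, N from the solution, and 1 + T as
    a bound for |t|^(1/q). It bounds the coefficients of the projection, which makes
    \<open>Z\<close> compact.\<close>
  define W where "W = 2 * N * (N * (1 + T))"
  define Z where "Z = {\<Sum>A\<in>\<A>. Lp_cmult (c A) (L2_ind A) | c. \<forall>A\<in>\<A>. norm (c A) \<le> norm (L2_ind A) * W / measure lborel A}"
  have Z: "compact Z" unfolding Z_def by (rule compact_Lp_combinations[OF \<A>(1)])
  \<comment> \<open>Recovers the state at time t from the Duhamel vector. It is jointly continuous,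
    so that times and vectors from compact sets give a compact set of states.\<close>
  define \<Theta> where "\<Theta> = (\<lambda>(t, z). flow t (L2_fourier (- 1) psi0 - Lp_cmult \<i> z))"
  have "continuous_on UNIV \<Theta>"
  proof -
    have "continuous_on UNIV (\<lambda>x. (fst x, L2_fourier (- 1) psi0 - Lp_cmult \<i> (snd x)))"
      by (intro continuous_intros bounded_linear.continuous_on[OF bounded_linear_Lp_cmult])
    from continuous_on_compose2[OF continuous_flow this] show ?thesis
      by (simp add: \<Theta>_def case_prod_unfold)
  qed
  then have "compact (\<Theta> ` ({- T..T} \<times> Z))"
    by (intro compact_continuous_image compact_Times Z compact_Icc) (auto intro: continuous_on_subset)
  then obtain C' where C': "finite C'" "\<forall>x\<in>\<Theta> ` ({- T..T} \<times> Z). \<exists>c\<in>C'. norm (x - c) \<le> \<epsilon> / 4"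
    using compact_finite_net[of _ "\<epsilon> / 4"] \<epsilon> by (metis divide_pos_pos zero_less_numeral)
  have "\<exists>c\<in>C'. norm (\<psi> t - c) \<le> \<epsilon> / 2 * exp (\<mu> * \<bar>t\<bar>)"
    if \<psi>S: "\<psi> \<in> bounded_solutions psi0 T N" and t: "t \<in> {- T..T}" for \<psi> t
  proof -
    obtain p V where pV: "Mp_bounded p N T V" "conj_exponent p \<le> N" "schroedinger_solution p psi0 V \<psi>"
      "\<And>t. t \<in> {- T..T} \<Longrightarrow> norm (\<psi> t) \<le> N"
      using \<psi>S unfolding bounded_solutions_def by blast
    interpret Mp_bounded p N T V by fact
    have \<psi>: "continuous_on UNIV \<psi>" using pV(3) by (simp add: schroedinger_solution_def)
    define I where "I = {min 0 t..max 0 t}"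
    obtain w where w: "\<psi> t = \<Theta> (t, w)"
      "\<And>h. norm (L2_pair w h) \<le> 2 * N * bochner_norm q I (\<lambda>s. L2_mult (\<psi> s) (adj_flow h s))"
      using duhamel_representation[OF pV(3) t] by (auto simp: \<Theta>_def I_def)
    have wW: "norm w \<le> W"
    proof -
      \<comment> \<open>Testing with the conjugate of w itself turns the estimate for the pairing
        into one for the norm.\<close>
      have "(norm w)\<^sup>2 = norm (L2_pair w (Lp_cnj w))" by (simp add: L2_pair_cnj norm_power)
      also have "\<dots> \<le> 2 * N * bochner_norm q I (\<lambda>s. L2_mult (\<psi> s) (adj_flow (Lp_cnj w) s))" by (rule w(2))
      also have "\<dots> \<le> 2 * N * ((N * norm w) * (max 0 t - min 0 t) powr (1 / q))"
        unfolding I_def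
      proof (intro mult_left_mono bochner_space_bounded(2) q)
        have c: "continuous_on UNIV (\<lambda>s. L2_mult (\<psi> s) (adj_flow (Lp_cnj w) s))"
          by (intro bounded_bilinear.continuous_on[OF bounded_bilinear_L2_mult] \<psi> continuous_adj_flow)
        show "(\<lambda>s. indicator {min 0 t..max 0 t} s *\<^sub>R L2_mult (\<psi> s) (adj_flow (Lp_cnj w) s)) \<in> borel_measurable borel"
          using borel_measurable_continuous_onI[OF c] by measurable
        fix s assume "s \<in> {min 0 t..max 0 t}"
        then have s: "s \<in> {- T..T}" using t by auto
        show "norm (L2_mult (\<psi> s) (adj_flow (Lp_cnj w) s)) \<le> N * norm w"
          using N norm_adj_flow_le[of "Lp_cnj w" s]
          by (intro order_trans[OF norm_L2_mult_le] mult_mono pV(4)[OF s]) (auto simp: norm_Lp_cnj)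
      qed (use N in auto)
      also have "\<dots> \<le> 2 * N * ((N * norm w) * (1 + T))"
      proof (intro mult_left_mono)
        have e: "max 0 t - min 0 t = \<bar>t\<bar>" by auto
        show "(max 0 t - min 0 t) powr (1 / q) \<le> 1 + T"
        proof (cases "\<bar>t\<bar> \<le> 1")
          case True
          then have "\<bar>t\<bar> powr (1 / q) \<le> 1" using q by (intro powr_le1) auto
          then show ?thesis using T by (simp only: e)
        next
          case False
          then have "\<bar>t\<bar> powr (1 / q) \<le> \<bar>t\<bar> powr 1" using q by (intro powr_mono) auto
          also have "\<dots> \<le> 1 + T" using t by auto
          finally show ?thesis by (simp only: e)
        qed
      qed (use N in auto)
      finally have "norm w * norm w \<le> W * norm w" by (simp add: W_def power2_eq_square mult_ac)
      moreover have "0 \<le> W" using N T by (simp add: W_def)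
      ultimately show ?thesis by (cases "norm w = 0") auto
    qed
    define \<beta> where "\<beta> = \<epsilon> / 4 * exp (\<mu> * \<bar>t\<bar>)"
    have \<beta>: "0 \<le> \<beta>" using \<epsilon> by (simp add: \<beta>_def)
    have unit: "norm (L2_pair w h) \<le> \<beta>"
      if h: "L2_trunc k h = h" "\<And>A. A \<in> \<A> \<Longrightarrow> L2_pair (L2_ind A) h = 0" "norm h = 1" for h k
    proof -
      have "\<forall>A\<in>\<A>. (\<integral>x. indicator A x * Lp_rep h x \<partial>lborel) = 0"
        using h(2) by (simp add: L2_pair_ind[OF Afin])
      then obtain b where b: "b \<in> borel_measurable borel" "\<And>s. 0 \<le> b s"
        "\<And>s c. \<bar>s\<bar> \<le> T \<Longrightarrow> c \<in> C \<Longrightarrow> norm (L2_mult c (adj_flow h s)) \<le> \<epsilon> * norm h + b s"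
        "(\<integral>\<^sup>+s. ennreal (indicator {- T..T} s * (b s)\<^sup>2) \<partial>lborel) \<le> ennreal (\<epsilon>' * (norm h)\<^sup>2)"
        using smooth[rule_format, OF h(1)] by blast
      have "bochner_norm q I (\<lambda>s. L2_mult (\<psi> s) (adj_flow h s)) \<le> 4 * \<epsilon> * exp (\<mu> * \<bar>t\<bar>) * (2 / \<mu>) powr (1 / q)"
        unfolding I_def
        using b \<epsilon>'(2)[unfolded D_def] unfolding h(3) mult_1_right power_one
        by (intro orbit_product_bound[OF \<psi> pV(4) N1 pV(2) t h(3) \<epsilon> \<mu> C(2)[OF \<psi>S] _ _ _ _ \<epsilon>'(1)]) auto
      \<comment> \<open>Here q \<le> N enters: the power is (32 N)^(-N/q), with exponent at most -1
        and base above 1.\<close>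
      also have "(2 / \<mu>) powr (1 / q) \<le> 1 / (32 * N)"
      proof -
        have "2 / \<mu> = (32 * N) powr (- N)" by (simp add: \<mu>_def powr_minus_divide)
        then have "(2 / \<mu>) powr (1 / q) = (32 * N) powr (- N * (1 / q))" by (simp add: powr_powr)
        also have "\<dots> \<le> (32 * N) powr (- 1)"
          using N1 q pV(2) by (intro powr_mono) (auto simp: field_simps)
        also have "\<dots> = 1 / (32 * N)" using N1 by (simp add: powr_minus_divide)
        finally show ?thesis .
      qed
      finally have "bochner_norm q I (\<lambda>s. L2_mult (\<psi> s) (adj_flow h s)) \<le> 4 * \<epsilon> * exp (\<mu> * \<bar>t\<bar>) * (1 / (32 * N))"
        using \<epsilon> by simp
      then have "2 * N * bochner_norm q I (\<lambda>s. L2_mult (\<psi> s) (adj_flow h s)) \<le> 2 * N * (4 * \<epsilon> * exp (\<mu> * \<bar>t\<bar>) * (1 / (32 * N)))"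
        by (rule mult_left_mono) (use N in simp)
      also have "\<dots> = \<beta>" using N1 by (simp add: \<beta>_def)
      finally show ?thesis using w(2)[of h] by linarith
    qed
    have all: "norm (L2_pair w h) \<le> \<beta> * norm h"
      if h: "L2_trunc k h = h" "\<And>A. A \<in> \<A> \<Longrightarrow> L2_pair (L2_ind A) h = 0" for h k
    proof (cases "h = 0")
      case False
      define u where "u = h /\<^sub>R norm h"
      have "norm (L2_pair w u) \<le> \<beta>"
      proof (rule unit)
        show "L2_trunc k u = u" by (simp add: u_def linear_simps[OF bounded_linear_L2_trunc] h(1))
        show "L2_pair (L2_ind A) u = 0" if "A \<in> \<A>" for A
          using h(2)[OF that] by (simp add: u_def bounded_bilinear.scaleR_right[OF bounded_bilinear_L2_pair])
        show "norm u = 1" using False by (simp add: u_def)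
      qed
      moreover have "L2_pair w u = L2_pair w h /\<^sub>R norm h"
        by (simp add: u_def bounded_bilinear.scaleR_right[OF bounded_bilinear_L2_pair])
      ultimately have "norm (L2_pair w h) / norm h \<le> \<beta>" by (simp add: divide_inverse mult.commute)
      then show ?thesis using False by (simp add: field_simps)
    qed (simp add: bounded_bilinear.zero_right[OF bounded_bilinear_L2_pair])
    define c where "c A = L2_pair (L2_ind A) w / measure lborel A" for A
    define z where "z = (\<Sum>A\<in>\<A>. Lp_cmult (c A) (L2_ind A))"
    have wz: "norm (w - z) \<le> \<beta>"
      unfolding z_def c_def using \<A> \<beta> by (intro L2_projection_bound[of _ R] all) auto
    have "z \<in> Z"
    proof -
      have "norm (c A) \<le> norm (L2_ind A) * W / measure lborel A" for A
      proof -
        have "norm (L2_pair (L2_ind A) w) \<le> norm (L2_ind A) * W"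
          by (rule order_trans[OF norm_L2_pair_le mult_left_mono[OF wW]]) simp
        then show ?thesis by (simp add: c_def norm_divide divide_right_mono)
      qed
      then show ?thesis unfolding Z_def z_def by blast
    qed
    then have "\<Theta> (t, z) \<in> \<Theta> ` ({- T..T} \<times> Z)" using t by blast
    then obtain c where c: "c \<in> C'" "norm (\<Theta> (t, z) - c) \<le> \<epsilon> / 4" using C'(2) by blast
    have "norm (\<Theta> (t, w) - \<Theta> (t, z)) \<le> \<beta>"
    proof -
      have "\<Theta> (t, w) - \<Theta> (t, z) = flow t (Lp_cmult \<i> (z - w))"
        by (simp add: \<Theta>_def linear_simps[OF bounded_linear_flow] linear_simps[OF bounded_linear_Lp_cmult])
      also have "norm \<dots> \<le> norm (z - w)"
        using order_trans[OF norm_flow_le norm_Lp_cmult_le, of t \<i> "z - w"] by simp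
      finally show ?thesis using wz by (simp add: norm_minus_commute)
    qed
    then have "norm (\<psi> t - c) \<le> \<beta> + \<epsilon> / 4"
      unfolding w(1) using c(2) norm_triangle_ineq[of "\<Theta> (t, w) - \<Theta> (t, z)" "\<Theta> (t, z) - c"] by simp
    also have "\<dots> \<le> \<epsilon> / 2 * exp (\<mu> * \<bar>t\<bar>)"
    proof -
      have "\<epsilon> / 4 * 1 \<le> \<epsilon> / 4 * exp (\<mu> * \<bar>t\<bar>)" using \<epsilon> \<mu> by (intro mult_left_mono) auto
      then show ?thesis by (simp add: \<beta>_def)
    qed
    finally show ?thesis using c(1) by blast
  qed
  then show ?thesis using C'(1) unfolding weighted_net_def by blast
qed

text \<open>The single point 0 is a net for \<epsilon> = N, because the solutions are bounded by N,
  and each step halves \<epsilon>. On [-T, T] the weight costs no more than the fixed factor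
  exp(\<mu> T), which the halving eventually beats.\<close>

lemma compact_bounded_solutions:
  assumes N1: "1 \<le> N" and T: "0 \<le> T"
  shows "compact (closure {\<psi> t | \<psi> t. \<psi> \<in> bounded_solutions psi0 T N \<and> t \<in> {- T..T}})"
proof (rule compact_closure_net)
  define \<mu> where "\<mu> = 2 * (32 * N) powr N"
  let ?S = "bounded_solutions psi0 T N"
  have net: "weighted_net ?S T \<mu> (N / 2 ^ k)" for k
  proof (induction k)
    case 0
    have "norm (\<psi> t - 0) \<le> N * exp (\<mu> * \<bar>t\<bar>)" if "\<psi> \<in> ?S" "t \<in> {- T..T}" for \<psi> t
    proof -
      have "norm (\<psi> t - 0) \<le> N" using that by (auto simp: bounded_solutions_def)
      also have "N * 1 \<le> N * exp (\<mu> * \<bar>t\<bar>)" using N1 by (intro mult_left_mono) (auto simp: \<mu>_def)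
      finally show ?thesis by simp
    qed
    then show ?case unfolding weighted_net_def by (intro exI[of _ "{0}"]) auto
  next
    case (Suc k)
    then have "weighted_net ?S T \<mu> (N / 2 ^ k / 2)"
      unfolding \<mu>_def using N1 T by (intro weighted_net_step) auto
    then show ?case by (simp add: mult.commute)
  qed
  fix \<epsilon> :: real assume \<epsilon>: "0 < \<epsilon>"
  define M where "M = N * exp (\<mu> * T)"
  have M: "0 < M" using N1 by (simp add: M_def)
  obtain k where "(1 / 2) ^ k < \<epsilon> / M"
    using real_arch_pow_inv[of "\<epsilon> / M" "1 / 2"] \<epsilon> M by auto
  then have k: "M / 2 ^ k \<le> \<epsilon>" using M by (simp add: field_simps)
  obtain C where C: "finite C" "\<And>\<psi> t. \<psi> \<in> ?S \<Longrightarrow> t \<in> {- T..T} \<Longrightarrow> \<exists>c\<in>C. norm (\<psi> t - c) \<le> N / 2 ^ k * exp (\<mu> * \<bar>t\<bar>)"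
    using net[of k] unfolding weighted_net_def by blast
  have "N / 2 ^ k * exp (\<mu> * \<bar>t\<bar>) \<le> \<epsilon>" if "t \<in> {- T..T}" for t
  proof -
    have "N / 2 ^ k * exp (\<mu> * \<bar>t\<bar>) \<le> N / 2 ^ k * exp (\<mu> * T)"
      using that N1 by (intro mult_left_mono) (auto simp: \<mu>_def mult_left_mono)
    also have "\<dots> = M / 2 ^ k" by (simp add: M_def)
    also note k
    finally show ?thesis .
  qed
  then show "\<exists>C. finite C \<and> (\<forall>x\<in>{\<psi> t | \<psi> t. \<psi> \<in> ?S \<and> t \<in> {- T..T}}. \<exists>c\<in>C. norm (x - c) \<le> \<epsilon>)"
    using C by (intro exI[of _ C]) (auto, meson order_trans)
qed

subsection \<open>The Baire category argument\<close>

text \<open>Infinite dimension in quantitative form: indicators of unit balls with centres 3 apart,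
  hence of disjoint sets of equal measure.\<close>

lemma separated_sequence_L2:
  "\<exists>(e :: nat \<Rightarrow> ('a::euclidean_space, complex, 2) Lp) r. 0 < r \<and> (\<forall>n. norm (e n) = r) \<and>
    (\<forall>m n. m \<noteq> n \<longrightarrow> r \<le> norm (e m - e n))"
proof -
  obtain b :: 'a where b: "b \<in> Basis" using nonempty_Basis by blast
  define B where "B n = ball ((3 * real n) *\<^sub>R b) 1" for n
  define e :: "nat \<Rightarrow> ('a, complex, 2) Lp" where "e n = L2_ind (B n)" for n
  define r where "r = sqrt (measure lborel (ball (0::'a) 1))"
  have B: "B n \<in> sets borel" "emeasure lborel (B n) < \<infinity>" for n
    unfolding B_def using emeasure_bounded_finite[OF bounded_ball] by auto
  have "(norm (e n))\<^sup>2 = measure lborel (ball (0::'a) 1)" for n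
    unfolding e_def norm_L2_ind[OF B] unfolding B_def using content_ball_conv_unit_ball[of 1 "(3 * real n) *\<^sub>R b"] by simp
  then have ne: "norm (e n) = r" for n
    unfolding r_def by (metis norm_ge_zero real_sqrt_unique)
  have "0 < r" unfolding r_def using content_ball_pos[of 1 "0::'a"] by simp
  moreover have "r \<le> norm (e m - e n)" if "m \<noteq> n" for m n
  proof -
    have disj: "B m \<inter> B n = {}"
    proof -
      have "dist ((3 * real m) *\<^sub>R b) ((3 * real n) *\<^sub>R b) = 3 * \<bar>real m - real n\<bar>"
      proof -
        have "(3 * real m) *\<^sub>R b - (3 * real n) *\<^sub>R b = (3 * (real m - real n)) *\<^sub>R b"
          by (simp add: algebra_simps)
        then show ?thesis using b by (simp only: dist_norm norm_scaleR norm_Basis abs_mult)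
      qed
      also have "\<dots> \<ge> 2"
      proof -
        have "1 \<le> \<bar>real m - real n\<bar>" using that by (cases "m < n") auto
        then show ?thesis by simp
      qed
      finally show ?thesis unfolding B_def by (intro disjoint_ballI) simp
    qed
    \<comment> \<open>On the m-th ball the difference equals the m-th indicator.\<close>
    have "AE x in lborel. norm (Lp_rep (e m) x) \<le> norm (Lp_rep (e m - e n) x)"
      using Lp_rep_ind[OF B, of m] Lp_rep_ind[OF B, of n] Lp_rep_diff[of "e m" "e n"] unfolding e_def
      by eventually_elim (use disj in \<open>auto simp: indicator_def\<close>)
    then have "norm (e m) \<le> norm (e m - e n)" by (rule norm_Lp_mono)
    then show ?thesis by (simp add: ne)
  qed
  ultimately show ?thesis using ne by (intro exI[of _ e] exI[of _ r]) simp
qed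

text \<open>If K contained a piece of the sphere around u, it would contain the radial projections
  of the separated points u + \<delta> e(n). These points themselves would then lie in a compact set
  of multiples of elements of K, and a subsequence would converge, which separation forbids.\<close>

lemma compact_sphere_interior_empty:
  fixes K :: "('a::euclidean_space, complex, 2) Lp set"
  assumes K: "compact K" and \<rho>: "0 < \<rho>"
  shows "(top_of_set (sphere 0 \<rho>)) interior_of (K \<inter> sphere 0 \<rho>) = {}"
  unfolding interior_of_eq_empty
proof (intro allI impI)
  fix U assume U: "openin (top_of_set (sphere 0 \<rho>)) U \<and> U \<subseteq> K \<inter> sphere 0 \<rho>"
  show "U = {}"
  proof (rule ccontr)
    assume "U \<noteq> {}"
    then obtain u where "u \<in> U" by blast
    then have "u \<in> K \<inter> sphere 0 \<rho>" using U by blast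
    then have u: "norm u = \<rho>" by simp
    have "\<forall>x\<in>U. \<exists>d>0. ball x d \<inter> sphere 0 \<rho> \<subseteq> U"
      using U unfolding openin_contains_ball by simp
    then obtain d where "0 < d" "ball u d \<inter> sphere 0 \<rho> \<subseteq> U" using \<open>u \<in> U\<close> by blast
    then have d: "0 < d" "ball u d \<inter> sphere 0 \<rho> \<subseteq> K" using U by auto
    obtain e :: "nat \<Rightarrow> ('a, complex, 2) Lp" and r where "0 < r \<and> (\<forall>n. norm (e n) = r) \<and>
        (\<forall>m n. m \<noteq> n \<longrightarrow> r \<le> norm (e m - e n))"
      using separated_sequence_L2[where 'a = 'a] by (elim exE) (rule that)
    then have e: "0 < r" "\<And>n. norm (e n) = r" "\<And>m n. m \<noteq> n \<Longrightarrow> r \<le> norm (e m - e n)" by auto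
    \<comment> \<open>Small compared with \<rho>, so that the points \<open>x n\<close> stay away
      from 0 and their norms below 2 \<rho>; small compared with d, because \<open>y n\<close> is
      within 2 \<delta> r of u: one \<delta> r for the perturbation and one for the
      projection.\<close>
    define \<delta> where "\<delta> = min \<rho> d / (3 * r)"
    have \<delta>: "0 < \<delta>" "\<delta> * r < \<rho> / 2" "2 * (\<delta> * r) < d" using \<rho> d(1) e(1) by (auto simp: \<delta>_def)
    define x where "x n = u + \<delta> *\<^sub>R e n" for n
    define y where "y n = (\<rho> / norm (x n)) *\<^sub>R x n" for n
    have nx: "\<bar>norm (x n) - \<rho>\<bar> \<le> \<delta> * r" for n
      using norm_triangle_ineq3[of "x n" u] \<delta>(1) e(2)[of n] u by (simp add: x_def)
    have nx0: "0 < norm (x n)" for n using nx[of n] \<delta>(2) \<rho> by linarith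
    have yK: "y n \<in> K" for n
    proof -
      have "norm (y n) = \<rho>" using nx0[of n] \<rho> by (simp add: y_def)
      moreover have "norm (u - y n) < d"
      proof -
        have "norm (x n - y n) = \<bar>norm (x n) - \<rho>\<bar>"
        proof -
          have "x n - y n = ((norm (x n) - \<rho>) / norm (x n)) *\<^sub>R x n"
            using nx0[of n] by (simp add: y_def diff_divide_distrib scaleR_diff_left)
          then show ?thesis using nx0[of n] by simp
        qed
        moreover have "norm (u - x n) = \<delta> * r" using \<delta>(1) e(2) by (simp add: x_def)
        ultimately show ?thesis
          using norm_triangle_ineq[of "u - x n" "x n - y n"] nx[of n] \<delta>(3) by simp
      qed
      ultimately show ?thesis using d(2) by (auto simp: dist_norm)
    qed
    \<comment> \<open>Undoes the projection to the sphere by scalars in [0, 2], at no loss of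
      compactness.\<close>
    let ?K' = "(\<lambda>(s, y). s *\<^sub>R y) ` ({0..2} \<times> K)"
    have "compact ?K'"
      by (intro compact_continuous_image compact_Times K compact_Icc)
        (auto simp: case_prod_unfold intro!: continuous_intros)
    moreover have "\<forall>n. x n \<in> ?K'"
    proof
      fix n
      have "x n = (norm (x n) / \<rho>) *\<^sub>R y n" using nx0[of n] \<rho> by (simp add: y_def)
      moreover have "norm (x n) / \<rho> \<in> {0..2}" using nx[of n] \<delta>(2) \<rho> by (auto simp: divide_simps)
      ultimately show "x n \<in> ?K'" using yK[of n] by (intro image_eqI[of _ _ "(norm (x n) / \<rho>, y n)"]) auto
    qed
    ultimately obtain l s where "strict_mono (s :: nat \<Rightarrow> nat)" "(x \<circ> s) \<longlonglongrightarrow> l"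
      by (metis compact_imp_seq_compact seq_compactE)
    then have s: "strict_mono s" "Cauchy (x \<circ> s)" using LIMSEQ_imp_Cauchy by auto
    then obtain M where M: "\<And>m n. m \<ge> M \<Longrightarrow> n \<ge> M \<Longrightarrow> norm ((x \<circ> s) m - (x \<circ> s) n) < \<delta> * r"
      unfolding Cauchy_iff using \<delta>(1) e(1) by (meson mult_pos_pos)
    have "(x \<circ> s) M - (x \<circ> s) (Suc M) = \<delta> *\<^sub>R (e (s M) - e (s (Suc M)))"
      by (simp add: x_def scaleR_diff_right)
    then have "\<delta> * norm (e (s M) - e (s (Suc M))) < \<delta> * r"
      using M[of M "Suc M"] \<delta>(1) by simp
    moreover have "s M \<noteq> s (Suc M)" using s(1) by (metis n_not_Suc_n strict_mono_eq)
    ultimately show False using e(3)[of "s M" "s (Suc M)"] \<delta>(1) by simp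
  qed
qed

text \<open>A single potential has a finite dual norm on each interval, and its solution is bounded
  there by continuity, so every attained state belongs to some piece. \<open>Suc N\<close> instead
  of \<open>N\<close> provides the lower bound 1 that the compactness of the pieces asks
  for.\<close>

lemma attainable_set_subset:
  fixes psi0 :: "('a::euclidean_space, complex, 2) Lp"
  shows
  "attainable_set psi0 \<subseteq> (\<Union>(T, N) \<in> UNIV. closure {\<psi> t | \<psi> t.
    \<psi> \<in> bounded_solutions psi0 (real T) (real (Suc N)) \<and> t \<in> {- real T..real T}})"
proof
  fix x assume "x \<in> attainable_set psi0"
  then obtain p V \<psi> t where p: "1 < p" and V: "V \<in> Mp_loc p" and sol: "schroedinger_solution p psi0 V \<psi>" and x: "x = \<psi> t"
    by (auto simp: attainable_set_def)
  obtain T :: nat where T: "\<bar>t\<bar> \<le> real T" using real_arch_simple by blast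
  let ?q = "conj_exponent p"
  have "Mp_pairing p {- real T..real T} V \<in> Mp p {- real T..real T}"
    by (rule Mp_pairing(1)[OF p V]) simp
  then have "\<exists>C. \<forall>f\<in>bochner_space ?q {- real T..real T}.
      \<bar>Mp_pairing p {- real T..real T} V f\<bar> \<le> C * bochner_norm ?q {- real T..real T} f"
    by (simp add: Mp_def Let_def)
  then obtain C where C: "\<And>f. f \<in> bochner_space ?q {- real T..real T} \<Longrightarrow>
      \<bar>Mp_pairing p {- real T..real T} V f\<bar> \<le> C * bochner_norm ?q {- real T..real T} f"
    by blast
  have "continuous_on UNIV \<psi>" using sol by (simp add: schroedinger_solution_def)
  then obtain B where B: "\<And>s. s \<in> {- real T..real T} \<Longrightarrow> norm (\<psi> s) \<le> B"
    using continuous_bounded_Icc by blast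
  obtain N :: nat where N: "max C (max ?q B) \<le> real N" using real_arch_simple by blast
  have "Mp_bounded p (real (Suc N)) (real T) V"
  proof
    fix f :: "real \<Rightarrow> ('a, real, 1) Lp"
    assume f: "f \<in> bochner_space ?q {- real T..real T}"
    have "C * bochner_norm ?q {- real T..real T} f \<le> real (Suc N) * bochner_norm ?q {- real T..real T} f"
      using N by (intro mult_right_mono) (auto simp: bochner_norm_def)
    then show "\<bar>Mp_pairing p {- real T..real T} V f\<bar> \<le> real (Suc N) * bochner_norm ?q {- real T..real T} f"
      using C[OF f] by linarith
  qed (use p V in auto)
  moreover have "norm (\<psi> s) \<le> real (Suc N)" if "s \<in> {- real T..real T}" for s
    using B[OF that] N by simp
  ultimately have "\<psi> \<in> bounded_solutions psi0 (real T) (real (Suc N))"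
    unfolding bounded_solutions_def using sol N
    by (intro CollectI exI[of _ p] exI[of _ V]) auto
  then have "x \<in> {\<psi> t | \<psi> t. \<psi> \<in> bounded_solutions psi0 (real T) (real (Suc N)) \<and> t \<in> {- real T..real T}}"
    using x T by (intro CollectI exI[of _ \<psi>] exI[of _ t]) auto
  from subsetD[OF closure_subset this]
  show "x \<in> (\<Union>(T, N) \<in> UNIV. closure {\<psi> t | \<psi> t.
    \<psi> \<in> bounded_solutions psi0 (real T) (real (Suc N)) \<and> t \<in> {- real T..real T}})"
    by (intro UN_I[of "(T, N)"]) (simp_all only: UNIV_I prod.case)
qed

lemma closed_sphere_normed: "closed (sphere (0::'b::real_normed_vector) r)"
proof -
  have "sphere (0::'b) r = norm -` {r}" by auto
  then show ?thesis by (simp add: closed_vimage continuous_on_norm_id)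
qed

text \<open>For psi0 = 0 the sphere is the single point 0, which is attained with the zero
  potential, and the interior would be the whole sphere.\<close>

theorem corollary3:
  fixes psi0 :: "(real ^ 'n::finite, complex, 2) Lp"
  assumes "psi0 \<noteq> 0"
  shows "(top_of_set (sphere 0 (norm psi0))) interior_of (attainable_set psi0) = {}"
proof -
  let ?S = "sphere (0 :: (real ^ 'n, complex, 2) Lp) (norm psi0)"
  define K where "K = (\<lambda>(T::nat, N::nat). closure {\<psi> t | \<psi> t.
    \<psi> \<in> bounded_solutions psi0 (real T) (real (Suc N)) \<and> t \<in> {- real T..real T}})"
  have K: "compact (K i)" for i
    unfolding K_def case_prod_unfold by (rule compact_bounded_solutions) simp_all
  define \<G> where "\<G> = range (\<lambda>i. K i \<inter> ?S)"
  have "top_of_set ?S interior_of \<Union>\<G> = {}"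
  proof (rule Baire_category_alt)
    have "completely_metrizable_space (top_of_set ?S)"
      by (intro completely_metrizable_space_closedin completely_metrizable_space_euclidean)
        (metis closed_closedin closed_sphere_normed)
    then show "completely_metrizable_space (top_of_set ?S) \<or>
      locally_compact_space (top_of_set ?S) \<and> regular_space (top_of_set ?S)" ..
    show "countable \<G>" by (simp add: \<G>_def)
    fix G assume "G \<in> \<G>"
    then obtain i where G: "G = K i \<inter> ?S" by (auto simp: \<G>_def)
    have "closed (K i)" using K by (rule compact_imp_closed)
    then have "closedin (top_of_set ?S) (?S \<inter> K i)" by (rule closedin_closed_Int)
    moreover have "top_of_set ?S interior_of (K i \<inter> ?S) = {}"
      using K assms by (intro compact_sphere_interior_empty) auto
    ultimately show "closedin (top_of_set ?S) G \<and> top_of_set ?S interior_of G = {}"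
      by (simp add: G Int_commute)
  qed
  moreover have "attainable_set psi0 \<inter> ?S \<subseteq> \<Union>\<G>"
    using attainable_set_subset[of psi0] unfolding \<G>_def K_def by fastforce
  \<comment> \<open>The interior relative to the sphere depends only on the part of the set that
    lies on the sphere.\<close>
  moreover have "top_of_set ?S interior_of (attainable_set psi0) = top_of_set ?S interior_of (attainable_set psi0 \<inter> ?S)"
    using interior_of_restrict[of "top_of_set ?S" "attainable_set psi0"] by (simp add: Int_commute)
  ultimately show ?thesis
    using interior_of_mono[of "attainable_set psi0 \<inter> ?S" "\<Union>\<G>" "top_of_set ?S"] by simp
qed

end
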